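(* Fix $\kappa>0$, $T>0$, $\sigma_\eta>0$, $m^\star>m>1$, and let $H$ and $V$ be the spaces of mean-free divergence-free periodic vector fields on $\mathbb{T}^2=[0,1]^2$ of Sobolev regularity $m$ and $m^\star$ respectively (see context). Let $\{(t_j,\mathbf{x}_j)\}_{j=1}^\infty$ be i.i.d. random variables uniformly distributed on $[0,T]\times\mathbb{T}^2$. Fix $\theta_0^{(1)},\theta_0^{(2)}\in H^m(\mathbb{T}^2)$ such that $$\left(\nabla\theta_0^{(1)}(\mathbf{x})\right)^{\perp}\cdot\nabla\theta_0^{(2)}(\mathbf{x})\neq 0\quad\text{for almost all }\mathbf{x}\in\mathbb{T}^2 .$$ For $\mathbf{v}\in H$ and $j=1,2,\dots$ define $$\mathcal{G}_{2j-1}(\mathbf{v}):=\theta(t_j,\mathbf{x}_j,\mathbf{v},\theta_0^{(1)}),\qquad \mathcal{G}_{2j}(\mathbf{v}):=\theta(t_j,\mathbf{x}_j,\mathbf{v},\theta_0^{(2)}),$$ where $\theta(\cdot,\cdot,\mathbf{v},\theta_0)$ is the solution of the advection-diffusion equation with flow $\mathbf{v}$ and initial condition $\theta_0$. Fix any $\mathbf{v}^\star\in V$ and let $\mathcal{Y}_j=\mathcal{G}_j(\mathbf{v}^\star)+\eta_j$, $j\ge1$, where the $\eta_j\sim N(0,\sigma_\eta^2)$ are i.i.d. and independent of $\{(t_j,\mathbf{x}_j)\}_{j=1}^\infty$. Fix a Borel probability measure $\mu_0$ on $H$, and for $N\ge1$ let $\mu^N_{\mathcal{Y}}$ be the (random)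 probability measure on $H$ $$\mu^N_{\mathcal{Y}}(d\mathbf{v})=\frac{1}{Z^N_{\mathcal{Y}}}\exp\left[-\frac{1}{2\sigma_\eta^2}\sum_{j=1}^N(\mathcal{Y}_j-\mathcal{G}_j(\mathbf{v}))^2\right]\mu_0(d\mathbf{v}),\qquad Z^N_{\mathcal{Y}}=\int_H\exp\left[-\frac{1}{2\sigma_\eta^2}\sum_{j=1}^N(\mathcal{Y}_j-\mathcal{G}_j(\mathbf{v}))^2\right]\mu_0(d\mathbf{v}).$$ Suppose that $\mu_0(B_V^r(\mathbf{v}^\star))>0$ for every $r>0$. Assume additionally that there exists a monotone increasing $f:\mathbb{R}^+\to\mathbb{R}^+$ with $\lim_{r\to\infty}f(r)=\infty$ and $$\sup_N\int_H f(\|\mathbf{v}\|_V)\,\mu^N_{\mathcal{Y}}(d\mathbf{v})<\infty\quad\text{almost surely.}$$ Then, almost surely, $\mu^N_{\mathcal{Y}}$ converges weakly (as probability measures on $H$) to the Dirac measure $\delta_{\mathbf{v}^\star}$; that is, on a set of full measure, $$\int_H\phi(\mathbf{v})\,\mu^N_{\mathcal{Y}}(d\mathbf{v})\to\phi(\mathbf{v}^\star)\quad\text{as }N\to\infty\text{ for every }\phi\in C_b(H).$$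
   Context: $\mathbb{T}^2=[0,1]^2$ with periodic boundary conditions. For $s\in\mathbb{R}$, $H^s(\mathbb{T}^2)$ is the space of real, mean-free periodic functions $u=\sum_{\mathbf{k}\in\mathbb{Z}^2\setminus\{0\}}c_{\mathbf{k}}e^{2\pi i\mathbf{k}\cdot\mathbf{x}}$, $\overline{c_{\mathbf{k}}}=c_{-\mathbf{k}}$, with $\|u\|_{H^s}^2=\sum_{\mathbf{k}}\|\mathbf{k}\|^{2s}|c_{\mathbf{k}}|^2<\infty$. The same notation is used for divergence-free vector fields $\mathbf{v}:\mathbb{T}^2\to\mathbb{R}^2$, for which $c_{\mathbf{k}}=v_{\mathbf{k}}\,\mathbf{k}^\perp/\|\mathbf{k}\|$ with $v_{\mathbf{k}}\in\mathbb{C}$, $\overline{v_{\mathbf{k}}}=-v_{-\mathbf{k}}$, and $(k_1,k_2)^\perp=(-k_2,k_1)$. $H$ is the space of such divergence-free fields in $H^m$ ($m>1$) and $V$ the space of such fields in $H^{m^\star}$ ($m^\star>m$); $B_V^r(\mathbf{v}_0)=\{\mathbf{v}\in V:\|\mathbf{v}-\mathbf{v}_0\|_V\le r\}$. For $\mathbf{v}\in H\setminus V$, $\|\mathbf{v}\|_V=\infty$ and $f(\infty)=\infty$. For $\mathbf{v}\in H$ and $\theta_0\in H^m(\mathbb{T}^2)$, $\theta=\theta(t,\mathbf{x},\mathbf{v},\theta_0)$ is the unique weak solution of $\partial_t\theta=-\mathbf{v}\cdot\nabla\theta+\kappa\Delta\theta$, $\theta(0,\cdot)=\theta_0$: $\theta\in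 L^2_{loc}([0,\infty);H^{m+1})\cap L^\infty([0,\infty);H^m)$, $\partial_t\theta\in L^2_{loc}([0,\infty);H^{m-1})$ (hence $\theta\in C([0,\infty);H^m)$, which is continuous on $[0,T]\times\mathbb{T}^2$ since $m>1$), and $\langle\partial_t\theta,\phi\rangle_{H^{-1}\times H^1}+\langle\mathbf{v}\cdot\nabla\theta,\phi\rangle_{L^2}+\kappa\langle\nabla\theta,\nabla\phi\rangle_{L^2}=0$ for all $\phi\in H^1(\mathbb{T}^2)$ and almost all $t\ge0$. "Almost surely" refers to the joint law of the observation points and the noise. *)

theory Defs
  imports "HOL-Probability.Probability"
begin

text \<open>
  Functions on the torus are 1-periodic functions on the plane; all integrals and almost-everywhere
  statements are taken over the fundamental cell \<open>[0,1]\<^sup>2\<close>.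
\<close>

type_synonym scalar_field = "real \<times> real \<Rightarrow> real"
type_synonym vector_field = "real \<times> real \<Rightarrow> real \<times> real"

abbreviation unit_cell :: "(real \<times> real) set" where
  "unit_cell \<equiv> cbox (0, 0) (1, 1)"

abbreviation torus :: "(real \<times> real) measure" where
  "torus \<equiv> lebesgue_on unit_cell"

definition periodic :: "(real \<times> real \<Rightarrow> 'a) \<Rightarrow> bool" where
  "periodic u \<longleftrightarrow> (\<forall>x (a::int) (b::int). u (x + (of_int a, of_int b)) = u x)"

definition perp :: "real \<times> real \<Rightarrow> real \<times> real" where
  "perp y = (- snd y, fst y)"

definition freq :: "int \<times> int \<Rightarrow> real \<times> real" where
  "freq k = (of_int (fst k), of_int (snd k))"

definition fourier_coeff :: "scalar_field \<Rightarrow> int \<times> int \<Rightarrow> complex" where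
  "fourier_coeff u k = (LINT x|torus. complex_of_real (u x) * cis (- (2 * pi * (freq k \<bullet> x))))"

definition L2_torus :: "scalar_field set" where
  "L2_torus = {u. periodic u \<and> u \<in> borel_measurable torus \<and> integrable torus (\<lambda>x. (u x)\<^sup>2)}"

definition L2_inner :: "scalar_field \<Rightarrow> scalar_field \<Rightarrow> real" where
  "L2_inner u w = (LINT x|torus. u x * w x)"

text \<open>
  The Sobolev spaces of mean-free functions, for exponents \<open>s \<ge> 0\<close> (the only ones needed), where every
  element is an \<open>L\<^sup>2\<close> function and hence the \<open>L\<^sup>2\<close> sum of its Fourier series.  The set consists of
  representatives of almost-everywhere classes.  The symmetry of the Fourier coefficients under
  \<open>k \<mapsto> -k\<close> holds because the functions are real-valued.
\<close>

definition sobolev :: "real \<Rightarrow> scalar_field set" where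
  "sobolev s = {u \<in> L2_torus. fourier_coeff u 0 = 0 \<and>
     (\<lambda>k. norm (freq k) powr (2 * s) * (cmod (fourier_coeff u k))\<^sup>2) summable_on (- {0})}"

definition sobolev_norm :: "real \<Rightarrow> scalar_field \<Rightarrow> real" where
  "sobolev_norm s u =
     sqrt (\<Sum>\<^sub>\<infinity>k\<in>- {0}. norm (freq k) powr (2 * s) * (cmod (fourier_coeff u k))\<^sup>2)"

text \<open>
  The divergence-free fields of regularity \<open>s > 1\<close>.  By Sobolev embedding every class has exactly one
  continuous representative; the set below consists of these representatives, so that
  \<open>div_free_norm\<close> separates its points.
\<close>

definition div_free :: "real \<Rightarrow> vector_field set" where
  "div_free s = {v. continuous_on UNIV v \<and> fst \<circ> v \<in> sobolev s \<and> snd \<circ> v \<in> sobolev s \<and>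
     (\<forall>k. k \<noteq> 0 \<longrightarrow> (\<exists>a::complex.
        fourier_coeff (fst \<circ> v) k = a * of_real (fst (perp (freq k)) / norm (freq k)) \<and>
        fourier_coeff (snd \<circ> v) k = a * of_real (snd (perp (freq k)) / norm (freq k))))}"

definition div_free_norm :: "real \<Rightarrow> vector_field \<Rightarrow> real" where
  "div_free_norm s v =
     sqrt (\<Sum>\<^sub>\<infinity>k\<in>- {0}. norm (freq k) powr (2 * s) *
       ((cmod (fourier_coeff (fst \<circ> v) k))\<^sup>2 + (cmod (fourier_coeff (snd \<circ> v) k))\<^sup>2))"

definition div_free_dist :: "real \<Rightarrow> vector_field \<Rightarrow> vector_field \<Rightarrow> real" where
  "div_free_dist s v w = div_free_norm s (\<lambda>x. v x - w x)"

definition div_free_cball :: "real \<Rightarrow> vector_field \<Rightarrow> real \<Rightarrow> vector_field set" where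
  "div_free_cball s v0 r = {v \<in> div_free s. div_free_dist s v v0 \<le> r}"

definition div_free_topology :: "real \<Rightarrow> vector_field topology" where
  "div_free_topology s = Metric_space.mtopology (div_free s) (div_free_dist s)"

definition div_free_borel :: "real \<Rightarrow> vector_field measure" where
  "div_free_borel s = sigma (div_free s) {U. openin (div_free_topology s) U}"

text \<open>
  The gradient of an \<open>H\<^sup>1\<close> function is an \<open>L\<^sup>2\<close> field, obtained by termwise differentiation of the
  Fourier series and determined up to null sets; \<open>grad\<close> picks a representative.
\<close>

definition is_grad :: "scalar_field \<Rightarrow> vector_field \<Rightarrow> bool" where
  "is_grad u g \<longleftrightarrow> fst \<circ> g \<in> L2_torus \<and> snd \<circ> g \<in> L2_torus \<and>
     (\<forall>k. fourier_coeff (fst \<circ> g) k = 2 * pi * \<i> * of_real (fst (freq k)) * fourier_coeff u k \<and>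
          fourier_coeff (snd \<circ> g) k = 2 * pi * \<i> * of_real (snd (freq k)) * fourier_coeff u k)"

definition grad :: "scalar_field \<Rightarrow> vector_field" where
  "grad u = (SOME g. is_grad u g)"

text \<open>
  \<open>L\<^sup>2\<^sub>l\<^sub>o\<^sub>c([0,\<infinity>); H\<^sup>s)\<close> and \<open>L\<^sup>\<infinity>([0,\<infinity>); H\<^sup>s)\<close>.  Since \<open>H\<^sup>s\<close> is a separable Hilbert space, strong
  measurability amounts to measurability of every Fourier coefficient (Pettis).
\<close>

definition time_measurable :: "(real \<Rightarrow> scalar_field) \<Rightarrow> bool" where
  "time_measurable w \<longleftrightarrow> (\<forall>k. (\<lambda>t. fourier_coeff (w t) k) \<in> borel_measurable (lebesgue_on {0..}))"

definition L2_loc :: "real \<Rightarrow> (real \<Rightarrow> scalar_field) set" where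
  "L2_loc s = {w. time_measurable w \<and> (AE t in lebesgue_on {0..}. w t \<in> sobolev s) \<and>
     (\<forall>S\<ge>0. (\<integral>\<^sup>+t. ennreal ((sobolev_norm s (w t))\<^sup>2) \<partial>lebesgue_on {0..S}) < \<infinity>)}"

definition L_inf :: "real \<Rightarrow> (real \<Rightarrow> scalar_field) set" where
  "L_inf s = {w. time_measurable w \<and> (AE t in lebesgue_on {0..}. w t \<in> sobolev s) \<and>
     (\<exists>C. AE t in lebesgue_on {0..}. sobolev_norm s (w t) \<le> C)}"

definition time_continuous :: "real \<Rightarrow> (real \<Rightarrow> scalar_field) \<Rightarrow> bool" where
  "time_continuous s w \<longleftrightarrow> (\<forall>t\<ge>0. w t \<in> sobolev s \<and>
     ((\<lambda>r. sobolev_norm s (\<lambda>x. w r x - w t x)) \<longlongrightarrow> 0) (at t within {0..}))"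

text \<open>
  \<open>w\<close> is the time derivative of the continuous curve \<open>\<theta>\<close>: \<open>\<theta>(t) = \<theta>(0) + \<integral>\<^sub>0\<^sup>t w\<close> as a Bochner integral,
  an identity that is written out on the Fourier coefficients.
\<close>

definition has_time_deriv :: "(real \<Rightarrow> scalar_field) \<Rightarrow> (real \<Rightarrow> scalar_field) \<Rightarrow> bool" where
  "has_time_deriv \<theta> w \<longleftrightarrow> (\<forall>t\<ge>0. \<forall>k.
     integrable (lebesgue_on {0..t}) (\<lambda>r. fourier_coeff (w r) k) \<and>
     fourier_coeff (\<theta> t) k = fourier_coeff (\<theta> 0) k + (LINT r|lebesgue_on {0..t}. fourier_coeff (w r) k))"

text \<open>
  Weak solutions of \<open>\<partial>\<^sub>t\<theta> = -v\<sqdot>\<nabla>\<theta> + \<kappa>\<Delta>\<theta>\<close>, \<open>\<theta>(0) = \<theta>\<^sub>0\<close>, for \<open>m > 1\<close>.  The first two clauses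
  select the representative that is continuous in time with values in \<open>H\<^sup>m\<close> and continuous in space,
  so that point values are meaningful.  The derivative \<open>w t\<close> lies in \<open>H\<^bsup>m-1\<^esup> \<subseteq> L\<^sup>2\<close>, on which the
  pairing of \<open>H\<^bsup>-1\<^esup>\<close> with \<open>H\<^sup>1\<close> is the \<open>L\<^sup>2\<close> inner product.
\<close>

definition weak_solution ::
    "real \<Rightarrow> real \<Rightarrow> vector_field \<Rightarrow> scalar_field \<Rightarrow> (real \<Rightarrow> scalar_field) \<Rightarrow> bool" where
  "weak_solution \<kappa> m v \<theta>0 \<theta> \<longleftrightarrow>
     time_continuous m \<theta> \<and> (\<forall>t\<ge>0. continuous_on UNIV (\<theta> t)) \<and>
     (AE x in torus. \<theta> 0 x = \<theta>0 x) \<and>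
     \<theta> \<in> L2_loc (m + 1) \<and> \<theta> \<in> L_inf m \<and>
     (\<exists>w \<in> L2_loc (m - 1). has_time_deriv \<theta> w \<and>
        (AE t in lebesgue_on {0..}. \<forall>\<phi> \<in> sobolev 1.
           L2_inner (w t) \<phi> + L2_inner (\<lambda>x. v x \<bullet> grad (\<theta> t) x) \<phi>
             + \<kappa> * (LINT x|torus. grad (\<theta> t) x \<bullet> grad \<phi> x) = 0))"

text \<open>
  Weak solutions exist and any two of them agree on \<open>[0,\<infinity>)\<close>; they are unconstrained
  at negative times, which is why \<open>SOME\<close> is used instead of \<open>THE\<close>.
\<close>

definition adv_diff_solution ::
    "real \<Rightarrow> real \<Rightarrow> vector_field \<Rightarrow> scalar_field \<Rightarrow> real \<Rightarrow> scalar_field" where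
  "adv_diff_solution \<kappa> m v \<theta>0 = (SOME \<theta>. weak_solution \<kappa> m v \<theta>0 \<theta>)"

definition likelihood ::
    "real \<Rightarrow> (nat \<Rightarrow> vector_field \<Rightarrow> real) \<Rightarrow> (nat \<Rightarrow> real) \<Rightarrow> nat \<Rightarrow> vector_field \<Rightarrow> real" where
  "likelihood \<sigma> G y N v = exp (- (1 / (2 * \<sigma>\<^sup>2)) * (\<Sum>j=1..N. (y j - G j v)\<^sup>2))"

definition posterior ::
    "real \<Rightarrow> vector_field measure \<Rightarrow> (nat \<Rightarrow> vector_field \<Rightarrow> real) \<Rightarrow> (nat \<Rightarrow> real) \<Rightarrow> nat
      \<Rightarrow> vector_field measure" where
  "posterior \<sigma> \<mu>0 G y N =
     density \<mu>0 (\<lambda>v. ennreal (likelihood \<sigma> G y N v / (\<integral>u. likelihood \<sigma> G y N u \<partial>\<mu>0)))"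

text \<open>\<open>f(\<parallel>v\<parallel>)\<close> with the conventions \<open>\<parallel>v\<parallel> = \<infinity>\<close> for \<open>v\<close> outside the space, and \<open>f(\<infinity>) = \<infinity>\<close>.\<close>

definition f_of_norm :: "(real \<Rightarrow> real) \<Rightarrow> real \<Rightarrow> vector_field \<Rightarrow> ennreal" where
  "f_of_norm f s v = (if v \<in> div_free s then ennreal (f (div_free_norm s v)) else \<infinity>)"

end

(*
  Fourier coefficients turn the advection-diffusion equation into an infinite system of linear ODEs, and weak
  solutions into its mode solutions.  Energy estimates for this system give existence, uniqueness, and a bound and a
  Lipschitz dependence on the field of the point values, both uniform on balls of H.

  The log likelihood ratio of v and vstar is -N/(2 sigma^2) times an empirical mean, whose limit is the population
  risk, the mean squared difference of the two solutions.  A strong law for orthogonal variables gives this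
  for each v; it is uniform on balls of V by the Lipschitz bound, since these balls are compact in H.  The risk
  vanishes only at vstar: if the solutions with the fields v and vstar agree, then subtracting the equations gives
  (v - vstar) . grad theta = 0 for both initial conditions, and their gradients span the plane.  Hence the posterior
  mass of a ball of V minus a neighbourhood of vstar decays exponentially against the prior mass of a small ball of V,
  and the moment hypothesis controls the mass outside large balls of V.
*)
theory Submission
 imports Defs "HOL-Library.Diagonal_Subsequence"
begin

section \<open>Fourier series on the torus\<close>

text \<open>\<open>adv_diff_solution\<close> is a choice, so nothing can be said about the forward
  map before existence is proved. The weak formulation also demands a bound in H^m that is uniform
  over all times, whereas the energy estimate alone grows exponentially. The gap is closed by
  interpolation with the mean square, which does not grow because the transport matrix of a
  divergence-free field is antisymmetric. No commutator estimate enters: diffusion controls one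
  derivative more than the energy and allows the transport term to be estimated one derivative
  lower, and H^m is an algebra since m > 1 in dimension two. The estimates are made for amplitudes
  in \<open>ennreal\<close>, so that sums exist without prior summability; in return, a term can be
  cancelled from both sides only after it is known to be finite. Almost sure convergence can be
  secured for only countably many fields at once. Finite nets of the balls of V are therefore drawn
  from one countable set, and the Lipschitz constant of the empirical mean, which contains the
  average absolute noise, is bounded along almost every path.\<close>

abbreviation freqs :: "(int \<times> int) measure" where "freqs \<equiv> count_space UNIV"

definition wave :: "int \<times> int => real \<times> real => complex" where "wave k x = cis (2 * pi * (freq k \<bullet> x))"

lemma freq_simps: "freq 0 = 0" "freq (j + k) = freq j + freq k" "freq (- k) = - freq k" "freq (j - k) = freq j - freq k"
 by (auto simp: freq_def prod_eq_iff)

lemma wave_0 [simp]: "wave 0 x = 1" by (simp add: wave_def freq_simps)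

lemma wave_add: "wave (j + k) x = wave j x * wave k x"
 by (simp add: wave_def freq_simps inner_add_left cis_mult algebra_simps)

lemma wave_minus: "wave (- k) x = cnj (wave k x)" by (simp add: wave_def freq_simps cis_cnj)

lemma norm_wave [simp]: "cmod (wave k x) = 1" by (simp add: wave_def)

lemma continuous_on_wave [continuous_intros]: "continuous_on S (wave k)"
 unfolding wave_def cis_conv_exp by (intro continuous_intros)

lemma periodic_wave: "periodic (wave k)"
proof -
 have "wave k (x + (of_int a, of_int b)) = wave k x" for x and a b :: int
 proof -
  have "freq k \<bullet> (of_int a, of_int b) = of_int (fst k * a + snd k * b)" by (simp add: freq_def)
  then have "wave k (x + (of_int a, of_int b)) = wave k x * cis (2 * pi * of_int (fst k * a + snd k * b))"
   by (simp add: wave_def inner_add_right distrib_left cis_mult)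
  also have "cis (2 * pi * of_int (fst k * a + snd k * b)) = 1" by (intro cis_multiple_2pi) auto
  finally show ?thesis by simp
 qed
 then show ?thesis by (simp add: periodic_def)
qed

lemma sets_lebesgue_cell [simp]: "unit_cell \<in> sets lebesgue" by simp

lemma continuous_torus_measurable:
 fixes f :: "real \<times> real => 'b::euclidean_space"
 assumes "continuous_on UNIV f"
 shows "f \<in> borel_measurable torus" by (rule continuous_imp_measurable_on_sets_lebesgue)
  (use assms continuous_on_subset in \<open>auto intro: continuous_on_subset\<close>)

lemma wave_measurable [measurable]: "wave k \<in> borel_measurable torus"
 by (intro continuous_torus_measurable continuous_intros)

lemma measure_torus: "measure torus (space torus) = 1" by (simp add: measure_restrict_space content_Pair)

lemma finite_measure_torus: "finite_measure torus" by (rule finite_measure_lebesgue_on) simp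

lemma prob_space_torus: "prob_space torus"
proof -
 interpret finite_measure torus by (rule finite_measure_torus)
 show ?thesis by (rule prob_spaceI) (use measure_torus in \<open>simp add: emeasure_eq_measure\<close>)
qed

lemma integrable_torus_bounded:
 fixes f :: "real \<times> real => 'b::{banach, second_countable_topology}"
 assumes "f \<in> borel_measurable torus" "\<And>x. norm (f x) <= B"
 shows "integrable torus f"
proof -
 interpret finite_measure torus by (rule finite_measure_torus)
 show ?thesis by (rule integrable_const_bound[where B=B]) (use assms in auto)
qed

lemma integrable_wave: "integrable torus (wave k)" by (rule integrable_torus_bounded[where B=1]) auto

lemma integrable_mult_wave:
 fixes f :: "real \<times> real => complex"
 assumes "integrable torus f"
 shows "integrable torus (\<lambda>x. f x * wave k x)"
 by (rule Bochner_Integration.integrable_bound[OF integrable_norm[OF assms]])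
  (use borel_measurable_integrable[OF assms] in \<open>auto simp: norm_mult\<close>)

text \<open>\<open>fourier_coeff\<close> accepts real functions only; the complex version is
  compatible with conjugation and with multiplication by waves, on which the following proofs
  rest.\<close>

definition fc :: "(real \<times> real => complex) => int \<times> int => complex" where "fc f k = (LINT x|torus. f x * wave (- k) x)"

lemma fourier_coeff_fc: "fourier_coeff u k = fc (\<lambda>x. of_real (u x)) k"
 by (simp add: fourier_coeff_def fc_def wave_def freq_simps)

lemma integral_cis_period:
 fixes n :: int
 shows "integral {0..1} (\<lambda>y. cis (2 * pi * (of_int n * y))) = (if n = 0 then 1 else 0)"
proof (cases "n = 0")
 case False
 define F where "F y = cis (2 * pi * (of_int n * y)) / (2 * pi * \<i> * of_int n)" for y :: real
 have "(F has_vector_derivative cis (2 * pi * (of_int n * y))) (at y within {0..1})" for y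
 proof -
  have "((\<lambda>z. exp (2 * pi * \<i> * of_int n * z) / (2 * pi * \<i> * of_int n)) has_field_derivative
    exp (2 * pi * \<i> * of_int n * of_real y)) (at (of_real y))"
   using False by (auto intro!: derivative_eq_intros)
  from has_vector_derivative_real_field[OF this] show ?thesis by (simp add: F_def[abs_def] cis_conv_exp mult_ac)
 qed
 then have "((\<lambda>y. cis (2 * pi * (of_int n * y))) has_integral (F 1 - F 0)) {0..1}"
  by (intro fundamental_theorem_of_calculus) auto
 moreover have "F 1 = F 0" using cis_multiple_2pi[of "of_int n"] by (simp add: F_def)
 ultimately show ?thesis using False by (simp add: integral_unique)
qed simp

lemma integral_wave: "(LINT x|torus. wave k x) = (if k = 0 then 1 else 0)"
proof -
 have "(LINT x|torus. wave k x) = integral unit_cell (wave k)"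
  by (rule lebesgue_integral_eq_integral) (auto simp: integrable_wave)
 also have "... = integral (cbox 0 1) (\<lambda>a. integral (cbox 0 1) (\<lambda>b. wave k (a, b)))"
  by (rule integral_prod_continuous) (rule continuous_on_wave)
 also have "... = integral {0..1} (\<lambda>a. integral {0..1} (\<lambda>b. cis (2 * pi * (of_int (fst k) * a)) *
   cis (2 * pi * (of_int (snd k) * b))))" by (simp add: wave_def freq_def cis_mult distrib_left)
 also have "... = (if k = 0 then 1 else 0)" by (auto simp: integral_cis_period prod_eq_iff)
 finally show ?thesis .
qed

lemma fc_add: "integrable torus f ==> integrable torus g ==> fc (\<lambda>x. f x + g x) k = fc f k + fc g k"
 unfolding fc_def by (simp add: integrable_mult_wave distrib_right)

lemma fc_diff: "integrable torus f ==> integrable torus g ==> fc (\<lambda>x. f x - g x) k = fc f k - fc g k"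
 unfolding fc_def by (simp add: integrable_mult_wave left_diff_distrib)

lemma fc_cmult: "fc (\<lambda>x. c * f x) k = c * fc f k" unfolding fc_def by (simp add: mult.assoc)

lemma fc_cnj: "fc (\<lambda>x. cnj (f x)) k = cnj (fc f (- k))"
proof -
 have "fc (\<lambda>x. cnj (f x)) k = (LINT x|torus. cnj (f x * wave k x))" by (simp add: fc_def wave_minus)
 also have "... = cnj (LINT x|torus. f x * wave k x)" by (rule Bochner_Integration.integral_cnj)
 finally show ?thesis by (simp add: fc_def)
qed

lemma norm_fc_le: assumes "integrable torus f" shows "cmod (fc f k) <= (LINT x|torus. cmod (f x))"
proof -
 have "cmod (fc f k) <= (LINT x|torus. cmod (f x * wave (- k) x))" unfolding fc_def by (rule integral_norm_bound)
 then show ?thesis by (simp add: norm_mult)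
qed

lemma fc_cong_AE:
 assumes "AE x in torus. f x = g x" "f \<in> borel_measurable torus" "g \<in> borel_measurable torus"
 shows "fc f k = fc g k"
 unfolding fc_def by (rule integral_cong_AE) (use assms in auto)

lemma fourier_coeff_cong_AE:
 assumes "AE x in torus. f x = g x" "f \<in> borel_measurable torus" "g \<in> borel_measurable torus"
 shows "fourier_coeff f k = fourier_coeff g k"
 unfolding fourier_coeff_fc by (rule fc_cong_AE) (use assms in auto)

section \<open>Uniqueness of Fourier coefficients\<close>

lemma integral_mult_trig_poly_eq_0:
 fixes f :: "real \<times> real => complex"
 assumes f: "integrable torus f" and z: "\<And>k. fc f k = 0" and p: "real_polynomial_function p"
 shows "(LINT x|torus. f x * of_real (p (wave (1,0) x, wave (0,1) x))) = 0"
proof -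
 \<comment> \<open>E maps the torus into C^2. In these coordinates a real polynomial is a
   trigonometric polynomial, because real and imaginary parts are combinations of a wave and its
   conjugate.\<close>
 define E where "E x = (wave (1,0) x, wave (0,1) x)" for x
 \<comment> \<open>The clause over all k makes I invariant under multiplication by a wave, which
   merely shifts the frequency.\<close>
 define I where "I h \<longleftrightarrow> integrable torus (\<lambda>x. f x * h x) \<and>
   (\<forall>k. (LINT x|torus. f x * h x * wave k x) = 0)" for h :: "real \<times> real => complex"
 have I1: "I (\<lambda>_. 1)"
 proof -
  have "(LINT x|torus. f x * wave k x) = 0" for k using z[of "- k"] by (simp add: fc_def)
  then show ?thesis using f by (simp add: I_def)
 qed
 have Iw: "I (\<lambda>x. h x * wave j x)" if "I h" for h j using that integrable_mult_wave[of "\<lambda>x. f x * h x" j]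
  by (auto simp: I_def mult.assoc simp del: split_paired_All simp flip: wave_add)
 have Ia: "I (\<lambda>x. h x + g x)" if "I h" "I g" for h g
  using that integrable_mult_wave[of "\<lambda>x. f x * h x"] integrable_mult_wave[of "\<lambda>x. f x * g x"]
  by (auto simp: I_def distrib_left distrib_right)
 have Ic: "I (\<lambda>x. c * h x)" if "I h" for h c
 proof -
  have "(LINT x|torus. f x * (c * h x) * wave k x) = c * (LINT x|torus. f x * h x * wave k x)" for k
   by (subst integral_mult_right_zero[symmetric]) (simp add: mult_ac)
  moreover have "integrable torus (\<lambda>x. c * (f x * h x))" using that by (auto simp: I_def)
  ultimately show ?thesis using that by (auto simp: I_def mult_ac)
 qed
 \<comment> \<open>The factor h is arbitrary in the induction, so that the product case is an
   application of one hypothesis after the other.\<close>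
 have "\<forall>h. I h \<longrightarrow> I (\<lambda>x. of_real (p (E x)) * h x)" using p
 proof induction
  case (linear p)
  interpret bounded_linear p by (rule linear)
  define a1 a2 b1 b2 where "a1 = p (1, 0)" and "a2 = p (\<i>, 0)" and "b1 = p (0, 1)" and "b2 = p (0, \<i>)"
  have pE: "p z = Re (fst z) * a1 + Im (fst z) * a2 + Re (snd z) * b1 + Im (snd z) * b2" for z
  proof -
   have "z = Re (fst z) *\<^sub>R (1, 0) + Im (fst z) *\<^sub>R (\<i>, 0) + Re (snd z) *\<^sub>R (0, 1) + Im (snd z) *\<^sub>R (0, \<i>)"
    by (simp add: prod_eq_iff complex_eq_iff)
   then have "p z = p (Re (fst z) *\<^sub>R (1, 0) + Im (fst z) *\<^sub>R (\<i>, 0) + Re (snd z) *\<^sub>R (0, 1) + Im (snd z) *\<^sub>R (0, \<i>))"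
    by simp
   then show ?thesis unfolding add scaleR a1_def a2_def b1_def b2_def by simp
  qed
  have re: "of_real (Re (wave j x)) = (wave j x + wave (- j) x) / 2" for j x by (simp add: wave_minus complex_eq_iff)
  have im: "of_real (Im (wave j x)) = (wave j x - wave (- j) x) / (2 * \<i>)" for j x
   by (simp add: wave_minus complex_diff_cnj mult_ac complex_i_mult_minus)
  have "of_real (p (E x)) * h x =
    ((a1 / 2 + a2 / (2 * \<i>)) * (h x * wave (1,0) x) + (a1 / 2 - a2 / (2 * \<i>)) * (h x * wave (- (1,0)) x)) +
    ((b1 / 2 + b2 / (2 * \<i>)) * (h x * wave (0,1) x) + (b1 / 2 - b2 / (2 * \<i>)) * (h x * wave (- (0,1)) x))"
   for h :: "real \<times> real => complex" and x
   unfolding pE E_def fst_conv snd_conv of_real_add of_real_mult re im by (simp add: field_simps)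
  then show ?case by (auto intro!: Ia Ic Iw)
 next
  case (const c)
  then show ?case by (auto intro: Ic)
 next
  case (add f g)
  then show ?case by (auto intro!: Ia simp: distrib_right)
 next
  case (mult f g)
  then show ?case by (auto simp: mult.assoc)
 qed
 with I1 have "I (\<lambda>x. of_real (p (E x)) * 1)" by blast
 then have "(LINT x|torus. f x * (of_real (p (E x)) * 1) * wave 0 x) = 0" unfolding I_def by blast
 then show ?thesis by (simp add: E_def)
qed

text \<open>Stone-Weierstrass on a compact set containing the image of the embedding extends the
  vanishing integrals from polynomials to continuous functions. The indicator of a closed set is a
  pointwise limit of such functions, so dominated convergence applies.\<close>

lemma integral_mult_closed_eq_0:
 fixes f :: "real \<times> real => complex" and C :: "(complex \<times> complex) set"
 assumes f: "integrable torus f" and z: "\<And>k. fc f k = 0" and C: "closed C" "C \<noteq> {}"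
 shows "(LINT x|torus. f x * indicator C (wave (1,0) x, wave (0,1) x)) = 0"
proof -
 define E where "E x = (wave (1,0) x, wave (0,1) x)" for x
 have contE: "continuous_on UNIV E" unfolding E_def by (intro continuous_intros)
 have fm: "f \<in> borel_measurable torus" using f by simp
 define K where "K = cball (0::complex) 1 \<times> cball (0::complex) 1"
 have K: "compact K" "E x \<in> K" for x by (auto simp: K_def E_def compact_Times)
 have *: "(LINT x|torus. f x * of_real (g (E x))) = 0" if g: "continuous_on UNIV g" for g :: "complex \<times> complex => real"
 proof -
  have gE: "(\<lambda>x. complex_of_real (g (E x))) \<in> borel_measurable torus"
   by (intro continuous_torus_measurable continuous_intros continuous_on_compose2[OF g contE]) auto
  obtain b where b: "\<And>z. z \<in> K ==> \<bar>g z\<bar> <= b"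
   using compact_continuous_image[OF continuous_on_subset[OF g] K(1)] compact_imp_bounded
   by (fastforce simp: bounded_iff)
  have ig: "integrable torus (\<lambda>x. f x * of_real (g (E x)))"
  proof (rule Bochner_Integration.integrable_bound[of _ "\<lambda>x. b * cmod (f x)"])
   show "AE x in torus. norm (f x * of_real (g (E x))) <= norm (b * cmod (f x))"
   proof (rule AE_I2)
    fix x
    have "\<bar>g (E x)\<bar> <= \<bar>b\<bar>" using b[OF K(2)[of x]] by linarith
    then show "norm (f x * of_real (g (E x))) <= norm (b * cmod (f x))"
     by (simp add: norm_mult abs_mult mult.commute[of _ "cmod (f x)"] mult_left_mono)
   qed
  qed (use f fm gE in auto)
  let ?I = "LINT x|torus. f x * of_real (g (E x))"
  have "cmod ?I <= e * (LINT x|torus. cmod (f x))" if e: "e > 0" for e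
  proof -
   obtain p where p: "real_polynomial_function p" "\<And>z. z \<in> K ==> \<bar>g z - p z\<bar> < e"
    using Stone_Weierstrass_real_polynomial_function[OF K(1) continuous_on_subset[OF g] e] by auto
   have cp: "continuous_on UNIV p" using p(1) continuous_on_polymonial_function real_polynomial_function_eq by metis
   have pE: "(\<lambda>x. complex_of_real (p (E x))) \<in> borel_measurable torus"
    by (intro continuous_torus_measurable continuous_intros continuous_on_compose2[OF cp contE]) auto
   have ip: "integrable torus (\<lambda>x. f x * of_real (p (E x)))"
   proof (rule Bochner_Integration.integrable_bound[of _ "\<lambda>x. (b + e) * cmod (f x)"])
    have "\<bar>p (E x)\<bar> <= b + e" for x using p(2)[OF K(2)[of x]] b[OF K(2)[of x]] by linarith
    then show "AE x in torus. norm (f x * of_real (p (E x))) <= norm ((b + e) * cmod (f x))"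
     by (auto simp: norm_mult abs_mult mult.commute intro!: mult_left_mono order_trans[OF _ abs_ge_self])
   qed (use f fm pE in auto)
   have "(LINT x|torus. f x * of_real (p (E x))) = 0"
    using integral_mult_trig_poly_eq_0[OF f z p(1)] by (simp add: E_def)
   then have "?I = (LINT x|torus. f x * of_real (g (E x)) - f x * of_real (p (E x)))" using ig ip by simp
   also have "cmod ... <= (LINT x|torus. cmod (f x * of_real (g (E x)) - f x * of_real (p (E x))))"
    by (rule integral_norm_bound)
   also have "... <= (LINT x|torus. e * cmod (f x))"
   proof (rule integral_mono)
    fix x
    have "cmod (f x * of_real (g (E x)) - f x * of_real (p (E x))) = cmod (f x) * \<bar>g (E x) - p (E x)\<bar>"
     by (simp add: norm_mult flip: right_diff_distrib of_real_diff)
    then show "cmod (f x * of_real (g (E x)) - f x * of_real (p (E x))) <= e * cmod (f x)"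
     using p(2)[OF K(2)[of x]] by (simp add: mult.commute[of e] mult_left_mono)
   qed (use f ig ip in auto)
   finally show ?thesis by simp
  qed note bd = this
  have "?I = 0"
  proof (rule ccontr)
   assume "?I \<noteq> 0"
   then have "0 < cmod ?I" by simp
   \<comment> \<open>The tolerance |I| / (2 (L + 1)) leads to |I| < |I|; the summand 1 covers the
     case L = 0.\<close>
   define L where "L = (LINT x|torus. cmod (f x))"
   have L: "L >= 0" by (simp add: L_def)
   have pos: "cmod ?I / (2 * (L + 1)) > 0" using \<open>0 < cmod ?I\<close> L by (intro divide_pos_pos) auto
   have "cmod ?I <= cmod ?I / (2 * (L + 1)) * L" using bd[OF pos] by (simp only: L_def)
   also have "... = cmod ?I * (L / (2 * (L + 1)))" by simp
   also have "... < cmod ?I * 1" by (rule mult_strict_left_mono) (use L \<open>0 < cmod ?I\<close> in \<open>auto simp: field_simps\<close>)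
   finally show False by simp
  qed
  then show ?thesis .
 qed
 \<comment> \<open>Tent functions of the distance to C: they are 1 on C, and at a point off C they
   are eventually 0 because C is closed.\<close>
 define g where "g n z = max 0 (1 - real n * infdist z C)" for n z
 have lim: "(\<lambda>n. g n z) \<longlonglongrightarrow> indicator C z" for z
 proof (cases "z \<in> C")
  case True then show ?thesis by (simp add: g_def)
 next
  case False
  then have pos: "infdist z C > 0" using C by (metis in_closed_iff_infdist_zero infdist_nonneg order_le_less)
  obtain N :: nat where N: "1 / infdist z C < N" using reals_Archimedean2 by blast
  have "g n z = 0" if "n >= N" for n
  proof -
   have "1 < real N * infdist z C" using N pos by (simp add: field_simps)
   also have "... <= real n * infdist z C" using that pos by (intro mult_right_mono) auto
   finally show ?thesis by (simp add: g_def)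
  qed
  then have "\<forall>\<^sub>F n in sequentially. g n z = 0" by (auto simp: eventually_sequentially)
  then show ?thesis using False by (simp add: tendsto_eventually)
 qed
 have gc: "continuous_on UNIV (g n)" for n unfolding g_def by (intro continuous_intros)
 have gE: "(\<lambda>x. complex_of_real (g n (E x))) \<in> borel_measurable torus" for n
  by (intro continuous_torus_measurable continuous_intros continuous_on_compose2[OF gc contE]) auto
 have ind: "(\<lambda>x. indicator C (E x) :: complex) \<in> borel_measurable torus"
 proof (rule borel_measurable_LIMSEQ_metric[OF gE])
  show "(\<lambda>n. complex_of_real (g n (E x))) \<longlonglongrightarrow> indicator C (E x)" for x
   using tendsto_of_real[OF lim[of "E x"], where 'a=complex] by (cases "E x \<in> C") auto
 qed
 have "(\<lambda>n. LINT x|torus. f x * of_real (g n (E x))) \<longlonglongrightarrow> (LINT x|torus. f x * indicator C (E x))"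
 proof (rule integral_dominated_convergence[where w="\<lambda>x. cmod (f x)"])
  show "AE x in torus. (\<lambda>n. f x * of_real (g n (E x))) \<longlonglongrightarrow> f x * indicator C (E x)"
  proof (rule AE_I2)
   fix x show "(\<lambda>n. f x * of_real (g n (E x))) \<longlonglongrightarrow> f x * indicator C (E x)"
    using tendsto_mult[OF tendsto_const tendsto_of_real[OF lim[of "E x"], where 'a=complex], of "f x"]
    by (cases "E x \<in> C") auto
  qed
  show "AE x in torus. norm (f x * of_real (g n (E x))) <= cmod (f x)" for n
  proof (rule AE_I2)
   fix x
   have "\<bar>g n (E x)\<bar> <= 1" unfolding g_def using infdist_nonneg[of "E x" C] by (simp add: max_def)
   then show "norm (f x * of_real (g n (E x))) <= cmod (f x)"
    using mult_left_mono[of "\<bar>g n (E x)\<bar>" 1 "cmod (f x)"] by (simp add: norm_mult)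
  qed
 qed (use f fm gE ind in auto)
 then show ?thesis using *[OF gc] by (simp add: LIMSEQ_const_iff E_def)
qed

text \<open>The embedding is injective on the open cell, so within the cell a closed box is the
  preimage of a closed set and f has integral zero over it. By Lebesgue differentiation the value of
  f at almost every point is a limit of averages over shrinking boxes.\<close>

lemma AE_eq_0_of_fc:
 fixes f :: "real \<times> real => complex"
 assumes f: "integrable torus f" and z: "\<And>k. fc f k = 0"
 shows "AE x in torus. f x = 0"
proof -
 \<comment> \<open>The boundary, where the embedding identifies opposite sides, is removed;
   extension by zero gives a function on the whole plane, to which the differentiation theorem
   applies.\<close>
 define f0 where "f0 x = (if x \<in> box (0,0) (1,1) then f x else 0)" for x :: "real \<times> real"
 define E where "E x = (wave (1,0) x, wave (0,1) x)" for x
 have contE: "continuous_on S E" for S unfolding E_def by (intro continuous_intros)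
 have fi: "f absolutely_integrable_on unit_cell" using f by (simp add: set_integrable_def integrable_restrict_space)
 have f0i: "f0 absolutely_integrable_on UNIV"
 proof -
  have "f absolutely_integrable_on box (0,0) (1,1)"
   by (rule set_integrable_subset[OF fi]) (use box_subset_cbox in auto)
  then show ?thesis by (simp add: f0_def[abs_def] absolutely_integrable_restrict_UNIV)
 qed
 have inj: "x = y" if "E x = E y" "x \<in> box (0,0) (1,1)" "y \<in> box (0,0) (1,1)" for x y
 proof -
  have *: "s = t" if "cis (2 * pi * s) = cis (2 * pi * t)" "0 < s" "s < 1" "0 < t" "t < 1" for s t :: real
  proof -
   have "sin (2 * pi * s) = sin (2 * pi * t) \<and> cos (2 * pi * s) = cos (2 * pi * t)"
    using that(1) by (simp add: complex_eq_iff)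
   then obtain n :: int where "2 * pi * s = 2 * pi * t + 2 * pi * n" using sin_cos_eq_iff by blast
   then have "2 * pi * s = 2 * pi * (t + of_int n)" by (simp add: distrib_left)
   then have "s = t + of_int n" by simp
   then have "n < 1" "n > -1" using that by linarith+
   then have "n = 0" by simp
   then show ?thesis using \<open>s = t + of_int n\<close> by simp
  qed
  show ?thesis using that *[of "fst x" "fst y"] *[of "snd x" "snd y"]
   by (cases x; cases y) (auto simp: E_def wave_def freq_def mem_box Basis_prod_def)
 qed
 have box0: "integral (cbox a b) f0 = 0" if ab: "cbox a b \<subseteq> box (0,0) (1,1)" "cbox a b \<noteq> {}" for a b
 proof -
  have "closed (E ` cbox a b)" by (intro compact_imp_closed compact_continuous_image contE compact_cbox)
  then have "(LINT x|torus. f x * indicator (E ` cbox a b) (E x)) = 0"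
   using integral_mult_closed_eq_0[OF f z] ab by (simp add: E_def)
  moreover have "integrable torus (\<lambda>x. f x * indicator (E ` cbox a b) (E x))"
  proof (rule Bochner_Integration.integrable_bound[OF f])
   have "E -` (E ` cbox a b) \<inter> UNIV \<in> sets borel"
    using continuous_closed_vimage[of "E ` cbox a b" E] \<open>closed (E ` cbox a b)\<close> contE[of UNIV]
    by (auto simp: continuous_on_eq_continuous_within)
   then have "E -` (E ` cbox a b) \<in> sets borel" by simp
   then have ind: "(indicator (E -` (E ` cbox a b)) :: real \<times> real => complex) \<in> borel_measurable torus"
    by (intro measurable_restrict_space1 borel_measurable_indicator) (simp add: borel_closed)
   show "(\<lambda>x. f x * indicator (E ` cbox a b) (E x)) \<in> borel_measurable torus"
    using borel_measurable_times[OF borel_measurable_integrable[OF f] ind] by (simp only: indicator_vimage)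
  qed (auto simp: indicator_def)
  ultimately have "integral unit_cell (\<lambda>x. f x * indicator (E ` cbox a b) (E x)) = 0"
   using lebesgue_integral_eq_integral[of unit_cell "\<lambda>x. f x * indicator (E ` cbox a b) (E x)"] by simp
  then have "integral (box (0,0) (1,1)) (\<lambda>x. f x * indicator (E ` cbox a b) (E x)) = 0"
   by (simp add: integral_open_interval)
  also have "integral (box (0,0) (1,1)) (\<lambda>x. f x * indicator (E ` cbox a b) (E x))
    = integral (box (0,0) (1,1)) (\<lambda>x. if x \<in> cbox a b then f x else 0)"
  proof (rule integral_cong)
   fix x :: "real \<times> real" assume x: "x \<in> box (0,0) (1,1)"
   have "E x \<in> E ` cbox a b \<longleftrightarrow> x \<in> cbox a b"
   proof
    assume "E x \<in> E ` cbox a b"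
    then obtain y where y: "y \<in> cbox a b" "E x = E y" by blast
    with ab(1) have "y \<in> box (0,0) (1,1)" by blast
    from inj[OF y(2) x this] y(1) show "x \<in> cbox a b" by simp
   qed blast
   then show "f x * indicator (E ` cbox a b) (E x) = (if x \<in> cbox a b then f x else 0)" by (simp add: indicator_def)
  qed
  also have "... = integral (cbox a b) f"
   using ab(1) by (subst integral_restrict_Int) (simp add: Int_absorb2 Int_commute)
  also have "... = integral (cbox a b) f0" by (rule integral_cong) (use ab in \<open>auto simp: f0_def\<close>)
  finally show ?thesis by simp
 qed
 obtain N where N: "negligible N" "\<And>x e. \<lbrakk>x \<notin> N; 0 < e\<rbrakk> \<Longrightarrow> \<exists>d>0. \<forall>h. 0 < h \<and> h < d \<longrightarrow>
    norm (integral (cbox x (x + h *\<^sub>R One)) f0 /\<^sub>R h ^ DIM(real \<times> real) - f0 x) < e"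
  using integrable_ccontinuous_explicit[of f0] f0i
   integrable_on_subcbox[of f0 UNIV] absolutely_integrable_on_def by (metis subset_UNIV)
 have z0: "f x = 0" if x: "x \<in> box (0,0) (1,1)" "x \<notin> N" for x
 proof (rule ccontr)
  assume "f x \<noteq> 0"
  then have "norm (f x) > 0" by simp
  from N(2)[OF x(2) this] obtain d where d: "d > 0" "\<And>h. 0 < h ==> h < d ==>
    norm (integral (cbox x (x + h *\<^sub>R One)) f0 /\<^sub>R h ^ DIM(real \<times> real) - f0 x) < norm (f x)" by blast
  obtain r where r: "r > 0" "r < 1 - fst x" "r < 1 - snd x" "r < d"
  proof
   let ?r = "min (min (1 - fst x) (1 - snd x)) d / 2"
   have p: "min (min (1 - fst x) (1 - snd x)) d > 0" using x(1) d(1) by (cases x) (auto simp: mem_box Basis_prod_def)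
   then show "?r > 0" "?r < 1 - fst x" "?r < 1 - snd x" "?r < d" by (auto simp: min_def split: if_splits)
  qed
  have One: "One = (1::real, 1::real)"
  proof (rule euclidean_eqI)
   fix b :: "real \<times> real" assume b: "b \<in> Basis"
   have "One \<bullet> b = (\<Sum>u\<in>Basis. if u = b then 1 else 0)"
    unfolding inner_sum_left using b by (intro sum.cong) (auto simp: inner_Basis)
   then show "One \<bullet> b = (1, 1) \<bullet> b" using b by (auto simp: Basis_prod_def)
  qed
  have "cbox x (x + r *\<^sub>R One) \<subseteq> box (0,0) (1,1)"
   using x r unfolding One by (cases x; auto simp: mem_box Basis_prod_def box_ne_empty)
  moreover have "cbox x (x + r *\<^sub>R One) \<noteq> {}"
   using r unfolding One by (cases x; auto simp: box_ne_empty Basis_prod_def)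
  ultimately have "integral (cbox x (x + r *\<^sub>R One)) f0 = 0" by (rule box0)
  with d(2)[OF r(1) r(4)] x(1) show False by (simp add: f0_def)
 qed
 have "negligible (N \<union> (unit_cell - box (0,0) (1,1)))" using N(1) negligible_frontier_interval by (metis negligible_Un)
 then have "N \<union> (unit_cell - box (0,0) (1,1)) \<in> null_sets lebesgue" by (simp add: negligible_iff_null_sets)
 then have "AE x in lebesgue. x \<notin> N \<union> (unit_cell - box (0,0) (1,1))" by (rule AE_not_in)
 then have "AE x in lebesgue. x \<in> unit_cell \<longrightarrow> f x = 0" by eventually_elim (use z0 in auto)
 then show ?thesis by (subst AE_restrict_space_iff) auto
qed

lemma AE_eq_of_fc:
 fixes f :: "real \<times> real => complex"
 assumes "integrable torus f" "integrable torus g" "\<And>k. fc f k = fc g k"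
 shows "AE x in torus. f x = g x"
proof -
 have "AE x in torus. f x - g x = 0" by (rule AE_eq_0_of_fc) (use assms in \<open>auto simp: fc_diff\<close>)
 then show ?thesis by simp
qed

subsection \<open>Absolutely convergent series\<close>

text \<open>The sum is an integral over counting measure, so that dominated convergence and Fubini
  apply to it directly.\<close>

definition series :: "(int \<times> int => complex) => real \<times> real => complex" where "series C x = (LINT k|freqs. C k * wave k x)"

lemma integrable_series: "integrable freqs C ==> integrable freqs (\<lambda>k. C k * wave k x)"
 by (rule Bochner_Integration.integrable_bound[OF integrable_norm]) (auto simp: norm_mult)

lemma norm_series_le: "integrable freqs C ==> cmod (series C x) <= (LINT k|freqs. cmod (C k))"
 unfolding series_def by (rule order_trans[OF integral_norm_bound]) (simp add: norm_mult)

lemma continuous_on_series: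
 assumes "integrable freqs C"
 shows "continuous_on S (series C)"
proof (rule continuous_on_sequentiallyI)
 fix u and a :: "real \<times> real" assume u: "u \<longlonglongrightarrow> a"
 show "(\<lambda>n. series C (u n)) \<longlonglongrightarrow> series C a" unfolding series_def
 proof (rule integral_dominated_convergence[where w="\<lambda>k. cmod (C k)"])
  have "(\<lambda>n. wave k (u n)) \<longlonglongrightarrow> wave k a" for k
   using continuous_on_tendsto_compose[OF continuous_on_wave[of UNIV k] u] by simp
  then show "AE k in freqs. (\<lambda>n. C k * wave k (u n)) \<longlonglongrightarrow> C k * wave k a" by (intro AE_I2 tendsto_intros)
 qed (use assms in \<open>auto simp: norm_mult\<close>)
qed

lemma periodic_series: "periodic (series C)" using periodic_wave by (simp add: periodic_def series_def)

lemma sigma_finite_freqs: "sigma_finite_measure freqs" by (rule sigma_finite_measure_count_space)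

text \<open>Fubini for frequencies and space: multiplication by \<open>wave j\<close> shifts the
  coefficients by j, so the product has the convolution of the coefficients.\<close>

lemma fc_series_mult:
 assumes C: "integrable freqs C" and g: "integrable torus g"
 shows "integrable torus (\<lambda>x. series C x * g x)" and "fc (\<lambda>x. series C x * g x) k = (LINT j|freqs. C j * fc g (k - j))"
proof -
 have sm: "series C \<in> borel_measurable torus" by (intro continuous_torus_measurable continuous_on_series C)
 have gm: "g \<in> borel_measurable torus" using g by simp
 show int: "integrable torus (\<lambda>x. series C x * g x)"
 proof (rule Bochner_Integration.integrable_bound[of _ "\<lambda>x. (LINT k|freqs. cmod (C k)) * cmod (g x)"])
  show "AE x in torus. norm (series C x * g x) <= norm ((LINT k|freqs. cmod (C k)) * cmod (g x))"
   using norm_series_le[OF C] by (intro AE_I2) (simp add: norm_mult abs_mult mult_right_mono)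
 qed (use g sm gm in auto)
 interpret T: finite_measure torus by (rule finite_measure_torus)
 interpret F: sigma_finite_measure freqs by (rule sigma_finite_freqs)
 interpret P: pair_sigma_finite freqs torus ..
 define h where "h = (\<lambda>(j, x). C j * wave j x * (g x * wave (- k) x))"
 have hm: "h \<in> borel_measurable (freqs \<Otimes>\<^sub>M torus)"
  by (rule measurable_pair_measure_countable1) (use gm in \<open>auto simp: h_def\<close>)
 have hi: "integrable (freqs \<Otimes>\<^sub>M torus) h"
 proof (rule P.Fubini_integrable[OF hm])
  have "(LINT x|torus. norm (h (j, x))) = cmod (C j) * (LINT x|torus. cmod (g x))" for j
   by (simp add: h_def norm_mult)
  then show "integrable freqs (\<lambda>j. LINT x|torus. norm (h (j, x)))" using C by simp
  show "AE j in freqs. integrable torus (\<lambda>x. h (j, x))"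
   using integrable_mult_right[OF integrable_mult_wave[OF integrable_mult_wave[OF g]], of "C _" "- k" _]
   by (intro AE_I2) (simp add: h_def mult_ac)
 qed
 have "fc (\<lambda>x. series C x * g x) k = (LINT x|torus. LINT j|freqs. h (j, x))" unfolding fc_def
 proof (rule Bochner_Integration.integral_cong)
  fix x
  have "(LINT j|freqs. h (j, x)) = series C x * (g x * wave (- k) x)" unfolding h_def series_def split_conv
   by (rule integral_mult_left_zero)
  then show "series C x * g x * wave (- k) x = (LINT j|freqs. h (j, x))" by simp
 qed simp
 also have "... = (LINT j|freqs. LINT x|torus. h (j, x))" by (rule P.Fubini_integral) (use hi in simp)
 also have "... = (LINT j|freqs. C j * fc g (k - j))"
 proof (rule Bochner_Integration.integral_cong)
  fix j
  have "h (j, x) = C j * (g x * wave (- (k - j)) x)" for x using wave_add[of j "- k" x] by (simp add: h_def mult_ac)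
  then show "(LINT x|torus. h (j, x)) = C j * fc g (k - j)" by (simp add: fc_def)
 qed simp
 finally show "fc (\<lambda>x. series C x * g x) k = (LINT j|freqs. C j * fc g (k - j))" .
qed

lemma integrable_torus_const [simp]: "integrable torus (\<lambda>_. c :: 'a::{banach, second_countable_topology})"
 by (rule finite_measure.integrable_const[OF finite_measure_torus])

lemma fc_1: "fc (\<lambda>_. 1) k = (if k = 0 then 1 else 0)" by (simp add: fc_def integral_wave)

lemma integral_freqs_single: "(LINT j|freqs. (if j = k then c j else 0)) = (c k :: complex)"
proof -
 have "(LINT j|freqs. (if j = k then c j else 0)) = (LINT j|freqs. indicator {k} j *\<^sub>R c k)"
  by (rule Bochner_Integration.integral_cong) auto
 then show ?thesis by (simp add: measure_def)
qed

lemma fc_series: assumes "integrable freqs C" shows "fc (series C) k = C k"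
proof -
 from fc_series_mult(2)[OF assms integrable_torus_const[of 1], of k]
 have "fc (series C) k = (LINT j|freqs. C j * (if k - j = 0 then 1 else 0))" by (simp add: fc_1)
 also have "... = (LINT j|freqs. (if j = k then C j else 0))" by (rule Bochner_Integration.integral_cong) auto
 finally show ?thesis by (simp add: integral_freqs_single)
qed

text \<open>Uniqueness gives equality almost everywhere. Continuous functions that agree almost
  everywhere in the open cell agree there at every point, then on the closure, and then on the plane
  by periodicity.\<close>

lemma series_eq_of_continuous:
 assumes f: "continuous_on UNIV f" "periodic f" and C: "integrable freqs (fc f)"
 shows "f = series (fc f)"
proof -
 have i: "integrable torus f" "integrable torus (series (fc f))"
 proof -
  have "integrable torus h" if "continuous_on UNIV h" for h :: "real \<times> real => complex"
  proof -
   have "compact (h ` unit_cell)" by (rule compact_continuous_image[OF continuous_on_subset[OF that]]) auto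
   then obtain B where B: "\<And>x. x \<in> unit_cell ==> norm (h x) <= B" by (force simp: bounded_iff dest: compact_imp_bounded)
   interpret finite_measure torus by (rule finite_measure_torus)
   show ?thesis by (rule integrable_const_bound[where B=B]) (use B continuous_torus_measurable[OF that] in auto)
  qed
  then show "integrable torus f" "integrable torus (series (fc f))" using f continuous_on_series[OF C] by auto
 qed
 have "AE x in torus. f x = series (fc f) x" by (rule AE_eq_of_fc) (use i fc_series[OF C] in auto)
 then have ae: "AE x in lebesgue. x \<in> unit_cell \<longrightarrow> f x = series (fc f) x" by (subst (asm) AE_restrict_space_iff) auto
 define d where "d x = norm (f x - series (fc f) x)" for x
 have dc: "continuous_on UNIV d" unfolding d_def by (intro continuous_intros f continuous_on_series C)
 have in0: "d x = 0" if x: "x \<in> box (0,0) (1,1)" for x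
 proof (rule ccontr)
  assume "d x \<noteq> 0"
  then have "x \<in> {y. d y > 0} \<inter> box (0,0) (1,1)" using x by (auto simp: d_def)
  moreover have "open ({y. d y > 0} \<inter> box (0,0) (1,1))"
   using open_Collect_less[of "\<lambda>_. 0" d] dc by (intro open_Int) auto
  ultimately have "\<not> negligible ({y. d y > 0} \<inter> box (0,0) (1,1))" using open_not_negligible by blast
  moreover have "AE y in lebesgue. y \<notin> {y. d y > 0} \<inter> box (0,0) (1,1)"
   using ae by eventually_elim (use box_subset_cbox[of "(0,0)" "(1,1)::real\<times>real"] in \<open>auto simp: d_def simp del: box_subset_cbox\<close>)
  then have "{y. d y > 0} \<inter> box (0,0) (1,1) \<in> null_sets lebesgue"
   using \<open>open ({y. d y > 0} \<inter> box (0,0) (1,1))\<close> by (subst (asm) AE_iff_null_sets[symmetric]) auto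
  ultimately show False by (simp add: negligible_iff_null_sets)
 qed
 have cl: "d x = 0" if "x \<in> unit_cell" for x
 proof -
  have "closure (box (0,0) (1,1::real)) = (unit_cell :: (real \<times> real) set)"
   by (rule closure_box) (auto simp: box_ne_empty Basis_prod_def)
  then show ?thesis
   using continuous_constant_on_closure[OF continuous_on_subset[OF dc subset_UNIV], of "box (0,0) (1,1)" 0 x]
    in0 that by auto
 qed
 have "d x = 0" for x
 proof -
  define a b where "a = - \<lfloor>fst x\<rfloor>" and "b = - \<lfloor>snd x\<rfloor>"
  have "d (x + (of_int a, of_int b)) = d x"
   using f(2) periodic_series[of "fc f"] by (simp add: d_def periodic_def del: split_paired_All)
  moreover have "x + (of_int a, of_int b) \<in> unit_cell"
   by (cases x) (auto simp: a_def b_def mem_box Basis_prod_def, linarith+)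
  ultimately show ?thesis using cl by metis
 qed
 then show ?thesis by (auto simp: d_def)
qed

subsection \<open>Square integrable functions\<close>

lemma integrable_of_square:
 fixes g :: "real \<times> real => complex"
 assumes "g \<in> borel_measurable torus" "integrable torus (\<lambda>x. (cmod (g x))^2)"
 shows "integrable torus g"
proof -
 interpret finite_measure torus by (rule finite_measure_torus)
 have "cmod z <= 1 + (cmod z)^2" for z
  using sum_power2_ge_zero[of "cmod z - 1/2" 0] by (simp add: power2_eq_square algebra_simps)
 then show ?thesis by (intro Bochner_Integration.integrable_bound[of _ "\<lambda>x. 1 + (cmod (g x))^2" g]) (use assms in auto)
qed

text \<open>An exhaustion by finite sets whose complements contain only frequencies of norm at least
  n; the tail estimates in Sobolev norms use this.\<close>

definition box_freqs :: "nat => (int \<times> int) set" where "box_freqs n = {- int n .. int n} \<times> {- int n .. int n}"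

lemma finite_box_freqs [simp]: "finite (box_freqs n)" by (simp add: box_freqs_def)

lemma eventually_mem_box_freqs: "\<forall>\<^sub>F n in sequentially. k \<in> box_freqs n"
proof -
 have "k \<in> box_freqs n" if "n >= nat (\<bar>fst k\<bar> + \<bar>snd k\<bar>)" for n using that by (cases k) (auto simp: box_freqs_def)
 then show ?thesis unfolding eventually_sequentially by blast
qed

lemma nn_integral_freqs_le:
 assumes "\<And>k. a k >= 0" "\<And>n. (\<Sum>k\<in>box_freqs n. a k) <= c"
 shows "(\<integral>\<^sup>+ k. ennreal (a k) \<partial>freqs) <= ennreal c"
proof (rule LIMSEQ_le_const2)
 show "(\<lambda>n. \<integral>\<^sup>+ k. indicator (box_freqs n) k * ennreal (a k) \<partial>freqs) \<longlonglongrightarrow> (\<integral>\<^sup>+ k. ennreal (a k) \<partial>freqs)"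
 proof (rule nn_integral_LIMSEQ)
  show "incseq (\<lambda>n k. indicator (box_freqs n) k * ennreal (a k))"
   by (auto simp: incseq_def le_fun_def indicator_def box_freqs_def)
  show "(\<lambda>n. indicator (box_freqs n) k * ennreal (a k)) \<longlonglongrightarrow> ennreal (a k)" for k
   using eventually_mem_box_freqs[of k] by (intro tendsto_eventually) (auto elim: eventually_mono)
 qed auto
 have "(\<integral>\<^sup>+ k. indicator (box_freqs n) k * ennreal (a k) \<partial>freqs) <= ennreal c" for n
 proof -
  have "(\<integral>\<^sup>+ k. indicator (box_freqs n) k * ennreal (a k) \<partial>freqs) = (\<Sum>k\<in>box_freqs n. ennreal (a k))"
   by (subst nn_integral_count_space'[of "box_freqs n"]) (auto intro: sum.cong)
  also have "... = ennreal (\<Sum>k\<in>box_freqs n. a k)" using assms(1) by (simp add: sum_ennreal)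
  finally show ?thesis using assms(2) by (simp add: ennreal_leI)
 qed
 then show "\<exists>N. \<forall>n\<ge>N. (\<integral>\<^sup>+ k. indicator (box_freqs n) k * ennreal (a k) \<partial>freqs) <= ennreal c" by blast
qed

definition poly_wave :: "(int \<times> int) set => (int \<times> int => complex) => real \<times> real => complex" where
 "poly_wave F D x = (\<Sum>k\<in>F. D k * wave k x)"

lemma continuous_on_poly_wave: "continuous_on S (poly_wave F D)" unfolding poly_wave_def by (intro continuous_intros)

lemma integrable_poly_wave_bounded:
 assumes "integrable torus g"
 shows "integrable torus (\<lambda>x. g x * poly_wave F D x)" "integrable torus (\<lambda>x. g x * cnj (poly_wave F D x))"
proof -
 have 1: "integrable torus (\<lambda>x. g x * (D k * wave k x))" for D k
  using integrable_mult_right[OF integrable_mult_wave[OF assms], of "D k" k] by (simp add: mult_ac)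
 show "integrable torus (\<lambda>x. g x * poly_wave F D x)"
  using 1 unfolding poly_wave_def sum_distrib_left by (intro Bochner_Integration.integrable_sum)
 show "integrable torus (\<lambda>x. g x * cnj (poly_wave F D x))"
  using 1[of "\<lambda>k. cnj (D (- k))" "- _"] unfolding poly_wave_def cnj_sum sum_distrib_left
  by (intro Bochner_Integration.integrable_sum) (simp add: wave_minus)
qed

lemma integrable_poly_wave: "integrable torus (poly_wave F D)"
 using integrable_poly_wave_bounded(1)[of "\<lambda>_. 1" F D] by simp

lemma fc_poly_wave:
 assumes "finite F" shows "fc (poly_wave F D) k = (if k \<in> F then D k else 0)"
proof -
 have "fc (poly_wave F D) k = (LINT x|torus. (\<Sum>j\<in>F. D j * wave (j - k) x))"
  using wave_add[of _ "- k"] by (simp add: fc_def poly_wave_def sum_distrib_right mult.assoc)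
 also have "... = (\<Sum>j\<in>F. D j * (LINT x|torus. wave (j - k) x))"
  by (subst Bochner_Integration.integral_sum) (auto intro: integrable_wave)
 also have "... = (\<Sum>j\<in>F. if j = k then D j else 0)" by (intro sum.cong) (auto simp: integral_wave)
 finally show ?thesis using assms by simp
qed

lemma integral_mult_cnj_poly_wave:
 assumes "integrable torus g"
 shows "(LINT x|torus. g x * cnj (poly_wave F D x)) = (\<Sum>k\<in>F. cnj (D k) * fc g k)"
proof -
 have "(LINT x|torus. g x * cnj (poly_wave F D x)) = (LINT x|torus. (\<Sum>k\<in>F. cnj (D k) * (g x * wave (- k) x)))"
  by (simp add: poly_wave_def sum_distrib_left wave_minus mult_ac)
 also have "... = (\<Sum>k\<in>F. cnj (D k) * fc g k)"
  by (subst Bochner_Integration.integral_sum) (auto intro: integrable_mult_wave[OF assms] simp: fc_def)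
 finally show ?thesis .
qed

lemma integral_poly_wave_sq:
 assumes "finite F"
 shows "integrable torus (\<lambda>x. (cmod (poly_wave F D x))^2)"
  "(LINT x|torus. (cmod (poly_wave F D x))^2) = (\<Sum>k\<in>F. (cmod (D k))^2)"
proof -
 have i: "integrable torus (\<lambda>x. poly_wave F D x * cnj (poly_wave F D x))"
  by (rule integrable_poly_wave_bounded(2)[OF integrable_poly_wave])
 then have i': "integrable torus (\<lambda>x. complex_of_real ((cmod (poly_wave F D x))^2))"
  by (simp only: complex_norm_square)
 then show "integrable torus (\<lambda>x. (cmod (poly_wave F D x))^2)" by (simp only: complex_of_real_integrable_eq)
 have "complex_of_real (LINT x|torus. (cmod (poly_wave F D x))^2)
   = (LINT x|torus. poly_wave F D x * cnj (poly_wave F D x))"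
  by (subst integral_complex_of_real[symmetric]) (simp only: complex_norm_square)
 also have "... = (\<Sum>k\<in>F. cnj (D k) * D k)"
  using assms by (simp add: integral_mult_cnj_poly_wave[OF integrable_poly_wave] fc_poly_wave)
 also have "... = complex_of_real (\<Sum>k\<in>F. (cmod (D k))^2)" by (simp only: of_real_sum complex_norm_square mult.commute)
 finally show "(LINT x|torus. (cmod (poly_wave F D x))^2) = (\<Sum>k\<in>F. (cmod (D k))^2)" using of_real_eq_iff by blast
qed

text \<open>Pythagoras: the integral of the cross term and the squared norm of the partial sum both
  equal the sum of the squared coefficients.\<close>

lemma projection_identity:
 assumes g: "g \<in> borel_measurable torus" "integrable torus (\<lambda>x. (cmod (g x))^2)" and F: "finite F"
 shows "integrable torus (\<lambda>x. (cmod (g x - poly_wave F (fc g) x))^2)"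
  "(LINT x|torus. (cmod (g x - poly_wave F (fc g) x))^2) = (LINT x|torus. (cmod (g x))^2) - (\<Sum>k\<in>F. (cmod (fc g k))^2)"
proof -
 let ?S = "poly_wave F (fc g)"
 have gi: "integrable torus g" by (rule integrable_of_square[OF g])
 define R where "R x = Re (g x * cnj (?S x))" for x
 have e: "(cmod (g x - ?S x))^2 = (cmod (g x))^2 + (cmod (?S x))^2 - 2 * R x" for x
  unfolding cmod_power2 R_def by (simp add: power2_eq_square algebra_simps)
 have iS: "integrable torus R" unfolding R_def by (rule integrable_Re[OF integrable_poly_wave_bounded(2)[OF gi]])
 show "integrable torus (\<lambda>x. (cmod (g x - ?S x))^2)"
  unfolding e by (intro Bochner_Integration.integrable_diff Bochner_Integration.integrable_add
    integrable_mult_right g iS integral_poly_wave_sq(1)[OF F])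
 have "(LINT x|torus. R x) = Re (\<Sum>k\<in>F. cnj (fc g k) * fc g k)"
  unfolding R_def using integral_mult_cnj_poly_wave[OF gi] integrable_poly_wave_bounded(2)[OF gi]
  by (subst integral_Re) auto
 also have "... = (\<Sum>k\<in>F. (cmod (fc g k))^2)"
  unfolding Re_sum cmod_power2 by (intro sum.cong) (simp_all add: power2_eq_square)
 finally show "(LINT x|torus. (cmod (g x - ?S x))^2) = (LINT x|torus. (cmod (g x))^2) - (\<Sum>k\<in>F. (cmod (fc g k))^2)"
  unfolding e using g iS integral_poly_wave_sq[OF F] by simp
qed

lemma bessel:
 assumes g: "g \<in> borel_measurable torus" "integrable torus (\<lambda>x. (cmod (g x))^2)"
 shows "integrable freqs (\<lambda>k. (cmod (fc g k))^2)" "(LINT k|freqs. (cmod (fc g k))^2) <= (LINT x|torus. (cmod (g x))^2)"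
proof -
 have "(\<Sum>k\<in>F. (cmod (fc g k))^2) <= (LINT x|torus. (cmod (g x))^2)" if "finite F" for F
 proof -
  have "0 <= (LINT x|torus. (cmod (g x - poly_wave F (fc g) x))^2)" by simp
  then show ?thesis using projection_identity(2)[OF g that] by linarith
 qed
 then have *: "(\<integral>\<^sup>+ k. ennreal ((cmod (fc g k))^2) \<partial>freqs) <= ennreal (LINT x|torus. (cmod (g x))^2)"
  by (intro nn_integral_freqs_le) auto
 then show i: "integrable freqs (\<lambda>k. (cmod (fc g k))^2)" by (intro integrableI_bounded) (auto intro: le_less_trans)
 show "(LINT k|freqs. (cmod (fc g k))^2) <= (LINT x|torus. (cmod (g x))^2)"
  using * by (subst (asm) nn_integral_eq_integral[OF i]) (auto simp: ennreal_le_iff)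
qed

text \<open>A subsequence of the partial sums is chosen so sparse that it converges almost
  everywhere. By Fatou its pointwise limit is also the limit in mean square, and coefficients depend
  continuously on the function in mean square.\<close>

lemma riesz_fischer:
 fixes C :: "int \<times> int => complex"
 assumes C: "integrable freqs (\<lambda>k. (cmod (C k))^2)"
 obtains g where "periodic g" "g \<in> borel_measurable torus" "integrable torus (\<lambda>x. (cmod (g x))^2)"
  "\<And>k. fc g k = C k" "(LINT x|torus. (cmod (g x))^2) = (LINT k|freqs. (cmod (C k))^2)"
proof -
 interpret torus: prob_space torus by (rule prob_space_torus)
 define tail where "tail n = (LINT k|freqs. (cmod (C k))^2) - (\<Sum>k\<in>box_freqs n. (cmod (C k))^2)" for n
 have sum_eq: "(\<Sum>k\<in>F. (cmod (C k))^2) = (LINT k|freqs. indicator F k * (cmod (C k))^2)" if "finite F" for F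
 proof -
  have fin: "finite {k \<in> UNIV. indicator F k * (cmod (C k))^2 \<noteq> 0}"
   by (rule finite_subset[OF _ that]) (auto simp: indicator_def)
  have "(LINT k|freqs. indicator F k * (cmod (C k))^2)
    = (\<Sum>k | k \<in> UNIV \<and> indicator F k * (cmod (C k))^2 \<noteq> 0. indicator F k * (cmod (C k))^2)"
   by (rule lebesgue_integral_count_space_finite_support[OF fin])
  also have "... = (\<Sum>k\<in>F. indicator F k * (cmod (C k))^2)"
   by (rule sum.mono_neutral_left[OF that]) (auto simp: indicator_def)
  also have "... = (\<Sum>k\<in>F. (cmod (C k))^2)" by (intro sum.cong) auto
  finally show ?thesis ..
 qed
 have int_ind: "integrable freqs (\<lambda>k. indicator A k * (cmod (C k))^2)" for A
  by (rule Bochner_Integration.integrable_bound[OF C]) (auto simp: indicator_def)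
 have tail_lim: "tail \<longlonglongrightarrow> 0"
 proof -
  have "(\<lambda>n. LINT k|freqs. indicator (box_freqs n) k * (cmod (C k))^2) \<longlonglongrightarrow> (LINT k|freqs. (cmod (C k))^2)"
  proof (rule integral_dominated_convergence[OF _ _ C])
   show "AE k in freqs. (\<lambda>n. indicator (box_freqs n) k * (cmod (C k))^2) \<longlonglongrightarrow> (cmod (C k))^2"
   proof (rule AE_I2)
    fix k show "(\<lambda>n. indicator (box_freqs n) k * (cmod (C k))^2) \<longlonglongrightarrow> (cmod (C k))^2"
     by (rule tendsto_eventually, rule eventually_mono[OF eventually_mem_box_freqs[of k]]) simp
   qed
  qed (auto simp: indicator_def)
  then have "tail \<longlonglongrightarrow> (LINT k|freqs. (cmod (C k))^2) - (LINT k|freqs. (cmod (C k))^2)"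
   unfolding tail_def sum_eq[OF finite_box_freqs] by (intro tendsto_diff tendsto_const)
  then show ?thesis by simp
 qed
 have tail_sum: "(\<Sum>k\<in>F. (cmod (C k))^2) <= tail n" if "finite F" "F \<inter> box_freqs n = {}" for F n
 proof -
  have "(\<Sum>k\<in>F. (cmod (C k))^2) + (\<Sum>k\<in>box_freqs n. (cmod (C k))^2) = (\<Sum>k\<in>F \<union> box_freqs n. (cmod (C k))^2)"
   using that by (simp add: sum.union_disjoint)
  also have "... <= (LINT k|freqs. (cmod (C k))^2)" unfolding sum_eq[OF finite_UnI[OF that(1) finite_box_freqs]]
   by (rule integral_mono[OF int_ind C]) (auto simp: indicator_def)
  finally show ?thesis by (simp add: tail_def)
 qed
 \<comment> \<open>The squared distances of successive terms then decay like 4^-n, so the distances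
   themselves are geometrically summable.\<close>
 have "\<exists>r. tail r <= (1/4)^n" for n
 proof -
  have "\<forall>\<^sub>F r in sequentially. tail r < (1/4)^n" using tail_lim by (rule order_tendstoD) simp
  then show ?thesis by (auto simp: eventually_sequentially intro: less_imp_le)
 qed
 then obtain r where r: "\<And>n. tail (r n) <= (1/4)^n" by metis
 define S where "S n = poly_wave (box_freqs (r n)) C" for n
 have Sm [measurable]: "S n \<in> borel_measurable torus" for n
  unfolding S_def by (intro continuous_torus_measurable continuous_on_poly_wave)
 have S_diff: "integrable torus (\<lambda>x. (cmod (S m x - S n x))^2)"
  "(LINT x|torus. (cmod (S m x - S n x))^2) <= (1/4)^m + (1/4)^n" for m n
 proof -
  let ?A = "box_freqs (r m)" and ?B = "box_freqs (r n)"
  define D where "D k = (if k \<in> ?A then C k else 0) - (if k \<in> ?B then C k else 0)" for k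
  have e: "S m x - S n x = poly_wave (?A \<union> ?B) D x" for x
  proof -
   have "S m x = (\<Sum>k\<in>?A \<union> ?B. (if k \<in> ?A then C k else 0) * wave k x)"
    unfolding S_def poly_wave_def by (rule sum.mono_neutral_cong_left) auto
   moreover have "S n x = (\<Sum>k\<in>?A \<union> ?B. (if k \<in> ?B then C k else 0) * wave k x)"
    unfolding S_def poly_wave_def by (rule sum.mono_neutral_cong_left) auto
   ultimately show ?thesis by (simp add: poly_wave_def D_def sum_subtractf left_diff_distrib)
  qed
  show "integrable torus (\<lambda>x. (cmod (S m x - S n x))^2)" unfolding e by (rule integral_poly_wave_sq) simp
  have "(LINT x|torus. (cmod (S m x - S n x))^2) = (\<Sum>k\<in>?A \<union> ?B. (cmod (D k))^2)"
   unfolding e by (rule integral_poly_wave_sq) simp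
  also have "... = (\<Sum>k\<in>(?A - ?B) \<union> (?B - ?A). (cmod (C k))^2)" by (rule sum.mono_neutral_cong_right) (auto simp: D_def)
  also have "... = (\<Sum>k\<in>?A - ?B. (cmod (C k))^2) + (\<Sum>k\<in>?B - ?A. (cmod (C k))^2)" by (rule sum.union_disjoint) auto
  also have "... <= tail (r n) + tail (r m)" by (intro add_mono tail_sum) auto
  finally show "(LINT x|torus. (cmod (S m x - S n x))^2) <= (1/4)^m + (1/4)^n" using r[of m] r[of n] by linarith
 qed
 have L1: "(LINT x|torus. cmod (S (Suc n) x - S n x)) <= 2 * (1/2)^n" for n
 proof -
  \<comment> \<open>Arithmetic and geometric mean with weight 2^n: the integral of the square has
    size 4^-n, so both summands end up of size 2^-n.\<close>
  have le: "cmod z <= ((1/2)^n + 2^n * (cmod z)^2) / 2" for z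
  proof -
   define p :: real where "p = 2^n"
   have p: "p > 0" "(1/2)^n = 1/p" by (simp_all add: p_def power_one_over)
   have "0 <= (p * cmod z - 1)^2 / p" using p by simp
   also have "(p * cmod z - 1)^2 / p = 1/p + p * (cmod z)^2 - 2 * cmod z"
    using p by (simp add: power2_eq_square field_simps)
   finally show ?thesis unfolding p(2) p_def[symmetric] by simp
  qed
  have "(LINT x|torus. cmod (S (Suc n) x - S n x)) <= (LINT x|torus. ((1/2)^n + 2^n * (cmod (S (Suc n) x - S n x))^2) / 2)"
   by (rule integral_mono') (use S_diff(1)[of "Suc n" n] le in auto)
  also have "... = ((1/2)^n + 2^n * (LINT x|torus. (cmod (S (Suc n) x - S n x))^2)) / 2"
   using S_diff(1)[of "Suc n" n] torus.prob_space by simp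
  also have "... <= ((1/2)^n + 2^n * ((1/4)^Suc n + (1/4)^n)) / 2" using S_diff(2)[of "Suc n" n] by simp
  also have "... <= 2 * (1/2)^n"
  proof -
   have "(2::real)^n * (1/4)^n = (1/2)^n" by (simp flip: power_mult_distrib)
   moreover have "(2::real)^n * ((1/4)^Suc n + (1/4)^n) = 5/4 * (2^n * (1/4)^n)" by simp
   ultimately have "(2::real)^n * ((1/4)^Suc n + (1/4)^n) = 5/4 * (1/2)^n" by (simp only:)
   then show ?thesis by (simp only:) simp
  qed
  finally show ?thesis .
 qed
 have S_int1: "integrable torus (\<lambda>x. cmod (S m x - S n x))" for m n
  using integrable_of_square[OF _ S_diff(1)[of m n]] by auto
 have "AE x in torus. summable (\<lambda>n. cmod (S (Suc n) x - S n x))"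
 proof -
  have "(\<integral>\<^sup>+ x. (\<Sum>n. ennreal (cmod (S (Suc n) x - S n x))) \<partial>torus)
    = (\<Sum>n. \<integral>\<^sup>+ x. ennreal (cmod (S (Suc n) x - S n x)) \<partial>torus)" by (rule nn_integral_suminf) auto
  also have "... = (\<Sum>n. ennreal (LINT x|torus. cmod (S (Suc n) x - S n x)))"
   by (simp add: nn_integral_eq_integral[OF S_int1])
  also have "... <= (\<Sum>n. ennreal (2 * (1/2)^n))" by (intro suminf_le summableI ennreal_leI L1)
  also have "... < \<infinity>" by (subst suminf_ennreal2) (auto intro!: summable_mult summable_geometric)
  finally have "(\<integral>\<^sup>+ x. (\<Sum>n. ennreal (cmod (S (Suc n) x - S n x))) \<partial>torus) \<noteq> \<infinity>" by simp
  then have "AE x in torus. (\<Sum>n. ennreal (cmod (S (Suc n) x - S n x))) \<noteq> \<infinity>" by (intro nn_integral_PInf_AE) auto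
  then show ?thesis by eventually_elim (use summable_suminf_not_top in auto)
 qed
 then have conv: "AE x in torus. convergent (\<lambda>n. S n x)"
 proof eventually_elim
  case (elim x)
  then have "summable (\<lambda>n. S (Suc n) x - S n x)" by (rule summable_norm_cancel)
  then have "convergent (\<lambda>n. \<Sum>i<n. S (Suc i) x - S i x)" by (simp add: summable_iff_convergent)
  then have "convergent (\<lambda>n. S n x - S 0 x)" unfolding sum_lessThan_telescope[of "\<lambda>n. S n x"] .
  then have "convergent (\<lambda>n. (S n x - S 0 x) + S 0 x)" by (intro convergent_add convergent_const)
  then show ?case by simp
 qed
 \<comment> \<open>\<open>lim\<close> is total, so g is defined at every point and inherits exact
   periodicity from the partial sums, even where they diverge.\<close>
 define g where "g x = lim (\<lambda>n. S n x)" for x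
 have gm [measurable]: "g \<in> borel_measurable torus" unfolding g_def[abs_def] by (rule borel_measurable_lim_metric) auto
 have g_lim: "AE x in torus. (\<lambda>n. S n x) \<longlonglongrightarrow> g x" using conv by eventually_elim (simp add: g_def convergent_LIMSEQ_iff)
 have gS_nn: "(\<integral>\<^sup>+ x. ennreal ((cmod (g x - S n x))^2) \<partial>torus) <= ennreal (2 * (1/4)^n)" for n
 proof -
  have "(\<integral>\<^sup>+ x. ennreal ((cmod (g x - S n x))^2) \<partial>torus)
    = (\<integral>\<^sup>+ x. liminf (\<lambda>m. ennreal ((cmod (S m x - S n x))^2)) \<partial>torus)"
  proof (rule nn_integral_cong_AE)
   show "AE x in torus. ennreal ((cmod (g x - S n x))^2) = liminf (\<lambda>m. ennreal ((cmod (S m x - S n x))^2))"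
    using g_lim
   proof eventually_elim
    case (elim x)
    have "(\<lambda>m. ennreal ((cmod (S m x - S n x))^2)) \<longlonglongrightarrow> ennreal ((cmod (g x - S n x))^2)"
     by (intro tendsto_intros elim)
    from lim_imp_Liminf[OF _ this] show ?case by simp
   qed
  qed
  also have "... <= liminf (\<lambda>m. \<integral>\<^sup>+ x. ennreal ((cmod (S m x - S n x))^2) \<partial>torus)" by (rule nn_integral_liminf) auto
  also have "... <= liminf (\<lambda>m. ennreal (2 * (1/4)^n))"
  proof (rule Liminf_mono)
   show "\<forall>\<^sub>F m in sequentially. (\<integral>\<^sup>+ x. ennreal ((cmod (S m x - S n x))^2) \<partial>torus) <= ennreal (2 * (1/4)^n)"
    using eventually_ge_at_top[of n]
   proof eventually_elim
    case (elim m)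
    have "(1/4::real)^m <= (1/4)^n" using elim by (intro power_decreasing) auto
    with S_diff(2)[of m n] have "(LINT x|torus. (cmod (S m x - S n x))^2) <= 2 * (1/4)^n" by linarith
    then show ?case by (subst nn_integral_eq_integral[OF S_diff(1)]) (auto intro!: ennreal_leI)
   qed
  qed
  finally show ?thesis by (subst (asm) Liminf_const) auto
 qed
 have gS_int: "integrable torus (\<lambda>x. (cmod (g x - S n x))^2)" for n
  by (rule integrableI_bounded) (auto intro: le_less_trans[OF gS_nn])
 have gS: "(LINT x|torus. (cmod (g x - S n x))^2) <= 2 * (1/4)^n" for n
  using gS_nn[of n] by (subst (asm) nn_integral_eq_integral[OF gS_int]) auto
 have g2: "integrable torus (\<lambda>x. (cmod (g x))^2)"
 proof (rule Bochner_Integration.integrable_bound)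
  show "integrable torus (\<lambda>x. 2 * (cmod (g x - S 0 x))^2 + 2 * (cmod (S 0 x))^2)"
   using gS_int integral_poly_wave_sq(1) by (auto simp: S_def)
  show "AE x in torus. norm ((cmod (g x))^2) <= norm (2 * (cmod (g x - S 0 x))^2 + 2 * (cmod (S 0 x))^2)"
  proof (rule AE_I2)
   fix x
   have "cmod (g x) <= cmod (g x - S 0 x) + cmod (S 0 x)" by (metis diff_add_cancel norm_triangle_ineq)
   then have "(cmod (g x))^2 <= (cmod (g x - S 0 x) + cmod (S 0 x))^2" by (intro power_mono) auto
   also have "... <= 2 * (cmod (g x - S 0 x))^2 + 2 * (cmod (S 0 x))^2"
    using zero_le_power2[of "cmod (g x - S 0 x) - cmod (S 0 x)"] by (simp add: power2_eq_square algebra_simps)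
   finally show "norm ((cmod (g x))^2) <= norm (2 * (cmod (g x - S 0 x))^2 + 2 * (cmod (S 0 x))^2)" by simp
  qed
 qed auto
 have gi: "integrable torus g" by (rule integrable_of_square[OF gm g2])
 have Si: "integrable torus (S n)" for n unfolding S_def by (rule integrable_poly_wave)
 have fcg: "fc g k = C k" for k
 proof -
  have bd: "(cmod (fc g k - fc (S n) k))^2 <= 2 * (1/4)^n" for n
  proof -
   have m: "(\<lambda>x. g x - S n x) \<in> borel_measurable torus" by auto
   have "(cmod (fc (\<lambda>x. g x - S n x) k))^2 <= (LINT x|torus. (cmod (g x - S n x))^2)"
    using projection_identity(2)[OF m gS_int[of n], of "{k}"]
     integral_nonneg_AE[of "\<lambda>x. (cmod (g x - S n x - poly_wave {k} (fc (\<lambda>x. g x - S n x)) x))^2" torus] by simp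
   then show ?thesis using gS[of n] by (simp add: fc_diff[OF gi Si])
  qed
  have bd2: "(cmod (fc (S n) k - C k))^2 <= (1/4)^n" for n
   using tail_sum[of "{k}" "r n"] r[of n] by (auto simp: S_def fc_poly_wave)
  have "(\<lambda>n. (2::real) * (1/4)^n) \<longlonglongrightarrow> 2 * 0" by (intro tendsto_mult tendsto_const LIMSEQ_power_zero) simp
  then have l1: "(\<lambda>n. (2::real) * (1/4)^n) \<longlonglongrightarrow> 0" by simp
  have l2: "(\<lambda>n. (1/4::real)^n) \<longlonglongrightarrow> 0" by (intro LIMSEQ_power_zero) simp
  have sq0: "(\<lambda>n. z n) \<longlonglongrightarrow> 0" if "(\<lambda>n. (cmod (z n))^2) \<longlonglongrightarrow> 0" for z :: "nat => complex"
   using tendsto_real_sqrt[OF that] by (simp add: tendsto_norm_zero_iff)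
  have "(\<lambda>n. fc g k - fc (S n) k) \<longlonglongrightarrow> 0" by (rule sq0, rule tendsto_sandwich[OF _ _ tendsto_const l1]) (use bd in auto)
  moreover have "(\<lambda>n. fc (S n) k - C k) \<longlonglongrightarrow> 0"
   by (rule sq0, rule tendsto_sandwich[OF _ _ tendsto_const l2]) (use bd2 in auto)
  ultimately have "(\<lambda>n. (fc g k - fc (S n) k) + (fc (S n) k - C k)) \<longlonglongrightarrow> 0 + 0" by (rule tendsto_add)
  then show ?thesis by (simp add: LIMSEQ_const_iff)
 qed
 have norm_eq: "(LINT x|torus. (cmod (g x))^2) = (LINT k|freqs. (cmod (C k))^2)"
 proof (rule antisym)
  have le: "(LINT x|torus. (cmod (g x))^2) <= (LINT k|freqs. (cmod (C k))^2) + 2 * (1/4)^n" for n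
  proof -
   have "fc g = C" using fcg by auto
   then have "(LINT x|torus. (cmod (g x))^2) = (LINT x|torus. (cmod (g x - S n x))^2) + (\<Sum>k\<in>box_freqs (r n). (cmod (C k))^2)"
    using projection_identity(2)[OF gm g2, of "box_freqs (r n)"] by (simp add: S_def)
   moreover have "(\<Sum>k\<in>box_freqs (r n). (cmod (C k))^2) <= (LINT k|freqs. (cmod (C k))^2)"
    using tail_sum[of "{}" "r n"] by (simp add: tail_def)
   ultimately show ?thesis using gS[of n] by linarith
  qed
  have "(\<lambda>n. (LINT k|freqs. (cmod (C k))^2) + 2 * (1/4)^n) \<longlonglongrightarrow> (LINT k|freqs. (cmod (C k))^2) + 2 * 0"
   by (intro tendsto_intros LIMSEQ_power_zero) simp
  from LIMSEQ_le_const[OF this] le show "(LINT x|torus. (cmod (g x))^2) <= (LINT k|freqs. (cmod (C k))^2)" by auto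
  show "(LINT k|freqs. (cmod (C k))^2) <= (LINT x|torus. (cmod (g x))^2)" using bessel(2)[OF gm g2] by (simp add: fcg)
 qed
 have "periodic g" using periodic_wave unfolding periodic_def g_def S_def poly_wave_def by simp
 then show thesis using that gm g2 fcg norm_eq by blast
qed

text \<open>Riesz-Fischer produces a function with the same coefficients for which the identity
  holds; by uniqueness it equals g almost everywhere.\<close>

lemma parseval_complex:
 assumes g: "g \<in> borel_measurable torus" "integrable torus (\<lambda>x. (cmod (g x))^2)"
 shows "(LINT x|torus. (cmod (g x))^2) = (LINT k|freqs. (cmod (fc g k))^2)"
proof -
 obtain h where "periodic h" and h: "h \<in> borel_measurable torus" "integrable torus (\<lambda>x. (cmod (h x))^2)"
  "\<And>k. fc h k = fc g k" "(LINT x|torus. (cmod (h x))^2) = (LINT k|freqs. (cmod (fc g k))^2)"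
  by (rule riesz_fischer[OF bessel(1)[OF g]]) (rule that)
 have ae: "AE x in torus. g x = h x"
  by (rule AE_eq_of_fc[OF integrable_of_square[OF g] integrable_of_square[OF h(1,2)]]) (simp add: h(3))
 have "(LINT x|torus. (cmod (g x))^2) = (LINT x|torus. (cmod (h x))^2)"
 proof (rule integral_cong_AE)
  show "AE x in torus. (cmod (g x))^2 = (cmod (h x))^2" using ae by eventually_elim simp
 qed (use g(1) h(1) in measurable)
 with h(4) show ?thesis by simp
qed

section \<open>Real square integrable functions\<close>

lemma L2_torus_D:
 assumes "u \<in> L2_torus"
 shows "(\<lambda>x. complex_of_real (u x)) \<in> borel_measurable torus"
  "integrable torus (\<lambda>x. (cmod (of_real (u x)))^2)" "integrable torus u"
  "integrable torus (\<lambda>x. complex_of_real (u x))" "u \<in> borel_measurable torus"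
proof -
 show 1: "(\<lambda>x. complex_of_real (u x)) \<in> borel_measurable torus" "u \<in> borel_measurable torus"
  using assms by (auto simp: L2_torus_def)
 show 2: "integrable torus (\<lambda>x. (cmod (of_real (u x)))^2)" using assms by (auto simp: L2_torus_def)
 show "integrable torus (\<lambda>x. complex_of_real (u x))" by (rule integrable_of_square[OF 1(1) 2])
 then show "integrable torus u" by (simp only: complex_of_real_integrable_eq)
qed

lemma fourier_coeff_minus: "fourier_coeff u (- k) = cnj (fourier_coeff u k)"
 using fc_cnj[of "\<lambda>x. of_real (u x)" "- k"] by (simp add: fourier_coeff_fc)

text \<open>Under the symmetry hypothesis the coefficients of the complex solution and of its
  conjugate coincide, so the real part has them as well.\<close>

lemma riesz_fischer_real:
 assumes C: "integrable freqs (\<lambda>k. (cmod (C k))^2)" "\<And>k. C (- k) = cnj (C k)"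
 obtains u where "u \<in> L2_torus" "\<And>k. fourier_coeff u k = C k"
proof -
 obtain g where g: "periodic g" "g \<in> borel_measurable torus" "integrable torus (\<lambda>x. (cmod (g x))^2)"
  "\<And>k. fc g k = C k" "(LINT x|torus. (cmod (g x))^2) = (LINT k|freqs. (cmod (C k))^2)"
  by (rule riesz_fischer[OF C(1)]) (rule that)
 have gi: "integrable torus g" by (rule integrable_of_square[OF g(2,3)])
 have "fourier_coeff (\<lambda>x. Re (g x)) k = C k" for k
 proof -
  have "complex_of_real (Re z) = 1/2 * z + 1/2 * cnj z" for z by (simp add: complex_eq_iff)
  then have "fourier_coeff (\<lambda>x. Re (g x)) k = fc (\<lambda>x. 1/2 * g x + 1/2 * cnj (g x)) k" by (simp add: fourier_coeff_fc)
  also have "... = 1/2 * fc g k + 1/2 * fc (\<lambda>x. cnj (g x)) k"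
   by (subst fc_add) (use gi in \<open>auto simp only: fc_cmult integrable_mult_right integrable_cnj\<close>)
  also have "... = C k" by (simp add: g(4) fc_cnj C(2))
  finally show ?thesis .
 qed
 moreover have "(\<lambda>x. Re (g x)) \<in> L2_torus"
 proof -
  have "integrable torus (\<lambda>x. (Re (g x))^2)"
   by (rule Bochner_Integration.integrable_bound[OF g(3)]) (use g(2) in \<open>auto simp: cmod_power2\<close>)
  then show ?thesis using g(1,2) by (auto simp: L2_torus_def periodic_def)
 qed
 ultimately show thesis using that by blast
qed

lemma L2_torus_add:
 assumes "u \<in> L2_torus" "w \<in> L2_torus"
 shows "(\<lambda>x. a * u x + b * w x) \<in> L2_torus"
proof -
 have "integrable torus (\<lambda>x. (a * u x + b * w x)^2)"
 proof (rule Bochner_Integration.integrable_bound)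
  show "integrable torus (\<lambda>x. 2 * a^2 * (u x)^2 + 2 * b^2 * (w x)^2)" using assms by (auto simp: L2_torus_def)
  have "(p + q)^2 <= 2 * p^2 + 2 * q^2" for p q :: real
   using zero_le_power2[of "p - q"] by (simp add: power2_eq_square algebra_simps)
  from this[of "a * u _" "b * w _"]
  show "AE x in torus. norm ((a * u x + b * w x)^2) <= norm (2 * a^2 * (u x)^2 + 2 * b^2 * (w x)^2)"
   by (intro AE_I2) (simp add: power_mult_distrib mult.assoc)
 qed (use assms in \<open>auto simp: L2_torus_def\<close>)
 then show ?thesis using assms by (auto simp: L2_torus_def periodic_def)
qed

lemma L2_torus_mult_integrable:
 assumes "u \<in> L2_torus" "w \<in> L2_torus"
 shows "integrable torus (\<lambda>x. u x * w x)"
proof (rule Bochner_Integration.integrable_bound)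
 show "integrable torus (\<lambda>x. (u x)^2 + (w x)^2)" using assms by (auto simp: L2_torus_def)
 have "\<bar>p * q\<bar> <= p^2 + q^2" for p q :: real
 proof -
  have "2 * \<bar>p * q\<bar> <= p^2 + q^2" using sum_squares_bound[of "\<bar>p\<bar>" "\<bar>q\<bar>"] by (simp add: abs_mult)
  moreover have "0 <= p^2 + q^2" by simp
  ultimately show ?thesis by linarith
 qed
 then show "AE x in torus. norm (u x * w x) <= norm ((u x)^2 + (w x)^2)" by auto
qed (use assms in \<open>auto simp: L2_torus_def\<close>)

lemma fourier_coeff_lin:
 assumes "u \<in> L2_torus" "w \<in> L2_torus"
 shows "fourier_coeff (\<lambda>x. a * u x + b * w x) k = a * fourier_coeff u k + b * fourier_coeff w k"
 using L2_torus_D(4)[OF assms(1)] L2_torus_D(4)[OF assms(2)] by (simp add: fourier_coeff_fc fc_add fc_cmult)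

lemma parseval:
 assumes u: "u \<in> L2_torus"
 shows "integrable freqs (\<lambda>k. (cmod (fourier_coeff u k))^2)"
  "(LINT x|torus. (u x)^2) = (LINT k|freqs. (cmod (fourier_coeff u k))^2)"
 using bessel(1)[OF L2_torus_D(1,2)[OF u]] parseval_complex[OF L2_torus_D(1,2)[OF u]] by (auto simp: fourier_coeff_fc)

text \<open>Polarization of the identity for squares.\<close>

lemma parseval_inner:
 assumes u: "u \<in> L2_torus" and w: "w \<in> L2_torus"
 shows "L2_inner u w = (LINT k|freqs. Re (fourier_coeff u k * cnj (fourier_coeff w k)))"
proof -
 let ?p = "\<lambda>x. 1 * u x + 1 * w x" and ?m = "\<lambda>x. 1 * u x + (-1) * w x"
 have pm: "?p \<in> L2_torus" "?m \<in> L2_torus" by (rule L2_torus_add[OF u w])+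
 have "L2_inner u w = (LINT x|torus. ((?p x)^2 - (?m x)^2) / 4)"
  unfolding L2_inner_def by (rule Bochner_Integration.integral_cong) (auto simp: power2_eq_square algebra_simps)
 also have "... = ((LINT x|torus. (?p x)^2) - (LINT x|torus. (?m x)^2)) / 4" using pm by (simp add: L2_torus_def)
 also have "... = (LINT k|freqs. ((cmod (fourier_coeff ?p k))^2 - (cmod (fourier_coeff ?m k))^2) / 4)"
  using parseval[OF pm(1)] parseval[OF pm(2)] by simp
 also have "... = (LINT k|freqs. Re (fourier_coeff u k * cnj (fourier_coeff w k)))"
  unfolding fourier_coeff_lin[OF u w] cmod_power2
  by (rule Bochner_Integration.integral_cong) (auto simp: power2_eq_square algebra_simps)
 finally show ?thesis .
qed

lemma AE_eq_of_fourier_coeff: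
 assumes "integrable torus u" "integrable torus w" "\<And>k. fourier_coeff u k = fourier_coeff w k"
 shows "AE x in torus. u x = w x"
 using AE_eq_of_fc[of "\<lambda>x. of_real (u x)" "\<lambda>x. of_real (w x)"] assms by (simp add: fourier_coeff_fc)

section \<open>Weighted square summable sequences\<close>

text \<open>Since \<open>0 powr s = 0\<close>, the weight of the zero frequency vanishes for every
  exponent, also for s = 0 and for negative s; weighted sums ignore the mean.\<close>

definition wt :: "real => int \<times> int => ennreal" where "wt s k = ennreal (norm (freq k) powr s)"

text \<open>The squared Sobolev norm of a sequence of amplitudes, possibly infinite. Amplitudes in
  place of coefficients allow pointwise comparison with majorants.\<close>

definition hs :: "real => (int \<times> int => ennreal) => ennreal" where "hs s A = (\<integral>\<^sup>+ k. (wt s k * A k)^2 \<partial>freqs)"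

definition conv :: "(int \<times> int => ennreal) => (int \<times> int => ennreal) => int \<times> int => ennreal" where
 "conv Q A k = (\<integral>\<^sup>+ l. Q (k - l) * A l \<partial>freqs)"

lemma freq_eq_0_iff [simp]: "freq k = 0 \<longleftrightarrow> k = 0" by (auto simp: freq_def prod_eq_iff)

lemma norm_freq_ge_1: "k \<noteq> 0 ==> norm (freq k) >= 1"
proof -
 assume k: "k \<noteq> 0"
 have "1 <= \<bar>fst k\<bar> \<or> 1 <= \<bar>snd k\<bar>" using k by (auto simp: prod_eq_iff)
 moreover have "\<bar>real_of_int (fst k)\<bar> <= norm (freq k)" "\<bar>real_of_int (snd k)\<bar> <= norm (freq k)"
  using norm_fst_le[of "real_of_int (fst k)" "real_of_int (snd k)"]
   norm_snd_le[of "real_of_int (snd k)" "real_of_int (fst k)"] by (auto simp: freq_def)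
 ultimately show ?thesis by linarith
qed

lemma norm_freq_minus [simp]: "norm (freq (- k)) = norm (freq k)" by (simp add: freq_simps)

lemma wt_0 [simp]: "wt s 0 = 0" by (simp add: wt_def freq_simps)

lemma wt_less_top [simp]: "wt s k < \<top>" by (simp add: wt_def)

lemma wt_zero [simp]: "k \<noteq> 0 ==> wt 0 k = 1" by (simp add: wt_def)

lemma wt_pos: "k \<noteq> 0 ==> wt s k > 0" by (simp add: wt_def)

lemma wt_mult: "wt s k * wt r k = wt (s + r) k" by (simp add: wt_def powr_add flip: ennreal_mult)

lemma wt_mono: "s <= r ==> wt s k <= wt r k"
proof (cases "k = 0")
 case False
 assume "s <= r"
 then show ?thesis using norm_freq_ge_1[OF False] by (auto simp: wt_def intro!: ennreal_leI powr_mono)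
qed simp

lemma wt_ge_1: "k \<noteq> 0 ==> s >= 0 ==> 1 <= wt s k" using wt_mono[of 0 s k] by simp

lemma hs_mono: "(\<And>k. A k <= B k) ==> hs s A <= hs s B"
 unfolding hs_def by (intro nn_integral_mono power_mono mult_left_mono) auto

lemma hs_mono_exp: "s <= r ==> hs s A <= hs r A"
 unfolding hs_def by (intro nn_integral_mono power_mono mult_right_mono wt_mono) auto

lemma hs_cmult: "hs s (\<lambda>k. c * A k) = c^2 * hs s A"
 unfolding hs_def by (subst nn_integral_cmult[symmetric]) (auto simp: power_mult_distrib mult_ac)

text \<open>Only the order is used: each summand is at most the larger one. This gives the constant
  4 instead of the sharp 2; it recurs in \<open>alg\<close> and in \<open>rate\<close>.\<close>

lemma ennreal_sq_add: "(x + y)^2 <= 4 * (x^2 + y^2)" for x y :: ennreal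
proof -
 have *: "(x + y)^2 <= 4 * (x^2 + y^2)" if "x <= y" for x y :: ennreal
 proof -
  have "(x + y)^2 <= (2 * y)^2" using add_right_mono[OF that, of y] by (intro power_mono) (auto simp: mult_2)
  also have "... = 4 * y^2" by (simp add: power_mult_distrib)
  also have "... <= 4 * (x^2 + y^2)" by (intro mult_left_mono) auto
  finally show ?thesis .
 qed
 show ?thesis using *[of x y] *[of y x] by (metis add.commute linear)
qed

lemma hs_add: "hs s (\<lambda>k. A k + B k) <= 4 * (hs s A + hs s B)"
proof -
 have "hs s (\<lambda>k. A k + B k) <= (\<integral>\<^sup>+ k. 4 * ((wt s k * A k)^2 + (wt s k * B k)^2) \<partial>freqs)"
  unfolding hs_def distrib_left[of "wt s _"] by (intro nn_integral_mono ennreal_sq_add)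
 also have "... = 4 * (hs s A + hs s B)" unfolding hs_def by (simp add: nn_integral_cmult nn_integral_add)
 finally show ?thesis .
qed

lemma hs_point: "(wt s k * A k)^2 <= hs s A"
proof -
 have "(wt s k * A k)^2 = (\<integral>\<^sup>+ j. (wt s j * A j)^2 * indicator {k} j \<partial>freqs)"
  by (subst nn_integral_indicator_singleton) auto
 also have "... <= hs s A" unfolding hs_def by (intro nn_integral_mono) (auto simp: indicator_def)
 finally show ?thesis .
qed

lemma hs_finite_point: "hs s A < \<top> ==> k \<noteq> 0 ==> A k < \<top>"
proof (rule ccontr)
 assume "hs s A < \<top>" "k \<noteq> 0" "\<not> A k < \<top>"
 then show False using hs_point[of s k A] wt_pos[of k s]
  by (auto simp: power2_eq_square ennreal_mult_eq_top_iff less_top[symmetric] top_unique)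
qed

subsection \<open>Summability of negative powers\<close>

lemma sum_int_le_zeta:
 assumes "m > 1"
 shows "(\<Sum>i = - int n..int n. (1 + real_of_int \<bar>i\<bar>) powr (- m)) <= 2 * (\<Sum>j. real (Suc j) powr (- m))"
proof -
 let ?g = "\<lambda>i::int. (1 + real_of_int \<bar>i\<bar>) powr (- m)"
 have sm: "summable (\<lambda>j. real (Suc j) powr (- m))"
  using assms by (subst summable_Suc_iff) (simp add: summable_real_powr_iff)
 have le: "(\<Sum>j\<le>n. real (Suc j) powr (- m)) <= (\<Sum>j. real (Suc j) powr (- m))" by (rule sum_le_suminf[OF sm]) auto
 have sub: "{- int n..int n} \<subseteq> int ` {..n} \<union> (\<lambda>j. - int j) ` {..n}"
 proof
  fix i assume "i \<in> {- int n..int n}"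
  then show "i \<in> int ` {..n} \<union> (\<lambda>j. - int j) ` {..n}"
   by (cases "i >= 0") (auto simp: image_iff intro: bexI[of _ "nat i"] bexI[of _ "nat (- i)"])
 qed
 have "sum ?g {- int n..int n} <= sum ?g (int ` {..n} \<union> (\<lambda>j. - int j) ` {..n})" using sub by (intro sum_mono2) auto
 also have "... <= sum ?g (int ` {..n}) + sum ?g ((\<lambda>j. - int j) ` {..n})" by (subst sum_Un) (auto intro: sum_nonneg)
 also have "... = 2 * (\<Sum>j\<le>n. real (Suc j) powr (- m))" by (subst (1 2) sum.reindex) (auto simp: inj_on_def add.commute)
 finally show ?thesis using le by linarith
qed

text \<open>The lattice sum of |k|^(-2m), which is the squared constant of the Sobolev
  embedding.\<close>

definition zeta :: "real => ennreal" where "zeta m = (\<integral>\<^sup>+ k. (wt (- m) k)^2 \<partial>freqs)"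

text \<open>With p and q the absolute values of the coordinates of a nonzero k, (1 + p) (1 + q) is
  at most 4 |k|^2. The lattice sum is thus dominated by 4^m times a product of two one-dimensional
  series with exponent m.\<close>

lemma zeta_finite:
 assumes m: "m > 1"
 shows "zeta m < \<top>"
proof -
 let ?g = "\<lambda>i::int. (1 + real_of_int \<bar>i\<bar>) powr (- m)"
 let ?Z = "\<Sum>j. real (Suc j) powr (- m)"
 define a where "a k = 4 powr m * (?g (fst k) * ?g (snd k))" for k :: "int \<times> int"
 have le: "(wt (- m) k)^2 <= ennreal (a k)" for k
 proof (cases "k = 0")
  case False
  define p q where "p = real_of_int \<bar>fst k\<bar>" and "q = real_of_int \<bar>snd k\<bar>"
  have N: "(norm (freq k))^2 = p^2 + q^2" by (simp add: p_def q_def freq_def norm_Pair)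
  have pq: "p >= 0" "q >= 0" by (auto simp: p_def q_def)
  have "\<bar>i\<bar> <= i * i" for i :: int using mult_left_mono[of 1 "\<bar>i\<bar>" "\<bar>i\<bar>"] by (cases "i = 0") auto
  then have "p <= p^2" "q <= q^2" unfolding p_def q_def power2_eq_square of_int_mult[symmetric] of_int_le_iff
   by simp_all
  moreover have "2 * (p * q) <= p^2 + q^2" using sum_squares_bound[of p q] by simp
  moreover have "1 <= p^2 + q^2" using norm_freq_ge_1[OF False] N one_le_power[of "norm (freq k)" 2] by simp
  ultimately have "(1 + p) * (1 + q) <= 4 * (norm (freq k))^2" unfolding N by (simp add: algebra_simps)
  then have "(4 * (norm (freq k))^2) powr (- m) <= ((1 + p) * (1 + q)) powr (- m)"
   using m pq by (intro powr_mono2') (auto intro!: mult_pos_pos)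
  then have "4 powr m * ((4 * (norm (freq k))^2) powr (- m)) <= a k"
   using pq by (simp add: a_def p_def q_def powr_mult)
  moreover have "4 powr m * ((4 * (norm (freq k))^2) powr (- m)) = ((norm (freq k)) powr (- m))^2"
  proof -
   have "4 powr m * (4 powr (- m) * x) = x" for x :: real unfolding mult.assoc[symmetric] powr_add[symmetric] by simp
   moreover have "((norm (freq k))^2) powr (- m) = ((norm (freq k)) powr (- m))^2"
    using False by (simp add: power2_eq_square powr_mult)
   ultimately show ?thesis by (simp only: powr_mult[of 4 "(norm (freq k))^2"])
  qed
  ultimately show ?thesis by (simp add: wt_def ennreal_power ennreal_leI)
 qed simp
 have "(\<Sum>k\<in>box_freqs n. a k) <= 4 powr m * (2 * ?Z)^2" for n
 proof -
  have "(\<Sum>k\<in>box_freqs n. a k) = 4 powr m * ((\<Sum>i = - int n..int n. ?g i) * (\<Sum>i = - int n..int n. ?g i))"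
   unfolding a_def sum_distrib_left[symmetric] box_freqs_def
   by (subst sum_product) (simp add: sum.cartesian_product case_prod_unfold)
  also have "... <= 4 powr m * ((2 * ?Z) * (2 * ?Z))"
   using sum_int_le_zeta[OF m, of n] order_trans[OF sum_nonneg sum_int_le_zeta[OF m, of n]]
   by (intro mult_left_mono mult_mono) (auto intro: sum_nonneg)
  finally show ?thesis by (simp add: power2_eq_square)
 qed
 then have "(\<integral>\<^sup>+ k. ennreal (a k) \<partial>freqs) <= ennreal (4 powr m * (2 * ?Z)^2)"
  by (intro nn_integral_freqs_le) (auto simp: a_def)
 moreover have "zeta m <= (\<integral>\<^sup>+ k. ennreal (a k) \<partial>freqs)" unfolding zeta_def by (intro nn_integral_mono le)
 ultimately show ?thesis by (meson ennreal_less_top order_le_less_trans)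
qed

text \<open>Cauchy-Schwarz with the weights |k|^(-m) and |k|^m. The weights do not see frequency
  zero, which is why A must vanish there.\<close>

lemma l1_le_hs:
 assumes "A 0 = 0"
 shows "(\<integral>\<^sup>+ k. A k \<partial>freqs)^2 <= zeta m * hs m A"
proof -
 have "A k = wt (- m) k * (wt m k * A k)" for k
  using assms wt_mult[of "- m" k m] by (cases "k = 0") (auto simp: mult.assoc[symmetric])
 then have "(\<integral>\<^sup>+ k. A k \<partial>freqs)^2 = (\<integral>\<^sup>+ k. wt (- m) k * (wt m k * A k) \<partial>freqs)^2" by simp
 also have "... <= zeta m * hs m A" unfolding zeta_def hs_def by (rule Cauchy_Schwarz_nn_integral) auto
 finally show ?thesis .
qed

subsection \<open>Convolution\<close>

lemma nn_integral_freqs_shift: "(\<integral>\<^sup>+ k. f (k - l) \<partial>freqs) = (\<integral>\<^sup>+ k. f k \<partial>freqs)"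
 by (rule nn_integral_bij_count_space) (auto intro!: bij_betwI[of _ _ _ "\<lambda>k. k + l"])

lemma nn_integral_freqs_reflect: "(\<integral>\<^sup>+ l. f (k - l) \<partial>freqs) = (\<integral>\<^sup>+ l. f l \<partial>freqs)"
 by (rule nn_integral_bij_count_space) (auto intro!: bij_betwI[of _ _ _ "\<lambda>l. k - l"])

lemma nn_integral_freqs_swap: "(\<integral>\<^sup>+ k. \<integral>\<^sup>+ l. f k l \<partial>freqs \<partial>freqs) = (\<integral>\<^sup>+ l. \<integral>\<^sup>+ k. f k l \<partial>freqs \<partial>freqs)"
 using nn_integral_fst_count_space[of "\<lambda>(k, l). f k l"] nn_integral_snd_count_space[of "\<lambda>(k, l). f k l"] by simp

lemma conv_commute: "conv Q A k = conv A Q k"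
 unfolding conv_def using nn_integral_freqs_reflect[of "\<lambda>l. Q (k - l) * A l" k] by (simp add: mult.commute)

lemma conv_mono: "(\<And>k. Q k <= Q' k) ==> (\<And>k. A k <= A' k) ==> conv Q A k <= conv Q' A' k"
 unfolding conv_def by (intro nn_integral_mono mult_mono) auto

text \<open>Cauchy-Schwarz for the measure with density \<open>f (k - l)\<close>, whose total mass
  does not depend on k.\<close>

lemma young: "(\<integral>\<^sup>+ k. (conv f g k)^2 \<partial>freqs) <= (\<integral>\<^sup>+ k. f k \<partial>freqs)^2 * (\<integral>\<^sup>+ k. (g k)^2 \<partial>freqs)"
proof -
 let ?F = "\<integral>\<^sup>+ k. f k \<partial>freqs"
 have "(conv f g k)^2 <= ?F * (\<integral>\<^sup>+ l. f (k - l) * (g l)^2 \<partial>freqs)" for k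
 proof -
  let ?M = "density freqs (\<lambda>l. f (k - l))"
  have "(\<integral>\<^sup>+ l. g l * 1 \<partial>?M)^2 <= (\<integral>\<^sup>+ l. (g l)^2 \<partial>?M) * (\<integral>\<^sup>+ l. 1^2 \<partial>?M)" by (rule Cauchy_Schwarz_nn_integral) auto
  then show ?thesis
   by (simp add: nn_integral_density emeasure_density conv_def nn_integral_freqs_reflect mult.commute)
 qed
 then have "(\<integral>\<^sup>+ k. (conv f g k)^2 \<partial>freqs) <= (\<integral>\<^sup>+ k. ?F * (\<integral>\<^sup>+ l. f (k - l) * (g l)^2 \<partial>freqs) \<partial>freqs)"
  by (intro nn_integral_mono)
 also have "... = ?F * (\<integral>\<^sup>+ l. \<integral>\<^sup>+ k. f (k - l) * (g l)^2 \<partial>freqs \<partial>freqs)"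
  by (subst nn_integral_cmult) (simp_all add: nn_integral_freqs_swap[of "\<lambda>k l. f (k - l) * (g l)^2"])
 also have "... = ?F * (\<integral>\<^sup>+ l. ?F * (g l)^2 \<partial>freqs)" by (simp add: nn_integral_multc nn_integral_freqs_shift)
 also have "... = ?F^2 * (\<integral>\<^sup>+ k. (g k)^2 \<partial>freqs)" by (simp add: nn_integral_cmult power2_eq_square mult.assoc)
 finally show ?thesis .
qed

text \<open>The constant of the algebra property of H^m: 4^m from squaring the weight inequality, 8
  from squaring a sum of two terms that obey the same bound.\<close>

definition alg :: "real => ennreal" where "alg m = ennreal (4 powr m) * 8 * zeta m"

lemma alg_finite: "m > 1 ==> alg m < \<top>" unfolding alg_def using zeta_finite[of m] by (simp add: ennreal_mult_less_top)

lemma wt_triangle: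
 assumes "s >= 0"
 shows "wt s k <= ennreal (2 powr s) * (wt s (k - l) + wt s l)"
proof -
 let ?a = "norm (freq (k - l))" and ?b = "norm (freq l)"
 have "norm (freq k) <= ?a + ?b" using norm_triangle_ineq[of "freq (k - l)" "freq l"] by (simp flip: freq_simps)
 then have "norm (freq k) <= 2 * max ?a ?b" by linarith
 then have "norm (freq k) powr s <= (2 * max ?a ?b) powr s" using assms by (intro powr_mono2) auto
 also have "... = 2 powr s * (max ?a ?b) powr s" by (simp add: powr_mult)
 also have "... <= 2 powr s * (?a powr s + ?b powr s)" by (intro mult_left_mono) (auto simp: max_def)
 finally have "ennreal (norm (freq k) powr s) <= ennreal (2 powr s * (?a powr s + ?b powr s))" by (rule ennreal_leI)
 then show ?thesis by (simp add: wt_def ennreal_mult)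
qed

text \<open>Up to a constant the weight at k passes to one of the two factors. The other factor is
  summable by \<open>l1_le_hs\<close>, so \<open>young\<close> bounds the convolution.\<close>

lemma hs_conv:
 assumes s: "s >= 0" and Q: "Q 0 = 0" and A: "A 0 = 0"
 shows "hs s (conv Q A) <= alg s * hs s Q * hs s A"
proof -
 let ?QW = "\<lambda>k. wt s k * Q k" and ?AW = "\<lambda>k. wt s k * A k"
 have "wt s k * conv Q A k <= ennreal (2 powr s) * (conv A ?QW k + conv Q ?AW k)" for k
 proof -
  have "wt s k * conv Q A k = (\<integral>\<^sup>+ l. wt s k * (Q (k - l) * A l) \<partial>freqs)"
   unfolding conv_def by (rule nn_integral_cmult[symmetric]) auto
  also have "... <= (\<integral>\<^sup>+ l. ennreal (2 powr s) * (?QW (k - l) * A l + Q (k - l) * ?AW l) \<partial>freqs)"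
  proof (rule nn_integral_mono)
   fix l
   have "wt s k * (Q (k - l) * A l) <= ennreal (2 powr s) * (wt s (k - l) + wt s l) * (Q (k - l) * A l)"
    by (intro mult_right_mono wt_triangle s) auto
   then show "wt s k * (Q (k - l) * A l) <= ennreal (2 powr s) * (?QW (k - l) * A l + Q (k - l) * ?AW l)"
    by (simp add: algebra_simps)
  qed
  also have "... = ennreal (2 powr s) * (conv ?QW A k + conv Q ?AW k)"
   unfolding conv_def by (simp add: nn_integral_cmult nn_integral_add)
  finally show ?thesis by (simp add: conv_commute[of ?QW])
 qed
 then have "hs s (conv Q A) <= (\<integral>\<^sup>+ k. (ennreal (2 powr s) * (conv A ?QW k + conv Q ?AW k))^2 \<partial>freqs)"
  unfolding hs_def by (intro nn_integral_mono power_mono) auto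
 also have "... <= (\<integral>\<^sup>+ k. ennreal (4 powr s) * 4 * ((conv A ?QW k)^2 + (conv Q ?AW k)^2) \<partial>freqs)"
 proof (rule nn_integral_mono)
  fix k
  have "((2::real) powr s)^2 = 4 powr s" by (simp add: power2_eq_square flip: powr_mult)
  then have "(ennreal (2 powr s) * (conv A ?QW k + conv Q ?AW k))^2
    = ennreal (4 powr s) * (conv A ?QW k + conv Q ?AW k)^2" by (simp add: power_mult_distrib ennreal_power)
  also have "... <= ennreal (4 powr s) * (4 * ((conv A ?QW k)^2 + (conv Q ?AW k)^2))"
   by (intro mult_left_mono ennreal_sq_add) auto
  finally show "(ennreal (2 powr s) * (conv A ?QW k + conv Q ?AW k))^2
    <= ennreal (4 powr s) * 4 * ((conv A ?QW k)^2 + (conv Q ?AW k)^2)" by (simp add: mult.assoc)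
 qed
 also have "... = ennreal (4 powr s) * 4 * ((\<integral>\<^sup>+ k. (conv A ?QW k)^2 \<partial>freqs) + (\<integral>\<^sup>+ k. (conv Q ?AW k)^2 \<partial>freqs))"
  by (simp add: nn_integral_cmult nn_integral_add)
 also have "... <= ennreal (4 powr s) * 4 * (zeta s * hs s A * hs s Q + zeta s * hs s Q * hs s A)"
 proof (intro mult_left_mono add_mono)
  show "(\<integral>\<^sup>+ k. (conv A ?QW k)^2 \<partial>freqs) <= zeta s * hs s A * hs s Q"
   using order_trans[OF young[of A ?QW] mult_right_mono[OF l1_le_hs[where A=A and m=s, OF A]]] by (simp add: hs_def)
  show "(\<integral>\<^sup>+ k. (conv Q ?AW k)^2 \<partial>freqs) <= zeta s * hs s Q * hs s A"
   using order_trans[OF young[of Q ?AW] mult_right_mono[OF l1_le_hs[where A=Q and m=s, OF Q]]] by (simp add: hs_def)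
 qed auto
 also have "... = alg s * hs s Q * hs s A"
 proof -
  have "c * 4 * (z * a * q + z * q * a) = c * 8 * z * q * a" for c z a q :: ennreal
  proof -
   have "z * a * q = z * q * a" by (simp only: mult_ac)
   then have "z * a * q + z * q * a = 2 * (z * q * a)" by (simp only: mult_2)
   then have "c * 4 * (z * a * q + z * q * a) = (4 * 2) * (c * (z * q * a))" by (simp add: mult_ac)
   then show ?thesis by (simp add: mult_ac)
  qed
  then show ?thesis by (simp add: alg_def)
 qed
 finally show ?thesis .
qed

lemma conv_finite:
 assumes "m > 1" "Q 0 = 0" "A 0 = 0" "hs m Q < \<top>" "hs m A < \<top>" "k \<noteq> 0"
 shows "conv Q A k < \<top>"
proof (rule hs_finite_point)
 show "hs m (conv Q A) < \<top>" using hs_conv[of m Q A] assms alg_finite[of m]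
  by (intro le_less_trans[OF hs_conv]) (auto simp: ennreal_mult_less_top)
qed fact

section \<open>Energy estimates for the Fourier modes\<close>

abbreviation amp :: "(int \<times> int => complex) => int \<times> int => ennreal" where "amp y \<equiv> \<lambda>k. ennreal (cmod (y k))"

abbreviation tm :: "real => real measure" where "tm t \<equiv> lebesgue_on {0..t}"

lemma tm_measurable:
 fixes g :: "real => 'a::euclidean_space"
 shows "continuous_on {0..} g ==> g \<in> borel_measurable (tm t)"
 by (rule continuous_imp_measurable_on_sets_lebesgue) (auto elim: continuous_on_subset)

lemma nn_integral_tm:
 assumes g: "continuous_on {0..} g" and pos: "\<And>s. s >= 0 ==> g s >= 0"
 shows "(\<integral>\<^sup>+ s. ennreal (g s) \<partial>tm t) = ennreal (integral {0..t} g)"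
proof -
 have i: "integrable (tm t) g" by (rule continuous_imp_integrable_real) (use g in \<open>auto elim: continuous_on_subset\<close>)
 have "(\<integral>\<^sup>+ s. ennreal (g s) \<partial>tm t) = ennreal (LINT s|tm t. g s)"
  by (rule nn_integral_eq_integral[OF i]) (auto intro!: AE_I2 pos)
 then show ?thesis using lebesgue_integral_eq_integral[OF i] by simp
qed

lemma has_real_derivative_norm_sq:
 fixes z :: "real => complex"
 assumes "(z has_vector_derivative D) (at s within S)"
 shows "((\<lambda>s. (cmod (z s))^2) has_real_derivative 2 * (z s \<bullet> D)) (at s within S)"
proof -
 have "((\<lambda>s. z s \<bullet> z s) has_derivative (\<lambda>h. z s \<bullet> (h *\<^sub>R D) + (h *\<^sub>R D) \<bullet> z s)) (at s within S)"
  using assms unfolding has_vector_derivative_def by (intro has_derivative_inner)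
 then show ?thesis by (simp add: power2_norm_eq_inner has_field_derivative_def inner_commute)
   (erule has_derivative_eq_rhs, auto simp: fun_eq_iff inner_commute)
qed

text \<open>The derivative of exp((\<beta> - \<alpha>) t) |z|^2 is integrated, and half of the
  damping absorbs the forcing. The two rates appear on opposite sides because all terms must be
  non-negative; each application sets one of them to zero.\<close>

lemma mode_energy:
 fixes z h :: "real => complex"
 assumes d: "d > 0" and ab: "\<alpha> >= 0" "\<beta> >= 0" and t: "t >= 0" and h: "continuous_on {0..} h"
  and z: "\<And>s. s >= 0 ==> (z has_vector_derivative - of_real d * z s - h s) (at s within {0..})"
 shows "ennreal (exp ((\<beta> - \<alpha>) * t) * (cmod (z t))^2)
   + (\<integral>\<^sup>+ s. ennreal (exp ((\<beta> - \<alpha>) * s) * ((\<alpha> + d) * (cmod (z s))^2)) \<partial>tm t)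
  <= ennreal ((cmod (z 0))^2) + (\<integral>\<^sup>+ s. ennreal (exp ((\<beta> - \<alpha>) * s) * (\<beta> * (cmod (z s))^2 + (cmod (h s))^2 / d)) \<partial>tm t)"
proof -
 define \<nu> where "\<nu> = \<beta> - \<alpha>"
 define F where "F s = exp (\<nu> * s) * (cmod (z s))^2" for s
 define F' where "F' s = exp (\<nu> * s) * (\<nu> * (cmod (z s))^2 + 2 * (z s \<bullet> (- of_real d * z s - h s)))" for s
 define a where "a s = exp (\<nu> * s) * ((\<alpha> + d) * (cmod (z s))^2)" for s
 define b where "b s = exp (\<nu> * s) * (\<beta> * (cmod (z s))^2 + (cmod (h s))^2 / d)" for s
 have zc: "continuous_on {0..} z" by (rule continuous_on_vector_derivative) (use z in auto)
 have cont: "continuous_on {0..} a" "continuous_on {0..} b"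
  unfolding a_def b_def by (intro continuous_intros zc h; use d in simp)+
 have sub: "{0..t} \<subseteq> {0..}" by auto
 have cont': "a integrable_on {0..t}" "b integrable_on {0..t}"
  by (intro integrable_continuous_real continuous_on_subset[OF cont(1) sub] continuous_on_subset[OF cont(2) sub])+
 have der: "(F has_vector_derivative F' s) (at s within {0..t})" if "s \<in> {0..t}" for s
 proof -
  have "(z has_vector_derivative - of_real d * z s - h s) (at s within {0..t})"
   by (rule has_vector_derivative_within_subset[OF z sub]) (use that in auto)
  note n = has_real_derivative_norm_sq[OF this]
  have e: "((\<lambda>s. exp (\<nu> * s)) has_real_derivative \<nu> * exp (\<nu> * s)) (at s within {0..t})"
   by (auto intro!: derivative_eq_intros)
  have "(F has_real_derivative F' s) (at s within {0..t})" unfolding F_def[abs_def] F'_def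
   by (rule DERIV_cong[OF DERIV_mult[OF e n]]) (simp add: algebra_simps)
  then show ?thesis by (simp add: has_real_derivative_iff_has_vector_derivative)
 qed
 then have FTC: "(F' has_integral (F t - F 0)) {0..t}" by (intro fundamental_theorem_of_calculus t)
 have le: "F' s <= b s - a s" for s
 proof -
  have "z s \<bullet> (- of_real d * z s - h s) = - d * (cmod (z s))^2 - z s \<bullet> h s"
   by (simp add: inner_diff_right power2_norm_eq_inner flip: scaleR_conv_of_real)
  moreover have "- (z s \<bullet> h s) <= cmod (z s) * cmod (h s)" using Cauchy_Schwarz_ineq2[of "z s" "h s"] by linarith
  moreover have "2 * (cmod (z s) * cmod (h s)) <= d * (cmod (z s))^2 + (cmod (h s))^2 / d"
  proof -
   have "0 <= (d * cmod (z s) - cmod (h s))^2 / d" using d by simp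
   also have "... = d * (cmod (z s))^2 + (cmod (h s))^2 / d - 2 * (cmod (z s) * cmod (h s))"
    using d by (simp add: power2_eq_square field_simps)
   finally show ?thesis by simp
  qed
  ultimately have "\<nu> * (cmod (z s))^2 + 2 * (z s \<bullet> (- of_real d * z s - h s))
    <= (\<beta> * (cmod (z s))^2 + (cmod (h s))^2 / d) - (\<alpha> + d) * (cmod (z s))^2"
   unfolding \<nu>_def left_diff_distrib distrib_right by linarith
  then have "F' s <= exp (\<nu> * s) * ((\<beta> * (cmod (z s))^2 + (cmod (h s))^2 / d) - (\<alpha> + d) * (cmod (z s))^2)"
   unfolding F'_def by (intro mult_left_mono) auto
  then show ?thesis by (simp only: a_def b_def right_diff_distrib)
 qed
 have "F t - F 0 = integral {0..t} F'" using FTC by (simp add: integral_unique)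
 also have "... <= integral {0..t} (\<lambda>s. b s - a s)"
  by (rule integral_le) (use FTC cont' le in \<open>auto intro: integrable_diff\<close>)
 also have "... = integral {0..t} b - integral {0..t} a"
  by (rule Henstock_Kurzweil_Integration.integral_diff[OF cont'(2,1)])
 finally have main: "F t + integral {0..t} a <= F 0 + integral {0..t} b" by linarith
 have pos: "a s >= 0" "b s >= 0" for s using ab d by (auto simp: a_def b_def)
 have nn: "(\<integral>\<^sup>+ s. ennreal (a s) \<partial>tm t) = ennreal (integral {0..t} a)"
  "(\<integral>\<^sup>+ s. ennreal (b s) \<partial>tm t) = ennreal (integral {0..t} b)"
  using nn_integral_tm[OF cont(1) pos(1)] nn_integral_tm[OF cont(2) pos(2)] by auto
 have ip: "integral {0..t} a >= 0" "integral {0..t} b >= 0"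
  using cont' pos by (auto intro!: Henstock_Kurzweil_Integration.integral_nonneg)
 have "ennreal (F t + integral {0..t} a) <= ennreal (F 0 + integral {0..t} b)" using main by (rule ennreal_leI)
 then have "ennreal (F t) + ennreal (integral {0..t} a) <= ennreal (F 0) + ennreal (integral {0..t} b)"
  using ip by (simp add: F_def)
 then show ?thesis unfolding nn[symmetric] by (simp add: F_def a_def b_def \<nu>_def)
qed

lemma nn_integral_freqs_tm:
 assumes "\<And>k. f k \<in> borel_measurable (tm t)"
 shows "(\<integral>\<^sup>+ k. \<integral>\<^sup>+ s. f k s \<partial>tm t \<partial>freqs) = (\<integral>\<^sup>+ s. \<integral>\<^sup>+ k. f k s \<partial>freqs \<partial>tm t)"
 by (rule nn_integral_count_space_nn_integral[symmetric]) (use assms in auto)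

lemma hs_measurable:
 assumes "\<And>k. (\<lambda>s. A s k) \<in> borel_measurable M"
 shows "(\<lambda>s. hs m (A s)) \<in> borel_measurable M"
proof -
 interpret sigma_finite_measure freqs by (rule sigma_finite_freqs)
 have "(\<lambda>(s, k). (wt m k * A s k)^2) \<in> borel_measurable (M \<Otimes>\<^sub>M freqs)"
  by (subst measurable_pair_swap_iff, simp, rule measurable_pair_measure_countable1) (use assms in auto)
 from borel_measurable_nn_integral[OF this] show ?thesis by (simp add: hs_def)
qed

text \<open>The mode inequality with d = c |k|^2 is multiplied by |k|^(2m) and summed. The damping
  becomes an H^(m+1) norm, and division of the forcing by d lowers its norm to H^(m-1).\<close>

lemma energy:
 fixes z h :: "real => int \<times> int => complex"
 assumes c: "c > 0" and ab: "\<alpha> >= 0" "\<beta> >= 0" and t: "t >= 0" and h: "\<And>k. continuous_on {0..} (\<lambda>s. h s k)"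
  and z: "\<And>k s. s >= 0 ==> ((\<lambda>s. z s k) has_vector_derivative
    - of_real (c * (norm (freq k))^2) * z s k - h s k) (at s within {0..})"
 shows "ennreal (exp ((\<beta> - \<alpha>) * t)) * hs m (amp (z t))
   + (\<integral>\<^sup>+ s. ennreal (exp ((\<beta> - \<alpha>) * s)) * (ennreal \<alpha> * hs m (amp (z s)) + ennreal c * hs (m + 1) (amp (z s))) \<partial>tm t)
  <= hs m (amp (z 0))
   + (\<integral>\<^sup>+ s. ennreal (exp ((\<beta> - \<alpha>) * s)) * (ennreal \<beta> * hs m (amp (z s)) + ennreal (1 / c) * hs (m - 1) (amp (h s))) \<partial>tm t)"
proof -
 define \<nu> where "\<nu> = \<beta> - \<alpha>"
 define w where "w k = (wt m k)^2" for k
 have zc: "continuous_on {0..} (\<lambda>s. z s k)" for k by (rule continuous_on_vector_derivative) (use z[of _ k] in auto)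
 define a where "a k s = ennreal (exp (\<nu> * s)) * (ennreal \<alpha> * (wt m k * amp (z s) k)^2 + ennreal c * (wt (m + 1) k * amp (z s) k)^2)" for k s
 define b where "b k s = ennreal (exp (\<nu> * s)) * (ennreal \<beta> * (wt m k * amp (z s) k)^2 + ennreal (1 / c) * (wt (m - 1) k * amp (h s) k)^2)" for k s
 have zm: "(\<lambda>s. z s k) \<in> borel_measurable (tm t)" "(\<lambda>s. h s k) \<in> borel_measurable (tm t)" for k
  using tm_measurable[OF zc] tm_measurable[OF h] by auto
 note [measurable] = zm
 have em [measurable]: "(\<lambda>s. exp (\<nu> * s)) \<in> borel_measurable (tm t)" by (intro tm_measurable continuous_intros)
 have am: "a k \<in> borel_measurable (tm t)" "b k \<in> borel_measurable (tm t)" for k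
  unfolding a_def[abs_def] b_def[abs_def] by measurable
 have sum_a: "(\<integral>\<^sup>+ k. a k s \<partial>freqs) = ennreal (exp (\<nu> * s)) * (ennreal \<alpha> * hs m (amp (z s)) + ennreal c * hs (m + 1) (amp (z s)))" for s
  unfolding a_def hs_def by (simp add: nn_integral_cmult nn_integral_add)
 have sum_b: "(\<integral>\<^sup>+ k. b k s \<partial>freqs) = ennreal (exp (\<nu> * s)) * (ennreal \<beta> * hs m (amp (z s)) + ennreal (1 / c) * hs (m - 1) (amp (h s)))" for s
  unfolding b_def hs_def by (simp add: nn_integral_cmult nn_integral_add)
 have mode: "ennreal (exp (\<nu> * t)) * (wt m k * amp (z t) k)^2 + (\<integral>\<^sup>+ s. a k s \<partial>tm t)
   <= (wt m k * amp (z 0) k)^2 + (\<integral>\<^sup>+ s. b k s \<partial>tm t)" for k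
 proof (cases "k = 0")
  case False
  define r where "r = norm (freq k)"
  have r: "r > 0" using False by (simp add: r_def)
  have d: "c * r^2 > 0" using c r by simp
  have a_eq: "a k s = w k * ennreal (exp (\<nu> * s) * ((\<alpha> + c * r^2) * (cmod (z s k))^2))" for s
  proof -
   have "(r powr (m + 1))^2 = (r powr m)^2 * r^2" using r by (simp add: powr_add power_mult_distrib)
   then have "exp (\<nu> * s) * (\<alpha> * (r powr m * cmod (z s k))^2 + c * (r powr (m + 1) * cmod (z s k))^2)
     = (r powr m)^2 * (exp (\<nu> * s) * ((\<alpha> + c * r^2) * (cmod (z s k))^2))"
    by (simp add: power_mult_distrib algebra_simps)
   then show ?thesis using c ab by (simp add: a_def w_def wt_def r_def[symmetric] ennreal_power
      flip: ennreal_mult ennreal_plus)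
  qed
  have b_eq: "b k s = w k * ennreal (exp (\<nu> * s) * (\<beta> * (cmod (z s k))^2 + (cmod (h s k))^2 / (c * r^2)))" for s
  proof -
   have "(r powr (m - 1))^2 = (r powr m)^2 / r^2" using r by (simp add: powr_diff power_divide)
   then have "exp (\<nu> * s) * (\<beta> * (r powr m * cmod (z s k))^2 + 1 / c * (r powr (m - 1) * cmod (h s k))^2)
     = (r powr m)^2 * (exp (\<nu> * s) * (\<beta> * (cmod (z s k))^2 + (cmod (h s k))^2 / (c * r^2)))"
    by (simp add: power_mult_distrib algebra_simps)
   then show ?thesis using c ab by (simp add: b_def w_def wt_def r_def[symmetric] ennreal_power
      flip: ennreal_mult ennreal_plus)
  qed
  have "w k * (ennreal (exp (\<nu> * t) * (cmod (z t k))^2)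
    + (\<integral>\<^sup>+ s. ennreal (exp (\<nu> * s) * ((\<alpha> + c * r^2) * (cmod (z s k))^2)) \<partial>tm t))
   <= w k * (ennreal ((cmod (z 0 k))^2)
    + (\<integral>\<^sup>+ s. ennreal (exp (\<nu> * s) * (\<beta> * (cmod (z s k))^2 + (cmod (h s k))^2 / (c * r^2))) \<partial>tm t))"
   unfolding \<nu>_def using mode_energy[OF d ab t h[of k] z[of _ k, folded r_def]] by (intro mult_left_mono) auto
  moreover have "w k * (\<integral>\<^sup>+ s. ennreal (exp (\<nu> * s) * ((\<alpha> + c * r^2) * (cmod (z s k))^2)) \<partial>tm t) = (\<integral>\<^sup>+ s. a k s \<partial>tm t)"
   unfolding a_eq by (rule nn_integral_cmult[symmetric]) measurable
  moreover have "w k * (\<integral>\<^sup>+ s. ennreal (exp (\<nu> * s) * (\<beta> * (cmod (z s k))^2 + (cmod (h s k))^2 / (c * r^2))) \<partial>tm t) = (\<integral>\<^sup>+ s. b k s \<partial>tm t)"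
   unfolding b_eq by (rule nn_integral_cmult[symmetric]) measurable
  ultimately show ?thesis by (simp add: distrib_left w_def power_mult_distrib ennreal_mult ennreal_power mult_ac)
 qed (simp add: a_def)
 have "ennreal (exp (\<nu> * t)) * hs m (amp (z t)) + (\<integral>\<^sup>+ s. (\<integral>\<^sup>+ k. a k s \<partial>freqs) \<partial>tm t)
   = (\<integral>\<^sup>+ k. ennreal (exp (\<nu> * t)) * (wt m k * amp (z t) k)^2 + (\<integral>\<^sup>+ s. a k s \<partial>tm t) \<partial>freqs)"
  unfolding hs_def nn_integral_freqs_tm[OF am(1), symmetric] by (simp add: nn_integral_cmult nn_integral_add)
 also have "... <= (\<integral>\<^sup>+ k. (wt m k * amp (z 0) k)^2 + (\<integral>\<^sup>+ s. b k s \<partial>tm t) \<partial>freqs)" by (rule nn_integral_mono) (rule mode)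
 also have "... = hs m (amp (z 0)) + (\<integral>\<^sup>+ s. (\<integral>\<^sup>+ k. b k s \<partial>freqs) \<partial>tm t)"
  unfolding hs_def nn_integral_freqs_tm[OF am(2), symmetric] by (simp add: nn_integral_add)
 finally show ?thesis unfolding sum_a sum_b \<nu>_def .
qed

subsection \<open>Transport operators\<close>

definition adv :: "(int \<times> int => int \<times> int => complex) => (int \<times> int => complex) => int \<times> int => complex" where
 "adv P y k = (LINT l|freqs. P k l * y l)"

text \<open>The shape of transport in divergence form: one derivative falls on the output frequency,
  and the rest is dominated by a convolution with the amplitudes Q.\<close>

definition op_bound :: "(int \<times> int => int \<times> int => complex) => (int \<times> int => ennreal) => bool" where
 "op_bound P Q \<longleftrightarrow> Q 0 = 0 \<and> (\<forall>k l. ennreal (cmod (P k l)) <= wt 1 k * Q (k - l))"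

text \<open>True without integrability, since the Bochner integral of a non-integrable function is
  0.\<close>

lemma norm_integral_le_nn: "ennreal (norm (integral\<^sup>L M f)) <= (\<integral>\<^sup>+ x. ennreal (norm (f x)) \<partial>M)"
 for f :: "_ => _::{banach, second_countable_topology}"
 by (cases "integrable M f") (auto simp: integral_norm_bound_ennreal not_integrable_integral_eq)

lemma nn_op_le:
 assumes "op_bound P Q"
 shows "(\<integral>\<^sup>+ l. ennreal (cmod (P k l * y l)) \<partial>freqs) <= wt 1 k * conv Q (amp y) k"
proof -
 have "(\<integral>\<^sup>+ l. ennreal (cmod (P k l * y l)) \<partial>freqs) <= (\<integral>\<^sup>+ l. wt 1 k * (Q (k - l) * amp y l) \<partial>freqs)"
  using assms unfolding op_bound_def by (intro nn_integral_mono)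
   (simp add: norm_mult ennreal_mult mult.assoc[symmetric] mult_right_mono del: split_paired_All)
 also have "... = wt 1 k * conv Q (amp y) k" unfolding conv_def by (rule nn_integral_cmult) auto
 finally show ?thesis .
qed

lemma norm_adv_le:
 assumes "op_bound P Q"
 shows "ennreal (cmod (adv P y k)) <= wt 1 k * conv Q (amp y) k"
 unfolding adv_def by (rule order_trans[OF norm_integral_le_nn nn_op_le[OF assms]])

lemma integrable_op:
 assumes "m > 1" "op_bound P Q" "hs m Q < \<top>" "y 0 = 0" "hs m (amp y) < \<top>"
 shows "integrable freqs (\<lambda>l. P k l * y l)"
proof (rule integrableI_bounded)
 have "wt 1 k * conv Q (amp y) k < \<top>" using conv_finite[of m Q "amp y" k] assms
  by (cases "k = 0") (auto simp: op_bound_def ennreal_mult_less_top)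
 then show "(\<integral>\<^sup>+ l. ennreal (cmod (P k l * y l)) \<partial>freqs) < \<infinity>"
  using nn_op_le[OF assms(2), of k y] by (simp add: order_le_less_trans)
qed simp

text \<open>The factor |k| in \<open>op_bound\<close> costs one order of regularity; what remains is
  a convolution in H^m.\<close>

lemma hs_adv:
 assumes "m > 1" "op_bound P Q" "y 0 = 0"
 shows "hs (m - 1) (amp (adv P y)) <= alg m * hs m Q * hs m (amp y)"
proof -
 have "hs (m - 1) (amp (adv P y)) <= hs m (conv Q (amp y))" unfolding hs_def
 proof (intro nn_integral_mono power_mono)
  fix k
  have "wt (m - 1) k * amp (adv P y) k <= wt (m - 1) k * (wt 1 k * conv Q (amp y) k)"
   by (intro mult_left_mono norm_adv_le assms) auto
  also have "... = wt m k * conv Q (amp y) k" by (simp add: mult.assoc[symmetric] wt_mult)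
  finally show "wt (m - 1) k * amp (adv P y) k <= wt m k * conv Q (amp y) k" .
 qed auto
 also have "... <= alg m * hs m Q * hs m (amp y)" by (rule hs_conv) (use assms in \<open>auto simp: op_bound_def\<close>)
 finally show ?thesis .
qed

text \<open>The system of ordinary differential equations for the modes. Boundedness in H^m on
  finite time intervals takes the place of continuity in H^m; it already makes the transport sums
  converge and depend continuously on time.\<close>

definition mode_sol :: "real => real => (int \<times> int => int \<times> int => complex) => (real => int \<times> int => complex) => bool" where
 "mode_sol c m P y \<longleftrightarrow> (\<forall>t\<ge>0. y t 0 = 0) \<and> (\<forall>S. \<exists>B<\<top>. \<forall>t\<in>{0..S}. hs m (amp (y t)) <= B) \<and>
   (\<forall>k. \<forall>t\<ge>0. ((\<lambda>t. y t k) has_vector_derivative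
    - of_real (c * (norm (freq k))^2) * y t k - adv P (y t) k) (at t within {0..}))"

text \<open>The exponential growth rate of the squared H^m norm: 1/c from absorbing the forcing into
  the damping, 4 from splitting the forcing into transport and an external part.\<close>

definition rate :: "real => real => (int \<times> int => ennreal) => real" where "rate c m Q = 4 / c * enn2real (alg m * hs m Q)"

lemma rate_nonneg: "c > 0 ==> rate c m Q >= 0" by (simp add: rate_def)

lemma ennreal_rate:
 assumes "c > 0" "m > 1" "hs m Q < \<top>"
 shows "ennreal (rate c m Q) = ennreal (4 / c) * (alg m * hs m Q)"
 unfolding rate_def using assms alg_finite[of m] by (subst ennreal_mult) (auto simp: ennreal_mult_less_top)

text \<open>Energy with \<alpha> equal to the rate and \<beta> = 0: the transport part of the
  forcing is bounded by exactly the term that \<alpha> contributes on the left, and the two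
  integrals cancel. This takes the place of a Gronwall inequality. Cancelling requires a finite
  integral, which the bound B provides.\<close>

lemma growth:
 fixes z g :: "real => int \<times> int => complex"
 assumes c: "c > 0" and m: "m > 1" and t: "t >= 0" and P: "op_bound P Q" and Q: "hs m Q < \<top>"
  and z0: "\<And>s. s >= 0 ==> z s 0 = 0"
  and bd: "B < \<top>" "\<And>s. s \<in> {0..t} ==> hs m (amp (z s)) <= B"
  and cont: "\<And>k. continuous_on {0..} (\<lambda>s. adv P (z s) k)" "\<And>k. continuous_on {0..} (\<lambda>s. g s k)"
  and z: "\<And>k s. s >= 0 ==> ((\<lambda>s. z s k) has_vector_derivative
    - of_real (c * (norm (freq k))^2) * z s k - (adv P (z s) k + g s k)) (at s within {0..})"
  and g: "\<And>s. s \<in> {0..t} ==> hs (m - 1) (amp (g s)) <= G"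
 shows "hs m (amp (z t)) <= ennreal (exp (rate c m Q * t)) * (hs m (amp (z 0)) + ennreal (4 / c * t) * G)"
  and "ennreal c * (\<integral>\<^sup>+ s. hs (m + 1) (amp (z s)) \<partial>tm t)
   <= ennreal (exp (rate c m Q * t)) * (hs m (amp (z 0)) + ennreal (4 / c * t) * G)"
proof -
 define \<alpha> where "\<alpha> = rate c m Q"
 have \<alpha>: "\<alpha> >= 0" using c by (simp add: \<alpha>_def rate_nonneg)
 define h where "h s k = adv P (z s) k + g s k" for s k
 have zc: "continuous_on {0..} (\<lambda>s. z s k)" for k by (rule continuous_on_vector_derivative) (use z[of _ k] in auto)
 have zm [measurable]: "(\<lambda>s. z s k) \<in> borel_measurable (tm t)" for k by (rule tm_measurable[OF zc])
 have em [measurable]: "(\<lambda>s. exp (r * s)) \<in> borel_measurable (tm t)" for r :: real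
  by (intro tm_measurable continuous_intros)
 have hm [measurable]: "(\<lambda>s. hs r (amp (z s))) \<in> borel_measurable (tm t)" for r by (rule hs_measurable) measurable
 let ?e = "\<lambda>s. ennreal (exp (- \<alpha> * s))"
 let ?X = "\<integral>\<^sup>+ s. ?e s * (ennreal \<alpha> * hs m (amp (z s))) \<partial>tm t"
 let ?Y = "\<integral>\<^sup>+ s. ?e s * (ennreal c * hs (m + 1) (amp (z s))) \<partial>tm t"
 have e1: "?e s <= 1" if "s \<in> {0..t}" for s using \<alpha> that by (simp add: mult_nonneg_nonneg)
 have emt: "emeasure (tm t) (space (tm t)) = ennreal t" using t by (simp add: emeasure_restrict_space)
 have const: "(\<integral>\<^sup>+ s. C \<partial>tm t) = C * ennreal t" for C using emt by simp
 have le: "ennreal (1 / c) * hs (m - 1) (amp (h s)) <= ennreal \<alpha> * hs m (amp (z s)) + ennreal (4 / c) * G"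
  if s: "s \<in> {0..t}" for s
 proof -
  have "hs (m - 1) (amp (h s)) <= hs (m - 1) (\<lambda>k. amp (adv P (z s)) k + amp (g s) k)"
   unfolding h_def by (intro hs_mono) (simp add: norm_triangle_ineq flip: ennreal_plus)
  also have "... <= 4 * (hs (m - 1) (amp (adv P (z s))) + hs (m - 1) (amp (g s)))" by (rule hs_add)
  also have "... <= 4 * (alg m * hs m Q * hs m (amp (z s)) + G)"
   by (intro mult_left_mono add_mono hs_adv[OF m P] g s z0) (use s in auto)
  finally have "ennreal (1 / c) * hs (m - 1) (amp (h s)) <= ennreal (1 / c) * (4 * (alg m * hs m Q * hs m (amp (z s)) + G))"
   by (intro mult_left_mono) auto
  also have "... = (ennreal (1 / c) * 4) * (alg m * hs m Q) * hs m (amp (z s)) + (ennreal (1 / c) * 4) * G"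
   by (simp add: algebra_simps)
  also have "ennreal (1 / c) * 4 = ennreal (4 / c)" using c ennreal_mult[of "1 / c" 4] by simp
  finally show ?thesis by (simp add: \<alpha>_def ennreal_rate[OF c m Q])
 qed
 have "?e t * hs m (amp (z t)) + (?X + ?Y)
   = ?e t * hs m (amp (z t)) + (\<integral>\<^sup>+ s. ?e s * (ennreal \<alpha> * hs m (amp (z s)) + ennreal c * hs (m + 1) (amp (z s))) \<partial>tm t)"
 proof -
  have "(\<integral>\<^sup>+ s. ?e s * (ennreal \<alpha> * hs m (amp (z s)) + ennreal c * hs (m + 1) (amp (z s))) \<partial>tm t) = ?X + ?Y"
   unfolding distrib_left by (rule nn_integral_add) measurable
  then show ?thesis by (simp only:)
 qed
 also have "... <= hs m (amp (z 0)) + (\<integral>\<^sup>+ s. ?e s * (ennreal 0 * hs m (amp (z s)) + ennreal (1 / c) * hs (m - 1) (amp (h s))) \<partial>tm t)"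
 proof -
  have hc: "continuous_on {0..} (\<lambda>s. h s k)" for k unfolding h_def by (intro continuous_intros cont)
  have zh: "((\<lambda>s. z s k) has_vector_derivative
    - of_real (c * (norm (freq k))^2) * z s k - h s k) (at s within {0..})" if "s >= 0" for k s
   unfolding h_def by (rule z[OF that])
  show ?thesis using energy[OF c \<alpha> order_refl t hc zh, of m] by simp
 qed
 also have "... <= hs m (amp (z 0)) + (\<integral>\<^sup>+ s. ?e s * (ennreal \<alpha> * hs m (amp (z s))) + ennreal (4 / c) * G \<partial>tm t)"
 proof (intro add_left_mono nn_integral_mono)
  fix s assume "s \<in> space (tm t)"
  then have s: "s \<in> {0..t}" by simp
  have "?e s * (ennreal 0 * hs m (amp (z s)) + ennreal (1 / c) * hs (m - 1) (amp (h s)))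
    <= ?e s * (ennreal \<alpha> * hs m (amp (z s)) + ennreal (4 / c) * G)"
   using le[OF s] by (intro mult_left_mono) auto
  also have "... <= ?e s * (ennreal \<alpha> * hs m (amp (z s))) + 1 * (ennreal (4 / c) * G)"
   unfolding distrib_left by (intro add_left_mono mult_right_mono e1 s) auto
  finally show "?e s * (ennreal 0 * hs m (amp (z s)) + ennreal (1 / c) * hs (m - 1) (amp (h s)))
    <= ?e s * (ennreal \<alpha> * hs m (amp (z s))) + ennreal (4 / c) * G" by simp
 qed
 also have "... = hs m (amp (z 0)) + (?X + ennreal (4 / c) * G * ennreal t)"
 proof -
  have "(\<integral>\<^sup>+ s. ?e s * (ennreal \<alpha> * hs m (amp (z s))) + ennreal (4 / c) * G \<partial>tm t)
    = ?X + (\<integral>\<^sup>+ s. ennreal (4 / c) * G \<partial>tm t)" by (rule nn_integral_add) measurable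
  then show ?thesis by (simp only: const)
 qed
 also have "... = hs m (amp (z 0)) + (?X + ennreal (4 / c * t) * G)"
 proof -
  have "ennreal (4 / c * t) = ennreal (4 / c) * ennreal t" using c t by (intro ennreal_mult) auto
  then show ?thesis by (simp only: mult_ac)
 qed
 finally have *: "?X + (?e t * hs m (amp (z t)) + ?Y) <= ?X + (hs m (amp (z 0)) + ennreal (4 / c * t) * G)"
  by (simp only: add_ac)
 have X: "?X < \<top>"
 proof -
  have "?X <= (\<integral>\<^sup>+ s. 1 * (ennreal \<alpha> * B) \<partial>tm t)" by (intro nn_integral_mono mult_mono bd e1 order_refl) auto
  also have "... = ennreal \<alpha> * B * ennreal t" by (simp only: mult_1 const)
  also have "... < \<top>" using bd(1) by (auto simp: ennreal_mult_less_top)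
  finally show ?thesis .
 qed
 let ?R = "hs m (amp (z 0)) + ennreal (4 / c * t) * G"
 have **: "?e t * hs m (amp (z t)) + ?Y <= ?R" using * X by (subst (asm) ennreal_add_left_cancel_le) auto
 have ee: "ennreal (exp (\<alpha> * t)) * ?e t = 1" by (simp flip: ennreal_mult exp_add)
 have "ennreal (exp (\<alpha> * t)) * (?e t * hs m (amp (z t))) <= ennreal (exp (\<alpha> * t)) * ?R"
  using ** by (intro mult_left_mono order_trans[OF _ **]) auto
 then show "hs m (amp (z t)) <= ennreal (exp (rate c m Q * t)) * ?R"
  unfolding mult.assoc[symmetric] ee by (simp add: \<alpha>_def mult.assoc)
 have "ennreal c * (\<integral>\<^sup>+ s. hs (m + 1) (amp (z s)) \<partial>tm t) <= ennreal (exp (\<alpha> * t)) * ?Y"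
 proof -
  have "ennreal (exp (\<alpha> * t)) * ?Y = (\<integral>\<^sup>+ s. ennreal (exp (\<alpha> * t)) * (?e s * (ennreal c * hs (m + 1) (amp (z s)))) \<partial>tm t)"
   by (rule nn_integral_cmult[symmetric]) measurable
  also have "... >= (\<integral>\<^sup>+ s. 1 * (ennreal c * hs (m + 1) (amp (z s))) \<partial>tm t)"
   unfolding mult.assoc[symmetric, of "ennreal (exp (\<alpha> * t))"]
  proof (intro nn_integral_mono mult_right_mono)
   fix s assume "s \<in> space (tm t)"
   then have "0 <= \<alpha> * (t - s)" using \<alpha> by simp
   then have "1 <= exp (\<alpha> * t) * exp (- \<alpha> * s)" by (simp add: algebra_simps flip: exp_add)
   then show "1 <= ennreal (exp (\<alpha> * t)) * ?e s" by (simp flip: ennreal_mult)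
  qed auto
  finally show ?thesis by (simp add: nn_integral_cmult)
 qed
 also have "... <= ennreal (exp (\<alpha> * t)) * ?R" by (intro mult_left_mono order_trans[OF _ **]) auto
 finally show "ennreal c * (\<integral>\<^sup>+ s. hs (m + 1) (amp (z s)) \<partial>tm t) <= ennreal (exp (rate c m Q * t)) * ?R"
  by (simp add: \<alpha>_def)
qed

section \<open>Continuity in time of the transport term\<close>

lemma op_bound_l1:
 assumes "m > 1" "op_bound P Q" "hs m Q < \<top>"
 shows "integrable freqs (\<lambda>l. P k l)"
proof (rule integrableI_bounded)
 have "(\<integral>\<^sup>+ l. Q l \<partial>freqs)^2 <= zeta m * hs m Q" using assms by (intro l1_le_hs) (auto simp: op_bound_def)
 also have "... < \<top>" using zeta_finite[of m] assms by (simp add: ennreal_mult_less_top)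
 finally have fin: "(\<integral>\<^sup>+ l. Q l \<partial>freqs) < \<top>"
  by (metis ennreal_mult_eq_top_iff less_top not_less_zero power2_eq_square zero_less_iff_neq_zero)
 have "(\<integral>\<^sup>+ l. ennreal (cmod (P k l)) \<partial>freqs) <= (\<integral>\<^sup>+ l. wt 1 k * Q (k - l) \<partial>freqs)"
  using assms by (intro nn_integral_mono) (simp add: op_bound_def del: split_paired_All)
 also have "... = wt 1 k * (\<integral>\<^sup>+ l. Q l \<partial>freqs)" by (simp add: nn_integral_cmult nn_integral_freqs_reflect)
 also have "... < \<top>" using fin by (simp add: ennreal_mult_less_top)
 finally show "(\<integral>\<^sup>+ l. ennreal (norm (P k l)) \<partial>freqs) < \<infinity>" by simp
qed simp

lemma mode_bound:
 assumes "m >= 0" "hs m (amp y) <= B" "B < \<top>" "y 0 = 0"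
 shows "cmod (y k) <= sqrt (enn2real B)"
proof (cases "k = 0")
 case False
 have "ennreal ((cmod (y k))^2) <= (wt m k * amp y k)^2"
  using mult_right_mono[OF wt_ge_1[OF False assms(1)], of "amp y k"] by (simp add: power_mono flip: ennreal_power)
 also have "... <= B" by (rule order_trans[OF hs_point assms(2)])
 finally have "(cmod (y k))^2 <= enn2real B" using assms(3) by (metis enn2real_ennreal enn2real_mono zero_le_power2)
 then show ?thesis by (rule real_le_rsqrt)
qed (use assms in simp)

text \<open>Dominated convergence over the frequencies: each row of P is summable, and the modes are
  bounded uniformly on bounded time intervals.\<close>

lemma adv_continuous:
 fixes y :: "real => int \<times> int => complex"
 assumes m: "m > 1" and P: "op_bound P Q" and Q: "hs m Q < \<top>" and y0: "\<And>t. t >= 0 ==> y t 0 = 0"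
  and bd: "\<And>S. \<exists>B<\<top>. \<forall>t\<in>{0..S}. hs m (amp (y t)) <= B"
  and cont: "\<And>k. continuous_on {0..} (\<lambda>t. y t k)"
 shows "continuous_on {0..} (\<lambda>t. adv P (y t) k)"
proof (rule continuous_on_sequentiallyI)
 fix u and a :: real
 assume u: "\<forall>n. u n \<in> {0..}" "a \<in> {0..}" "u \<longlonglongrightarrow> a"
 obtain S where S: "\<And>n. u n <= S"
  using convergent_imp_Bseq[of u] u(3) by (auto simp: convergent_def Bseq_def abs_le_iff)
 obtain B where B: "B < \<top>" "\<And>t. t \<in> {0..S} ==> hs m (amp (y t)) <= B" using bd[of S] by blast
 show "(\<lambda>n. adv P (y (u n)) k) \<longlonglongrightarrow> adv P (y a) k" unfolding adv_def
 proof (rule integral_dominated_convergence[where w="\<lambda>l. cmod (P k l) * sqrt (enn2real B)"])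
  show "integrable freqs (\<lambda>l. cmod (P k l) * sqrt (enn2real B))"
   using op_bound_l1[OF m P Q, of k] by (intro integrable_mult_left integrable_norm) auto
  have "(\<lambda>n. y (u n) l) \<longlonglongrightarrow> y a l" for l using continuous_on_tendsto_compose[OF cont u(3)] u by auto
  then show "AE l in freqs. (\<lambda>n. P k l * y (u n) l) \<longlonglongrightarrow> P k l * y a l" by (intro AE_I2 tendsto_mult tendsto_const)
  have "cmod (y (u n) l) <= sqrt (enn2real B)" for n l by (rule mode_bound[of m]) (use m B u S y0 in auto)
  then show "AE l in freqs. cmod (P k l * y (u n) l) <= cmod (P k l) * sqrt (enn2real B)" for n
   by (intro AE_I2) (simp add: norm_mult mult_left_mono)
 qed auto
qed

lemma mode_sol_D:
 assumes "mode_sol c m P y"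
 shows "t >= 0 ==> y t 0 = 0" and "\<exists>B<\<top>. \<forall>t\<in>{0..S}. hs m (amp (y t)) <= B" and "t >= 0 ==> ((\<lambda>t. y t k) has_vector_derivative
    - of_real (c * (norm (freq k))^2) * y t k - adv P (y t) k) (at t within {0..})"
 using assms unfolding mode_sol_def by blast+

lemma mode_sol_continuous:
 assumes "mode_sol c m P y" shows "continuous_on {0..} (\<lambda>t. y t k)"
 by (rule continuous_on_vector_derivative[OF mode_sol_D(3)[OF assms]]) simp

lemma mode_sol_adv_continuous:
 assumes "m > 1" "op_bound P' Q" "hs m Q < \<top>" "mode_sol c m P y"
 shows "continuous_on {0..} (\<lambda>t. adv P' (y t) k)"
 by (rule adv_continuous[OF assms(1-3) mode_sol_D(1,2)[OF assms(4)] mode_sol_continuous[OF assms(4)]])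

section \<open>Mean-square decay and a bound uniform in time\<close>

lemma amgm_ennreal: "a * b <= a^2 + b^2" for a b :: ennreal
proof -
 have *: "a * b <= a^2 + b^2" if "a <= b" for a b :: ennreal
  using mult_right_mono[OF that, of b] by (simp add: power2_eq_square add_increasing)
 show ?thesis using *[of a b] *[of b a] by (metis add.commute linear mult.commute)
qed

text \<open>The flux out of a finite set of modes involves only pairs with one index outside the set,
 because the contributions of the other pairs cancel by antisymmetry.\<close>

lemma flux_bound:
 assumes m: "m > 1" and P: "op_bound P Q" and Q: "hs m Q < \<top>" and anti: "\<And>k l. cnj (P k l) = - P l k"
  and y: "y 0 = 0" "hs m (amp y) < \<top>" and n: "n >= 1"
 shows "ennreal \<bar>\<Sum>k\<in>box_freqs n. Re (cnj (y k) * adv P y k)\<bar>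
  <= ennreal (real n powr (1 - m)) * (hs m (amp y) + alg m * hs m Q * hs m (amp y))"
proof -
 let ?F = "box_freqs n"
 define R where "R k = (LINT l|freqs. (if l \<in> ?F then 0 else P k l * y l))" for k
 have adv_eq: "adv P y k = (\<Sum>l\<in>?F. P k l * y l) + R k" for k
 proof -
  have i: "integrable freqs (\<lambda>l. P k l * y l)" by (rule integrable_op[OF m P Q y])
  have i1: "integrable freqs (\<lambda>l. indicator ?F l *\<^sub>R (P k l * y l))"
   and i2: "integrable freqs (\<lambda>l. if l \<in> ?F then 0 else P k l * y l)"
   by (rule Bochner_Integration.integrable_bound[OF i]; auto simp: indicator_def)+
  have "adv P y k = (LINT l|freqs. indicator ?F l *\<^sub>R (P k l * y l) + (if l \<in> ?F then 0 else P k l * y l))"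
   unfolding adv_def by (rule Bochner_Integration.integral_cong) auto
  also have "... = (LINT l|freqs. indicator ?F l *\<^sub>R (P k l * y l)) + R k"
   unfolding R_def by (rule Bochner_Integration.integral_add[OF i1 i2])
  also have "(LINT l|freqs. indicator ?F l *\<^sub>R (P k l * y l)) = (\<Sum>l\<in>?F. P k l * y l)"
  proof -
   have fin: "finite {l \<in> UNIV. indicator ?F l *\<^sub>R (P k l * y l) \<noteq> 0}"
    by (rule finite_subset[OF _ finite_box_freqs[of n]]) (auto simp: indicator_def)
   have "(LINT l|freqs. indicator ?F l *\<^sub>R (P k l * y l))
     = (\<Sum>l | l \<in> UNIV \<and> indicator ?F l *\<^sub>R (P k l * y l) \<noteq> 0. indicator ?F l *\<^sub>R (P k l * y l))"
    by (rule lebesgue_integral_count_space_finite_support[OF fin])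
   also have "... = (\<Sum>l\<in>?F. indicator ?F l *\<^sub>R (P k l * y l))"
    by (rule sum.mono_neutral_left) (auto simp: indicator_def)
   also have "... = (\<Sum>l\<in>?F. P k l * y l)" by (intro sum.cong) auto
   finally show ?thesis .
  qed
  finally show ?thesis .
 qed
 \<comment> \<open>The part of the double sum inside the box: conjugation together with a swap of
   the indices turns it into its negative, so it is purely imaginary.\<close>
 define S where "S = (\<Sum>k\<in>?F. \<Sum>l\<in>?F. cnj (y k) * P k l * y l)"
 have "cnj S = (\<Sum>k\<in>?F. \<Sum>l\<in>?F. - (cnj (y l) * P l k * y k))"
  unfolding S_def cnj_sum by (intro sum.cong refl) (simp add: anti mult_ac)
 also have "... = - S" unfolding S_def sum_negf by (subst sum.swap) simp
 finally have "Re (cnj S) = Re (- S)" by simp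
 then have S0: "Re S = 0" by simp
 have "(\<Sum>k\<in>?F. cnj (y k) * adv P y k) = S + (\<Sum>k\<in>?F. cnj (y k) * R k)"
  unfolding adv_eq S_def by (simp add: distrib_left sum.distrib sum_distrib_left mult.assoc)
 then have "Re (\<Sum>k\<in>?F. cnj (y k) * adv P y k) = Re S + Re (\<Sum>k\<in>?F. cnj (y k) * R k)" by (simp only: plus_complex.sel)
 then have "(\<Sum>k\<in>?F. Re (cnj (y k) * adv P y k)) = Re (\<Sum>k\<in>?F. cnj (y k) * R k)"
  unfolding S0 add_0_left by (simp only: Re_sum)
 then have "\<bar>\<Sum>k\<in>?F. Re (cnj (y k) * adv P y k)\<bar> <= cmod (\<Sum>k\<in>?F. cnj (y k) * R k)" by (simp only: abs_Re_le_cmod)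
 also have "... <= (\<Sum>k\<in>?F. cmod (y k) * cmod (R k))" by (rule order_trans[OF norm_sum]) (simp add: norm_mult)
 finally have "ennreal \<bar>\<Sum>k\<in>?F. Re (cnj (y k) * adv P y k)\<bar> <= ennreal (\<Sum>k\<in>?F. cmod (y k) * cmod (R k))"
  by (rule ennreal_leI)
 also have "... = (\<Sum>k\<in>?F. amp y k * ennreal (cmod (R k)))" by (simp add: sum_ennreal[symmetric] ennreal_mult)
 also have "... <= (\<Sum>k\<in>?F. \<integral>\<^sup>+ l. (if l \<in> ?F then 0 else amp y k * (ennreal (cmod (P k l)) * amp y l)) \<partial>freqs)"
 proof (rule sum_mono)
  fix k
  have "ennreal (cmod (R k)) <= (\<integral>\<^sup>+ l. ennreal (cmod (if l \<in> ?F then 0 else P k l * y l)) \<partial>freqs)"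
   unfolding R_def by (rule norm_integral_le_nn)
  then have "amp y k * ennreal (cmod (R k)) <= amp y k * (\<integral>\<^sup>+ l. ennreal (cmod (if l \<in> ?F then 0 else P k l * y l)) \<partial>freqs)"
   by (intro mult_left_mono) auto
  also have "... = (\<integral>\<^sup>+ l. amp y k * ennreal (cmod (if l \<in> ?F then 0 else P k l * y l)) \<partial>freqs)"
   by (rule nn_integral_cmult[symmetric]) auto
  also have "... = (\<integral>\<^sup>+ l. (if l \<in> ?F then 0 else amp y k * (ennreal (cmod (P k l)) * amp y l)) \<partial>freqs)"
   by (intro nn_integral_cong) (auto simp: norm_mult ennreal_mult)
  finally show "amp y k * ennreal (cmod (R k)) <= (\<integral>\<^sup>+ l. (if l \<in> ?F then 0 else amp y k * (ennreal (cmod (P k l)) * amp y l)) \<partial>freqs)" .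
 qed
 also have "... = (\<integral>\<^sup>+ k. (\<integral>\<^sup>+ l. (if l \<in> ?F then 0 else amp y k * (ennreal (cmod (P k l)) * amp y l)) \<partial>freqs) \<partial>count_space ?F)"
  by (rule nn_integral_count_space_finite[symmetric]) simp
 also have "... <= (\<integral>\<^sup>+ k. (\<integral>\<^sup>+ l. (if l \<in> ?F then 0 else amp y k * (ennreal (cmod (P k l)) * amp y l)) \<partial>freqs) \<partial>freqs)"
  unfolding nn_integral_count_space_indicator[of ?F, simplified]
  by (intro nn_integral_mono) (auto simp: indicator_def)
 also have "... = (\<integral>\<^sup>+ l. (\<integral>\<^sup>+ k. (if l \<in> ?F then 0 else amp y k * (ennreal (cmod (P k l)) * amp y l)) \<partial>freqs) \<partial>freqs)"
  by (rule nn_integral_freqs_swap)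
 also have "... <= (\<integral>\<^sup>+ l. ennreal (real n powr (1 - m)) * ((wt m l * amp y l)^2 + (wt m l * conv Q (amp y) l)^2) \<partial>freqs)"
 proof (rule nn_integral_mono)
  fix l
  show "(\<integral>\<^sup>+ k. (if l \<in> ?F then 0 else amp y k * (ennreal (cmod (P k l)) * amp y l)) \<partial>freqs)
    <= ennreal (real n powr (1 - m)) * ((wt m l * amp y l)^2 + (wt m l * conv Q (amp y) l)^2)"
  proof (cases "l \<in> ?F")
   case False
   have l: "l \<noteq> 0" using False by (auto simp: box_freqs_def zero_prod_def)
   have nl: "real n <= norm (freq l)"
   proof -
    have "real n <= \<bar>real_of_int (fst l)\<bar> \<or> real n <= \<bar>real_of_int (snd l)\<bar>"
     using False by (cases l) (auto simp: box_freqs_def)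
    then show ?thesis using norm_fst_le[of "real_of_int (fst l)" "real_of_int (snd l)"]
      norm_snd_le[of "real_of_int (snd l)" "real_of_int (fst l)"] by (auto simp: freq_def)
   qed
   \<comment> \<open>Antisymmetry moves the derivative weight from k to the outer frequency
     l.\<close>
   have Pl: "ennreal (cmod (P k l)) <= wt 1 l * Q (l - k)" for k
   proof -
    have "cmod (P k l) = cmod (P l k)" by (metis anti complex_mod_cnj norm_minus_cancel)
    then show ?thesis using P by (simp add: op_bound_def del: split_paired_All)
   qed
   have "(\<integral>\<^sup>+ k. amp y k * (ennreal (cmod (P k l)) * amp y l) \<partial>freqs)
     <= (\<integral>\<^sup>+ k. (wt 1 l * amp y l) * (Q (l - k) * amp y k) \<partial>freqs)"
   proof (rule nn_integral_mono)
    fix k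
    have "amp y k * (ennreal (cmod (P k l)) * amp y l) <= amp y k * (wt 1 l * Q (l - k) * amp y l)"
     by (intro mult_left_mono mult_right_mono Pl) auto
    then show "amp y k * (ennreal (cmod (P k l)) * amp y l) <= (wt 1 l * amp y l) * (Q (l - k) * amp y k)"
     by (simp only: mult_ac)
   qed
   also have "... = wt 1 l * (amp y l * conv Q (amp y) l)"
    unfolding conv_def by (subst nn_integral_cmult) (auto simp: mult_ac)
   also have "... <= (ennreal (real n powr (1 - m)) * wt m l) * (amp y l * (wt m l * conv Q (amp y) l))"
   proof (intro mult_mono order_refl)
    \<comment> \<open>Outside the box |l| is at least n, and m > 1, so |l| is at most n^(1-m) |l|^m.
      This is the source of the decaying factor.\<close>
    have "norm (freq l) powr 1 = norm (freq l) powr (1 - m) * norm (freq l) powr m" by (simp flip: powr_add)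
    also have "... <= real n powr (1 - m) * norm (freq l) powr m"
     using n m nl by (intro mult_right_mono powr_mono2') auto
    finally show "wt 1 l <= ennreal (real n powr (1 - m)) * wt m l"
     unfolding wt_def by (simp add: ennreal_leI flip: ennreal_mult)
    show "conv Q (amp y) l <= wt m l * conv Q (amp y) l"
     using mult_right_mono[OF wt_ge_1[OF l, of m], of "conv Q (amp y) l"] m by simp
   qed auto
   also have "... = ennreal (real n powr (1 - m)) * ((wt m l * amp y l) * (wt m l * conv Q (amp y) l))"
    by (simp only: mult_ac)
   also have "... <= ennreal (real n powr (1 - m)) * ((wt m l * amp y l)^2 + (wt m l * conv Q (amp y) l)^2)"
    by (intro mult_left_mono amgm_ennreal) auto
   finally show ?thesis using False by simp
  qed simp
 qed
 also have "... = ennreal (real n powr (1 - m)) * (hs m (amp y) + hs m (conv Q (amp y)))"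
  unfolding hs_def by (simp add: nn_integral_cmult nn_integral_add)
 also have "... <= ennreal (real n powr (1 - m)) * (hs m (amp y) + alg m * hs m Q * hs m (amp y))"
  using P m y by (intro mult_left_mono add_left_mono hs_conv) (auto simp: op_bound_def)
 finally show ?thesis .
qed

text \<open>An antisymmetric matrix does not change the sum of squares. The energy is truncated to a
  box, where it can be differentiated termwise, and the flux out of the box vanishes as the box
  grows.\<close>

lemma l2_decay:
 assumes c: "c > 0" and m: "m > 1" and P: "op_bound P Q" and Q: "hs m Q < \<top>" and anti: "\<And>k l. cnj (P k l) = - P l k"
  and y: "mode_sol c m P y" and t: "t >= 0"
 shows "hs 0 (amp (y t)) <= hs 0 (amp (y 0))"
proof -
 obtain B where B: "B < \<top>" "\<And>s. s \<in> {0..t} ==> hs m (amp (y s)) <= B" using mode_sol_D(2)[OF y] by blast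
 have y0: "y s 0 = 0" if "s >= 0" for s by (rule mode_sol_D(1)[OF y that])
 define M where "M = enn2real (B + alg m * hs m Q * B)"
 have M: "B + alg m * hs m Q * B = ennreal M" using B(1) Q alg_finite[OF m] by (simp add: M_def ennreal_mult_less_top)
 define \<delta> where "\<delta> n = real n powr (1 - m) * M" for n :: nat
 define E where "E n s = (\<Sum>k\<in>box_freqs n. (cmod (y s k))^2)" for n s
 have M0: "M >= 0" by (simp add: M_def)
 have flux: "\<bar>\<Sum>k\<in>box_freqs n. Re (cnj (y s k) * adv P (y s) k)\<bar> <= \<delta> n" if n: "n >= 1" and s: "s \<in> {0..t}" for n s
 proof -
  have "ennreal \<bar>\<Sum>k\<in>box_freqs n. Re (cnj (y s k) * adv P (y s) k)\<bar>
    <= ennreal (real n powr (1 - m)) * (hs m (amp (y s)) + alg m * hs m Q * hs m (amp (y s)))"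
   by (rule flux_bound[OF m P Q anti _ _ n]) (use s y0 B in \<open>auto intro: le_less_trans\<close>)
  also have "... <= ennreal (real n powr (1 - m)) * (B + alg m * hs m Q * B)" by (intro mult_left_mono add_mono B s) auto
  also have "... = ennreal (\<delta> n)" unfolding M \<delta>_def using M0 by (simp add: ennreal_mult)
  finally show ?thesis using M0 by (simp add: \<delta>_def)
 qed
 have En: "E n t <= E n 0 + 2 * \<delta> n * t" if n: "n >= 1" for n
 proof (cases "t = 0")
  case False
  then have t': "0 < t" using t by simp
  define f where "f s = E n s - 2 * \<delta> n * s" for s
  have "f t <= f 0"
  proof (rule DERIV_nonpos_imp_decreasing_open[OF t])
   fix s assume s: "0 < s" "s < t"
   have at: "at s within {0..} = at s" using s by (intro at_within_interior) simp
   have "((\<lambda>s. y s k) has_vector_derivative - of_real (c * (norm (freq k))^2) * y s k - adv P (y s) k) (at s)" for k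
    unfolding at[symmetric] by (rule mode_sol_D(3)[OF y]) (use s in simp)
   from has_real_derivative_norm_sq[OF this]
   have "((\<lambda>s. E n s) has_real_derivative
     (\<Sum>k\<in>box_freqs n. 2 * (y s k \<bullet> (- of_real (c * (norm (freq k))^2) * y s k - adv P (y s) k)))) (at s)"
    unfolding E_def by (intro DERIV_sum)
   then have "(f has_real_derivative
     (\<Sum>k\<in>box_freqs n. 2 * (y s k \<bullet> (- of_real (c * (norm (freq k))^2) * y s k - adv P (y s) k))) - 2 * \<delta> n) (at s)"
    unfolding f_def[abs_def] by (auto intro!: derivative_eq_intros)
   moreover have "(\<Sum>k\<in>box_freqs n. 2 * (y s k \<bullet> (- of_real (c * (norm (freq k))^2) * y s k - adv P (y s) k)))
     <= (\<Sum>k\<in>box_freqs n. - 2 * Re (cnj (y s k) * adv P (y s) k))"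
   proof (rule sum_mono)
    fix k
    have "y s k \<bullet> (- of_real (c * (norm (freq k))^2) * y s k - adv P (y s) k)
      = - (c * (norm (freq k))^2) * (y s k \<bullet> y s k) - y s k \<bullet> adv P (y s) k"
    proof -
     have "- of_real (c * (norm (freq k))^2) * y s k = (- (c * (norm (freq k))^2)) *\<^sub>R y s k"
      unfolding scaleR_conv_of_real by (simp only: of_real_minus)
     then show ?thesis by (simp only: inner_diff_right inner_scaleR_right)
    qed
    also have "... <= - (y s k \<bullet> adv P (y s) k)" using c by simp
    finally show "2 * (y s k \<bullet> (- of_real (c * (norm (freq k))^2) * y s k - adv P (y s) k))
      <= - 2 * Re (cnj (y s k) * adv P (y s) k)" by (simp add: inner_complex_def)
   qed
   moreover have "(\<Sum>k\<in>box_freqs n. - 2 * Re (cnj (y s k) * adv P (y s) k)) <= 2 * \<delta> n"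
    using flux[OF n, of s] s unfolding sum_distrib_left[symmetric] by auto
   ultimately show "\<exists>z. (f has_real_derivative z) (at s) \<and> z <= 0" by fastforce
  next
   show "continuous_on {0..t} f" unfolding f_def E_def
    by (intro continuous_intros continuous_on_subset[OF mode_sol_continuous[OF y]]) auto
  qed
  then show ?thesis by (simp add: f_def)
 qed simp
 have hs0: "hs 0 (amp (y s)) = (\<integral>\<^sup>+ k. ennreal ((cmod (y s k))^2) \<partial>freqs)" if "s >= 0" for s
  unfolding hs_def using y0[OF that]
  by (intro nn_integral_cong) (metis ennreal_power mult_1 norm_ge_zero norm_zero power_zero_numeral wt_0 wt_zero mult_zero_left ennreal_0)
 have fin0: "(\<integral>\<^sup>+ k. ennreal ((cmod (y 0 k))^2) \<partial>freqs) < \<top>"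
  using hs0[of 0] hs_mono_exp[of 0 m "amp (y 0)"] B(2)[of 0] B(1) m t by (auto intro: le_less_trans)
 define e0 where "e0 = enn2real (\<integral>\<^sup>+ k. ennreal ((cmod (y 0 k))^2) \<partial>freqs)"
 have e0: "(\<integral>\<^sup>+ k. ennreal ((cmod (y 0 k))^2) \<partial>freqs) = ennreal e0" "e0 >= 0" using fin0 by (auto simp: e0_def)
 have E0: "E n 0 <= e0" for n
 proof -
  have "ennreal (E n 0) = (\<Sum>k\<in>box_freqs n. ennreal ((cmod (y 0 k))^2))"
   unfolding E_def by (rule sum_ennreal[symmetric]) simp
  also have "... = (\<integral>\<^sup>+ k. ennreal ((cmod (y 0 k))^2) \<partial>count_space (box_freqs n))"
   by (rule nn_integral_count_space_finite[symmetric]) simp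
  also have "... <= ennreal e0"
   unfolding e0(1)[symmetric] nn_integral_count_space_indicator[of "box_freqs n", simplified]
   by (intro nn_integral_mono) (auto simp: indicator_def)
  finally show ?thesis using e0(2) by (simp add: ennreal_le_iff)
 qed
 have \<delta>0: "\<delta> \<longlonglongrightarrow> 0"
 proof -
  have "(\<lambda>n. real n powr (1 - m)) \<longlonglongrightarrow> 0" using tendsto_neg_powr[OF _ filterlim_real_sequentially, of "1 - m"] m by simp
  from tendsto_mult_right[OF this, of M] show ?thesis by (simp add: \<delta>_def[abs_def])
 qed
 \<comment> \<open>n stays fixed while the estimate is applied to larger boxes j, whose flux error
   tends to zero.\<close>
 have "E n t <= e0" for n
 proof (rule LIMSEQ_le_const)
  have "(\<lambda>j. e0 + 2 * \<delta> j * t) \<longlonglongrightarrow> e0 + 2 * 0 * t" by (intro tendsto_intros \<delta>0)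
  then show "(\<lambda>j. e0 + 2 * \<delta> j * t) \<longlonglongrightarrow> e0" by simp
  have "E n t <= e0 + 2 * \<delta> j * t" if "j >= max 1 n" for j
  proof -
   have "E n t <= E j t" unfolding E_def using that by (intro sum_mono2) (auto simp: box_freqs_def)
   then show ?thesis using En[of j] E0[of j] that by simp
  qed
  then show "\<exists>N. \<forall>j\<ge>N. E n t <= e0 + 2 * \<delta> j * t" by blast
 qed
 then have "(\<integral>\<^sup>+ k. ennreal ((cmod (y t k))^2) \<partial>freqs) <= ennreal e0" by (intro nn_integral_freqs_le) (auto simp: E_def)
 then show ?thesis using t by (simp add: hs0 e0(1))
qed

text \<open>Frequencies with c |k|^2 at least b are controlled by the H^(m+1) norm; for the others
  |k|^2 is at most b / c, and the mean square suffices.\<close>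

lemma interpolation:
 assumes "c > 0" "b >= 0" "m > 0"
 shows "ennreal b * hs m A <= ennreal c * hs (m + 1) A + ennreal (b * (b / c) powr m) * hs 0 A"
proof -
 have "ennreal b * (wt m k)^2 <= ennreal c * (wt (m + 1) k)^2 + ennreal (b * (b / c) powr m) * (wt 0 k)^2" for k
 proof (cases "k = 0")
  case False
  define r where "r = norm (freq k)"
  have r: "r > 0" using False by (simp add: r_def)
  have r2: "(r powr m)^2 = (r^2) powr m" "(r powr (m + 1))^2 = r^2 * (r^2) powr m"
   using r by (simp_all add: power2_eq_square powr_mult powr_add)
  have "b * (r^2) powr m <= c * (r^2 * (r^2) powr m) + b * (b / c) powr m"
  proof (cases "b <= c * r^2")
   case True
   then have "b * (r^2) powr m <= (c * r^2) * (r^2) powr m" by (intro mult_right_mono) auto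
   then show ?thesis using assms by (simp add: mult.assoc add_increasing2)
  next
   case False
   then have "r^2 <= b / c" using assms by (simp add: field_simps)
   then have "(r^2) powr m <= (b / c) powr m" using assms by (intro powr_mono2) auto
   then have "b * (r^2) powr m <= b * (b / c) powr m" using assms by (intro mult_left_mono) auto
   then show ?thesis using assms by (simp add: add_increasing)
  qed
  then have "ennreal (b * (r^2) powr m) <= ennreal (c * (r^2 * (r^2) powr m) + b * (b / c) powr m)"
   by (rule ennreal_leI)
  then show ?thesis
   using False assms by (simp add: wt_def[of m] wt_def[of "m + 1"] r_def[symmetric] ennreal_power r2 ennreal_mult)
 qed simp
 then have "(\<integral>\<^sup>+ k. (ennreal b * (wt m k)^2) * (A k)^2 \<partial>freqs)
   <= (\<integral>\<^sup>+ k. (ennreal c * (wt (m + 1) k)^2 + ennreal (b * (b / c) powr m) * (wt 0 k)^2) * (A k)^2 \<partial>freqs)"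
  by (intro nn_integral_mono mult_right_mono) auto
 then show ?thesis unfolding hs_def
  by (simp add: distrib_right power_mult_distrib mult.assoc nn_integral_cmult nn_integral_add del: wt_zero)
qed

lemma mode_sol_growth:
 assumes "c > 0" "m > 1" "op_bound P Q" "hs m Q < \<top>" "mode_sol c m P y" "t >= 0"
 shows "hs m (amp (y t)) <= ennreal (exp (rate c m Q * t)) * hs m (amp (y 0))"
  and "ennreal c * (\<integral>\<^sup>+ s. hs (m + 1) (amp (y s)) \<partial>tm t) <= ennreal (exp (rate c m Q * t)) * hs m (amp (y 0))"
proof -
 obtain B where B: "B < \<top>" "\<And>s. s \<in> {0..t} ==> hs m (amp (y s)) <= B" using mode_sol_D(2)[OF assms(5)] by blast
 have z: "((\<lambda>s. y s k) has_vector_derivative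
    - of_real (c * (norm (freq k))^2) * y s k - (adv P (y s) k + (\<lambda>_ _. 0) s k)) (at s within {0..})"
  if "s >= 0" for s k
  using mode_sol_D(3)[OF assms(5) that] by simp
 note G = growth[OF assms(1,2,6,3,4) _ B mode_sol_adv_continuous[OF assms(2-5)] _ z, of 0]
 have y0: "\<And>s. s >= 0 ==> y s 0 = 0" by (rule mode_sol_D(1)[OF assms(5)])
 show "hs m (amp (y t)) <= ennreal (exp (rate c m Q * t)) * hs m (amp (y 0))" using G(1) y0 by (simp add: hs_def)
 show "ennreal c * (\<integral>\<^sup>+ s. hs (m + 1) (amp (y s)) \<partial>tm t) <= ennreal (exp (rate c m Q * t)) * hs m (amp (y 0))"
  using G(2) y0 by (simp add: hs_def)
qed

lemma mode_sol_initial_finite: "mode_sol c m P y ==> hs m (amp (y 0)) < \<top>"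
proof -
 assume "mode_sol c m P y"
 then obtain B where "B < \<top>" "\<forall>s\<in>{0..0}. hs m (amp (y s)) <= B" unfolding mode_sol_def by blast
 then show ?thesis by (auto intro: le_less_trans)
qed

text \<open>Energy with \<alpha> = 0 and \<beta> = 1. The terms on the right are interpolated
  between the dissipation, which cancels against the left side, and the mean square, which does not
  increase. The weight exp(s) integrates to at most exp(t), and this factor is finally divided
  out.\<close>

lemma mode_sol_bounded:
 assumes c: "c > 0" and m: "m > 1" and P: "op_bound P Q" and Q: "hs m Q < \<top>"
  and anti: "\<And>k l. cnj (P k l) = - P l k" and y: "mode_sol c m P y"
 shows "\<exists>C<\<top>. \<forall>t\<ge>0. hs m (amp (y t)) <= C"
proof -
 define q where "q = enn2real (alg m * hs m Q)"
 have q: "alg m * hs m Q = ennreal q" "q >= 0" using Q alg_finite[OF m] by (auto simp: q_def ennreal_mult_less_top)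
 \<comment> \<open>The 1 comes from differentiating the weight exp(s), the q / c from the transport
   term.\<close>
 define b where "b = 1 + q / c"
 have b: "b >= 0" using q c by (simp add: b_def)
 define M where "M = b * (b / c) powr m"
 have y0: "y s 0 = 0" if "s >= 0" for s by (rule mode_sol_D(1)[OF y that])
 have fin: "hs m (amp (y 0)) < \<top>" by (rule mode_sol_initial_finite[OF y])
 have "hs m (amp (y t)) <= hs m (amp (y 0)) + ennreal M * hs 0 (amp (y 0))" if t: "t >= 0" for t
 proof -
  have zm [measurable]: "(\<lambda>s. y s k) \<in> borel_measurable (tm t)" for k
   by (rule tm_measurable[OF mode_sol_continuous[OF y]])
  have em [measurable]: "(\<lambda>s. exp s) \<in> borel_measurable (tm t)" by (intro tm_measurable continuous_intros)
  have hm [measurable]: "(\<lambda>s. hs r (amp (y s))) \<in> borel_measurable (tm t)" for r by (rule hs_measurable) measurable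
  have z: "((\<lambda>s. y s k) has_vector_derivative
    - of_real (c * (norm (freq k))^2) * y s k - adv P (y s) k) (at s within {0..})"
   if "s >= 0" for s k by (rule mode_sol_D(3)[OF y that])
  let ?X = "\<integral>\<^sup>+ s. ennreal (exp s) * (ennreal c * hs (m + 1) (amp (y s))) \<partial>tm t"
  \<comment> \<open>The dissipation integral can be cancelled only if it is finite; the exponential
    growth bound gives this for each t.\<close>
  have X: "?X < \<top>"
  proof -
   have "?X <= (\<integral>\<^sup>+ s. ennreal (exp t) * (ennreal c * hs (m + 1) (amp (y s))) \<partial>tm t)"
    by (intro nn_integral_mono mult_right_mono ennreal_leI) auto
   also have "... = ennreal (exp t) * (ennreal c * (\<integral>\<^sup>+ s. hs (m + 1) (amp (y s)) \<partial>tm t))"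
    by (simp add: nn_integral_cmult)
   also have "... <= ennreal (exp t) * (ennreal (exp (rate c m Q * t)) * hs m (amp (y 0)))"
    by (intro mult_left_mono mode_sol_growth(2)[OF c m P Q y t]) auto
   also have "... < \<top>" using fin by (simp add: ennreal_mult_less_top)
   finally show ?thesis .
  qed
  have int_exp: "(\<integral>\<^sup>+ s. ennreal (exp s) \<partial>tm t) <= ennreal (exp t)"
  proof -
   have "(exp has_integral (exp t - exp 0)) {0..t}" by (rule fundamental_theorem_of_calculus[OF t])
     (auto intro!: derivative_eq_intros simp: has_real_derivative_iff_has_vector_derivative[symmetric])
   then have "integral {0..t} exp = exp t - 1" by (simp add: integral_unique)
   then show ?thesis by (subst nn_integral_tm) (auto intro!: continuous_intros ennreal_leI)
  qed
  have "ennreal (exp t) * hs m (amp (y t)) + ?X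
    <= hs m (amp (y 0)) + (\<integral>\<^sup>+ s. ennreal (exp s) * (hs m (amp (y s)) + ennreal (1 / c) * hs (m - 1) (amp (adv P (y s)))) \<partial>tm t)"
   using energy[OF c order_refl _ t mode_sol_adv_continuous[OF m P Q y] z, of 1 m] by simp
  also have "... <= hs m (amp (y 0)) + (\<integral>\<^sup>+ s. ennreal (exp s) * (ennreal c * hs (m + 1) (amp (y s))) + ennreal M * hs 0 (amp (y 0)) * ennreal (exp s) \<partial>tm t)"
  proof (intro add_left_mono nn_integral_mono)
   fix s assume "s \<in> space (tm t)"
   then have s: "s >= 0" by simp
   have "hs m (amp (y s)) + ennreal (1 / c) * hs (m - 1) (amp (adv P (y s)))
     <= hs m (amp (y s)) + ennreal (1 / c) * (alg m * hs m Q * hs m (amp (y s)))"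
    by (intro add_left_mono mult_left_mono hs_adv[OF m P] y0 s) auto
   also have "... = ennreal b * hs m (amp (y s))" unfolding q(1) b_def using q(2) c
    by (simp add: ennreal_mult[symmetric] mult.assoc[symmetric] distrib_right)
   also have "... <= ennreal c * hs (m + 1) (amp (y s)) + ennreal M * hs 0 (amp (y s))"
    unfolding M_def by (rule interpolation) (use c b m in auto)
   also have "... <= ennreal c * hs (m + 1) (amp (y s)) + ennreal M * hs 0 (amp (y 0))"
    by (intro add_left_mono mult_left_mono l2_decay[OF c m P Q anti y s]) auto
   finally have "ennreal (exp s) * (hs m (amp (y s)) + ennreal (1 / c) * hs (m - 1) (amp (adv P (y s))))
     <= ennreal (exp s) * (ennreal c * hs (m + 1) (amp (y s)) + ennreal M * hs 0 (amp (y 0)))"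
    by (intro mult_left_mono) auto
   then show "ennreal (exp s) * (hs m (amp (y s)) + ennreal (1 / c) * hs (m - 1) (amp (adv P (y s))))
     <= ennreal (exp s) * (ennreal c * hs (m + 1) (amp (y s))) + ennreal M * hs 0 (amp (y 0)) * ennreal (exp s)"
    by (simp only: distrib_left mult_ac)
  qed
  also have "... = hs m (amp (y 0)) + (?X + ennreal M * hs 0 (amp (y 0)) * (\<integral>\<^sup>+ s. ennreal (exp s) \<partial>tm t))"
   by (simp add: nn_integral_add nn_integral_cmult)
  also have "... <= hs m (amp (y 0)) + (?X + ennreal M * hs 0 (amp (y 0)) * ennreal (exp t))"
   by (intro add_left_mono mult_left_mono int_exp) auto
  finally have "?X + ennreal (exp t) * hs m (amp (y t)) <= ?X + (hs m (amp (y 0)) + ennreal M * hs 0 (amp (y 0)) * ennreal (exp t))"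
   by (simp only: add_ac)
  then have "ennreal (exp t) * hs m (amp (y t)) <= hs m (amp (y 0)) + ennreal M * hs 0 (amp (y 0)) * ennreal (exp t)"
   using X by (subst (asm) ennreal_add_left_cancel_le) auto
  also have "... <= ennreal (exp t) * hs m (amp (y 0)) + ennreal M * hs 0 (amp (y 0)) * ennreal (exp t)"
   using mult_right_mono[of 1 "ennreal (exp t)" "hs m (amp (y 0))"] t by (intro add_right_mono) simp
  also have "... = ennreal (exp t) * (hs m (amp (y 0)) + ennreal M * hs 0 (amp (y 0)))"
   by (simp only: distrib_left mult_ac)
  finally show ?thesis by (subst (asm) ennreal_mult_le_mult_iff) auto
 qed
 moreover have "hs m (amp (y 0)) + ennreal M * hs 0 (amp (y 0)) < \<top>"
  using fin hs_mono_exp[of 0 m "amp (y 0)"] m by (auto simp: ennreal_mult_less_top intro: le_less_trans)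
 ultimately show ?thesis by blast
qed

section \<open>Dependence on the transport operator\<close>

lemma adv_diff:
 assumes "integrable freqs (\<lambda>l. P k l * y l)" "integrable freqs (\<lambda>l. P k l * y' l)"
 shows "adv P (\<lambda>l. y l - y' l) k = adv P y k - adv P y' k"
 using assms unfolding adv_def by (simp add: right_diff_distrib)

text \<open>The difference solves the equation of y with the additional forcing (P - P') y' and zero
  initial value, so \<open>growth\<close> applies; y' itself enters through its own growth
  bound.\<close>

lemma mode_sol_stability:
 assumes c: "c > 0" and m: "m > 1" and P: "op_bound P Q" and Q: "hs m Q < \<top>"
  and P': "op_bound P' Q'" and Q': "hs m Q' < \<top>"
  and D: "op_bound (\<lambda>k l. P k l - P' k l) D"
  and y: "mode_sol c m P y" and y': "mode_sol c m P' y'" and t: "t >= 0" and init: "y 0 = y' 0"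
 shows "hs m (amp (\<lambda>k. y t k - y' t k)) <= ennreal (exp (rate c m Q * t)) *
  (ennreal (4 / c * t) * (alg m * hs m D * (ennreal (exp (rate c m Q' * t)) * hs m (amp (y' 0)))))"
proof -
 define z where "z s k = y s k - y' s k" for s k
 define g where "g s = adv (\<lambda>k l. P k l - P' k l) (y' s)" for s
 obtain B where B: "B < \<top>" "\<And>s. s \<in> {0..t} ==> hs m (amp (y s)) <= B" using mode_sol_D(2)[OF y] by blast
 obtain B' where B': "B' < \<top>" "\<And>s. s \<in> {0..t} ==> hs m (amp (y' s)) <= B'" using mode_sol_D(2)[OF y'] by blast
 have zb: "hs m (amp (z s)) <= 4 * (B + B')" if "s \<in> {0..t}" for s
 proof -
  have "hs m (amp (z s)) <= hs m (\<lambda>k. amp (y s) k + amp (y' s) k)"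
   unfolding z_def by (intro hs_mono) (simp add: norm_triangle_ineq4 flip: ennreal_plus)
  also have "... <= 4 * (hs m (amp (y s)) + hs m (amp (y' s)))" by (rule hs_add)
  also have "... <= 4 * (B + B')" by (intro mult_left_mono add_mono B B' that) auto
  finally show ?thesis .
 qed
 have hfin: "hs m (amp (y s)) < \<top>" "hs m (amp (y' s)) < \<top>" if s: "s >= 0" for s
 proof -
  show "hs m (amp (y s)) < \<top>" by (rule le_less_trans[OF mode_sol_growth(1)[OF c m P Q y s]])
    (use mode_sol_initial_finite[OF y] in \<open>simp add: ennreal_mult_less_top\<close>)
  show "hs m (amp (y' s)) < \<top>" by (rule le_less_trans[OF mode_sol_growth(1)[OF c m P' Q' y' s]])
    (use mode_sol_initial_finite[OF y'] in \<open>simp add: ennreal_mult_less_top\<close>)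
 qed
 have y0: "\<And>s. s >= 0 ==> y s 0 = 0" "\<And>s. s >= 0 ==> y' s 0 = 0" using mode_sol_D(1)[OF y] mode_sol_D(1)[OF y'] by auto
 have advz: "adv P (z s) k = adv P (y s) k - adv P (y' s) k" if s: "s >= 0" for s k unfolding z_def
  by (rule adv_diff; rule integrable_op[OF m P Q]) (use y0 hfin s in auto)
 have gd: "g s k = adv P (y' s) k - adv P' (y' s) k" if s: "s >= 0" for s k
 proof -
  have "integrable freqs (\<lambda>l. P k l * y' s l)" "integrable freqs (\<lambda>l. P' k l * y' s l)"
   using integrable_op[OF m P Q] integrable_op[OF m P' Q'] y0 hfin s by auto
  then show ?thesis unfolding g_def adv_def by (simp add: left_diff_distrib)
 qed
 have cont1: "continuous_on {0..} (\<lambda>s. adv P (z s) k)" for k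
 proof -
  have "continuous_on {0..} (\<lambda>s. adv P (y s) k - adv P (y' s) k)"
   by (intro continuous_intros mode_sol_adv_continuous[OF m P Q y] mode_sol_adv_continuous[OF m P Q y'])
  then show ?thesis by (rule continuous_on_eq) (auto simp: advz)
 qed
 have cont2: "continuous_on {0..} (\<lambda>s. g s k)" for k
 proof -
  have "continuous_on {0..} (\<lambda>s. adv P (y' s) k - adv P' (y' s) k)"
   by (intro continuous_intros mode_sol_adv_continuous[OF m P Q y'] mode_sol_adv_continuous[OF m P' Q' y'])
  then show ?thesis by (rule continuous_on_eq) (auto simp: gd)
 qed
 have der: "((\<lambda>s. z s k) has_vector_derivative
    - of_real (c * (norm (freq k))^2) * z s k - (adv P (z s) k + g s k)) (at s within {0..})" if s: "s >= 0" for k s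
 proof -
  have "((\<lambda>s. y s k) has_vector_derivative - of_real (c * (norm (freq k))^2) * y s k - adv P (y s) k) (at s within {0..})"
   "((\<lambda>s. y' s k) has_vector_derivative - of_real (c * (norm (freq k))^2) * y' s k - adv P' (y' s) k) (at s within {0..})"
   using mode_sol_D(3)[OF y s] mode_sol_D(3)[OF y' s] by auto
  from has_vector_derivative_diff[OF this] show ?thesis
   unfolding advz[OF s] gd[OF s] z_def by (simp add: algebra_simps)
 qed
 define G where "G = alg m * hs m D * (ennreal (exp (rate c m Q' * t)) * hs m (amp (y' 0)))"
 have g_le: "hs (m - 1) (amp (g s)) <= G" if s: "s \<in> {0..t}" for s
 proof -
  have s0: "s >= 0" using s by simp
  have "hs (m - 1) (amp (g s)) <= alg m * hs m D * hs m (amp (y' s))"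
   unfolding g_def by (rule hs_adv[OF m D]) (use y0 s0 in auto)
  also have "hs m (amp (y' s)) <= ennreal (exp (rate c m Q' * s)) * hs m (amp (y' 0))"
   by (rule mode_sol_growth(1)[OF c m P' Q' y' s0])
  also have "... <= ennreal (exp (rate c m Q' * t)) * hs m (amp (y' 0))"
   using s rate_nonneg[OF c, of m Q'] by (intro mult_right_mono ennreal_leI) (auto intro!: mult_left_mono)
  finally show ?thesis unfolding G_def by (simp add: mult_left_mono)
 qed
 have fin: "4 * (B + B') < \<top>" using B(1) B'(1) by (auto simp: ennreal_mult_less_top)
 have z0: "z s 0 = 0" if "s >= 0" for s using y0 that by (simp add: z_def)
 have "hs m (amp (z t)) <= ennreal (exp (rate c m Q * t)) * (hs m (amp (z 0)) + ennreal (4 / c * t) * G)"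
  by (rule growth(1)[OF c m t P Q z0 fin zb cont1 cont2 der g_le])
 moreover have "hs m (amp (z 0)) = 0" using init by (simp add: z_def hs_def)
 ultimately show ?thesis by (simp add: G_def z_def)
qed

section \<open>Existence of mode solutions\<close>

lemma at_within_atLeast_0:
 fixes t :: real
 assumes "t >= 0" "t < S"
 shows "at t within {0..} = at t within {0..S}" by (rule at_within_nhd[of t "{..<S}"]) (use assms in auto)

lemma continuous_on_atLeast_0:
 fixes f :: "real => 'a::topological_space"
 assumes "\<And>S. S > 0 ==> continuous_on {0..S} f"
 shows "continuous_on {0..} f"
 unfolding continuous_on_def
proof
 fix t :: real assume t: "t \<in> {0..}"
 have "(f \<longlongrightarrow> f t) (at t within {0..t + 1})" using assms[of "t + 1"] t by (auto simp: continuous_on_def)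
 then show "(f \<longlongrightarrow> f t) (at t within {0..})" using at_within_atLeast_0[of t "t + 1"] t by simp
qed

lemma integral_form_derivative:
 fixes f g :: "real => complex"
 assumes g: "continuous_on {0..} g" and f: "\<And>t. t >= 0 ==> f t = f0 + integral {0..t} g" and t: "t >= 0"
 shows "(f has_vector_derivative g t) (at t within {0..})"
proof -
 have "continuous_on {0..t + 1} g" by (rule continuous_on_subset[OF g]) auto
 then have "((\<lambda>u. integral {0..u} g) has_vector_derivative g t) (at t within {0..t + 1})"
  by (rule integral_has_vector_derivative) (use t in auto)
 then have "((\<lambda>u. f0 + integral {0..u} g) has_vector_derivative g t) (at t within {0..t + 1})"
  by (auto intro!: derivative_eq_intros)
 then have "(f has_vector_derivative g t) (at t within {0..t + 1})"
  by (rule has_vector_derivative_transform[rotated 2]) (use t f in auto)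
 then show ?thesis using at_within_atLeast_0[of t "t + 1"] t by simp
qed

lemma integral_of_derivative:
 fixes f g :: "real => complex"
 assumes f: "\<And>t. t >= 0 ==> (f has_vector_derivative g t) (at t within {0..})" and t: "t >= 0"
 shows "(g has_integral (f t - f 0)) {0..t}"
 by (rule fundamental_theorem_of_calculus[OF t], rule has_vector_derivative_within_subset[OF f]) auto

text \<open>Duhamel iteration for the diffusion semigroup perturbed by transport: each term is the
  response to the transport of its predecessor, and the sum of all terms solves the system.\<close>

primrec dyson :: "real => (int \<times> int => int \<times> int => complex) => (int \<times> int => complex) => nat => real => int \<times> int => complex" where
 "dyson c P a 0 = (\<lambda>t k. of_real (exp (- (c * (norm (freq k))^2) * t)) * a k)"
| "dyson c P a (Suc n) = (\<lambda>t k. - of_real (exp (- (c * (norm (freq k))^2) * t)) *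
   integral {0..t} (\<lambda>s. of_real (exp (c * (norm (freq k))^2 * s)) * adv P (dyson c P a n s) k))"

text \<open>Time-independent amplitudes that bound the Dyson terms up to the factor exp(r t).
  Frequency zero is cut off explicitly, since a convolution need not vanish there.\<close>

primrec majorant :: "ennreal => (int \<times> int => ennreal) => (int \<times> int => ennreal) => nat => int \<times> int => ennreal" where
 "majorant e Q A 0 = A"
| "majorant e Q A (Suc n) = (\<lambda>k. if k = 0 then 0 else e * conv Q (majorant e Q A n) k)"

context
 fixes c m r :: real and P :: "int \<times> int => int \<times> int => complex" and Q :: "int \<times> int => ennreal"
  and a :: "int \<times> int => complex"
 assumes c: "c > 0" and m: "m > 1" and r: "r > 0" and P: "op_bound P Q" and Q: "hs m Q < \<top>"
  and a0: "a 0 = 0" and a: "hs m (amp a) < \<top>"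
begin

abbreviation "dy \<equiv> dyson c P a"
text \<open>The maximum over w > 0 of w / (c w^2 + r), attained at w = sqrt (r / c). It tends to
  zero as r grows, which is how the series is made to converge.\<close>

abbreviation "eps \<equiv> 1 / (2 * sqrt (c * r))"
abbreviation "maj \<equiv> majorant (ennreal eps) Q (amp a)"

lemma eps_pos: "eps > 0" using c r by simp

lemma maj_0: "maj n 0 = 0" using a0 by (cases n) auto

lemma hs_maj: "hs m (maj n) <= (ennreal (eps^2) * (alg m * hs m Q)) ^ n * hs m (amp a)"
proof (induction n)
 case (Suc n)
 have "hs m (maj (Suc n)) <= hs m (\<lambda>k. ennreal eps * conv Q (maj n) k)" by (rule hs_mono) auto
 also have "... = ennreal (eps^2) * hs m (conv Q (maj n))" using eps_pos by (simp add: hs_cmult ennreal_power)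
 also have "... <= ennreal (eps^2) * (alg m * hs m Q * hs m (maj n))"
  using m P maj_0 by (intro mult_left_mono hs_conv) (auto simp: op_bound_def)
 also have "... <= ennreal (eps^2) * (alg m * hs m Q * ((ennreal (eps^2) * (alg m * hs m Q)) ^ n * hs m (amp a)))"
  by (intro mult_left_mono Suc) auto
 finally show ?case by (simp only: power_Suc mult_ac)
qed simp

lemma hs_maj_finite: "hs m (maj n) < \<top>"
proof -
 have "(ennreal (eps^2) * (alg m * hs m Q)) ^ n < \<top>"
  using alg_finite[OF m] Q by (intro power_less_top_ennreal[THEN iffD2]) (auto simp: ennreal_mult_less_top)
 then show ?thesis using a by (intro le_less_trans[OF hs_maj]) (auto simp: ennreal_mult_less_top)
qed

text \<open>The derivative lost in the transport term is regained by integrating the diffusion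
  kernel: with the weight exp(r t) the factor at frequency k is |k| / (c |k|^2 + r), which is at
  most \<open>eps\<close> for every k.\<close>

lemma kernel_bound:
 assumes t: "t >= 0" and C: "C >= 0" and g: "continuous_on {0..} g"
  and gb: "\<And>s. s \<in> {0..t} ==> cmod (g s) <= norm (freq k) * (exp (r * s) * C)"
 shows "cmod (- of_real (exp (- (c * (norm (freq k))^2) * t)) *
   integral {0..t} (\<lambda>s. of_real (exp (c * (norm (freq k))^2 * s)) * g s)) <= exp (r * t) * (eps * C)"
proof -
 define w where "w = norm (freq k)"
 define d where "d = c * w^2"
 have d: "d >= 0" using c by (simp add: d_def)
 have dr: "d + r > 0" using d r by simp
 have g': "continuous_on {0..t} g" by (rule continuous_on_subset[OF g]) auto
 have I: "((\<lambda>s. w * C * exp ((d + r) * s)) has_integral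
   (w * C * exp ((d + r) * t) / (d + r) - w * C * exp ((d + r) * 0) / (d + r))) {0..t}"
  by (rule fundamental_theorem_of_calculus[OF t])
   (use dr in \<open>auto intro!: derivative_eq_intros simp: has_real_derivative_iff_has_vector_derivative[symmetric]\<close>)
 have "cmod (integral {0..t} (\<lambda>s. of_real (exp (d * s)) * g s)) <= integral {0..t} (\<lambda>s. w * C * exp ((d + r) * s))"
 proof (rule integral_norm_bound_integral)
  show "(\<lambda>s. of_real (exp (d * s)) * g s) integrable_on {0..t}"
   by (intro integrable_continuous_real continuous_intros g')
  show "(\<lambda>s. w * C * exp ((d + r) * s)) integrable_on {0..t}" using I by blast
  fix s assume s: "s \<in> {0..t}"
  have "cmod (of_real (exp (d * s)) * g s) <= exp (d * s) * (w * (exp (r * s) * C))"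
   using gb[OF s] by (simp add: norm_mult w_def)
  also have "... = w * C * exp ((d + r) * s)" unfolding distrib_right[of d r s] exp_add by (simp only: mult_ac)
  finally show "cmod (of_real (exp (d * s)) * g s) <= w * C * exp ((d + r) * s)" .
 qed
 also have "... = w * C * (exp ((d + r) * t) - 1) / (d + r)"
  unfolding integral_unique[OF I] by (simp add: diff_divide_distrib right_diff_distrib)
 also have "... <= w * C * exp ((d + r) * t) / (d + r)"
  using dr C by (intro divide_right_mono mult_left_mono) (auto simp: w_def)
 finally have "exp (- d * t) * cmod (integral {0..t} (\<lambda>s. of_real (exp (d * s)) * g s))
   <= exp (- d * t) * (w * C * exp ((d + r) * t) / (d + r))" by (intro mult_left_mono) auto
 also have "... = exp (r * t) * (w / (d + r) * C)"
 proof -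
  have "exp (- d * t) * exp ((d + r) * t) = exp (r * t)" by (simp add: algebra_simps flip: exp_add)
  then show ?thesis by (simp add: field_simps)
 qed
 also have "... <= exp (r * t) * (eps * C)"
 proof -
  have "0 <= (sqrt c * w - sqrt r)^2" by simp
  also have "... = d + r - 2 * sqrt (c * r) * w"
   using c r by (simp add: d_def power2_diff power_mult_distrib real_sqrt_mult)
  finally have "w / (d + r) <= eps" using dr c r by (simp add: field_simps)
  then show ?thesis using C by (intro mult_left_mono mult_right_mono) auto
 qed
 finally show ?thesis by (simp add: norm_mult d_def w_def)
qed

lemma adv_le_maj:
 assumes "\<And>l. amp y l <= ennreal (exp (r * s)) * A l"
 shows "ennreal (cmod (adv P y k)) <= wt 1 k * (ennreal (exp (r * s)) * conv Q A k)"
proof -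
 have "conv Q (amp y) k <= conv Q (\<lambda>l. ennreal (exp (r * s)) * A l) k" by (intro conv_mono assms order_refl)
 also have "... = ennreal (exp (r * s)) * conv Q A k"
  unfolding conv_def by (subst nn_integral_cmult[symmetric]) (auto simp: mult_ac)
 finally show ?thesis by (intro order_trans[OF norm_adv_le[OF P]] mult_left_mono) auto
qed

lemma hs_exp_le:
 assumes "\<And>k. amp y k <= ennreal (exp (r * t)) * A k" "t <= S"
 shows "hs m (amp y) <= ennreal ((exp (r * S))^2) * hs m A"
proof -
 have "hs m (amp y) <= hs m (\<lambda>k. ennreal (exp (r * S)) * A k)"
  using assms r by (intro hs_mono order_trans[OF assms(1)] mult_right_mono ennreal_leI) auto
 then show ?thesis by (simp add: hs_cmult ennreal_power)
qed

text \<open>The claims are proved together, because continuity of the next term rests on the bound,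
  the continuity and the vanishing mean of the current one.\<close>

lemma dyson_props: "(\<forall>t\<ge>0. dy n t 0 = 0) \<and> (\<forall>k. continuous_on {0..} (\<lambda>t. dy n t k)) \<and>
  (\<forall>t\<ge>0. \<forall>k. amp (dy n t) k <= ennreal (exp (r * t)) * maj n k)"
proof (induction n)
 case 0
 have "amp (dy 0 t) k <= ennreal (exp (r * t)) * amp a k" if t: "t >= 0" for t k
 proof -
  have "exp (- (c * (norm (freq k))^2) * t) <= exp (r * t)"
   using c r t by (subst exp_le_cancel_iff) (simp add: mult_nonneg_nonneg order_trans[of _ 0])
  then show ?thesis by (simp add: norm_mult mult_right_mono flip: ennreal_mult)
 qed
 then show ?case using a0 by (auto intro!: continuous_intros)
next
 case (Suc n)
 have ac: "continuous_on {0..} (\<lambda>s. adv P (dy n s) k)" for k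
 proof (rule adv_continuous[OF m P Q])
  show "\<exists>B<\<top>. \<forall>t\<in>{0..S}. hs m (amp (dy n t)) <= B" for S
  proof (intro exI conjI ballI)
   show "ennreal ((exp (r * S))^2) * hs m (maj n) < \<top>" using hs_maj_finite[of n] by (simp add: ennreal_mult_less_top)
   fix t assume "t \<in> {0..S}"
   then show "hs m (amp (dy n t)) <= ennreal ((exp (r * S))^2) * hs m (maj n)"
    using Suc by (intro hs_exp_le[of _ t]) (auto simp del: split_paired_All)
  qed
 qed (use Suc in auto)
 \<comment> \<open>The weight |k| in \<open>op_bound\<close> vanishes at k = 0: transport creates no
   mean.\<close>
 have P0: "P 0 l = 0" for l
 proof -
  have "ennreal (cmod (P 0 l)) <= wt 1 0 * Q (0 - l)" using P unfolding op_bound_def by blast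
  then show ?thesis by simp
 qed
 have z: "dy (Suc n) t 0 = 0" for t
 proof -
  have "adv P (dy n s) 0 = 0" for s by (simp add: adv_def P0)
  then show ?thesis by simp
 qed
 have Ic: "continuous_on {0..} (\<lambda>t. integral {0..t} (\<lambda>s. of_real (exp (c * (norm (freq k))^2 * s)) * adv P (dy n s) k))" for k
 proof (rule continuous_on_atLeast_0)
  fix S :: real
  show "continuous_on {0..S} (\<lambda>t. integral {0..t} (\<lambda>s. of_real (exp (c * (norm (freq k))^2 * s)) * adv P (dy n s) k))"
   by (intro indefinite_integral_continuous_1 integrable_continuous_real continuous_intros continuous_on_subset[OF ac]) auto
 qed
 have cont: "continuous_on {0..} (\<lambda>t. dy (Suc n) t k)" for k unfolding dyson.simps by (intro continuous_intros Ic)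
 have "amp (dy (Suc n) t) k <= ennreal (exp (r * t)) * maj (Suc n) k" if t: "t >= 0" for t k
 proof (cases "k = 0")
  case True then show ?thesis using z by simp
 next
  case False
  have C: "conv Q (maj n) k < \<top>"
   by (rule conv_finite[OF m _ maj_0 Q hs_maj_finite False]) (use P in \<open>simp add: op_bound_def\<close>)
  define C where "C = enn2real (conv Q (maj n) k)"
  have C': "conv Q (maj n) k = ennreal C" "C >= 0" using C by (auto simp: C_def)
  have "cmod (dy (Suc n) t k) <= exp (r * t) * (eps * C)" unfolding dyson.simps
  proof (rule kernel_bound[OF t C'(2) ac])
   fix s assume s: "s \<in> {0..t}"
   have "ennreal (cmod (adv P (dy n s) k)) <= wt 1 k * (ennreal (exp (r * s)) * conv Q (maj n) k)"
    by (rule adv_le_maj) (use Suc s in auto)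
   also have "... = ennreal (norm (freq k) * (exp (r * s) * C))" using C' by (simp add: wt_def ennreal_mult)
   finally show "cmod (adv P (dy n s) k) <= norm (freq k) * (exp (r * s) * C)" using C' by simp
  qed
  then have "ennreal (cmod (dy (Suc n) t k)) <= ennreal (exp (r * t) * (eps * C))" by (rule ennreal_leI)
  also have "... = ennreal (exp (r * t)) * maj (Suc n) k"
   unfolding majorant.simps(2) if_not_P[OF False] C'(1) using C'(2) eps_pos
   by (simp only: ennreal_mult exp_ge_zero mult_nonneg_nonneg less_imp_le)
  finally show ?thesis .
 qed
 then show ?case using z cont by blast
qed

lemma dyson_0: "t >= 0 ==> dy n t 0 = 0" and dyson_continuous: "continuous_on {0..} (\<lambda>t. dy n t k)"
 and dyson_maj: "t >= 0 ==> amp (dy n t) k <= ennreal (exp (r * t)) * maj n k"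
 using dyson_props[of n] by blast+

lemma hs_dyson_finite: "t >= 0 ==> hs m (amp (dy n t)) < \<top>" by (rule le_less_trans[OF hs_exp_le[OF dyson_maj order_refl]])
  (auto simp: ennreal_mult_less_top hs_maj_finite)

lemma dyson_adv_continuous: "continuous_on {0..} (\<lambda>s. adv P (dy n s) k)"
proof (rule adv_continuous[OF m P Q])
 show "\<exists>B<\<top>. \<forall>t\<in>{0..S}. hs m (amp (dy n t)) <= B" for S
 proof (intro exI conjI ballI)
  show "ennreal ((exp (r * S))^2) * hs m (maj n) < \<top>" using hs_maj_finite[of n] by (simp add: ennreal_mult_less_top)
  fix t assume "t \<in> {0..S}"
  then show "hs m (amp (dy n t)) <= ennreal ((exp (r * S))^2) * hs m (maj n)"
   by (intro hs_exp_le[of _ t] dyson_maj) auto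
 qed
qed (rule dyson_0 dyson_continuous, assumption?)+

lemma dyson_derivative_0:
 assumes "t >= 0"
 shows "((\<lambda>t. dy 0 t k) has_vector_derivative - of_real (c * (norm (freq k))^2) * dy 0 t k) (at t within {0..})"
proof -
 have e: "((\<lambda>t. exp (- (c * (norm (freq k))^2) * t)) has_vector_derivative
   - (c * (norm (freq k))^2) * exp (- (c * (norm (freq k))^2) * t)) (at t within {0..})"
  by (auto intro!: derivative_eq_intros simp: has_real_derivative_iff_has_vector_derivative[symmetric])
 from has_vector_derivative_mult_left[OF bounded_linear.has_vector_derivative[OF bounded_linear_of_real this], of "a k"]
 show ?thesis by (simp add: mult_ac)
qed

lemma dyson_derivative_Suc:
 assumes t: "t >= 0"
 shows "((\<lambda>t. dy (Suc n) t k) has_vector_derivative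
  - of_real (c * (norm (freq k))^2) * dy (Suc n) t k - adv P (dy n t) k) (at t within {0..})"
proof -
 define d where "d = c * (norm (freq k))^2"
 have e: "((\<lambda>t. - exp (- d * t)) has_vector_derivative d * exp (- d * t)) (at t within {0..})"
  by (auto intro!: derivative_eq_intros simp: has_real_derivative_iff_has_vector_derivative[symmetric])
 define g where "g s = complex_of_real (exp (d * s)) * adv P (dy n s) k" for s
 have g: "continuous_on {0..} g" unfolding g_def by (intro continuous_intros dyson_adv_continuous)
 have I: "((\<lambda>t. integral {0..t} g) has_vector_derivative g t) (at t within {0..})"
  by (rule integral_form_derivative[OF g _ t, of _ 0]) simp
 have eq: "dy (Suc n) = (\<lambda>t k. - of_real (exp (- (c * (norm (freq k))^2) * t)) *
   integral {0..t} (\<lambda>s. of_real (exp (c * (norm (freq k))^2 * s)) * adv P (dy n s) k))" by (rule dyson.simps)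
 have one: "complex_of_real (exp (- d * t)) * complex_of_real (exp (d * t)) = 1" by (simp flip: of_real_mult exp_add)
 have "complex_of_real (- exp (- d * t)) * g t = - adv P (dy n t) k"
  unfolding g_def using one by (metis mult.assoc mult_1 mult_minus_left of_real_minus)
 with has_vector_derivative_mult[OF bounded_linear.has_vector_derivative[OF bounded_linear_of_real e] I]
 show ?thesis unfolding eq d_def[symmetric] g_def[symmetric] by (simp add: mult_ac)
qed

section \<open>Summation of the Dyson series\<close>

definition partial :: "nat => real => int \<times> int => complex" where "partial N t k = (\<Sum>n<N. dy n t k)"

lemma adv_partial: "t >= 0 ==> adv P (partial N t) k = (\<Sum>n<N. adv P (dy n t) k)"
 unfolding adv_def partial_def sum_distrib_left
 by (rule Bochner_Integration.integral_sum) (intro integrable_op[OF m P Q] dyson_0 hs_dyson_finite)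

text \<open>The damping acts on one more term than the transport, because term n + 1 is driven by
  term n.\<close>

lemma partial_integral_eq:
 assumes t: "t >= 0"
 shows "((\<lambda>s. - of_real (c * (norm (freq k))^2) * partial (Suc N) s k - adv P (partial N s) k)
   has_integral (partial (Suc N) t k - a k)) {0..t}"
proof (induction N)
 case 0
 have "((\<lambda>s. - of_real (c * (norm (freq k))^2) * dy 0 s k) has_integral (dy 0 t k - dy 0 0 k)) {0..t}"
  by (rule integral_of_derivative[OF _ t]) (rule dyson_derivative_0)
 then show ?case by (simp add: partial_def adv_def)
next
 case (Suc N)
 have "((\<lambda>s. - of_real (c * (norm (freq k))^2) * dy (Suc N) s k - adv P (dy N s) k)
   has_integral (dy (Suc N) t k - dy (Suc N) 0 k)) {0..t}"
  by (rule integral_of_derivative[OF _ t]) (rule dyson_derivative_Suc)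
 moreover have "dy (Suc N) 0 k = 0" by simp
 ultimately have "((\<lambda>s. - of_real (c * (norm (freq k))^2) * dy (Suc N) s k - adv P (dy N s) k)
   has_integral dy (Suc N) t k) {0..t}" by (simp only: diff_0_right)
 from has_integral_add[OF Suc this]
 have "((\<lambda>s. (- of_real (c * (norm (freq k))^2) * partial (Suc N) s k - adv P (partial N s) k) +
   (- of_real (c * (norm (freq k))^2) * dy (Suc N) s k - adv P (dy N s) k))
   has_integral (partial (Suc N) t k - a k + dy (Suc N) t k)) {0..t}" .
 moreover have "partial (Suc N) t k - a k + dy (Suc N) t k = partial (Suc (Suc N)) t k - a k"
  by (simp add: partial_def del: dyson.simps)
 ultimately have I: "((\<lambda>s. (- of_real (c * (norm (freq k))^2) * partial (Suc N) s k - adv P (partial N s) k) +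
   (- of_real (c * (norm (freq k))^2) * dy (Suc N) s k - adv P (dy N s) k))
   has_integral (partial (Suc (Suc N)) t k - a k)) {0..t}" by (simp only:)
 show ?case
 proof (rule has_integral_eq[OF _ I])
  fix s assume "s \<in> {0..t}"
  then have "adv P (partial (Suc N) s) k = adv P (partial N s) k + adv P (dy N s) k" by (simp add: adv_partial)
  moreover have "partial (Suc (Suc N)) s k = partial (Suc N) s k + dy (Suc N) s k"
   by (simp add: partial_def del: dyson.simps)
  ultimately show "(- of_real (c * (norm (freq k))^2) * partial (Suc N) s k - adv P (partial N s) k) +
   (- of_real (c * (norm (freq k))^2) * dy (Suc N) s k - adv P (dy N s) k)
   = - of_real (c * (norm (freq k))^2) * partial (Suc (Suc N)) s k - adv P (partial (Suc N) s) k"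
   by (simp only: distrib_left) simp
 qed
qed

definition total :: "int \<times> int => ennreal" where "total k = (\<Sum>n. maj n k)"

definition limit_sol :: "real => int \<times> int => complex" where "limit_sol t k = (\<Sum>n. dy n t k)"

lemma total_0: "total 0 = 0" by (simp add: total_def maj_0)

context
 assumes small: "4 * (ennreal (eps^2) * (alg m * hs m Q)) <= ennreal (1 / 2)"
begin

text \<open>Cauchy-Schwarz in n with the weights 2^-n and 2^n replaces the square of the series by a
  series of squares with factors 4^n. This is why the smallness condition carries a factor
  4.\<close>

lemma hs_total: "hs m total < \<top>"
proof -
 have pw: "(4 * \<rho>) ^ n = 4 ^ n * \<rho> ^ n" for \<rho> :: ennreal and n by (rule power_mult_distrib)
 have geo: "(\<Sum>n. ennreal (q ^ n)) < \<top>" if "0 <= q" "q < 1" for q :: real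
  by (subst suminf_ennreal2) (use that in \<open>auto intro!: summable_geometric\<close>)
 have sq: "(wt m k * total k)^2 <= (\<Sum>n. ennreal ((1/4) ^ n)) * (\<Sum>n. 4 ^ n * (wt m k * maj n k)^2)" for k
 proof -
  have "wt m k * total k = (\<Sum>n. wt m k * maj n k)" by (simp add: total_def ennreal_suminf_cmult)
  also have "... = (\<integral>\<^sup>+ n. ennreal ((1/2) ^ n) * (2 ^ n * (wt m k * maj n k)) \<partial>count_space UNIV)"
  proof -
   have "ennreal ((1/2) ^ n) * 2 ^ n = 1" for n
   proof -
    have "(2::ennreal) ^ n = ennreal (2 ^ n)" using ennreal_power[of 2 n] by simp
    then show ?thesis by (simp add: ennreal_mult[symmetric] power_one_over)
   qed
   then show ?thesis by (simp add: nn_integral_count_space_nat mult.assoc[symmetric])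
  qed
  finally have "(wt m k * total k)^2 <= (\<integral>\<^sup>+ n. (ennreal ((1/2) ^ n))^2 \<partial>count_space UNIV) *
    (\<integral>\<^sup>+ n. (2 ^ n * (wt m k * maj n k))^2 \<partial>count_space UNIV)"
   by (simp only:) (rule Cauchy_Schwarz_nn_integral; simp)
  also have "... = (\<Sum>n. ennreal ((1/4) ^ n)) * (\<Sum>n. 4 ^ n * (wt m k * maj n k)^2)"
  proof -
   have "(ennreal ((1/2) ^ n))^2 = ennreal ((1/4) ^ n)" for n
    by (simp add: ennreal_power power_mult[symmetric] mult.commute[of n] power_mult power2_eq_square[of "1/2::real"])
   moreover have "(2 ^ n * (wt m k * maj n k))^2 = 4 ^ n * (wt m k * maj n k)^2" for n
   proof -
    have "((2::ennreal) ^ n)^2 = (2^2) ^ n" by (simp only: power_mult[symmetric] mult.commute)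
    also have "... = 4 ^ n" by simp
    finally show ?thesis by (simp add: power_mult_distrib)
   qed
   ultimately show ?thesis by (simp add: nn_integral_count_space_nat)
  qed
  finally show ?thesis .
 qed
 have "hs m total <= (\<integral>\<^sup>+ k. (\<Sum>n. ennreal ((1/4) ^ n)) * (\<Sum>n. 4 ^ n * (wt m k * maj n k)^2) \<partial>freqs)"
  unfolding hs_def by (intro nn_integral_mono sq)
 also have "... = (\<Sum>n. ennreal ((1/4) ^ n)) * (\<Sum>n. 4 ^ n * hs m (maj n))"
  unfolding hs_def by (simp add: nn_integral_cmult nn_integral_suminf)
 also have "... <= (\<Sum>n. ennreal ((1/4) ^ n)) * (\<Sum>n. ennreal ((1/2) ^ n) * hs m (amp a))"
 proof (intro mult_left_mono suminf_le summableI)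
  fix n
  have "4 ^ n * hs m (maj n) <= 4 ^ n * ((ennreal (eps^2) * (alg m * hs m Q)) ^ n * hs m (amp a))"
   by (intro mult_left_mono hs_maj) auto
  also have "... = (4 * (ennreal (eps^2) * (alg m * hs m Q))) ^ n * hs m (amp a)" by (simp only: pw mult.assoc)
  also have "... <= ennreal (1/2) ^ n * hs m (amp a)" by (intro mult_right_mono power_mono small) auto
  finally show "4 ^ n * hs m (maj n) <= ennreal ((1/2) ^ n) * hs m (amp a)" by (subst ennreal_power[symmetric]) auto
 qed auto
 also have "... < \<top>"
 proof -
  have "(\<Sum>n. ennreal ((1/4) ^ n)) < \<top>" "(\<Sum>n. ennreal ((1/2) ^ n)) < \<top>" by (rule geo; simp)+
  with a show ?thesis by (simp only: ennreal_suminf_multc ennreal_mult_less_top simp_thms)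
 qed
 finally show ?thesis .
qed

lemma total_finite: "total k < \<top>" using hs_finite_point[OF hs_total, of k] by (cases "k = 0") (auto simp: total_0)

lemma suminf_dyson_le: "t >= 0 ==> (\<Sum>n. amp (dy n t) k) <= ennreal (exp (r * t)) * total k"
 unfolding total_def ennreal_suminf_cmult[symmetric] by (intro suminf_le summableI dyson_maj)

lemma summable_dyson: "t >= 0 ==> summable (\<lambda>n. cmod (dy n t k))"
proof -
 assume t: "t >= 0"
 have "(\<Sum>n. amp (dy n t) k) < \<top>"
  by (rule le_less_trans[OF suminf_dyson_le[OF t]]) (simp add: ennreal_mult_less_top total_finite)
 then show ?thesis by (intro summable_suminf_not_top) auto
qed

lemma partial_le: "t >= 0 ==> amp (partial N t) k <= ennreal (exp (r * t)) * total k"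
proof -
 assume t: "t >= 0"
 have "amp (partial N t) k <= ennreal (\<Sum>n<N. cmod (dy n t k))" unfolding partial_def by (intro ennreal_leI norm_sum)
 also have "... = (\<Sum>n<N. amp (dy n t) k)" by (rule sum_ennreal[symmetric]) simp
 also have "... <= (\<Sum>n. amp (dy n t) k)" by (rule sum_le_suminf) auto
 also have "... <= ennreal (exp (r * t)) * total k" by (rule suminf_dyson_le[OF t])
 finally show ?thesis .
qed

lemma partial_limit: "t >= 0 ==> (\<lambda>N. partial N t k) \<longlonglongrightarrow> limit_sol t k" unfolding partial_def limit_sol_def
 by (rule summable_LIMSEQ[OF summable_norm_cancel[OF summable_dyson]])

lemma limit_le: "t >= 0 ==> amp (limit_sol t) k <= ennreal (exp (r * t)) * total k"
 by (rule LIMSEQ_le_const2[of "\<lambda>N. amp (partial N t) k"]) (auto intro!: tendsto_intros partial_limit partial_le)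

lemma limit_0: "t >= 0 ==> limit_sol t 0 = 0" using limit_le[of t 0] by (simp add: total_0)

lemma partial_0: "t >= 0 ==> partial N t 0 = 0" by (simp add: partial_def dyson_0 del: dyson.simps)

lemma limit_bounded: "\<exists>B<\<top>. \<forall>t\<in>{0..S}. hs m (amp (limit_sol t)) <= B" using hs_exp_le[OF limit_le, of _ S] hs_total
 by (intro exI[of _ "ennreal ((exp (r * S))^2) * hs m total"]) (auto simp: ennreal_mult_less_top)

lemma adv_partial_limit:
 assumes t: "t >= 0"
 shows "(\<lambda>N. adv P (partial N t) k) \<longlonglongrightarrow> adv P (limit_sol t) k"
 unfolding adv_def
proof (rule integral_dominated_convergence)
 let ?B = "ennreal ((exp (r * t))^2) * hs m total"
 show "integrable freqs (\<lambda>l. cmod (P k l) * sqrt (enn2real ?B))"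
  using op_bound_l1[OF m P Q, of k] by (intro integrable_mult_left integrable_norm) auto
 show "AE l in freqs. (\<lambda>N. P k l * partial N t l) \<longlonglongrightarrow> P k l * limit_sol t l"
  by (intro AE_I2 tendsto_mult tendsto_const partial_limit t)
 have B: "?B < \<top>" using hs_total by (simp add: ennreal_mult_less_top)
 have "cmod (partial N t l) <= sqrt (enn2real ?B)" for N l
  by (rule mode_bound[of m]) (use m hs_exp_le[OF partial_le[OF t] order_refl] B partial_0[OF t] in auto)
 then show "AE l in freqs. cmod (P k l * partial N t l) <= cmod (P k l) * sqrt (enn2real ?B)" for N
  by (intro AE_I2) (simp add: norm_mult mult_left_mono)
qed auto

text \<open>Dominated convergence in time: on [0, t] the majorant \<open>total\<close> bounds the
  integrands by a constant that does not depend on the number of terms.\<close>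

lemma limit_integral_eq:
 assumes t: "t >= 0"
 defines "g \<equiv> \<lambda>k s. - of_real (c * (norm (freq k))^2) * limit_sol s k - adv P (limit_sol s) k"
 shows "g k integrable_on {0..t}" "limit_sol t k = a k + integral {0..t} (g k)"
proof -
 define f where "f N s = - of_real (c * (norm (freq k))^2) * partial (Suc N) s k - adv P (partial N s) k" for N s
 have fI: "(f N has_integral (partial (Suc N) t k - a k)) {0..t}" for N
  unfolding f_def by (rule partial_integral_eq[OF t])
 define b1 where "b1 = enn2real (ennreal (exp (r * t)) * total k)"
 define b2 where "b2 = enn2real (wt 1 k * (ennreal (exp (r * t)) * conv Q total k))"
 have fin2: "wt 1 k * (ennreal (exp (r * t)) * conv Q total k) < \<top>"
  using conv_finite[OF m _ total_0 Q hs_total, of k] P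
  by (cases "k = 0") (auto simp: op_bound_def ennreal_mult_less_top)
 have bd: "cmod (f N s) <= \<bar>c * (norm (freq k))^2\<bar> * b1 + b2" if s: "s \<in> {0..t}" for N s
 proof -
  have s0: "s >= 0" using s by simp
  have e: "ennreal (exp (r * s)) <= ennreal (exp (r * t))" using s r by (intro ennreal_leI) simp
  have "amp (partial (Suc N) s) k <= ennreal (exp (r * t)) * total k"
   by (rule order_trans[OF partial_le[OF s0]]) (intro mult_right_mono e, simp)
  also have "... = ennreal b1" using total_finite[of k] by (simp add: b1_def ennreal_mult_less_top)
  finally have 1: "cmod (partial (Suc N) s k) <= b1" by (simp add: b1_def)
  have "ennreal (cmod (adv P (partial N s) k)) <= wt 1 k * (ennreal (exp (r * s)) * conv Q total k)"
   by (rule adv_le_maj[OF partial_le[OF s0]])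
  also have "... <= wt 1 k * (ennreal (exp (r * t)) * conv Q total k)" by (intro mult_left_mono mult_right_mono e) auto
  also have "... = ennreal b2" using fin2 by (simp add: b2_def)
  finally have 2: "cmod (adv P (partial N s) k) <= b2" by (simp add: b2_def)
  have "cmod (f N s) <= cmod (- of_real (c * (norm (freq k))^2) * partial (Suc N) s k) + cmod (adv P (partial N s) k)"
   unfolding f_def by (rule norm_triangle_ineq4)
  also have "cmod (- of_real (c * (norm (freq k))^2) * partial (Suc N) s k) = \<bar>c * (norm (freq k))^2\<bar> * cmod (partial (Suc N) s k)"
   by (simp only: norm_mult norm_minus_cancel norm_of_real)
  also have "... <= \<bar>c * (norm (freq k))^2\<bar> * b1" by (intro mult_left_mono 1) auto
  finally show ?thesis using 2 by linarith
 qed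
 have lim: "(\<lambda>N. f N s) \<longlonglongrightarrow> g k s" if s: "s \<in> {0..t}" for s unfolding f_def g_def using s
  by (intro tendsto_intros adv_partial_limit LIMSEQ_Suc[OF partial_limit]) auto
 have fi: "f N integrable_on {0..t}" for N using fI by blast
 have ci: "(\<lambda>s. \<bar>c * (norm (freq k))^2\<bar> * b1 + b2) integrable_on {0..t}" by (rule integrable_const_ivl)
 show "g k integrable_on {0..t}" by (rule dominated_convergence(1)[OF fi ci bd lim])
 have "(\<lambda>N. integral {0..t} (f N)) \<longlonglongrightarrow> integral {0..t} (g k)" by (rule dominated_convergence(2)[OF fi ci bd lim])
 then have "(\<lambda>N. partial (Suc N) t k - a k) \<longlonglongrightarrow> integral {0..t} (g k)" by (simp only: integral_unique[OF fI])
 moreover have "(\<lambda>N. partial (Suc N) t k - a k) \<longlonglongrightarrow> limit_sol t k - a k"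
  by (intro tendsto_intros LIMSEQ_Suc[OF partial_limit] t)
 ultimately have "integral {0..t} (g k) = limit_sol t k - a k" by (rule LIMSEQ_unique)
 then show "limit_sol t k = a k + integral {0..t} (g k)" by simp
qed

lemma limit_continuous: "continuous_on {0..} (\<lambda>t. limit_sol t k)"
proof (rule continuous_on_atLeast_0)
 fix S :: real assume S: "S > 0"
 let ?g = "\<lambda>s. - of_real (c * (norm (freq k))^2) * limit_sol s k - adv P (limit_sol s) k"
 have "continuous_on {0..S} (\<lambda>t. a k + integral {0..t} ?g)"
  using limit_integral_eq(1)[of S k] S by (intro continuous_intros indefinite_integral_continuous_1) simp
 then show "continuous_on {0..S} (\<lambda>t. limit_sol t k)" by (rule continuous_on_eq) (use limit_integral_eq(2) in auto)
qed

lemma limit_mode_sol: "mode_sol c m P limit_sol" "limit_sol 0 = a"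
proof -
 have ac: "continuous_on {0..} (\<lambda>t. adv P (limit_sol t) k)" for k
  by (rule adv_continuous[OF m P Q limit_0 limit_bounded limit_continuous])
 have "((\<lambda>t. limit_sol t k) has_vector_derivative
   - of_real (c * (norm (freq k))^2) * limit_sol t k - adv P (limit_sol t) k) (at t within {0..})"
  if t: "t >= 0" for t k by (rule integral_form_derivative[OF _ limit_integral_eq(2) t])
   (intro continuous_intros ac limit_continuous)
 then show "mode_sol c m P limit_sol" using limit_0 limit_bounded by (simp add: mode_sol_def)
 show "limit_sol 0 = a" using limit_integral_eq(2)[of 0] by (auto simp: fun_eq_iff)
qed

end

end

text \<open>The majorant is handed out together with the solution: a sequence in H^m that dominates
  the modes on bounded time intervals is what later proves continuity in time with values in
  H^m.\<close>

lemma mode_sol_exists: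
 assumes c: "c > 0" and m: "m > 1" and P: "op_bound P Q" and Q: "hs m Q < \<top>"
  and a0: "a 0 = 0" and a: "hs m (amp a) < \<top>"
 obtains y r A where "mode_sol c m P y" "y 0 = a" "r > 0" "hs m A < \<top>" "\<And>k. A k < \<top>"
  "\<And>t k. t >= 0 ==> amp (y t) k <= ennreal (exp (r * t)) * A k"
proof -
 define K where "K = enn2real (alg m * hs m Q)"
 have K: "alg m * hs m Q = ennreal K" "K >= 0" using Q alg_finite[OF m] by (auto simp: K_def ennreal_mult_less_top)
 \<comment> \<open>The smallness condition amounts to K / (c r) being at most 1/2, that is, c r at
   least 2 K; the summand 1 keeps r positive when K = 0.\<close>
 define r where "r = 2 * K / c + 1"
 have r: "r > 0" using K c by (simp add: r_def add_nonneg_pos)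
 have "c * r = 2 * K + c" using c by (simp add: r_def distrib_left)
 then have cr: "c * r >= 2 * K" "c * r > 0" using c K(2) by simp_all
 have e2: "(1 / (2 * sqrt (c * r)))^2 = 1 / (4 * (c * r))" using cr by (simp add: power_divide power_mult_distrib)
 have "4 * (ennreal ((1 / (2 * sqrt (c * r)))^2) * (alg m * hs m Q)) = ennreal (4 * (1 / (4 * (c * r)) * K))"
  unfolding e2 K using cr K(2) ennreal_mult[of 4 "1 / (4 * (c * r)) * K"]
   ennreal_mult[of "1 / (4 * (c * r))" K] by simp
 also have "... <= ennreal (1 / 2)" using cr by (intro ennreal_leI) (simp add: field_simps)
 finally have small: "4 * (ennreal ((1 / (2 * sqrt (c * r)))^2) * (alg m * hs m Q)) <= ennreal (1 / 2)" .
 note asm = c m r P Q a0 a small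
 show thesis by (rule that[OF limit_mode_sol[OF asm] r hs_total[OF asm] total_finite[OF asm] limit_le[OF asm]])
qed

section \<open>Sobolev spaces and Fourier coefficients\<close>

lemma sum_le_integral_freqs:
 fixes f :: "int \<times> int => real"
 assumes "integrable freqs f" "\<And>k. f k >= 0" "finite F"
 shows "sum f F <= (LINT k|freqs. f k)"
proof -
 have "ennreal (sum f F) = (\<integral>\<^sup>+ k. ennreal (f k) \<partial>count_space F)"
  using assms by (simp add: nn_integral_count_space_finite sum_ennreal)
 also have "... <= (\<integral>\<^sup>+ k. ennreal (f k) \<partial>freqs)" unfolding nn_integral_count_space_indicator[of F, simplified]
  by (intro nn_integral_mono) (auto simp: indicator_def)
 also have "... = ennreal (LINT k|freqs. f k)" by (rule nn_integral_eq_integral) (use assms in auto)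
 finally show ?thesis using assms(2) by (simp add: ennreal_le_iff integral_nonneg_AE)
qed

text \<open>Both notions of summation assign 0 to a divergent series, so the values agree without a
  summability assumption.\<close>

lemma summable_on_freqs_iff:
 fixes f :: "int \<times> int => real"
 assumes f: "\<And>k. f k >= 0"
 shows "f summable_on UNIV \<longleftrightarrow> integrable freqs f" and "infsum f UNIV = (LINT k|freqs. f k)"
proof -
 have 1: "integrable freqs f \<and> (LINT k|freqs. f k) <= infsum f UNIV" if s: "f summable_on UNIV"
 proof -
  have "sum f (box_freqs n) <= infsum f UNIV" for n by (rule finite_sum_le_infsum[OF s]) (use f in auto)
  then have *: "(\<integral>\<^sup>+ k. ennreal (f k) \<partial>freqs) <= ennreal (infsum f UNIV)" by (intro nn_integral_freqs_le f)
  have i: "integrable freqs f" by (rule integrableI_bounded) (use f * in \<open>auto intro: le_less_trans\<close>)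
  have "(LINT k|freqs. f k) <= infsum f UNIV"
   using * by (subst (asm) nn_integral_eq_integral[OF i]) (auto simp: f infsum_nonneg ennreal_le_iff)
  with i show ?thesis by simp
 qed
 have 2: "f summable_on UNIV \<and> infsum f UNIV <= (LINT k|freqs. f k)" if i: "integrable freqs f"
 proof
  show s: "f summable_on UNIV" by (rule nonneg_bdd_above_summable_on)
    (use f sum_le_integral_freqs[OF i f] in \<open>auto intro!: bdd_aboveI[of _ "LINT k|freqs. f k"]\<close>)
  show "infsum f UNIV <= (LINT k|freqs. f k)"
   by (rule infsum_le_finite_sums[OF s]) (rule sum_le_integral_freqs[OF i f])
 qed
 show iff: "f summable_on UNIV \<longleftrightarrow> integrable freqs f" using 1 2 by blast
 show "infsum f UNIV = (LINT k|freqs. f k)"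
 proof (cases "integrable freqs f")
  case True then show ?thesis using 1 2 by (intro antisym) auto
 next
  case False then show ?thesis using iff by (simp add: infsum_not_exists not_integrable_integral_eq)
 qed
qed

lemma summable_on_minus_0_iff:
 fixes g :: "int \<times> int => real"
 assumes g: "\<And>k. g k >= 0"
 shows "(\<lambda>k. norm (freq k) powr (2 * s) * g k) summable_on (- {0}) \<longleftrightarrow> (\<integral>\<^sup>+ k. (wt s k)^2 * ennreal (g k) \<partial>freqs) < \<top>"
  and "ennreal (\<Sum>\<^sub>\<infinity>k\<in>- {0}. norm (freq k) powr (2 * s) * g k) <= (\<integral>\<^sup>+ k. (wt s k)^2 * ennreal (g k) \<partial>freqs)"
  and "(\<integral>\<^sup>+ k. (wt s k)^2 * ennreal (g k) \<partial>freqs) < \<top> ==>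
   ennreal (\<Sum>\<^sub>\<infinity>k\<in>- {0}. norm (freq k) powr (2 * s) * g k) = (\<integral>\<^sup>+ k. (wt s k)^2 * ennreal (g k) \<partial>freqs)"
proof -
 define h where "h k = norm (freq k) powr (2 * s) * g k" for k
 have h: "h k >= 0" for k using g by (simp add: h_def)
 have h0: "h 0 = 0" by (simp add: h_def)
 have 1: "h summable_on (- {0}) \<longleftrightarrow> h summable_on UNIV" by (rule summable_on_cong_neutral) (auto simp: h0)
 have 2: "infsum h (- {0}) = infsum h UNIV" by (rule infsum_cong_neutral) (auto simp: h0)
 have e: "(wt s k)^2 * ennreal (g k) = ennreal (h k)" for k
 proof -
  have "(norm (freq k) powr s)^2 = norm (freq k) powr (2 * s)" by (simp add: power2_eq_square flip: powr_add)
  then show ?thesis using g by (simp add: wt_def h_def ennreal_power ennreal_mult)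
 qed
 have fin: "integrable freqs h \<longleftrightarrow> (\<integral>\<^sup>+ k. ennreal (h k) \<partial>freqs) < \<top>" using h by (simp add: integrable_iff_bounded)
 show "(\<lambda>k. norm (freq k) powr (2 * s) * g k) summable_on (- {0}) \<longleftrightarrow> (\<integral>\<^sup>+ k. (wt s k)^2 * ennreal (g k) \<partial>freqs) < \<top>"
  unfolding e using 1 summable_on_freqs_iff(1)[OF h] fin by (simp add: h_def[symmetric])
 have eq: "ennreal (infsum h (- {0})) = (\<integral>\<^sup>+ k. ennreal (h k) \<partial>freqs)" if "integrable freqs h"
  unfolding 2 summable_on_freqs_iff(2)[OF h] by (rule nn_integral_eq_integral[symmetric]) (use that h in auto)
 show "(\<integral>\<^sup>+ k. (wt s k)^2 * ennreal (g k) \<partial>freqs) < \<top> ==>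
   ennreal (\<Sum>\<^sub>\<infinity>k\<in>- {0}. norm (freq k) powr (2 * s) * g k) = (\<integral>\<^sup>+ k. (wt s k)^2 * ennreal (g k) \<partial>freqs)"
  unfolding e using eq fin by (simp add: h_def[symmetric])
 show "ennreal (\<Sum>\<^sub>\<infinity>k\<in>- {0}. norm (freq k) powr (2 * s) * g k) <= (\<integral>\<^sup>+ k. (wt s k)^2 * ennreal (g k) \<partial>freqs)"
 proof (cases "integrable freqs h")
  case True then show ?thesis unfolding e using eq by (simp add: h_def[symmetric])
 next
  case False
  then show ?thesis unfolding e using fin by (simp add: top_unique less_top[symmetric])
 qed
qed

lemma hs_eq: "hs s (amp a) = (\<integral>\<^sup>+ k. (wt s k)^2 * ennreal ((cmod (a k))^2) \<partial>freqs)"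
 by (simp add: hs_def power_mult_distrib ennreal_power)

lemma sobolev_iff: "u \<in> sobolev s \<longleftrightarrow> u \<in> L2_torus \<and> fourier_coeff u 0 = 0 \<and> hs s (amp (fourier_coeff u)) < \<top>"
 unfolding sobolev_def hs_eq mem_Collect_eq by (subst summable_on_minus_0_iff(1)) auto

text \<open>In general only an inequality, because \<open>sobolev_norm\<close> is 0 when the series
  diverges.\<close>

lemma sobolev_norm_sq_le: "ennreal ((sobolev_norm s u)^2) <= hs s (amp (fourier_coeff u))"
proof -
 have "(sobolev_norm s u)^2 = (\<Sum>\<^sub>\<infinity>k\<in>- {0}. norm (freq k) powr (2 * s) * (cmod (fourier_coeff u k))^2)"
  unfolding sobolev_norm_def by (rule real_sqrt_pow2) (auto intro: infsum_nonneg)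
 then show ?thesis unfolding hs_eq by (simp only:) (rule summable_on_minus_0_iff(2), simp)
qed

lemma sobolev_norm_sq:
 assumes "hs s (amp (fourier_coeff u)) < \<top>"
 shows "hs s (amp (fourier_coeff u)) = ennreal ((sobolev_norm s u)^2)"
proof -
 have "(sobolev_norm s u)^2 = (\<Sum>\<^sub>\<infinity>k\<in>- {0}. norm (freq k) powr (2 * s) * (cmod (fourier_coeff u k))^2)"
  unfolding sobolev_norm_def by (rule real_sqrt_pow2) (auto intro: infsum_nonneg)
 then show ?thesis using assms unfolding hs_eq by (simp only:) (rule summable_on_minus_0_iff(3)[symmetric], simp)
qed

lemma sobolev_norm_nonneg: "sobolev_norm s u >= 0"
 unfolding sobolev_norm_def by (auto intro!: real_sqrt_ge_zero infsum_nonneg)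

lemma sobolev_L2: "u \<in> sobolev s ==> u \<in> L2_torus" by (simp add: sobolev_def)

lemma sobolev_mono: "s <= r ==> u \<in> sobolev r ==> u \<in> sobolev s"
 using hs_mono_exp[of s r "amp (fourier_coeff u)"] by (auto simp: sobolev_iff)

lemma hs_imp_l1:
 assumes "m > 1" "a 0 = 0" "hs m (amp a) < \<top>"
 shows "integrable freqs a" and "(\<integral>\<^sup>+ k. ennreal (cmod (a k)) \<partial>freqs)^2 <= zeta m * hs m (amp a)"
proof -
 show le: "(\<integral>\<^sup>+ k. ennreal (cmod (a k)) \<partial>freqs)^2 <= zeta m * hs m (amp a)" by (rule l1_le_hs) (use assms in simp)
 also have "... < \<top>" using zeta_finite[of m] assms by (simp add: ennreal_mult_less_top)
 finally have "(\<integral>\<^sup>+ k. ennreal (cmod (a k)) \<partial>freqs) < \<top>"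
  by (auto simp: power2_eq_square ennreal_mult_eq_top_iff less_top[symmetric])
 then show "integrable freqs a" by (intro integrableI_bounded) auto
qed

lemma hs_imp_l2:
 assumes "s >= 0" "a 0 = 0" "hs s (amp a) < \<top>"
 shows "integrable freqs (\<lambda>k. (cmod (a k))^2)"
proof (rule integrableI_bounded)
 have "(\<integral>\<^sup>+ k. ennreal (norm ((cmod (a k))^2)) \<partial>freqs) <= hs s (amp a)" unfolding hs_def
 proof (rule nn_integral_mono)
  fix k
  show "ennreal (norm ((cmod (a k))^2)) <= (wt s k * amp a k)^2"
   using power_mono[OF mult_right_mono[OF wt_ge_1[of k s], of "amp a k"], of 2] assms
   by (cases "k = 0") (auto simp: ennreal_power)
 qed
 then show "(\<integral>\<^sup>+ k. ennreal (norm ((cmod (a k))^2)) \<partial>freqs) < \<infinity>" using assms(3) by (simp add: le_less_trans)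
qed simp

text \<open>Reindexing by k to -k shows that the sum equals its own conjugate, so nothing is lost by
  taking the real part.\<close>

lemma real_series:
 assumes C: "integrable freqs C" "\<And>k. C (- k) = cnj (C k)"
 defines "u \<equiv> \<lambda>x. Re (series C x)"
 shows "continuous_on UNIV u" "u \<in> L2_torus" "fourier_coeff u k = C k" "of_real (u x) = series C x"
proof -
 have real: "of_real (u x) = series C x" for x
 proof -
  have "cnj (series C x) = (LINT k|freqs. cnj (C k * wave k x))"
   unfolding series_def by (rule Bochner_Integration.integral_cnj[symmetric])
  also have "... = (LINT k|freqs. C (- k) * wave (- k) x)" by (simp add: C(2) wave_minus)
  also have "... = (LINT k|distr freqs freqs uminus. C k * wave k x)" by (rule integral_distr[symmetric]) auto
  also have "distr freqs freqs (uminus :: int \<times> int => int \<times> int) = freqs"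
   by (rule distr_bij_count_space) (auto intro!: bij_betwI[of _ _ _ uminus])
  finally have "cnj (series C x) = series C x" by (simp add: series_def)
  then show ?thesis by (simp add: u_def complex_eq_iff)
 qed
 then show "of_real (u x) = series C x" .
 show c: "continuous_on UNIV u" unfolding u_def by (intro continuous_intros continuous_on_series C)
 have bd: "\<bar>u x\<bar> <= (LINT k|freqs. cmod (C k))" for x
  unfolding u_def by (rule order_trans[OF abs_Re_le_cmod norm_series_le[OF C(1)]])
 show "u \<in> L2_torus"
 proof -
  have "integrable torus (\<lambda>x. (u x)^2)"
  proof (rule integrable_torus_bounded)
   show "norm ((u x)^2) <= (LINT k|freqs. cmod (C k))^2" for x using power_mono[OF bd[of x], of 2] by simp
   show "(\<lambda>x. (u x)^2) \<in> borel_measurable torus" by (intro continuous_torus_measurable continuous_intros c)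
  qed
  then show ?thesis using periodic_series[of C] continuous_torus_measurable[OF c]
   by (auto simp: L2_torus_def periodic_def u_def)
 qed
 show "fourier_coeff u k = C k" unfolding fourier_coeff_fc real using fc_series[OF C(1)] by simp
qed

lemma continuous_eq_series:
 assumes u: "continuous_on UNIV u" "u \<in> L2_torus" and C: "integrable freqs (fourier_coeff u)"
 shows "complex_of_real (u x) = series (fourier_coeff u) x"
proof -
 have e: "fourier_coeff u = fc (\<lambda>x. complex_of_real (u x))" by (auto simp: fourier_coeff_fc)
 have "periodic (\<lambda>x. complex_of_real (u x))" using u(2) by (auto simp: L2_torus_def periodic_def)
 moreover have "continuous_on UNIV (\<lambda>x. complex_of_real (u x))" by (intro continuous_intros u)
 ultimately have "(\<lambda>x. complex_of_real (u x)) = series (fc (\<lambda>x. complex_of_real (u x)))"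
  using C unfolding e by (intro series_eq_of_continuous)
 then show ?thesis unfolding e by metis
qed

text \<open>Sobolev embedding: the sum of the absolute coefficients bounds the supremum, and
  Cauchy-Schwarz bounds that sum.\<close>

lemma sup_bound:
 assumes m: "m > 1" and a: "a 0 = 0" "hs m (amp a) <= ennreal B" and B: "B >= 0"
 shows "cmod (series a x) <= sqrt (enn2real (zeta m) * B)"
proof -
 have fin: "hs m (amp a) < \<top>" using a(2) by (rule le_less_trans) simp
 have i: "integrable freqs a" by (rule hs_imp_l1(1)[OF m a(1) fin])
 have "ennreal ((LINT k|freqs. cmod (a k))^2) = (\<integral>\<^sup>+ k. ennreal (cmod (a k)) \<partial>freqs)^2"
  using i by (subst nn_integral_eq_integral) (auto simp: ennreal_power)
 also have "... <= zeta m * ennreal B"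
  by (rule order_trans[OF hs_imp_l1(2)[OF m a(1) fin]]) (intro mult_left_mono a(2), simp)
 also have "... = ennreal (enn2real (zeta m) * B)" using zeta_finite[OF m] B by (simp add: ennreal_mult)
 finally have "(LINT k|freqs. cmod (a k))^2 <= enn2real (zeta m) * B" using B by (simp add: ennreal_le_iff)
 then have "(LINT k|freqs. cmod (a k)) <= sqrt (enn2real (zeta m) * B)" by (rule real_le_rsqrt)
 then show ?thesis using norm_series_le[OF i, of x] by linarith
qed

subsection \<open>Gradients\<close>

text \<open>\<open>grad\<close> is a choice and needs a witness: for u in H^1 the coefficients 2 pi
  i k u_k are square summable and symmetric, so Riesz-Fischer realises them.\<close>

lemma is_grad_grad:
 assumes u: "u \<in> sobolev 1"
 shows "is_grad u (grad u)"
proof -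
 have hs1: "hs 1 (amp (fourier_coeff u)) < \<top>" and u0: "fourier_coeff u 0 = 0" using u by (auto simp: sobolev_iff)
 have ex: "\<exists>w. w \<in> L2_torus \<and> (\<forall>k. fourier_coeff w k = 2 * pi * \<i> * of_real (p (freq k)) * fourier_coeff u k)"
  if p: "\<And>x. \<bar>p x\<bar> <= norm x" "\<And>x. p (- x) = - p x" for p :: "real \<times> real => real"
 proof -
  let ?C = "\<lambda>k. 2 * pi * \<i> * of_real (p (freq k)) * fourier_coeff u k"
  have "integrable freqs (\<lambda>k. (cmod (?C k))^2)"
  proof (rule Bochner_Integration.integrable_bound)
   have "wt 0 k * amp (\<lambda>k. of_real (norm (freq k)) * fourier_coeff u k) k = wt 1 k * amp (fourier_coeff u) k" for k
    by (cases "k = 0") (simp_all add: wt_def norm_mult ennreal_mult)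
   then have "hs 0 (amp (\<lambda>k. of_real (norm (freq k)) * fourier_coeff u k)) = hs 1 (amp (fourier_coeff u))"
    by (simp only: hs_def)
   then have "integrable freqs (\<lambda>k. (cmod (of_real (norm (freq k)) * fourier_coeff u k))^2)"
    using hs1 u0 by (intro hs_imp_l2[of 0]) simp_all
   then show "integrable freqs (\<lambda>k. (2 * pi)^2 * (cmod (of_real (norm (freq k)) * fourier_coeff u k))^2)" by simp
   show "AE k in freqs. norm ((cmod (?C k))^2) <= norm ((2 * pi)^2 * (cmod (of_real (norm (freq k)) * fourier_coeff u k))^2)"
   proof (rule AE_I2)
    fix k
    have 1: "(p (freq k))^2 <= (norm (freq k))^2" using power_mono[OF p(1)[of "freq k"] abs_ge_zero, of 2] by simp
    show "norm ((cmod (?C k))^2) <= norm ((2 * pi)^2 * (cmod (of_real (norm (freq k)) * fourier_coeff u k))^2)"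
     using mult_right_mono[OF 1, of "(cmod (fourier_coeff u k))^2"]
     by (simp add: norm_mult power_mult_distrib mult.assoc)
   qed
  qed simp
  moreover have "?C (- k) = cnj (?C k)" for k by (simp add: fourier_coeff_minus freq_simps p(2))
  ultimately show ?thesis using riesz_fischer_real[of ?C] by metis
 qed
 have nrm: "\<bar>fst x\<bar> <= norm x" "\<bar>snd x\<bar> <= norm x" for x :: "real \<times> real"
  using norm_fst_le[of "fst x" "snd x"] norm_snd_le[of "snd x" "fst x"] by simp_all
 obtain w1 where w1: "w1 \<in> L2_torus" "\<And>k. fourier_coeff w1 k = 2 * pi * \<i> * of_real (fst (freq k)) * fourier_coeff u k"
  using ex[of fst, OF nrm(1) fst_uminus] by blast
 obtain w2 where w2: "w2 \<in> L2_torus" "\<And>k. fourier_coeff w2 k = 2 * pi * \<i> * of_real (snd (freq k)) * fourier_coeff u k"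
  using ex[of snd, OF nrm(2) snd_uminus] by blast
 have "is_grad u (\<lambda>x. (w1 x, w2 x))" using w1 w2 by (simp add: is_grad_def comp_def)
 then show ?thesis unfolding grad_def by (rule someI[of "is_grad u"])
qed

lemma integrable_freqs_mult:
 assumes "integrable freqs (\<lambda>k. (cmod (a k))^2)" "integrable freqs (\<lambda>k. (cmod (b k))^2)"
 shows "integrable freqs (\<lambda>k. Re (a k * cnj (b k)))"
proof (rule Bochner_Integration.integrable_bound)
 show "integrable freqs (\<lambda>k. (cmod (a k))^2 + (cmod (b k))^2)" using assms by simp
 show "AE k in freqs. norm (Re (a k * cnj (b k))) <= norm ((cmod (a k))^2 + (cmod (b k))^2)"
 proof (rule AE_I2)
  fix k
  have "\<bar>Re (a k * cnj (b k))\<bar> <= cmod (a k) * cmod (b k)"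
   using abs_Re_le_cmod[of "a k * cnj (b k)"] by (simp add: norm_mult)
  moreover have "2 * (cmod (a k) * cmod (b k)) <= (cmod (a k))^2 + (cmod (b k))^2"
   using sum_squares_bound[of "cmod (a k)" "cmod (b k)"] by simp
  moreover have "0 <= cmod (a k) * cmod (b k)" by simp
  ultimately show "norm (Re (a k * cnj (b k))) <= norm ((cmod (a k))^2 + (cmod (b k))^2)" by simp
 qed
qed simp

lemma grad_inner:
 assumes u: "u \<in> sobolev 1" and w: "w \<in> sobolev 1"
 shows "integrable freqs (\<lambda>k. Re (of_real (4 * pi^2 * (norm (freq k))^2) * fourier_coeff u k * cnj (fourier_coeff w k)))"
  and "(LINT x|torus. grad u x \<bullet> grad w x)
   = (LINT k|freqs. Re (of_real (4 * pi^2 * (norm (freq k))^2) * fourier_coeff u k * cnj (fourier_coeff w k)))"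
proof -
 note gu = is_grad_grad[OF u, unfolded is_grad_def] and gw = is_grad_grad[OF w, unfolded is_grad_def]
 let ?g = "\<lambda>p u. p \<circ> grad u"
 have eq: "Re (of_real (4 * pi^2 * (norm (freq k))^2) * fourier_coeff u k * cnj (fourier_coeff w k))
   = Re (fourier_coeff (fst \<circ> grad u) k * cnj (fourier_coeff (fst \<circ> grad w) k))
    + Re (fourier_coeff (snd \<circ> grad u) k * cnj (fourier_coeff (snd \<circ> grad w) k))" for k
 proof -
  have n: "(norm (freq k))^2 = (fst (freq k))^2 + (snd (freq k))^2" by (simp add: freq_def norm_Pair)
  have "(2 * pi * \<i> * of_real p * a) * cnj (2 * pi * \<i> * of_real p * b) = of_real (4 * pi^2 * p^2) * (a * cnj b)" for p a b
   by (simp add: power2_eq_square)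
  then show ?thesis using gu gw unfolding n by (simp only: plus_complex.sel(1)[symmetric]) (simp add: algebra_simps)
 qed
 have i: "integrable freqs (\<lambda>k. Re (fourier_coeff a k * cnj (fourier_coeff b k)))"
  if "a \<in> L2_torus" "b \<in> L2_torus" for a b
  by (rule integrable_freqs_mult[OF parseval(1)[OF that(1)] parseval(1)[OF that(2)]])
 show "integrable freqs (\<lambda>k. Re (of_real (4 * pi^2 * (norm (freq k))^2) * fourier_coeff u k * cnj (fourier_coeff w k)))"
  unfolding eq using i gu gw by (intro Bochner_Integration.integrable_add) auto
 have "(LINT x|torus. grad u x \<bullet> grad w x) = (LINT x|torus. (fst \<circ> grad u) x * (fst \<circ> grad w) x + (snd \<circ> grad u) x * (snd \<circ> grad w) x)"
  by (simp add: inner_prod_def)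
 also have "... = L2_inner (fst \<circ> grad u) (fst \<circ> grad w) + L2_inner (snd \<circ> grad u) (snd \<circ> grad w)"
  unfolding L2_inner_def using gu gw by (intro Bochner_Integration.integral_add L2_torus_mult_integrable) blast+
 also have "... = (LINT k|freqs. Re (of_real (4 * pi^2 * (norm (freq k))^2) * fourier_coeff u k * cnj (fourier_coeff w k)))"
  unfolding eq using i gu gw by (simp add: parseval_inner)
 finally show "(LINT x|torus. grad u x \<bullet> grad w x)
   = (LINT k|freqs. Re (of_real (4 * pi^2 * (norm (freq k))^2) * fourier_coeff u k * cnj (fourier_coeff w k)))" .
qed

subsection \<open>The transport operator of a divergence-free field\<close>

definition vc :: "vector_field => (int \<times> int => complex)" where "vc v = fourier_coeff (fst \<circ> v)"

definition vc' :: "vector_field => (int \<times> int => complex)" where "vc' v = fourier_coeff (snd \<circ> v)"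

text \<open>The derivative factor is k and not l: this is the matrix of div (v u), which equals v .
  grad u for divergence-free v. In this form the derivative falls on the output frequency, as
  \<open>op_bound\<close> demands.\<close>

definition adv_mat :: "vector_field => int \<times> int => int \<times> int => complex" where
 "adv_mat v k l = 2 * pi * \<i> * (of_real (fst (freq k)) * vc v (k - l) + of_real (snd (freq k)) * vc' v (k - l))"

definition vamp :: "vector_field => int \<times> int => ennreal" where
 "vamp v k = ennreal (2 * pi * (cmod (vc v k) + cmod (vc' v k)))"

lemma div_free_D:
 assumes "v \<in> div_free s"
 shows "continuous_on UNIV v" "fst \<circ> v \<in> sobolev s" "snd \<circ> v \<in> sobolev s" "vc v 0 = 0" "vc' v 0 = 0"
  "of_real (fst (freq k)) * vc v k + of_real (snd (freq k)) * vc' v k = 0"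
proof -
 show *: "continuous_on UNIV v" "fst \<circ> v \<in> sobolev s" "snd \<circ> v \<in> sobolev s" using assms by (auto simp: div_free_def)
 show z: "vc v 0 = 0" "vc' v 0 = 0" using * by (auto simp: vc_def vc'_def sobolev_iff)
 show "of_real (fst (freq k)) * vc v k + of_real (snd (freq k)) * vc' v k = 0"
 proof (cases "k = 0")
  case False
  then obtain a :: complex where "fourier_coeff (fst \<circ> v) k = a * of_real (fst (perp (freq k)) / norm (freq k))"
   "fourier_coeff (snd \<circ> v) k = a * of_real (snd (perp (freq k)) / norm (freq k))"
   using assms unfolding div_free_def by blast
  then show ?thesis by (simp add: vc_def vc'_def perp_def)
 qed (use z in simp)
qed

lemma op_bound_adv_mat:
 assumes "v \<in> div_free s"
 shows "op_bound (adv_mat v) (vamp v)"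
 unfolding op_bound_def
proof (intro conjI allI)
 show "vamp v 0 = 0" using div_free_D[OF assms] by (simp add: vamp_def)
 fix k l
 have "cmod (adv_mat v k l) = 2 * pi * cmod (of_real (fst (freq k)) * vc v (k - l) + of_real (snd (freq k)) * vc' v (k - l))"
  by (simp add: adv_mat_def norm_mult)
 also have "... <= 2 * pi * (\<bar>fst (freq k)\<bar> * cmod (vc v (k - l)) + \<bar>snd (freq k)\<bar> * cmod (vc' v (k - l)))"
  by (intro mult_left_mono order_trans[OF norm_triangle_ineq]) (auto simp: norm_mult)
 also have "... <= 2 * pi * (norm (freq k) * cmod (vc v (k - l)) + norm (freq k) * cmod (vc' v (k - l)))"
  using norm_fst_le[of "fst (freq k)" "snd (freq k)"] norm_snd_le[of "snd (freq k)" "fst (freq k)"]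
  by (intro mult_left_mono add_mono mult_right_mono) auto
 also have "... = norm (freq k) * (2 * pi * (cmod (vc v (k - l)) + cmod (vc' v (k - l))))" by (simp add: algebra_simps)
 finally have "ennreal (cmod (adv_mat v k l)) <= ennreal (norm (freq k) * (2 * pi * (cmod (vc v (k - l)) + cmod (vc' v (k - l)))))"
  by (rule ennreal_leI)
 then show "ennreal (cmod (adv_mat v k l)) <= wt 1 k * vamp v (k - l)" by (simp add: wt_def vamp_def ennreal_mult)
qed

lemma hs_vamp: "hs s (vamp v) <= ennreal (16 * pi^2) * (hs s (amp (vc v)) + hs s (amp (vc' v)))"
proof -
 have "hs s (vamp v) = hs s (\<lambda>k. ennreal (2 * pi) * (amp (vc v) k + amp (vc' v) k))"
  by (simp add: vamp_def[abs_def] ennreal_mult)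
 also have "... = ennreal (4 * pi^2) * hs s (\<lambda>k. amp (vc v) k + amp (vc' v) k)"
  by (simp add: hs_cmult ennreal_power power_mult_distrib)
 also have "... <= ennreal (4 * pi^2) * (4 * (hs s (amp (vc v)) + hs s (amp (vc' v))))"
  by (intro mult_left_mono hs_add) auto
 also have "... = ennreal (16 * pi^2) * (hs s (amp (vc v)) + hs s (amp (vc' v)))"
 proof -
  have "ennreal (16 * pi^2) = ennreal (4 * pi^2) * 4" using ennreal_mult[of "4 * pi^2" 4] by simp
  then show ?thesis by (simp only: mult.assoc)
 qed
 finally show ?thesis .
qed

lemma hs_vamp_finite:
 assumes "v \<in> div_free s" "r <= s" shows "hs r (vamp v) < \<top>"
proof -
 have "hs s (vamp v) < \<top>" using div_free_D(2,3)[OF assms(1)]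
  by (intro le_less_trans[OF hs_vamp]) (auto simp: sobolev_iff vc_def vc'_def ennreal_mult_less_top)
 then show ?thesis using hs_mono_exp[OF assms(2)] by (rule le_less_trans[rotated])
qed

lemma vc_minus: "vc v (- k) = cnj (vc v k)" "vc' v (- k) = cnj (vc' v k)"
 by (simp_all add: vc_def vc'_def fourier_coeff_minus)

text \<open>Divergence-freeness makes k - l orthogonal to the coefficient of v at k - l, so k and l
  may be exchanged in the derivative factor.\<close>

lemma adv_mat_antisym:
 assumes "v \<in> div_free s"
 shows "cnj (adv_mat v k l) = - adv_mat v l k"
proof -
 have m: "vc v (l - k) = cnj (vc v (k - l))" "vc' v (l - k) = cnj (vc' v (k - l))"
  using vc_minus[of v "k - l"] by simp_all
 have "of_real (fst (freq k) - fst (freq l)) * vc v (k - l) + of_real (snd (freq k) - snd (freq l)) * vc' v (k - l) = 0"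
  using div_free_D(6)[OF assms, of "k - l"] by (simp add: freq_simps)
 from arg_cong[OF this, of cnj]
 have "of_real (fst (freq k)) * cnj (vc v (k - l)) + of_real (snd (freq k)) * cnj (vc' v (k - l))
   = of_real (fst (freq l)) * cnj (vc v (k - l)) + of_real (snd (freq l)) * cnj (vc' v (k - l))"
  by (simp add: algebra_simps)
 then show ?thesis by (simp add: adv_mat_def m)
qed

lemma adv_mat_minus: "adv_mat v (- k) (- l) = cnj (adv_mat v k l)"
proof -
 have "- k - - l = - (k - l)" by simp
 then have e: "vc v (- k - - l) = cnj (vc v (k - l))" "vc' v (- k - - l) = cnj (vc' v (k - l))"
  by (simp_all only: vc_minus)
 have alg: "2 * pi * \<i> * (of_real (- p) * cnj a + of_real (- q) * cnj b)
   = cnj (2 * pi * \<i> * (of_real p * a + of_real q * b))" for p q a b by (simp add: complex_eq_iff algebra_simps)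
 show ?thesis unfolding adv_mat_def e freq_simps(3) fst_uminus snd_uminus by (rule alg)
qed

lemma adv_mat_diff:
 assumes "v \<in> div_free s" "w \<in> div_free s"
 shows "op_bound (\<lambda>k l. adv_mat v k l - adv_mat w k l) (vamp (\<lambda>x. v x - w x))"
  and "vc (\<lambda>x. v x - w x) = (\<lambda>k. vc v k - vc w k)" and "vc' (\<lambda>x. v x - w x) = (\<lambda>k. vc' v k - vc' w k)"
proof -
 have L: "fst \<circ> v \<in> L2_torus" "snd \<circ> v \<in> L2_torus" "fst \<circ> w \<in> L2_torus" "snd \<circ> w \<in> L2_torus"
  using assms div_free_D sobolev_L2 by blast+
 show d: "vc (\<lambda>x. v x - w x) = (\<lambda>k. vc v k - vc w k)" "vc' (\<lambda>x. v x - w x) = (\<lambda>k. vc' v k - vc' w k)"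
  using fourier_coeff_lin[OF L(1,3), of 1 "-1"] fourier_coeff_lin[OF L(2,4), of 1 "-1"]
  by (auto simp: vc_def vc'_def comp_def)
 show "op_bound (\<lambda>k l. adv_mat v k l - adv_mat w k l) (vamp (\<lambda>x. v x - w x))" unfolding op_bound_def
 proof (intro conjI allI)
  show "vamp (\<lambda>x. v x - w x) 0 = 0" using div_free_D[OF assms(1)] div_free_D[OF assms(2)] by (simp add: vamp_def d)
  fix k l
  have "adv_mat v k l - adv_mat w k l = 2 * pi * \<i> * (of_real (fst (freq k)) * (vc v (k - l) - vc w (k - l)) + of_real (snd (freq k)) * (vc' v (k - l) - vc' w (k - l)))"
   by (simp add: adv_mat_def algebra_simps)
  then have "cmod (adv_mat v k l - adv_mat w k l) = 2 * pi * cmod (of_real (fst (freq k)) * (vc v (k - l) - vc w (k - l)) + of_real (snd (freq k)) * (vc' v (k - l) - vc' w (k - l)))"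
   by (simp add: norm_mult)
  also have "... <= 2 * pi * (\<bar>fst (freq k)\<bar> * cmod (vc v (k - l) - vc w (k - l)) + \<bar>snd (freq k)\<bar> * cmod (vc' v (k - l) - vc' w (k - l)))"
   by (intro mult_left_mono order_trans[OF norm_triangle_ineq]) (auto simp: norm_mult)
  also have "... <= 2 * pi * (norm (freq k) * cmod (vc v (k - l) - vc w (k - l)) + norm (freq k) * cmod (vc' v (k - l) - vc' w (k - l)))"
   using norm_fst_le[of "fst (freq k)" "snd (freq k)"] norm_snd_le[of "snd (freq k)" "fst (freq k)"]
   by (intro mult_left_mono add_mono mult_right_mono) auto
  also have "... = norm (freq k) * (2 * pi * (cmod (vc v (k - l) - vc w (k - l)) + cmod (vc' v (k - l) - vc' w (k - l))))"
   by (simp add: algebra_simps)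
  finally have "ennreal (cmod (adv_mat v k l - adv_mat w k l)) <= ennreal (norm (freq k) * (2 * pi * (cmod (vc v (k - l) - vc w (k - l)) + cmod (vc' v (k - l) - vc' w (k - l)))))"
   by (rule ennreal_leI)
  then show "ennreal (cmod (adv_mat v k l - adv_mat w k l)) <= wt 1 k * vamp (\<lambda>x. v x - w x) (k - l)"
   by (simp add: wt_def vamp_def d ennreal_mult)
 qed
qed

lemma vc_l1:
 assumes "m > 1" "v \<in> div_free m"
 shows "integrable freqs (vc v)" "integrable freqs (vc' v)"
  "complex_of_real (fst (v x)) = series (vc v) x" "complex_of_real (snd (v x)) = series (vc' v) x"
proof -
 note D = div_free_D[OF assms(2)]
 have h: "hs m (amp (vc v)) < \<top>" "hs m (amp (vc' v)) < \<top>" using D by (auto simp: sobolev_iff vc_def vc'_def)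
 show i: "integrable freqs (vc v)" "integrable freqs (vc' v)"
  using hs_imp_l1(1)[OF assms(1) D(4) h(1)] hs_imp_l1(1)[OF assms(1) D(5) h(2)] by auto
 have "continuous_on UNIV (fst \<circ> v)" "continuous_on UNIV (snd \<circ> v)"
  using D(1) by (auto simp: comp_def intro: continuous_intros)
 then show "complex_of_real (fst (v x)) = series (vc v) x" "complex_of_real (snd (v x)) = series (vc' v) x"
  using continuous_eq_series[of "fst \<circ> v" x] continuous_eq_series[of "snd \<circ> v" x] D sobolev_L2 i
  by (auto simp: vc_def vc'_def)
qed

text \<open>The product formula first yields the derivative on the input frequency k - j. Since j is
  orthogonal to the coefficient of v at j, it may be moved to the output frequency k.\<close>

lemma transport_coeff:
 assumes m: "m > 1" and v: "v \<in> div_free m" and g: "is_grad u g" and u: "u \<in> L2_torus"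
 shows "(\<lambda>x. v x \<bullet> g x) \<in> L2_torus" and "fourier_coeff (\<lambda>x. v x \<bullet> g x) k = adv (adv_mat v) (fourier_coeff u) k"
proof -
 note V = vc_l1[OF m v]
 have gL: "fst \<circ> g \<in> L2_torus" "snd \<circ> g \<in> L2_torus"
  and gc: "\<And>k. fourier_coeff (fst \<circ> g) k = 2 * pi * \<i> * of_real (fst (freq k)) * fourier_coeff u k"
   "\<And>k. fourier_coeff (snd \<circ> g) k = 2 * pi * \<i> * of_real (snd (freq k)) * fourier_coeff u k"
  using g by (auto simp: is_grad_def)
 have cv: "continuous_on UNIV (\<lambda>x. fst (v x))" "continuous_on UNIV (\<lambda>x. snd (v x))"
  using div_free_D(1)[OF v] by (auto intro: continuous_intros)
 have prodL: "(\<lambda>x. a x * b x) \<in> L2_torus"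
  if a: "continuous_on UNIV a" "a \<in> L2_torus" "\<And>x. \<bar>a x\<bar> <= B" and b: "b \<in> L2_torus" for a b :: scalar_field and B
 proof -
  have "integrable torus (\<lambda>x. (a x * b x)^2)"
  proof (rule Bochner_Integration.integrable_bound)
   show "integrable torus (\<lambda>x. B^2 * (b x)^2)" using b by (auto simp: L2_torus_def)
   show "AE x in torus. norm ((a x * b x)^2) <= norm (B^2 * (b x)^2)"
   proof (rule AE_I2)
    fix x
    have "(a x)^2 <= B^2" using power_mono[OF a(3)[of x], of 2] by simp
    then show "norm ((a x * b x)^2) <= norm (B^2 * (b x)^2)" by (simp add: power_mult_distrib mult_right_mono)
   qed
  qed (use a b in \<open>auto simp: L2_torus_def\<close>)
  then show ?thesis using a b by (auto simp: L2_torus_def periodic_def)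
 qed
 have bd1: "\<bar>fst (v x)\<bar> <= (LINT k|freqs. cmod (vc v k))" for x
  using norm_series_le[OF V(1), of x] V(3)[of x] by (metis norm_of_real)
 have bd2: "\<bar>snd (v x)\<bar> <= (LINT k|freqs. cmod (vc' v k))" for x
  using norm_series_le[OF V(2), of x] V(4)[of x] by (metis norm_of_real)
 have vL: "(\<lambda>x. fst (v x)) \<in> L2_torus" "(\<lambda>x. snd (v x)) \<in> L2_torus"
  using div_free_D(2,3)[OF v] sobolev_L2 by (auto simp: comp_def)
 have p1: "(\<lambda>x. fst (v x) * (fst \<circ> g) x) \<in> L2_torus" by (rule prodL[OF cv(1) vL(1) bd1 gL(1)])
 have p2: "(\<lambda>x. snd (v x) * (snd \<circ> g) x) \<in> L2_torus" by (rule prodL[OF cv(2) vL(2) bd2 gL(2)])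
 have eq: "(\<lambda>x. v x \<bullet> g x) = (\<lambda>x. 1 * (fst (v x) * (fst \<circ> g) x) + 1 * (snd (v x) * (snd \<circ> g) x))"
  by (auto simp: inner_prod_def)
 show "(\<lambda>x. v x \<bullet> g x) \<in> L2_torus" unfolding eq by (rule L2_torus_add[OF p1 p2])
 have b: "\<exists>B. \<forall>k. cmod (fourier_coeff a k) <= B" if "a \<in> L2_torus" for a
  using norm_fc_le[OF L2_torus_D(4)[OF that]] unfolding fourier_coeff_fc by blast
 have c1: "fourier_coeff (\<lambda>x. fst (v x) * (fst \<circ> g) x) k = (LINT j|freqs. vc v j * fourier_coeff (fst \<circ> g) (k - j))"
  unfolding fourier_coeff_fc of_real_mult V(3) by (rule fc_series_mult(2)[OF V(1) L2_torus_D(4)[OF gL(1)]])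
 have c2: "fourier_coeff (\<lambda>x. snd (v x) * (snd \<circ> g) x) k = (LINT j|freqs. vc' v j * fourier_coeff (snd \<circ> g) (k - j))"
  unfolding fourier_coeff_fc of_real_mult V(4) by (rule fc_series_mult(2)[OF V(2) L2_torus_D(4)[OF gL(2)]])
 have int: "integrable freqs (\<lambda>j. C j * fourier_coeff a (k - j))" if C: "integrable freqs C" and a: "a \<in> L2_torus" for C a
 proof -
  obtain B where B: "\<And>k. cmod (fourier_coeff a k) <= B" using b[OF a] by blast
  show ?thesis
  proof (rule Bochner_Integration.integrable_bound)
   show "integrable freqs (\<lambda>j. B * cmod (C j))" using C by simp
   show "AE j in freqs. norm (C j * fourier_coeff a (k - j)) <= norm (B * cmod (C j))"
    using B order_trans[OF norm_ge_zero B] by (intro AE_I2) (simp add: norm_mult mult.commute[of B] mult_left_mono)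
  qed simp
 qed
 have "fourier_coeff (\<lambda>x. v x \<bullet> g x) k = (LINT j|freqs. vc v j * fourier_coeff (fst \<circ> g) (k - j) + vc' v j * fourier_coeff (snd \<circ> g) (k - j))"
  unfolding eq fourier_coeff_lin[OF p1 p2] c1 c2
  using int[OF V(1) gL(1)] int[OF V(2) gL(2)] by simp
 also have "... = (LINT j|freqs. adv_mat v k (k - j) * fourier_coeff u (k - j))"
 proof (rule Bochner_Integration.integral_cong)
  fix j
  have *: "of_real (fst (freq j)) * vc v j + of_real (snd (freq j)) * vc' v j = 0" by (rule div_free_D(6)[OF v])
  have "vc v j * of_real (fst (freq (k - j))) + vc' v j * of_real (snd (freq (k - j)))
    = of_real (fst (freq k)) * vc v j + of_real (snd (freq k)) * vc' v j"
  proof -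
   have "vc v j * of_real (fst (freq (k - j))) + vc' v j * of_real (snd (freq (k - j)))
    = (of_real (fst (freq k)) * vc v j + of_real (snd (freq k)) * vc' v j)
     - (of_real (fst (freq j)) * vc v j + of_real (snd (freq j)) * vc' v j)"
    by (simp add: freq_simps algebra_simps)
   then show ?thesis using * by simp
  qed
  then have "(2 * pi * \<i>) * (vc v j * of_real (fst (freq (k - j))) + vc' v j * of_real (snd (freq (k - j)))) * fourier_coeff u (k - j)
    = adv_mat v k (k - j) * fourier_coeff u (k - j)" by (simp add: adv_mat_def)
  then show "vc v j * fourier_coeff (fst \<circ> g) (k - j) + vc' v j * fourier_coeff (snd \<circ> g) (k - j) = adv_mat v k (k - j) * fourier_coeff u (k - j)"
   unfolding gc by (simp add: algebra_simps)
 qed simp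
 also have "... = (LINT l|distr freqs freqs (\<lambda>j. k - j). adv_mat v k l * fourier_coeff u l)"
  by (rule integral_distr[symmetric]) auto
 also have "distr freqs freqs (\<lambda>j. k - j) = freqs"
  by (rule distr_bij_count_space) (auto intro!: bij_betwI[of _ _ _ "\<lambda>j. k - j"])
 finally show "fourier_coeff (\<lambda>x. v x \<bullet> g x) k = adv (adv_mat v) (fourier_coeff u) k" by (simp add: adv_def)
qed

text \<open>By Parseval the weak form is the real inner product of a residual X with the test
  function. Frequency zero is exempt because test functions have mean zero.\<close>

lemma weak_form_iff:
 assumes m: "m > 1" and v: "v \<in> div_free m" and u: "u \<in> sobolev m" and w: "w \<in> L2_torus"
 shows "(\<forall>\<phi>\<in>sobolev 1. L2_inner w \<phi> + L2_inner (\<lambda>x. v x \<bullet> grad u x) \<phi> + \<kappa> * (LINT x|torus. grad u x \<bullet> grad \<phi> x) = 0) \<longleftrightarrow>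
  (\<forall>k. k \<noteq> 0 \<longrightarrow> fourier_coeff w k = - of_real (4 * pi^2 * \<kappa> * (norm (freq k))^2) * fourier_coeff u k
    - adv (adv_mat v) (fourier_coeff u) k)"
proof -
 have u1: "u \<in> sobolev 1" using sobolev_mono[OF _ u, of 1] m by simp
 note T = transport_coeff[OF m v is_grad_grad[OF u1] sobolev_L2[OF u1]]
 define X where "X k = fourier_coeff w k + adv (adv_mat v) (fourier_coeff u) k
  + of_real (4 * pi^2 * \<kappa> * (norm (freq k))^2) * fourier_coeff u k" for k
 have main: "L2_inner w \<phi> + L2_inner (\<lambda>x. v x \<bullet> grad u x) \<phi> + \<kappa> * (LINT x|torus. grad u x \<bullet> grad \<phi> x)
   = (LINT k|freqs. Re (X k * cnj (fourier_coeff \<phi> k)))" if \<phi>: "\<phi> \<in> sobolev 1" for \<phi>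
 proof -
  have \<phi>L: "\<phi> \<in> L2_torus" by (rule sobolev_L2[OF \<phi>])
  have i1: "integrable freqs (\<lambda>k. Re (fourier_coeff w k * cnj (fourier_coeff \<phi> k)))"
   by (rule integrable_freqs_mult[OF parseval(1)[OF w] parseval(1)[OF \<phi>L]])
  have i2: "integrable freqs (\<lambda>k. Re (adv (adv_mat v) (fourier_coeff u) k * cnj (fourier_coeff \<phi> k)))"
   using integrable_freqs_mult[OF parseval(1)[OF T(1)] parseval(1)[OF \<phi>L]] unfolding T(2) .
  have p2: "L2_inner (\<lambda>x. v x \<bullet> grad u x) \<phi> = (LINT k|freqs. Re (adv (adv_mat v) (fourier_coeff u) k * cnj (fourier_coeff \<phi> k)))"
   using parseval_inner[OF T(1) \<phi>L] unfolding T(2) .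
  note G = grad_inner[OF u1 \<phi>]
  have "Re (X k * cnj (fourier_coeff \<phi> k)) = Re (fourier_coeff w k * cnj (fourier_coeff \<phi> k))
    + Re (adv (adv_mat v) (fourier_coeff u) k * cnj (fourier_coeff \<phi> k))
    + \<kappa> * Re (of_real (4 * pi^2 * (norm (freq k))^2) * fourier_coeff u k * cnj (fourier_coeff \<phi> k))" for k
  proof -
   have "of_real (4 * pi^2 * \<kappa> * (norm (freq k))^2) * fourier_coeff u k * cnj (fourier_coeff \<phi> k)
     = \<kappa> *\<^sub>R (of_real (4 * pi^2 * (norm (freq k))^2) * fourier_coeff u k * cnj (fourier_coeff \<phi> k))"
    by (simp add: scaleR_conv_of_real)
   then show ?thesis unfolding X_def distrib_right by (simp only: plus_complex.sel(1) scaleR_complex.sel(1))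
  qed
  then have "(LINT k|freqs. Re (X k * cnj (fourier_coeff \<phi> k))) = (LINT k|freqs. Re (fourier_coeff w k * cnj (fourier_coeff \<phi> k))
    + Re (adv (adv_mat v) (fourier_coeff u) k * cnj (fourier_coeff \<phi> k))
    + \<kappa> * Re (of_real (4 * pi^2 * (norm (freq k))^2) * fourier_coeff u k * cnj (fourier_coeff \<phi> k)))"
   by (simp only:)
  also have "... = (LINT k|freqs. Re (fourier_coeff w k * cnj (fourier_coeff \<phi> k)))
    + (LINT k|freqs. Re (adv (adv_mat v) (fourier_coeff u) k * cnj (fourier_coeff \<phi> k)))
    + \<kappa> * (LINT k|freqs. Re (of_real (4 * pi^2 * (norm (freq k))^2) * fourier_coeff u k * cnj (fourier_coeff \<phi> k)))"
  proof -
   have i3: "integrable freqs (\<lambda>k. \<kappa> * Re (of_real (4 * pi^2 * (norm (freq k))^2) * fourier_coeff u k * cnj (fourier_coeff \<phi> k)))"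
    by (rule integrable_mult_right) (rule G(1))
   show ?thesis unfolding Bochner_Integration.integral_add[OF Bochner_Integration.integrable_add[OF i1 i2] i3]
     Bochner_Integration.integral_add[OF i1 i2] Bochner_Integration.integral_mult_right_zero ..
  qed
  finally show ?thesis unfolding parseval_inner[OF w \<phi>L] p2 G(2) by simp
 qed
 have X0: "X k = 0 \<longleftrightarrow> fourier_coeff w k = - of_real (4 * pi^2 * \<kappa> * (norm (freq k))^2) * fourier_coeff u k
    - adv (adv_mat v) (fourier_coeff u) k" for k
 proof -
  have "X k = fourier_coeff w k - (- of_real (4 * pi^2 * \<kappa> * (norm (freq k))^2) * fourier_coeff u k
    - adv (adv_mat v) (fourier_coeff u) k)" by (simp add: X_def)
  then show ?thesis by (simp only: eq_iff_diff_eq_0[of "fourier_coeff w k"])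
 qed
 have Xm: "X (- k) = cnj (X k)" for k
 proof -
  have "adv (adv_mat v) (fourier_coeff u) (- k) = cnj (adv (adv_mat v) (fourier_coeff u) k)"
   unfolding T(2)[symmetric] by (rule fourier_coeff_minus)
  then show ?thesis by (simp add: X_def fourier_coeff_minus)
 qed
 show ?thesis
 proof
  assume L: "\<forall>\<phi>\<in>sobolev 1. L2_inner w \<phi> + L2_inner (\<lambda>x. v x \<bullet> grad u x) \<phi>
    + \<kappa> * (LINT x|torus. grad u x \<bullet> grad \<phi> x) = 0"
  show "\<forall>k. k \<noteq> 0 \<longrightarrow> fourier_coeff w k = - of_real (4 * pi^2 * \<kappa> * (norm (freq k))^2) * fourier_coeff u k
    - adv (adv_mat v) (fourier_coeff u) k"
  proof (intro allI impI)
   fix k :: "int \<times> int" assume k: "k \<noteq> 0"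
   have kk: "- k \<noteq> k" using k by (auto simp: prod_eq_iff)
   \<comment> \<open>A real test function is supported on k and -k together; giving it the
     coefficients of the residual makes the pairing equal to 2 |X k|^2.\<close>
   define D where "D j = (if j = k then X k else if j = - k then cnj (X k) else 0)" for j
   have fin: "finite {j. D j \<noteq> 0}" by (rule finite_subset[of _ "{k, - k}"]) (auto simp: D_def)
   have Dsym: "D (- j) = cnj (D j)" for j using kk by (auto simp: D_def minus_equation_iff)
   have sup: "(\<integral>\<^sup>+ j. f j \<partial>freqs) < \<top>" if "\<And>j. f j < \<top>" "\<And>j. D j = 0 ==> f j = 0" for f :: "int \<times> int => ennreal"
   proof -
    have "(\<integral>\<^sup>+ j. f j \<partial>freqs) = (\<Sum>j\<in>{j. D j \<noteq> 0}. f j)"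
     by (rule nn_integral_count_space'[OF fin]) (use that in auto)
    also have "... < \<top>" using that(1) fin by (auto simp: less_top)
    finally show ?thesis .
   qed
   have "integrable freqs (\<lambda>j. (cmod (D j))^2)"
    by (rule integrableI_bounded) (use sup[of "\<lambda>j. ennreal ((cmod (D j))^2)"] in auto)
   then obtain \<phi> where \<phi>: "\<phi> \<in> L2_torus" "\<And>j. fourier_coeff \<phi> j = D j" using riesz_fischer_real[of D] Dsym by blast
   have D0: "D 0 = 0" using k by (simp add: D_def)
   have "\<phi> \<in> sobolev 1" unfolding sobolev_iff \<phi>(2) hs_def using \<phi>(1) D0 sup[of "\<lambda>j. (wt 1 j * amp D j)^2"]
    by (auto simp: power2_eq_square ennreal_mult_less_top)
   then have "0 = (LINT j|freqs. Re (X j * cnj (fourier_coeff \<phi> j)))" using L main by simp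
   also have "... = (\<Sum>j\<in>{j. D j \<noteq> 0}. Re (X j * cnj (D j)))"
   proof -
    have sub: "{j \<in> UNIV. Re (X j * cnj (D j)) \<noteq> 0} \<subseteq> {j. D j \<noteq> 0}" by auto
    have "(LINT j|freqs. Re (X j * cnj (D j))) = (\<Sum>j | j \<in> UNIV \<and> Re (X j * cnj (D j)) \<noteq> 0. Re (X j * cnj (D j)))"
     by (rule lebesgue_integral_count_space_finite_support[OF finite_subset[OF sub fin]])
    also have "... = (\<Sum>j\<in>{j. D j \<noteq> 0}. Re (X j * cnj (D j)))" by (rule sum.mono_neutral_left[OF fin sub]) auto
    finally show ?thesis unfolding \<phi>(2) .
   qed
   also have "... = (\<Sum>j\<in>{k, - k}. Re (X j * cnj (D j)))" by (rule sum.mono_neutral_left) (auto simp: D_def)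
   also have "... = 2 * (cmod (X k))^2" using kk by (simp add: D_def Xm cmod_power2) (simp add: power2_eq_square)
   finally have "X k = 0" by simp
   then show "fourier_coeff w k = - of_real (4 * pi^2 * \<kappa> * (norm (freq k))^2) * fourier_coeff u k
     - adv (adv_mat v) (fourier_coeff u) k" unfolding X0 .
  qed
 next
  assume R: "\<forall>k. k \<noteq> 0 \<longrightarrow> fourier_coeff w k = - of_real (4 * pi^2 * \<kappa> * (norm (freq k))^2) * fourier_coeff u k
    - adv (adv_mat v) (fourier_coeff u) k"
  show "\<forall>\<phi>\<in>sobolev 1. L2_inner w \<phi> + L2_inner (\<lambda>x. v x \<bullet> grad u x) \<phi> + \<kappa> * (LINT x|torus. grad u x \<bullet> grad \<phi> x) = 0"
  proof
   fix \<phi> assume \<phi>: "\<phi> \<in> sobolev 1"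
   then have "fourier_coeff \<phi> 0 = 0" by (simp add: sobolev_iff)
   moreover have "X k = 0" if "k \<noteq> 0" for k using R that unfolding X0 by blast
   ultimately have "X k * cnj (fourier_coeff \<phi> k) = 0" for k by (cases "k = 0") auto
   then show "L2_inner w \<phi> + L2_inner (\<lambda>x. v x \<bullet> grad u x) \<phi> + \<kappa> * (LINT x|torus. grad u x \<bullet> grad \<phi> x) = 0"
    unfolding main[OF \<phi>] by (simp only:) simp
  qed
 qed
qed

section \<open>Weak solutions and mode solutions\<close>

text \<open>Essential bounds are carried over to every time by continuity, which needs good times
  arbitrarily close to t.\<close>

lemma AE_nonneg_ex:
 assumes ae: "AE r in lebesgue_on {0..}. P r" and t: "(t::real) >= 0" and d: "d > 0"
 shows "\<exists>r. t <= r \<and> r < t + d \<and> P r"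
proof (rule ccontr)
 assume no: "\<not> ?thesis"
 have "AE r in lebesgue. r \<in> {0..} \<longrightarrow> P r" using ae by (subst (asm) AE_restrict_space_iff) auto
 then have "AE r in lebesgue. r \<notin> {t<..<t + d}" by eventually_elim (use no t in auto)
 then have "{t<..<t + d} \<in> null_sets lebesgue" by (subst (asm) AE_iff_null_sets[symmetric]) auto
 then have "emeasure lebesgue {t<..<t + d} = 0" by auto
 then show False using d by simp
qed

lemma fourier_coeff_diff:
 assumes "u \<in> L2_torus" "w \<in> L2_torus"
 shows "fourier_coeff (\<lambda>x. u x - w x) k = fourier_coeff u k - fourier_coeff w k"
 using fourier_coeff_lin[OF assms, of 1 "-1" k] by simp

lemma eventually_at_within_mem: "\<forall>\<^sub>F r in at t within S. r \<in> S" by (simp add: eventually_at_filter)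

text \<open>The weak formulation offers the time derivative only almost everywhere and in integrated
  form. Its modes agree with an expression that is continuous in time, so the fundamental theorem of
  calculus turns the integral identity into a classical derivative at every t.\<close>

lemma weak_imp_mode:
 assumes \<kappa>: "\<kappa> > 0" and m: "m > 1" and v: "v \<in> div_free m" and W: "weak_solution \<kappa> m v \<theta>0 \<theta>"
 shows "mode_sol (4 * pi^2 * \<kappa>) m (adv_mat v) (\<lambda>t. fourier_coeff (\<theta> t))"
proof -
 define y where "y t = fourier_coeff (\<theta> t)" for t
 define c where "c = 4 * pi^2 * \<kappa>"
 have S: "\<theta> t \<in> sobolev m" if "t >= 0" for t using W that by (auto simp: weak_solution_def time_continuous_def)
 have lim: "((\<lambda>r. sobolev_norm m (\<lambda>x. \<theta> r x - \<theta> t x)) \<longlongrightarrow> 0) (at t within {0..})" if "t >= 0" for t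
  using W that by (auto simp: weak_solution_def time_continuous_def)
 have L: "\<theta> t \<in> L2_torus" if "t >= 0" for t using S[OF that] by (rule sobolev_L2)
 have y0: "y t 0 = 0" if "t >= 0" for t using S[OF that] by (simp add: y_def sobolev_iff)
 have yfin: "hs m (amp (y t)) < \<top>" if "t >= 0" for t using S[OF that] by (simp add: y_def sobolev_iff)
 have diff: "hs m (amp (\<lambda>k. y r k - y t k)) = ennreal ((sobolev_norm m (\<lambda>x. \<theta> r x - \<theta> t x))^2)"
  if "r >= 0" "t >= 0" for r t
 proof -
  have e: "fourier_coeff (\<lambda>x. \<theta> r x - \<theta> t x) = (\<lambda>k. y r k - y t k)"
   by (auto simp: y_def fourier_coeff_diff[OF L L] that)
  have "hs m (amp (\<lambda>k. y r k - y t k)) <= hs m (\<lambda>k. amp (y r) k + amp (y t) k)"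
   by (intro hs_mono) (simp add: norm_triangle_ineq4 flip: ennreal_plus)
  also have "... <= 4 * (hs m (amp (y r)) + hs m (amp (y t)))" by (rule hs_add)
  also have "... < \<top>" using yfin that by (simp add: ennreal_mult_less_top)
  finally show ?thesis using sobolev_norm_sq[of m "\<lambda>x. \<theta> r x - \<theta> t x"] unfolding e by blast
 qed
 have mode_le: "cmod (y r k - y t k) <= sobolev_norm m (\<lambda>x. \<theta> r x - \<theta> t x)" if "r >= 0" "t >= 0" for r t k
 proof -
  have "cmod ((\<lambda>k. y r k - y t k) k) <= sqrt (enn2real (ennreal ((sobolev_norm m (\<lambda>x. \<theta> r x - \<theta> t x))^2)))"
   by (rule mode_bound[of m]) (use m diff[OF that] y0 that in auto)
  then show ?thesis using sobolev_norm_nonneg[of m "\<lambda>x. \<theta> r x - \<theta> t x"] by simp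
 qed
 have cont: "continuous_on {0..} (\<lambda>t. y t k)" for k unfolding continuous_on_def
 proof
  fix t :: real assume t: "t \<in> {0..}"
  have "((\<lambda>r. y r k - y t k) \<longlongrightarrow> 0) (at t within {0..})"
  proof (rule Lim_null_comparison)
   show "\<forall>\<^sub>F r in at t within {0..}. norm (y r k - y t k) <= sobolev_norm m (\<lambda>x. \<theta> r x - \<theta> t x)"
    using eventually_at_within_mem[of "{0..}" t] by eventually_elim (use t mode_le in auto)
   show "((\<lambda>r. sobolev_norm m (\<lambda>x. \<theta> r x - \<theta> t x)) \<longlongrightarrow> 0) (at t within {0..})" using lim t by simp
  qed
  then show "((\<lambda>t. y t k) \<longlongrightarrow> y t k) (at t within {0..})" by (rule LIM_zero_cancel)
 qed
 obtain C where C: "AE t in lebesgue_on {0..}. sobolev_norm m (\<theta> t) <= C"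
  using W by (auto simp: weak_solution_def L_inf_def)
 \<comment> \<open>The essential bound C holds at some time r so close to t that the two states
   differ by less than 1 in H^m.\<close>
 have bdd: "hs m (amp (y t)) <= 4 * (1 + ennreal (C^2))" if t: "t >= 0" for t
 proof -
  have "\<forall>\<^sub>F r in at t within {0..}. sobolev_norm m (\<lambda>x. \<theta> r x - \<theta> t x) < 1"
   using lim[OF t] by (rule order_tendstoD) simp
  then obtain d where d: "d > 0" "\<And>r. r \<in> {0..} ==> r \<noteq> t ==> dist r t < d ==> sobolev_norm m (\<lambda>x. \<theta> r x - \<theta> t x) < 1"
   unfolding eventually_at by blast
  obtain r where r: "t <= r" "r < t + d" "sobolev_norm m (\<theta> r) <= C" using AE_nonneg_ex[OF C t d(1)] by blast
  have r0: "r >= 0" using r t by simp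
  have "(sobolev_norm m (\<theta> r))^2 <= C^2" using r sobolev_norm_nonneg[of m "\<theta> r"] by (intro power_mono) auto
  then have hr: "hs m (amp (y r)) <= ennreal (C^2)"
   using sobolev_norm_sq[of m "\<theta> r"] yfin[OF r0] by (simp add: y_def ennreal_leI)
  have hd: "hs m (amp (\<lambda>k. y t k - y r k)) <= 1"
  proof (cases "r = t")
   case True then show ?thesis by (simp add: hs_def)
  next
   case False
   then have n: "sobolev_norm m (\<lambda>x. \<theta> r x - \<theta> t x) < 1" using d r r0 by (auto simp: dist_real_def)
   have "hs m (amp (\<lambda>k. y t k - y r k)) = hs m (amp (\<lambda>k. y r k - y t k))" by (simp add: norm_minus_commute)
   also have "... <= ennreal (1^2)" unfolding diff[OF r0 t] using n sobolev_norm_nonneg[of m "\<lambda>x. \<theta> r x - \<theta> t x"]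
    by (intro ennreal_leI power_mono) auto
   finally show ?thesis by simp
  qed
  have "amp (y t) k <= amp (\<lambda>k. y t k - y r k) k + amp (y r) k" for k
   using norm_triangle_ineq[of "y t k - y r k" "y r k"] by (simp add: ennreal_leI flip: ennreal_plus)
  then have "hs m (amp (y t)) <= hs m (\<lambda>k. amp (\<lambda>k. y t k - y r k) k + amp (y r) k)" by (rule hs_mono)
  also have "... <= 4 * (hs m (amp (\<lambda>k. y t k - y r k)) + hs m (amp (y r)))" by (rule hs_add)
  also have "... <= 4 * (1 + ennreal (C^2))" by (intro mult_left_mono add_mono hd hr) auto
  finally show ?thesis .
 qed
 have bd: "\<exists>B<\<top>. \<forall>t\<in>{0..S}. hs m (amp (y t)) <= B" for S
  using bdd by (intro exI[of _ "4 * (1 + ennreal (C^2))"]) (auto simp: ennreal_mult_less_top)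
 have Q: "hs m (vamp v) < \<top>" by (rule hs_vamp_finite[OF v order_refl])
 note P = op_bound_adv_mat[OF v]
 have ac: "continuous_on {0..} (\<lambda>t. adv (adv_mat v) (y t) k)" for k by (rule adv_continuous[OF m P Q y0 bd cont])
 define g where "g k t = - of_real (c * (norm (freq k))^2) * y t k - adv (adv_mat v) (y t) k" for k t
 have gc: "continuous_on {0..} (g k)" for k unfolding g_def by (intro continuous_intros ac cont)
 obtain w where w: "w \<in> L2_loc (m - 1)" "has_time_deriv \<theta> w" "AE t in lebesgue_on {0..}. \<forall>\<phi> \<in> sobolev 1.
      L2_inner (w t) \<phi> + L2_inner (\<lambda>x. v x \<bullet> grad (\<theta> t) x) \<phi> + \<kappa> * (LINT x|torus. grad (\<theta> t) x \<bullet> grad \<phi> x) = 0"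
  using W by (auto simp: weak_solution_def)
 have wL: "AE t in lebesgue_on {0..}. w t \<in> sobolev (m - 1)" using w(1) by (simp add: L2_loc_def)
 have eq: "AE t in lebesgue_on {0..}. \<forall>k. k \<noteq> 0 \<longrightarrow> fourier_coeff (w t) k = g k t"
 proof -
  have "AE t in lebesgue_on {0..}. t \<in> {0::real..}" by (rule AE_I2) simp
  then show ?thesis using w(3) wL
  proof eventually_elim
   case (elim t)
   then show ?case using weak_form_iff[OF m v S sobolev_L2, of t "w t" "m - 1" \<kappa>] by (simp add: g_def c_def y_def)
  qed
 qed
 have int: "y t k = y 0 k + integral {0..t} (g k)" if t: "t >= 0" and k: "k \<noteq> 0" for t k
 proof -
  have wi: "integrable (tm t) (\<lambda>r. fourier_coeff (w r) k)"
   and we: "y t k = y 0 k + (LINT r|tm t. fourier_coeff (w r) k)"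
   using w(2) t unfolding has_time_deriv_def y_def by blast+
  have gi: "integrable (tm t) (g k)" by (rule continuous_imp_integrable_real[OF continuous_on_subset[OF gc]]) auto
  have "(LINT r|tm t. fourier_coeff (w r) k) = (LINT r|tm t. g k r)"
  proof (rule integral_cong_AE)
   have "AE r in lebesgue. r \<in> {0..} \<longrightarrow> (\<forall>k. k \<noteq> 0 \<longrightarrow> fourier_coeff (w r) k = g k r)"
    using eq by (subst (asm) AE_restrict_space_iff) auto
   then have "AE r in lebesgue. r \<in> {0..t} \<longrightarrow> fourier_coeff (w r) k = g k r"
    by eventually_elim (use k in \<open>auto simp del: split_paired_All\<close>)
   then show "AE r in tm t. fourier_coeff (w r) k = g k r" by (subst AE_restrict_space_iff) auto
  qed (use wi gi in auto)
  also have "... = integral {0..t} (g k)" by (rule lebesgue_integral_eq_integral[OF gi]) auto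
  finally show ?thesis using we by simp
 qed
 have der: "((\<lambda>t. y t k) has_vector_derivative g k t) (at t within {0..})" if t: "t >= 0" for t k
 proof (cases "k = 0")
  case False
  show ?thesis by (rule integral_form_derivative[OF gc int[OF _ False] t])
 next
  case True
  \<comment> \<open>The weak form is silent about frequency zero. There both sides vanish, since the
    solution has mean zero and transport creates none.\<close>
  have P0: "adv_mat v 0 l = 0" for l by (simp add: adv_mat_def freq_simps)
  have "g k t = 0" using True y0[OF t] by (simp add: g_def adv_def P0)
  moreover have "((\<lambda>t. y t k) has_vector_derivative 0) (at t within {0..})"
   by (rule has_vector_derivative_transform[of _ _ _ "\<lambda>_. 0"]) (use True y0 t in auto)
  ultimately show ?thesis by simp
 qed
 show ?thesis unfolding mode_sol_def y_def[symmetric] c_def[symmetric]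
  using y0 bd der by (simp add: g_def del: split_paired_All)
qed

section \<open>Uniqueness, reality and existence of solutions\<close>

lemma nn_integral_freqs_uminus: "(\<integral>\<^sup>+ k. f (- k) \<partial>freqs) = (\<integral>\<^sup>+ k. f k \<partial>freqs)"
 by (rule nn_integral_bij_count_space) (auto intro!: bij_betwI[of _ _ _ uminus])

lemma integral_freqs_uminus: "(LINT k|freqs. f (- k)) = (LINT k|freqs. (f k :: complex))"
proof -
 have "(LINT k|freqs. f (- k)) = (LINT k|distr freqs freqs uminus. f k)" by (rule integral_distr[symmetric]) auto
 also have "distr freqs freqs (uminus :: int \<times> int => int \<times> int) = freqs"
  by (rule distr_bij_count_space) (auto intro!: bij_betwI[of _ _ _ uminus])
 finally show ?thesis .
qed

lemma wt_uminus: "wt s (- k) = wt s k" by (simp add: wt_def)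

lemma mode_sol_unique:
 assumes c: "c > 0" and m: "m > 1" and P: "op_bound P Q" and Q: "hs m Q < \<top>"
  and y: "mode_sol c m P y" and y': "mode_sol c m P y'" and init: "y 0 = y' 0" and t: "t >= 0"
 shows "y t = y' t"
proof -
 have D: "op_bound (\<lambda>k l. P k l - P k l) (\<lambda>_. 0)" by (simp add: op_bound_def)
 have "hs m (amp (\<lambda>k. y t k - y' t k)) <= 0"
  using mode_sol_stability[OF c m P Q P Q D y y' t init] by (simp add: hs_def)
 then have z: "(wt m k * amp (\<lambda>k. y t k - y' t k) k)^2 = 0" for k
  using hs_point[of m k "amp (\<lambda>k. y t k - y' t k)"] by (metis le_zero_eq)
 show ?thesis
 proof
  fix k show "y t k = y' t k"
  proof (cases "k = 0")
   case True then show ?thesis using mode_sol_D(1)[OF y t] mode_sol_D(1)[OF y' t] by simp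
  next
   case False then show ?thesis using z[of k] wt_pos[OF False, of m] by auto
  qed
 qed
qed

text \<open>Conjugation combined with the reflection of frequencies gives another solution with the
  same initial value, so uniqueness applies.\<close>

lemma mode_sol_real:
 assumes c: "c > 0" and m: "m > 1" and v: "v \<in> div_free m"
  and y: "mode_sol c m (adv_mat v) y" and y0: "\<And>k. y 0 (- k) = cnj (y 0 k)" and t: "t >= 0"
 shows "y t (- k) = cnj (y t k)"
proof -
 define y' where "y' t k = cnj (y t (- k))" for t k
 have hs': "hs m (amp (y' t)) = hs m (amp (y t))" for t
  unfolding hs_def y'_def using nn_integral_freqs_uminus[of "\<lambda>k. (wt m k * ennreal (cmod (y t k)))^2"]
  by (simp add: wt_uminus)
 have adv': "adv (adv_mat v) (y' t) k = cnj (adv (adv_mat v) (y t) (- k))" for t k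
 proof -
  have "cnj (adv (adv_mat v) (y t) (- k)) = (LINT l|freqs. cnj (adv_mat v (- k) l * y t l))"
   unfolding adv_def by (rule Bochner_Integration.integral_cnj[symmetric])
  also have "... = (LINT l|freqs. cnj (adv_mat v (- k) (- l) * y t (- l)))" by (rule integral_freqs_uminus[symmetric])
  also have "... = (LINT l|freqs. adv_mat v k l * y' t l)"
   by (rule Bochner_Integration.integral_cong) (simp_all only: adv_mat_minus y'_def complex_cnj_mult complex_cnj_cnj)
  finally show ?thesis by (simp add: adv_def)
 qed
 have "mode_sol c m (adv_mat v) y'" unfolding mode_sol_def
 proof (intro conjI allI impI)
  show "y' t 0 = 0" if "t >= 0" for t using mode_sol_D(1)[OF y that] by (simp add: y'_def)
  show "\<exists>B<\<top>. \<forall>t\<in>{0..S}. hs m (amp (y' t)) <= B" for S unfolding hs' by (rule mode_sol_D(2)[OF y])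
  fix k and t :: real assume t: "t >= 0"
  have "((\<lambda>t. y' t k) has_vector_derivative cnj (- of_real (c * (norm (freq (- k)))^2) * y t (- k) - adv (adv_mat v) (y t) (- k))) (at t within {0..})"
   unfolding y'_def by (rule bounded_linear.has_vector_derivative[OF bounded_linear_cnj mode_sol_D(3)[OF y t]])
  then show "((\<lambda>t. y' t k) has_vector_derivative - of_real (c * (norm (freq k))^2) * y' t k - adv (adv_mat v) (y' t) k) (at t within {0..})"
   by (simp add: y'_def[symmetric] adv')
 qed
 moreover have "y 0 = y' 0" unfolding y'_def using y0 by (auto simp: fun_eq_iff simp del: split_paired_All)
 ultimately have "y t = y' t"
  by (intro mode_sol_unique[OF c m op_bound_adv_mat[OF v] hs_vamp_finite[OF v order_refl] y _ _ t])
 then show ?thesis by (metis y'_def complex_cnj_cnj)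
qed

lemma fourier_coeff_zero: "fourier_coeff (\<lambda>_. 0) k = 0" by (simp add: fourier_coeff_def)

text \<open>The modes from the Dyson series are summed to a continuous function, for which each
  clause of the weak formulation is verified. This justifies the choice in
  \<open>adv_diff_solution\<close>.\<close>

lemma weak_solution_exists:
 assumes \<kappa>: "\<kappa> > 0" and m: "m > 1" and v: "v \<in> div_free m" and \<theta>0: "\<theta>0 \<in> sobolev m"
 shows "\<exists>\<theta>. weak_solution \<kappa> m v \<theta>0 \<theta>"
proof -
 define c where "c = 4 * pi^2 * \<kappa>"
 have c: "c > 0" using \<kappa> by (simp add: c_def)
 define P where "P = adv_mat v"
 have P: "op_bound P (vamp v)" unfolding P_def by (rule op_bound_adv_mat[OF v])
 have Q: "hs m (vamp v) < \<top>" by (rule hs_vamp_finite[OF v order_refl])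
 have a: "fourier_coeff \<theta>0 0 = 0" "hs m (amp (fourier_coeff \<theta>0)) < \<top>" using \<theta>0 by (auto simp: sobolev_iff)
 obtain y r A where y: "mode_sol c m P y" "y 0 = fourier_coeff \<theta>0" and r: "r > 0"
  and A: "hs m A < \<top>" "\<And>k. A k < \<top>" and yA: "\<And>t k. t >= 0 ==> amp (y t) k <= ennreal (exp (r * t)) * A k"
  by (rule mode_sol_exists[where P=P and a="fourier_coeff \<theta>0", OF c m P Q a]) (rule that)
 note D = mode_sol_D[OF y(1)]
 note yc = mode_sol_continuous[OF y(1)]
 have ac: "continuous_on {0..} (\<lambda>t. adv P (y t) k)" for k by (rule mode_sol_adv_continuous[OF m P Q y(1)])
 have sym: "y t (- k) = cnj (y t k)" if "t >= 0" for t k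
  using mode_sol_real[OF c m v y(1)[unfolded P_def] _ that] by (simp add: y(2) fourier_coeff_minus)
 have yfin: "hs m (amp (y t)) < \<top>" if t: "t >= 0" for t using D(2)[of t] t by (auto intro: le_less_trans)
 have l1: "integrable freqs (y t)" if "t >= 0" for t by (rule hs_imp_l1(1)[OF m D(1)[OF that] yfin[OF that]])
 define \<theta> where "\<theta> t = (\<lambda>x. Re (series (y t) x))" for t
 have RS: "continuous_on UNIV (\<theta> t)" "\<theta> t \<in> L2_torus" "fourier_coeff (\<theta> t) = y t" if t: "t >= 0" for t
  using real_series[OF l1[OF t] sym[OF t]] unfolding \<theta>_def by auto
 have S: "\<theta> t \<in> sobolev m" if t: "t >= 0" for t using RS[OF t] D(1)[OF t] yfin[OF t] by (simp add: sobolev_iff)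
 have tc: "time_continuous m \<theta>" unfolding time_continuous_def
 proof (intro allI impI conjI S)
  fix t :: real assume t: "t >= 0"
  show "((\<lambda>r. sobolev_norm m (\<lambda>x. \<theta> r x - \<theta> t x)) \<longlongrightarrow> 0) (at t within {0..})" unfolding tendsto_at_iff_sequentially
  proof (intro allI impI)
   fix X :: "nat => real" assume X: "\<forall>i. X i \<in> {0..} - {t}" and Xt: "X \<longlonglongrightarrow> t"
   have X0: "X i >= 0" for i using X by simp
   obtain S where S: "\<And>n. X n <= S"
    using convergent_imp_Bseq[of X] Xt by (auto simp: convergent_def Bseq_def abs_le_iff)
   have tS: "t <= S" using LIMSEQ_le_const2[OF Xt] S by blast
   have co: "fourier_coeff (\<lambda>x. \<theta> (X i) x - \<theta> t x) = (\<lambda>k. y (X i) k - y t k)" for i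
    using fourier_coeff_diff[OF RS(2)[OF X0] RS(2)[OF t], of i] RS(3)[OF X0, of i] RS(3)[OF t] by auto
   have amp_le: "amp (y s) k <= ennreal (exp (r * S)) * A k" if "0 <= s" "s <= S" for s k
    using r that by (intro order_trans[OF yA] mult_right_mono ennreal_leI) auto
   have dl: "amp (\<lambda>k. y (X i) k - y t k) k <= 2 * ennreal (exp (r * S)) * A k" for i k
   proof -
    have "amp (\<lambda>k. y (X i) k - y t k) k <= amp (y (X i)) k + amp (y t) k"
     by (simp add: norm_triangle_ineq4 flip: ennreal_plus)
    also have "... <= ennreal (exp (r * S)) * A k + ennreal (exp (r * S)) * A k"
     by (intro add_mono amp_le) (use X0 S t tS in auto)
    finally show ?thesis by (simp add: mult_2 distrib_right)
   qed
   have dom: "(\<integral>\<^sup>+ k. (wt m k * (2 * ennreal (exp (r * S)) * A k))^2 \<partial>freqs) < \<top>"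
    unfolding hs_def[of m "\<lambda>k. 2 * ennreal (exp (r * S)) * A k", symmetric]
    by (simp add: hs_cmult A ennreal_mult_less_top power2_eq_square)
   \<comment> \<open>Convergence of each mode becomes convergence in H^m by dominated convergence,
     the majorant A being independent of time.\<close>
   have "(\<lambda>i. hs m (amp (\<lambda>k. y (X i) k - y t k))) \<longlonglongrightarrow> (\<integral>\<^sup>+ k. 0 \<partial>freqs)" unfolding hs_def
   proof (rule nn_integral_dominated_convergence[where w="\<lambda>k. (wt m k * (2 * ennreal (exp (r * S)) * A k))^2"])
    show "AE k in freqs. (wt m k * amp (\<lambda>k. y (X i) k - y t k) k)^2 <= (wt m k * (2 * ennreal (exp (r * S)) * A k))^2" for i
     by (intro AE_I2 power_mono mult_left_mono dl) auto
    show "AE k in freqs. (\<lambda>i. (wt m k * amp (\<lambda>k. y (X i) k - y t k) k)^2) \<longlonglongrightarrow> 0"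
    proof (rule AE_I2)
     fix k
     have "(\<lambda>i. y (X i) k) \<longlonglongrightarrow> y t k" using continuous_on_tendsto_compose[OF yc Xt] X0 t by auto
     then have "(\<lambda>i. y (X i) k - y t k) \<longlonglongrightarrow> 0" by (rule LIM_zero)
     then have "(\<lambda>i. (norm (freq k) powr m * cmod (y (X i) k - y t k))^2) \<longlonglongrightarrow> (norm (freq k) powr m * cmod 0)^2"
      by (intro tendsto_intros)
     then have "(\<lambda>i. ennreal ((norm (freq k) powr m * cmod (y (X i) k - y t k))^2)) \<longlonglongrightarrow> ennreal 0"
      by (intro tendsto_ennrealI) simp
     then show "(\<lambda>i. (wt m k * amp (\<lambda>k. y (X i) k - y t k) k)^2) \<longlonglongrightarrow> 0"
      by (simp add: wt_def ennreal_mult[symmetric] ennreal_power)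
    qed
   qed (use dom in auto)
   then have h0: "(\<lambda>i. hs m (amp (\<lambda>k. y (X i) k - y t k))) \<longlonglongrightarrow> 0" by simp
   have nq: "hs m (amp (\<lambda>k. y (X i) k - y t k)) = ennreal ((sobolev_norm m (\<lambda>x. \<theta> (X i) x - \<theta> t x))^2)" for i
   proof -
    have "hs m (amp (\<lambda>k. y (X i) k - y t k)) <= hs m (\<lambda>k. 2 * ennreal (exp (r * S)) * A k)"
     by (rule hs_mono) (rule dl)
    also have "... < \<top>" using dom by (simp add: hs_def)
    finally show ?thesis using sobolev_norm_sq[of m "\<lambda>x. \<theta> (X i) x - \<theta> t x"] unfolding co by blast
   qed
   have "(\<lambda>i. (sobolev_norm m (\<lambda>x. \<theta> (X i) x - \<theta> t x))^2) \<longlonglongrightarrow> 0"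
    using h0 unfolding nq by (subst (asm) ennreal_0[symmetric], subst (asm) tendsto_ennreal_iff) auto
   from tendsto_real_sqrt[OF this]
   show "((\<lambda>r. sobolev_norm m (\<lambda>x. \<theta> r x - \<theta> t x)) \<circ> X) \<longlonglongrightarrow> 0" by (simp add: comp_def sobolev_norm_nonneg)
  qed
 qed
 have init: "AE x in torus. \<theta> 0 x = \<theta>0 x"
  by (rule AE_eq_of_fourier_coeff) (use RS[of 0] sobolev_L2[OF \<theta>0] y(2) in \<open>auto intro: L2_torus_D\<close>)
 have ym [measurable]: "(\<lambda>t. y t k) \<in> borel_measurable (lebesgue_on {0..})" for k
  by (rule continuous_imp_measurable_on_sets_lebesgue[OF yc]) simp
 have advm [measurable]: "(\<lambda>t. adv P (y t) k) \<in> borel_measurable (lebesgue_on {0..})" for k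
  by (rule continuous_imp_measurable_on_sets_lebesgue[OF ac]) simp
 have hsm [measurable]: "(\<lambda>t. hs s (amp (y t))) \<in> borel_measurable (lebesgue_on {0..})" for s
  by (rule hs_measurable) measurable
 have hsm' [measurable]: "(\<lambda>t. hs s (amp (y t))) \<in> borel_measurable (tm S)" for s S
  by (rule hs_measurable, rule measurable_compose[OF tm_measurable[OF continuous_on_norm[OF yc]] measurable_ennreal])
 have tm\<theta>: "time_measurable \<theta>" unfolding time_measurable_def
 proof
  fix k
  have "(\<lambda>t. fourier_coeff (\<theta> t) k) \<in> borel_measurable (lebesgue_on {0..}) \<longleftrightarrow> (\<lambda>t. y t k) \<in> borel_measurable (lebesgue_on {0..})"
   by (rule measurable_cong) (simp add: RS)
  then show "(\<lambda>t. fourier_coeff (\<theta> t) k) \<in> borel_measurable (lebesgue_on {0..})" using ym by blast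
 qed
 have I: "(\<integral>\<^sup>+ s. hs (m + 1) (amp (y s)) \<partial>tm S) < \<top>" if S: "S >= 0" for S
 proof -
  have "ennreal c * (\<integral>\<^sup>+ s. hs (m + 1) (amp (y s)) \<partial>tm S) < \<top>"
   by (rule le_less_trans[OF mode_sol_growth(2)[OF c m P Q y(1) S]])
    (use yfin[of 0] in \<open>simp add: ennreal_mult_less_top\<close>)
  then show ?thesis using c by (auto simp: ennreal_mult_less_top)
 qed
 \<comment> \<open>The energy estimate makes the squared H^(m+1) norm integrable in time, hence
   finite at almost every time; at such times the time derivative lies in H^(m-1).\<close>
 define good where "good t \<longleftrightarrow> hs (m + 1) (amp (y t)) < \<top>" for t
 have goodAE: "AE t in lebesgue_on {0..}. good t"
 proof -
  have "AE t in lebesgue. t \<in> {0..real n} \<longrightarrow> good t" for n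
  proof -
   have "AE t in tm (real n). hs (m + 1) (amp (y t)) \<noteq> \<infinity>" by (rule nn_integral_PInf_AE) (use I[of "real n"] in auto)
   then show ?thesis by (subst (asm) AE_restrict_space_iff) (auto simp: good_def less_top)
  qed
  then have "AE t in lebesgue. \<forall>n. t \<in> {0..real n} \<longrightarrow> good t" by (intro AE_all_countable[THEN iffD2] allI)
  then have "AE t in lebesgue. t \<in> {0..} \<longrightarrow> good t"
  proof eventually_elim
   case (elim t)
   obtain n :: nat where "t <= real n" using real_arch_simple by blast
   then show ?case using elim by auto
  qed
  then show ?thesis by (subst AE_restrict_space_iff) auto
 qed
 have nn0: "AE t in lebesgue_on {0..}. t \<in> {0::real..}" by (rule AE_I2) simp
 have L2\<theta>: "\<theta> \<in> L2_loc (m + 1)" unfolding L2_loc_def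
 proof (intro CollectI conjI allI impI tm\<theta>)
  show "AE t in lebesgue_on {0..}. \<theta> t \<in> sobolev (m + 1)"
   using goodAE nn0 by eventually_elim (use RS D(1) in \<open>auto simp: sobolev_iff good_def\<close>)
  fix S :: real assume S: "S >= 0"
  have "(\<integral>\<^sup>+t. ennreal ((sobolev_norm (m + 1) (\<theta> t))^2) \<partial>tm S) <= (\<integral>\<^sup>+ s. hs (m + 1) (amp (y s)) \<partial>tm S)"
  proof (rule nn_integral_mono)
   fix t assume "t \<in> space (tm S)"
   then show "ennreal ((sobolev_norm (m + 1) (\<theta> t))^2) <= hs (m + 1) (amp (y t))"
    using sobolev_norm_sq_le[of "m + 1" "\<theta> t"] RS(3)[of t] by simp
  qed
  then show "(\<integral>\<^sup>+t. ennreal ((sobolev_norm (m + 1) (\<theta> t))^2) \<partial>tm S) < \<infinity>" using I[OF S] by (simp add: le_less_trans)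
 qed
 have Linf\<theta>: "\<theta> \<in> L_inf m"
 proof -
  obtain C where C: "C < \<top>" "\<And>t. t >= 0 ==> hs m (amp (y t)) <= C"
   using mode_sol_bounded[OF c m P Q adv_mat_antisym[OF v, folded P_def] y(1)] by blast
  have "sobolev_norm m (\<theta> t) <= sqrt (enn2real C)" if t: "t >= 0" for t
  proof (rule real_le_rsqrt)
   have "ennreal ((sobolev_norm m (\<theta> t))^2) <= C"
    using order_trans[OF sobolev_norm_sq_le[of m "\<theta> t"], of C] C(2)[OF t] RS(3)[OF t] by simp
   then show "(sobolev_norm m (\<theta> t))^2 <= enn2real C"
    using C(1) by (metis enn2real_ennreal enn2real_mono zero_le_power2)
  qed
  then show ?thesis using tm\<theta> S unfolding L_inf_def by (intro CollectI conjI exI[of _ "sqrt (enn2real C)"] AE_I2) auto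
 qed
 define g where "g k t = - of_real (c * (norm (freq k))^2) * y t k - adv P (y t) k" for k t
 have gc: "continuous_on {0..} (g k)" for k unfolding g_def by (intro continuous_intros ac yc)
 have gm [measurable]: "g k \<in> borel_measurable (lebesgue_on {0..})" for k
  by (rule continuous_imp_measurable_on_sets_lebesgue[OF gc]) simp
 have P0: "P 0 l = 0" for l by (simp add: P_def adv_mat_def freq_simps)
 have g0: "g 0 t = 0" for t by (simp add: g_def adv_def P0 freq_simps)
 have hsg: "hs (m - 1) (amp (\<lambda>k. g k t)) <= 4 * (ennreal (c^2) * hs (m + 1) (amp (y t)) + alg m * hs m (vamp v) * hs m (amp (y t)))"
  if t: "t >= 0" for t
 proof -
  have "hs (m - 1) (amp (\<lambda>k. g k t)) <= hs (m - 1) (\<lambda>k. amp (\<lambda>k. of_real (c * (norm (freq k))^2) * y t k) k + amp (adv P (y t)) k)"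
  proof (rule hs_mono)
   fix k
   have "cmod (g k t) <= cmod (- of_real (c * (norm (freq k))^2) * y t k) + cmod (adv P (y t) k)"
    unfolding g_def by (rule norm_triangle_ineq4)
   also have "cmod (- of_real (c * (norm (freq k))^2) * y t k) = cmod (of_real (c * (norm (freq k))^2) * y t k)"
    by (simp only: norm_mult norm_minus_cancel)
   finally show "amp (\<lambda>k. g k t) k <= amp (\<lambda>k. of_real (c * (norm (freq k))^2) * y t k) k + amp (adv P (y t)) k"
    by (simp add: ennreal_leI flip: ennreal_plus)
  qed
  also have "... <= 4 * (hs (m - 1) (amp (\<lambda>k. of_real (c * (norm (freq k))^2) * y t k)) + hs (m - 1) (amp (adv P (y t))))"
   by (rule hs_add)
  also have "hs (m - 1) (amp (\<lambda>k. of_real (c * (norm (freq k))^2) * y t k)) = ennreal (c^2) * hs (m + 1) (amp (y t))"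
  proof -
   have "wt (m - 1) k * amp (\<lambda>k. of_real (c * (norm (freq k))^2) * y t k) k = wt (m + 1) k * (ennreal c * amp (y t) k)" for k
   proof (cases "k = 0")
    case False
    define n where "n = norm (freq k)"
    have n: "n > 0" using False by (simp add: n_def)
    have *: "n powr (m - 1) * n^2 = n powr (m + 1)" using n by (simp add: powr_add powr_diff power2_eq_square)
    have "n powr (m - 1) * (c * n^2 * cmod (y t k)) = n powr (m + 1) * (c * cmod (y t k))"
     unfolding *[symmetric] by (simp only: mult_ac)
    then show ?thesis using c by (simp add: wt_def norm_mult n_def[symmetric] norm_power flip: ennreal_mult)
   qed simp
   then have "hs (m - 1) (amp (\<lambda>k. of_real (c * (norm (freq k))^2) * y t k)) = hs (m + 1) (\<lambda>k. ennreal c * amp (y t) k)"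
    unfolding hs_def by (simp only:)
   then show ?thesis using c by (simp add: hs_cmult ennreal_power)
  qed
  also have "hs (m - 1) (amp (adv P (y t))) <= alg m * hs m (vamp v) * hs m (amp (y t))"
   by (rule hs_adv[OF m P]) (rule D(1)[OF t])
  finally show ?thesis by (simp add: mult_left_mono add_left_mono)
 qed
 have hsg_fin: "hs (m - 1) (amp (\<lambda>k. g k t)) < \<top>" if t: "t >= 0" "good t" for t by (rule le_less_trans[OF hsg[OF t(1)]])
   (use t(2) yfin[OF t(1)] Q alg_finite[OF m] in \<open>simp add: good_def ennreal_mult_less_top\<close>)
 \<comment> \<open>The time derivative, realised at good times and set to zero otherwise. On
   non-negative times this alters a null set only, and the coefficients remain measurable.\<close>
 define w where "w t = (if t >= 0 \<and> good t then SOME u. u \<in> L2_torus \<and> (\<forall>k. fourier_coeff u k = g k t) else (\<lambda>_. 0))" for t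
 have w1: "w t \<in> L2_torus \<and> (\<forall>k. fourier_coeff (w t) k = g k t)" if t: "t >= 0" "good t" for t
 proof -
  have "integrable freqs (\<lambda>k. (cmod (g k t))^2)" by (rule hs_imp_l2[of "m - 1"]) (use m g0 hsg_fin[OF t] in auto)
  moreover have "g (- k) t = cnj (g k t)" for k
  proof -
   have "adv P (y t) (- k) = cnj (adv P (y t) k)"
   proof -
    have "adv P (y t) (- k) = (LINT l|freqs. P (- k) (- l) * y t (- l))"
     unfolding adv_def by (rule integral_freqs_uminus[symmetric])
    also have "... = (LINT l|freqs. cnj (P k l * y t l))"
     by (rule Bochner_Integration.integral_cong) (simp_all only: P_def adv_mat_minus sym[OF t(1)] complex_cnj_mult)
    also have "... = cnj (adv P (y t) k)" unfolding adv_def by (rule Bochner_Integration.integral_cnj)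
    finally show ?thesis .
   qed
   then show ?thesis by (simp add: g_def sym[OF t(1)])
  qed
  ultimately have "\<exists>u. u \<in> L2_torus \<and> (\<forall>k. fourier_coeff u k = g k t)"
   using riesz_fischer_real[of "\<lambda>k. g k t"] by blast
  from someI_ex[OF this] show ?thesis using t by (simp add: w_def)
 qed
 have wc: "fourier_coeff (w t) k = (if good t then g k t else 0)" if "t >= 0" for t k
  using w1[OF that] by (auto simp: w_def that fourier_coeff_zero simp del: split_paired_All)
 have wS: "w t \<in> sobolev (m - 1)" if t: "t >= 0" "good t" for t
 proof -
  have "fourier_coeff (w t) = (\<lambda>k. g k t)" using w1[OF t] by auto
  then show ?thesis using w1[OF t] g0 hsg_fin[OF t] by (simp add: sobolev_iff)
 qed
 have wL2: "w \<in> L2_loc (m - 1)" unfolding L2_loc_def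
 proof (intro CollectI conjI allI impI)
  show "time_measurable w" unfolding time_measurable_def
  proof
   fix k
   have "(\<lambda>t. fourier_coeff (w t) k) \<in> borel_measurable (lebesgue_on {0..}) \<longleftrightarrow> (\<lambda>t. if good t then g k t else 0) \<in> borel_measurable (lebesgue_on {0..})"
    by (rule measurable_cong) (simp add: wc)
   also have "..." unfolding good_def by measurable
   finally show "(\<lambda>t. fourier_coeff (w t) k) \<in> borel_measurable (lebesgue_on {0..})" .
  qed
  show "AE t in lebesgue_on {0..}. w t \<in> sobolev (m - 1)" using goodAE nn0 by eventually_elim (use wS in auto)
  fix S :: real assume S: "S >= 0"
  obtain B where B: "B < \<top>" "\<And>t. t \<in> {0..S} ==> hs m (amp (y t)) <= B" using D(2)[of S] by blast
  have "(\<integral>\<^sup>+t. ennreal ((sobolev_norm (m - 1) (w t))^2) \<partial>tm S)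
    <= (\<integral>\<^sup>+ t. 4 * (ennreal (c^2) * hs (m + 1) (amp (y t)) + alg m * hs m (vamp v) * B) \<partial>tm S)"
  proof (rule nn_integral_mono)
   fix t assume "t \<in> space (tm S)"
   then have t: "t \<in> {0..S}" by simp
   have "ennreal ((sobolev_norm (m - 1) (w t))^2) <= hs (m - 1) (amp (fourier_coeff (w t)))"
    by (rule sobolev_norm_sq_le)
   also have "... <= hs (m - 1) (amp (\<lambda>k. g k t))" by (rule hs_mono) (use t wc in auto)
   also have "... <= 4 * (ennreal (c^2) * hs (m + 1) (amp (y t)) + alg m * hs m (vamp v) * hs m (amp (y t)))"
    by (rule hsg) (use t in simp)
   also have "... <= 4 * (ennreal (c^2) * hs (m + 1) (amp (y t)) + alg m * hs m (vamp v) * B)"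
    by (intro mult_left_mono add_left_mono B t) auto
   finally show "ennreal ((sobolev_norm (m - 1) (w t))^2) <= 4 * (ennreal (c^2) * hs (m + 1) (amp (y t)) + alg m * hs m (vamp v) * B)" .
  qed
  also have "... = 4 * (ennreal (c^2) * (\<integral>\<^sup>+ t. hs (m + 1) (amp (y t)) \<partial>tm S) + alg m * hs m (vamp v) * B * emeasure (tm S) (space (tm S)))"
  proof -
   have "(\<integral>\<^sup>+ t. 4 * (ennreal (c^2) * hs (m + 1) (amp (y t)) + alg m * hs m (vamp v) * B) \<partial>tm S)
     = 4 * (\<integral>\<^sup>+ t. ennreal (c^2) * hs (m + 1) (amp (y t)) + alg m * hs m (vamp v) * B \<partial>tm S)"
    by (rule nn_integral_cmult) measurable
   also have "(\<integral>\<^sup>+ t. ennreal (c^2) * hs (m + 1) (amp (y t)) + alg m * hs m (vamp v) * B \<partial>tm S)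
     = (\<integral>\<^sup>+ t. ennreal (c^2) * hs (m + 1) (amp (y t)) \<partial>tm S) + (\<integral>\<^sup>+ t. alg m * hs m (vamp v) * B \<partial>tm S)"
    by (rule nn_integral_add) measurable
   also have "(\<integral>\<^sup>+ t. ennreal (c^2) * hs (m + 1) (amp (y t)) \<partial>tm S) = ennreal (c^2) * (\<integral>\<^sup>+ t. hs (m + 1) (amp (y t)) \<partial>tm S)"
    by (rule nn_integral_cmult) measurable
   finally show ?thesis by (simp only: nn_integral_const)
  qed
  also have "... < \<top>"
   using I[OF S] B(1) Q alg_finite[OF m] S by (simp add: ennreal_mult_less_top emeasure_restrict_space)
  finally show "(\<integral>\<^sup>+t. ennreal ((sobolev_norm (m - 1) (w t))^2) \<partial>tm S) < \<infinity>" by simp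
 qed
 have htd: "has_time_deriv \<theta> w" unfolding has_time_deriv_def
 proof (intro allI impI)
  fix t :: real and k assume t: "t >= 0"
  have gi: "integrable (tm t) (g k)" by (rule continuous_imp_integrable_real[OF continuous_on_subset[OF gc]]) auto
  have ae: "AE r in tm t. fourier_coeff (w r) k = g k r"
  proof -
   have "AE r in lebesgue. r \<in> {0..} \<longrightarrow> good r" using goodAE by (subst (asm) AE_restrict_space_iff) auto
   then have "AE r in lebesgue. r \<in> {0..t} \<longrightarrow> fourier_coeff (w r) k = g k r" by eventually_elim (use wc in auto)
   then show ?thesis by (subst AE_restrict_space_iff) auto
  qed
  have wm: "(\<lambda>r. fourier_coeff (w r) k) \<in> borel_measurable (tm t)"
  proof -
   have "(\<lambda>r. fourier_coeff (w r) k) \<in> borel_measurable (lebesgue_on {0..})"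
    using wL2 unfolding L2_loc_def time_measurable_def by blast
   then have "(\<lambda>r. fourier_coeff (w r) k) \<in> borel_measurable (restrict_space (lebesgue_on {0..}) {0..t})"
    by (rule measurable_restrict_space1)
   then show ?thesis by (subst (asm) restrict_restrict_space) (auto simp: Int_absorb1)
  qed
  have "integrable (tm t) (\<lambda>r. fourier_coeff (w r) k)"
   using gi integrable_cong_AE[OF wm borel_measurable_integrable[OF gi] ae] by blast
  moreover have "fourier_coeff (\<theta> t) k = fourier_coeff (\<theta> 0) k + (LINT r|tm t. fourier_coeff (w r) k)"
  proof -
   have "(LINT r|tm t. fourier_coeff (w r) k) = (LINT r|tm t. g k r)"
    by (rule integral_cong_AE[OF wm borel_measurable_integrable[OF gi] ae])
   also have "... = integral {0..t} (g k)" by (rule lebesgue_integral_eq_integral[OF gi]) auto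
   also have "... = y t k - y 0 k" using integral_of_derivative[of "\<lambda>t. y t k" "g k", OF _ t] D(3) unfolding g_def
    by (intro integral_unique) blast
   finally show ?thesis using RS(3)[OF t] RS(3)[of 0] by simp
  qed
  ultimately show "integrable (tm t) (\<lambda>r. fourier_coeff (w r) k) \<and>
    fourier_coeff (\<theta> t) k = fourier_coeff (\<theta> 0) k + (LINT r|tm t. fourier_coeff (w r) k)" by blast
 qed
 have weak: "AE t in lebesgue_on {0..}. \<forall>\<phi> \<in> sobolev 1.
      L2_inner (w t) \<phi> + L2_inner (\<lambda>x. v x \<bullet> grad (\<theta> t) x) \<phi> + \<kappa> * (LINT x|torus. grad (\<theta> t) x \<bullet> grad \<phi> x) = 0"
  using goodAE nn0
 proof eventually_elim
  case (elim t)
  then have t: "t >= 0" "good t" by auto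
  show ?case by (subst weak_form_iff[OF m v S[OF t(1)]])
    (use w1[OF t] RS(3)[OF t(1)] in \<open>auto simp: g_def c_def P_def simp del: split_paired_All\<close>)
 qed
 have "weak_solution \<kappa> m v \<theta>0 \<theta>" unfolding weak_solution_def using tc RS(1) init L2\<theta> Linf\<theta> wL2 htd weak by blast
 then show ?thesis by (rule exI[of _ \<theta>])
qed

section \<open>The space of divergence-free fields\<close>

text \<open>Both components enter one amplitude through the Euclidean norm of C^2: the triangle
  inequality then holds at each frequency, and the norm of the field is reproduced exactly.\<close>

definition vnorm :: "(int \<times> int => complex) => (int \<times> int => complex) => int \<times> int => ennreal" where
 "vnorm a b k = ennreal (norm (a k, b k))"

lemma hs_vnorm: "hs s (vnorm a b) = hs s (amp a) + hs s (amp b)"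
proof -
 have "(wt s k * vnorm a b k)^2 = (wt s k * amp a k)^2 + (wt s k * amp b k)^2" for k
  by (simp add: power_mult_distrib vnorm_def norm_Pair ennreal_power distrib_left)
 then show ?thesis unfolding hs_def by (simp add: nn_integral_add)
qed

lemma div_free_norm_sq:
 assumes "hs s (vnorm (vc v) (vc' v)) < \<top>"
 shows "hs s (vnorm (vc v) (vc' v)) = ennreal ((div_free_norm s v)^2)"
proof -
 let ?g = "\<lambda>k. (cmod (vc v k))^2 + (cmod (vc' v k))^2"
 have e: "hs s (vnorm (vc v) (vc' v)) = (\<integral>\<^sup>+ k. (wt s k)^2 * ennreal (?g k) \<partial>freqs)"
  unfolding hs_def by (simp add: power_mult_distrib vnorm_def norm_Pair ennreal_power)
 have "(div_free_norm s v)^2 = (\<Sum>\<^sub>\<infinity>k\<in>- {0}. norm (freq k) powr (2 * s) * ?g k)"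
  unfolding div_free_norm_def vc_def vc'_def by (rule real_sqrt_pow2) (auto intro!: infsum_nonneg mult_nonneg_nonneg)
 then show ?thesis using summable_on_minus_0_iff(3)[of ?g s] assms unfolding e by simp
qed

lemma div_free_norm_nonneg: "div_free_norm s v >= 0"
 unfolding div_free_norm_def by (auto intro!: infsum_nonneg mult_nonneg_nonneg)

lemma div_free_hs_finite:
 assumes "v \<in> div_free s" shows "hs s (vnorm (vc v) (vc' v)) < \<top>"
 using div_free_D(2,3)[OF assms] by (simp add: hs_vnorm vc_def vc'_def sobolev_iff)

lemma vnorm_le: "vnorm (\<lambda>k. a k - a' k) (\<lambda>k. b k - b' k) k <= vnorm a b k + vnorm a' b' k"
 using norm_triangle_ineq4[of "(a k, b k)" "(a' k, b' k)"] by (simp add: vnorm_def ennreal_leI flip: ennreal_plus)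

text \<open>A metric needs the triangle inequality with constant 1, which \<open>hs_add\<close> does
  not give; here the cross term is estimated by Cauchy-Schwarz.\<close>

lemma minkowski:
 assumes A: "hs s a = ennreal (A^2)" "A >= 0" and B: "hs s b = ennreal (B^2)" "B >= 0"
  and C: "\<And>k. c k <= a k + b k" "hs s c = ennreal (C^2)" "C >= 0"
 shows "C <= A + B"
proof -
 let ?a = "\<lambda>k. wt s k * a k" and ?b = "\<lambda>k. wt s k * b k"
 define X where "X = (\<integral>\<^sup>+ k. ?a k * ?b k \<partial>freqs)"
 have "X^2 <= hs s a * hs s b" unfolding X_def hs_def by (rule Cauchy_Schwarz_nn_integral) auto
 also have "... = ennreal ((A * B)^2)" unfolding A B by (simp add: power_mult_distrib ennreal_mult)
 finally have X2: "X^2 <= ennreal ((A * B)^2)" .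
 then have "X < \<top>" by (cases X) (auto simp: power2_eq_square top_unique)
 then obtain x where x: "X = ennreal x" "x >= 0" by (cases X) auto
 have "x^2 <= (A * B)^2" using X2 x by (simp add: ennreal_power)
 then have xAB: "x <= A * B" using A B by (rule_tac power2_le_imp_le) auto
 have "hs s c <= hs s (\<lambda>k. a k + b k)" by (rule hs_mono) (rule C)
 also have "... = (\<integral>\<^sup>+ k. (?a k)^2 + (2 * (?a k * ?b k) + (?b k)^2) \<partial>freqs)"
  unfolding hs_def by (intro nn_integral_cong) (simp add: power2_eq_square algebra_simps mult_2)
 also have "... = hs s a + (2 * X + hs s b)" unfolding hs_def X_def by (simp add: nn_integral_add nn_integral_cmult)
 also have "... = ennreal (A^2 + (2 * x + B^2))" unfolding A B x using x(2) ennreal_mult[of 2 x] by simp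
 finally have "C^2 <= A^2 + (2 * x + B^2)" unfolding C(2) by (subst (asm) ennreal_le_iff) (use x(2) in auto)
 also have "... <= (A + B)^2" using xAB by (simp add: power2_eq_square algebra_simps)
 finally show ?thesis using A B by (rule_tac power2_le_imp_le) auto
qed

lemma div_free_dist_sq:
 assumes "v \<in> div_free s" "w \<in> div_free s"
 shows "hs s (vnorm (\<lambda>k. vc v k - vc w k) (\<lambda>k. vc' v k - vc' w k)) = ennreal ((div_free_dist s v w)^2)"
proof -
 have fin: "hs s (vnorm (\<lambda>k. vc v k - vc w k) (\<lambda>k. vc' v k - vc' w k)) < \<top>"
 proof -
  have "hs s (vnorm (\<lambda>k. vc v k - vc w k) (\<lambda>k. vc' v k - vc' w k))
    <= hs s (\<lambda>k. vnorm (vc v) (vc' v) k + vnorm (vc w) (vc' w) k)" by (rule hs_mono) (rule vnorm_le)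
  also have "... <= 4 * (hs s (vnorm (vc v) (vc' v)) + hs s (vnorm (vc w) (vc' w)))" by (rule hs_add)
  also have "... < \<top>" using div_free_hs_finite assms by (simp add: ennreal_mult_less_top)
  finally show ?thesis .
 qed
 then show ?thesis using div_free_norm_sq[of s "\<lambda>x. v x - w x"]
  unfolding adv_mat_diff(2,3)[OF assms] div_free_dist_def by blast
qed

lemma div_free_dist_nonneg: "div_free_dist s v w >= 0" unfolding div_free_dist_def by (rule div_free_norm_nonneg)

lemma div_free_ext:
 assumes "m > 1" "v \<in> div_free m" "w \<in> div_free m" "\<And>k. vc v k = vc w k" "\<And>k. vc' v k = vc' w k"
 shows "v = w"
proof
 fix x
 have "vc v = vc w" "vc' v = vc' w" using assms by auto
 then have "complex_of_real (fst (v x)) = of_real (fst (w x))" "complex_of_real (snd (v x)) = of_real (snd (w x))"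
  using vc_l1(3,4)[OF assms(1,2), of x] vc_l1(3,4)[OF assms(1,3), of x] by simp_all
 then show "v x = w x" by (simp add: prod_eq_iff)
qed

lemma div_free_dist_commute: "div_free_dist s v w = div_free_dist s w v"
proof -
 have n: "cmod (fourier_coeff (p \<circ> (\<lambda>x. v x - w x)) k) = cmod (fourier_coeff (p \<circ> (\<lambda>x. w x - v x)) k)"
  if "\<And>x. p (- x) = - p x" for p :: "real \<times> real => real" and k
 proof -
  have "(p \<circ> (\<lambda>x. v x - w x)) = (\<lambda>x. - (p \<circ> (\<lambda>x. w x - v x)) x)" using that[of "w _ - v _"] by auto
  then have "fourier_coeff (p \<circ> (\<lambda>x. v x - w x)) k = - fourier_coeff (p \<circ> (\<lambda>x. w x - v x)) k"
   by (simp add: fourier_coeff_def)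
  then show ?thesis by simp
 qed
 have "cmod (fourier_coeff (fst \<circ> (\<lambda>x. v x - w x)) k) = cmod (fourier_coeff (fst \<circ> (\<lambda>x. w x - v x)) k)"
  "cmod (fourier_coeff (snd \<circ> (\<lambda>x. v x - w x)) k) = cmod (fourier_coeff (snd \<circ> (\<lambda>x. w x - v x)) k)" for k
  by (rule n, simp)+
 then show ?thesis unfolding div_free_dist_def div_free_norm_def by (simp only:)
qed

lemma Metric_space_div_free:
 assumes m: "m > 1" shows "Metric_space (div_free m) (div_free_dist m)"
proof
 show "0 <= div_free_dist m v w" for v w by (rule div_free_dist_nonneg)
 show "div_free_dist m v w = div_free_dist m w v" for v w by (rule div_free_dist_commute)
 show "(div_free_dist m v w = 0) = (v = w)" if v: "v \<in> div_free m" and w: "w \<in> div_free m" for v w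
 proof
  assume "div_free_dist m v w = 0"
  then have "hs m (vnorm (\<lambda>k. vc v k - vc w k) (\<lambda>k. vc' v k - vc' w k)) = 0" using div_free_dist_sq[OF v w] by simp
  then have z: "(wt m k * vnorm (\<lambda>k. vc v k - vc w k) (\<lambda>k. vc' v k - vc' w k) k)^2 = 0" for k
   using hs_point[of m k "vnorm (\<lambda>k. vc v k - vc w k) (\<lambda>k. vc' v k - vc' w k)"] by (metis le_zero_eq)
  have "vc v k = vc w k \<and> vc' v k = vc' w k" for k
  proof (cases "k = 0")
   case True then show ?thesis using div_free_D[OF v] div_free_D[OF w] by simp
  next
   case False then show ?thesis using z[of k] wt_pos[OF False, of m] by (auto simp: vnorm_def zero_prod_def)
  qed
  then show "v = w" by (intro div_free_ext[OF m v w]) auto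
 next
  assume "v = w"
  then have "ennreal ((div_free_dist m v w)^2) = 0" using div_free_dist_sq[OF v w] by (simp add: hs_def vnorm_def)
  then show "div_free_dist m v w = 0" by simp
 qed
 show "div_free_dist m u w <= div_free_dist m u v + div_free_dist m v w"
  if "u \<in> div_free m" "v \<in> div_free m" "w \<in> div_free m" for u v w
 proof (rule minkowski[OF div_free_dist_sq[OF that(1,2)] div_free_dist_nonneg div_free_dist_sq[OF that(2,3)] div_free_dist_nonneg _ div_free_dist_sq[OF that(1,3)] div_free_dist_nonneg])
  fix k
  have "(vc u k - vc w k, vc' u k - vc' w k) = (vc u k - vc v k, vc' u k - vc' v k) + (vc v k - vc w k, vc' v k - vc' w k)"
   by simp
  then have "norm (vc u k - vc w k, vc' u k - vc' w k) <= norm (vc u k - vc v k, vc' u k - vc' v k) + norm (vc v k - vc w k, vc' v k - vc' w k)"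
   by (metis norm_triangle_ineq)
  then show "vnorm (\<lambda>k. vc u k - vc w k) (\<lambda>k. vc' u k - vc' w k) k
   <= vnorm (\<lambda>k. vc u k - vc v k) (\<lambda>k. vc' u k - vc' v k) k + vnorm (\<lambda>k. vc v k - vc w k) (\<lambda>k. vc' v k - vc' w k) k"
   by (simp add: vnorm_def ennreal_leI flip: ennreal_plus)
 qed
qed

lemma div_free_mono:
 assumes "s <= r" "v \<in> div_free r" shows "v \<in> div_free s"
 using assms sobolev_mono[OF assms(1)] by (auto simp: div_free_def)

lemma div_free_dist_mono:
 assumes "s <= r" "v \<in> div_free r" "w \<in> div_free r"
 shows "div_free_dist s v w <= div_free_dist r v w"
proof -
 have "ennreal ((div_free_dist s v w)^2) <= ennreal ((div_free_dist r v w)^2)"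
  unfolding div_free_dist_sq[OF assms(2,3), symmetric]
   div_free_dist_sq[OF div_free_mono[OF assms(1,2)] div_free_mono[OF assms(1,3)], symmetric]
  by (rule hs_mono_exp[OF assms(1)])
 then have "(div_free_dist s v w)^2 <= (div_free_dist r v w)^2" by (subst (asm) ennreal_le_iff) auto
 then show ?thesis by (rule power2_le_imp_le[OF _ div_free_dist_nonneg])
qed

lemma zero_div_free: "(\<lambda>_. 0) \<in> div_free s"
proof -
 have f: "fst \<circ> (\<lambda>_. 0) = (\<lambda>_::real\<times>real. 0::real)" "snd \<circ> (\<lambda>_. 0) = (\<lambda>_::real\<times>real. 0::real)" by auto
 have "(\<lambda>_. 0) \<in> sobolev s" by (simp add: sobolev_iff L2_torus_def periodic_def fourier_coeff_zero hs_def)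
 then show ?thesis by (auto simp: div_free_def f fourier_coeff_zero intro!: exI[of _ 0])
qed

lemma div_free_norm_eq_dist: "div_free_norm s v = div_free_dist s v (\<lambda>_. 0)" by (simp add: div_free_dist_def)

subsection \<open>Compactness\<close>

lemma div_free_of_coeffs:
 assumes m: "m > 1" and L: "hs m (amp a) < \<top>" "hs m (amp b) < \<top>" "a 0 = 0" "b 0 = 0"
  and sym: "\<And>k. a (- k) = cnj (a k)" "\<And>k. b (- k) = cnj (b k)"
  and div: "\<And>k. of_real (fst (freq k)) * a k + of_real (snd (freq k)) * b k = 0"
 obtains u where "u \<in> div_free m" "vc u = a" "vc' u = b"
proof -
 define u where "u x = (Re (series a x), Re (series b x))" for x
 note A = real_series[OF hs_imp_l1(1)[OF m L(3,1)] sym(1)]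
 note B = real_series[OF hs_imp_l1(1)[OF m L(4,2)] sym(2)]
 have c: "fst \<circ> u = (\<lambda>x. Re (series a x))" "snd \<circ> u = (\<lambda>x. Re (series b x))" by (auto simp: u_def)
 have v: "vc u = a" "vc' u = b" using A(3) B(3) by (auto simp: vc_def vc'_def c)
 have co: "continuous_on UNIV u" unfolding u_def by (intro continuous_on_Pair A(1) B(1))
 have S: "fst \<circ> u \<in> sobolev m" "snd \<circ> u \<in> sobolev m" using A(2) B(2) L v by (auto simp: sobolev_iff c vc_def vc'_def)
 have "\<exists>\<alpha>::complex. a k = \<alpha> * of_real (fst (perp (freq k)) / norm (freq k)) \<and> b k = \<alpha> * of_real (snd (perp (freq k)) / norm (freq k))"
  if k: "k \<noteq> 0" for k
 proof -
  define p q where "p = complex_of_real (fst (freq k))" and "q = complex_of_real (snd (freq k))"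
  define n where "n = complex_of_real (norm (freq k))"
  have n: "n \<noteq> 0" using k by (simp add: n_def)
  have n2: "n * n = p * p + q * q"
  proof -
   have "norm (freq k) * norm (freq k) = fst (freq k) * fst (freq k) + snd (freq k) * snd (freq k)"
    by (simp add: freq_def norm_Pair power2_eq_square[symmetric])
   then show ?thesis unfolding n_def p_def q_def by (simp flip: of_real_mult of_real_add)
  qed
  have d: "p * a k + q * b k = 0" using div[of k] by (simp add: p_def q_def)
  \<comment> \<open>The component of the coefficient along the unit vector perpendicular to the
    frequency; the component along the frequency vanishes by the divergence condition.\<close>
  define \<alpha> where "\<alpha> = (p * b k - q * a k) / n"
  have "\<alpha> * (- q / n) = ((q * q) * a k - p * (q * b k)) / (n * n)"
   by (simp add: \<alpha>_def algebra_simps diff_divide_distrib)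
  also have "q * b k = - (p * a k)" using d by (simp add: eq_neg_iff_add_eq_0 add.commute)
  also have "((q * q) * a k - p * - (p * a k)) / (n * n) = a k"
  proof -
   have "(q * q) * a k - p * - (p * a k) = (n * n) * a k" unfolding n2 by (simp add: algebra_simps)
   then show ?thesis using n by simp
  qed
  finally have 1: "\<alpha> * (- q / n) = a k" .
  have "\<alpha> * (p / n) = ((p * p) * b k - q * (p * a k)) / (n * n)"
   by (simp add: \<alpha>_def algebra_simps diff_divide_distrib)
  also have "p * a k = - (q * b k)" using d by (simp add: eq_neg_iff_add_eq_0)
  also have "((p * p) * b k - q * - (q * b k)) / (n * n) = b k"
  proof -
   have "(p * p) * b k - q * - (q * b k) = (n * n) * b k" unfolding n2 by (simp add: algebra_simps)
   then show ?thesis using n by simp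
  qed
  finally have 2: "\<alpha> * (p / n) = b k" .
  show ?thesis by (rule exI[of _ \<alpha>]) (use 1 2 in \<open>simp add: perp_def p_def q_def n_def\<close>)
 qed
 then have "u \<in> div_free m" using co S v unfolding div_free_def vc_def vc'_def by (simp del: split_paired_All)
 then show thesis using that v by blast
qed

text \<open>Outside the box |k| is at least n, so lowering the exponent from r to s gains the factor
  n^(s - r), which enters squared.\<close>

lemma hs_split:
 assumes "s <= r" "n >= 1"
 shows "hs s A <= (\<Sum>k\<in>box_freqs n. (wt s k * A k)^2) + ennreal (real n powr (2 * (s - r))) * hs r A"
proof -
 have "(wt s k * A k)^2 <= (wt s k * A k)^2 * indicator (box_freqs n) k + ennreal (real n powr (2 * (s - r))) * (wt r k * A k)^2" for k
 proof (cases "k \<in> box_freqs n")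
  case False
  have nk: "real n <= norm (freq k)"
  proof -
   have "real n <= \<bar>real_of_int (fst k)\<bar> \<or> real n <= \<bar>real_of_int (snd k)\<bar>"
    using False by (cases k) (auto simp: box_freqs_def)
   then show ?thesis using norm_fst_le[of "real_of_int (fst k)" "real_of_int (snd k)"]
     norm_snd_le[of "real_of_int (snd k)" "real_of_int (fst k)"] by (auto simp: freq_def)
  qed
  have "norm (freq k) powr s = norm (freq k) powr (s - r) * norm (freq k) powr r" by (simp flip: powr_add)
  also have "... <= real n powr (s - r) * norm (freq k) powr r"
   using assms nk by (intro mult_right_mono powr_mono2') auto
  finally have "wt s k <= ennreal (real n powr (s - r)) * wt r k"
   unfolding wt_def by (simp add: ennreal_leI flip: ennreal_mult)
  then have "(wt s k * A k)^2 <= (ennreal (real n powr (s - r)) * wt r k * A k)^2"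
   by (intro power_mono mult_right_mono) auto
  also have "... = ennreal ((real n powr (s - r))^2) * (wt r k * A k)^2"
   by (simp add: power_mult_distrib ennreal_power mult.assoc)
  also have "(real n powr (s - r))^2 = real n powr (2 * (s - r))" by (simp add: power2_eq_square flip: powr_add)
  finally show ?thesis using False by simp
 qed simp
 then have "hs s A <= (\<integral>\<^sup>+ k. (wt s k * A k)^2 * indicator (box_freqs n) k + ennreal (real n powr (2 * (s - r))) * (wt r k * A k)^2 \<partial>freqs)"
  unfolding hs_def by (intro nn_integral_mono)
 also have "... = (\<integral>\<^sup>+ k. (wt s k * A k)^2 * indicator (box_freqs n) k \<partial>freqs) + ennreal (real n powr (2 * (s - r))) * hs r A"
  unfolding hs_def by (simp add: nn_integral_add nn_integral_cmult)
 also have "(\<integral>\<^sup>+ k. (wt s k * A k)^2 * indicator (box_freqs n) k \<partial>freqs) = (\<Sum>k\<in>box_freqs n. (wt s k * A k)^2)"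
  by (subst nn_integral_count_space'[of "box_freqs n"]) (auto intro: sum.cong)
 finally show ?thesis .
qed

text \<open>Rellich compactness on the Fourier side: a diagonal subsequence converges at every
  frequency, Fatou keeps the limit in the ball of the stronger norm, and \<open>hs_split\<close>
  makes the tails uniformly small in the weaker one.\<close>

lemma div_free_compact:
 assumes m: "m > 1" and mm: "m < m'" and v: "\<And>n. v n \<in> div_free m'" "\<And>n. div_free_norm m' (v n) <= R"
 obtains u r where "u \<in> div_free m'" "div_free_norm m' u <= R" "strict_mono (r :: nat => nat)"
  "(\<lambda>n. div_free_dist m (v (r n)) u) \<longlonglongrightarrow> 0"
proof -
 have R: "R >= 0" by (rule order_trans[OF div_free_norm_nonneg v(2)])
 have m': "m' > 1" using m mm by simp
 have hR: "hs m' (vnorm (vc (v n)) (vc' (v n))) <= ennreal (R^2)" for n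
  unfolding div_free_norm_sq[OF div_free_hs_finite[OF v(1)]]
  by (intro ennreal_leI power_mono v(2) div_free_norm_nonneg)
 define f where "f n k = (vc (v n) k, vc' (v n) k)" for n k
 have bd: "norm (f n k) <= R" for n k
 proof -
  have h: "hs m' (amp (\<lambda>k. complex_of_real (norm (f n k)))) <= ennreal (R^2)"
   using hR[of n] by (simp add: vnorm_def[abs_def] f_def)
  have "cmod (complex_of_real (norm (f n k))) <= sqrt (enn2real (ennreal (R^2)))"
   by (rule mode_bound[OF _ h]) (use m' div_free_D[OF v(1)] in \<open>auto simp: f_def norm_Pair\<close>)
  then show ?thesis using R by simp
 qed
 define e where "e = (from_nat_into (UNIV :: (int \<times> int) set))"
 interpret S: subseqs "\<lambda>n s. convergent (\<lambda>i. f (s i) (e n))"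
 proof
  fix n and s :: "nat => nat"
  have "bounded (range (\<lambda>i. f (s i) (e n)))" by (auto intro!: boundedI[of _ R] bd)
  then obtain l r' where "strict_mono r'" "((\<lambda>i. f (s i) (e n)) \<circ> r') \<longlonglongrightarrow> l"
   using bounded_imp_convergent_subsequence by blast
  then show "\<exists>r'. strict_mono r' \<and> convergent (\<lambda>i. f ((s \<circ> r') i) (e n))"
   by (auto simp: convergent_def comp_def simp del: split_paired_Ex)
 qed
 define r where "r = S.diagseq"
 have r: "strict_mono r" unfolding r_def by (rule S.subseq_diagseq)
 have conv: "convergent (\<lambda>i. f (r i) k)" for k
 proof -
  obtain n where n: "e n = k" using from_nat_into_surj[of UNIV k] by (auto simp: e_def)
  have "convergent (\<lambda>i. f ((r \<circ> (+) (Suc n)) i) (e n))" unfolding r_def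
  proof (rule S.diagseq_holds)
   fix \<rho> s :: "nat => nat" and n assume "strict_mono \<rho>" "convergent (\<lambda>i. f (s i) (e n))"
   then show "convergent (\<lambda>i. f ((s \<circ> \<rho>) i) (e n))"
    using convergent_subseq_convergent[of "\<lambda>i. f (s i) (e n)" \<rho>] by (simp add: comp_def)
  qed
  then have "convergent (\<lambda>i. f (r (i + Suc n)) (e n))" by (simp add: comp_def add.commute)
  then show ?thesis using convergent_ignore_initial_segment[of "\<lambda>i. f (r i) (e n)" "Suc n"] n by simp
 qed
 define a b where "a k = fst (lim (\<lambda>i. f (r i) k))" and "b k = snd (lim (\<lambda>i. f (r i) k))" for k
 have lim: "(\<lambda>i. vc (v (r i)) k) \<longlonglongrightarrow> a k" "(\<lambda>i. vc' (v (r i)) k) \<longlonglongrightarrow> b k" for k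
  using tendsto_fst[OF convergent_LIMSEQ_iff[THEN iffD1, OF conv[of k]]]
   tendsto_snd[OF convergent_LIMSEQ_iff[THEN iffD1, OF conv[of k]]] by (auto simp: a_def b_def f_def)
 have hab: "hs m' (vnorm a b) <= ennreal (R^2)"
 proof -
  have "hs m' (vnorm a b) = (\<integral>\<^sup>+ k. liminf (\<lambda>i. (wt m' k * vnorm (vc (v (r i))) (vc' (v (r i))) k)^2) \<partial>freqs)"
   unfolding hs_def
  proof (rule nn_integral_cong)
   fix k
   have "(\<lambda>i. ennreal ((norm (freq k) powr m' * norm (vc (v (r i)) k, vc' (v (r i)) k))^2))
     \<longlonglongrightarrow> ennreal ((norm (freq k) powr m' * norm (a k, b k))^2)" by (intro tendsto_intros lim)
   then have "(\<lambda>i. (wt m' k * vnorm (vc (v (r i))) (vc' (v (r i))) k)^2) \<longlonglongrightarrow> (wt m' k * vnorm a b k)^2"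
    by (simp add: wt_def vnorm_def ennreal_power flip: ennreal_mult)
   from lim_imp_Liminf[OF _ this] show "(wt m' k * vnorm a b k)^2 = liminf (\<lambda>i. (wt m' k * vnorm (vc (v (r i))) (vc' (v (r i))) k)^2)"
    by simp
  qed
  also have "... <= liminf (\<lambda>i. \<integral>\<^sup>+ k. (wt m' k * vnorm (vc (v (r i))) (vc' (v (r i))) k)^2 \<partial>freqs)"
   by (rule nn_integral_liminf) auto
  also have "... <= liminf (\<lambda>i. ennreal (R^2))" by (intro Liminf_mono always_eventually allI) (rule hR[unfolded hs_def])
  also have "... = ennreal (R^2)" by (rule Liminf_const) simp
  finally show ?thesis .
 qed
 then have "hs m' (vnorm a b) < \<top>" by (rule le_less_trans) simp
 then have fin: "hs m' (amp a) < \<top>" "hs m' (amp b) < \<top>" unfolding hs_vnorm by auto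
 obtain u where u: "u \<in> div_free m'" "vc u = a" "vc' u = b"
 proof (rule div_free_of_coeffs[OF m' fin])
  show "a 0 = 0" "b 0 = 0" using lim[of 0] div_free_D(4,5)[OF v(1)] by (simp_all add: LIMSEQ_const_iff)
  show "a (- k) = cnj (a k)" for k
   using LIMSEQ_unique[OF lim(1)[of "- k"]] tendsto_cnj[OF lim(1)[of k]] by (simp add: vc_minus)
  show "b (- k) = cnj (b k)" for k
   using LIMSEQ_unique[OF lim(2)[of "- k"]] tendsto_cnj[OF lim(2)[of k]] by (simp add: vc_minus)
  fix k
  have "(\<lambda>i. of_real (fst (freq k)) * vc (v (r i)) k + of_real (snd (freq k)) * vc' (v (r i)) k)
    \<longlonglongrightarrow> of_real (fst (freq k)) * a k + of_real (snd (freq k)) * b k" by (intro tendsto_intros lim)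
  then show "of_real (fst (freq k)) * a k + of_real (snd (freq k)) * b k = 0"
   using div_free_D(6)[OF v(1)] by (simp add: LIMSEQ_const_iff)
 qed (rule that)
 have uR: "div_free_norm m' u <= R"
 proof -
  have "ennreal ((div_free_norm m' u)^2) <= ennreal (R^2)"
   using hab div_free_norm_sq[OF div_free_hs_finite[OF u(1)]] unfolding u by simp
  then have "(div_free_norm m' u)^2 <= R^2" by (subst (asm) ennreal_le_iff) auto
  then show ?thesis by (rule power2_le_imp_le[OF _ R])
 qed
 define Z where "Z i = vnorm (\<lambda>k. vc (v (r i)) k - vc u k) (\<lambda>k. vc' (v (r i)) k - vc' u k)" for i
 have Zr: "hs m' (Z i) <= ennreal (8 * R^2)" for i
 proof -
  have "hs m' (Z i) <= hs m' (\<lambda>k. vnorm (vc (v (r i))) (vc' (v (r i))) k + vnorm (vc u) (vc' u) k)"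
   unfolding Z_def by (rule hs_mono) (rule vnorm_le)
  also have "... <= 4 * (hs m' (vnorm (vc (v (r i))) (vc' (v (r i)))) + hs m' (vnorm (vc u) (vc' u)))" by (rule hs_add)
  also have "... <= 4 * (ennreal (R^2) + ennreal (R^2))" using hab hR unfolding u by (intro mult_left_mono add_mono) auto
  also have "... = ennreal (8 * R^2)"
   using ennreal_mult[of 8 "R^2"] by (simp add: mult_2[symmetric] mult.assoc[symmetric])
  finally show ?thesis .
 qed
 have Zd: "hs m (Z i) = ennreal ((div_free_dist m (v (r i)) u)^2)" for i
  unfolding Z_def by (rule div_free_dist_sq) (use v u mm div_free_mono[of m m'] in auto)
 have "(\<lambda>i. div_free_dist m (v (r i)) u) \<longlonglongrightarrow> 0"
 proof (rule LIMSEQ_I)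
  fix \<epsilon> :: real assume \<epsilon>: "\<epsilon> > 0"
  have "(\<lambda>n. real n powr (2 * (m - m')) * (8 * R^2)) \<longlonglongrightarrow> 0 * (8 * R^2)"
   using tendsto_neg_powr[OF _ filterlim_real_sequentially, of "2 * (m - m')"] mm by (intro tendsto_mult tendsto_const) simp
  then have "\<forall>\<^sub>F n in sequentially. real n powr (2 * (m - m')) * (8 * R^2) < \<epsilon>^2 / 2"
   using \<epsilon> by (intro order_tendstoD) auto
  then obtain n0 where n0: "\<And>n. n >= n0 ==> real n powr (2 * (m - m')) * (8 * R^2) < \<epsilon>^2 / 2"
   by (auto simp: eventually_sequentially)
  define n where "n = max 1 n0"
  have n: "n >= 1" "real n powr (2 * (m - m')) * (8 * R^2) < \<epsilon>^2 / 2" using n0[of n] by (auto simp: n_def)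
  define s where "s i = (\<Sum>k\<in>box_freqs n. (norm (freq k) powr m * norm (vc (v (r i)) k - vc u k, vc' (v (r i)) k - vc' u k))^2)" for i
  have "s \<longlonglongrightarrow> (\<Sum>k\<in>box_freqs n. (norm (freq k) powr m * norm (vc u k - vc u k, vc' u k - vc' u k))^2)"
   unfolding s_def using lim unfolding u by (intro tendsto_intros) auto
  then have "s \<longlonglongrightarrow> 0" by (simp add: zero_prod_def[symmetric])
  then have "\<forall>\<^sub>F i in sequentially. s i < \<epsilon>^2 / 2" using \<epsilon> by (intro order_tendstoD) auto
  then obtain i0 where i0: "\<And>i. i >= i0 ==> s i < \<epsilon>^2 / 2" by (auto simp: eventually_sequentially)
  have "div_free_dist m (v (r i)) u < \<epsilon>" if i: "i >= i0" for i
  proof -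
   have "hs m (Z i) <= (\<Sum>k\<in>box_freqs n. (wt m k * Z i k)^2) + ennreal (real n powr (2 * (m - m'))) * hs m' (Z i)"
    by (rule hs_split) (use mm n in auto)
   also have "(\<Sum>k\<in>box_freqs n. (wt m k * Z i k)^2) = ennreal (s i)" unfolding s_def by (subst sum_ennreal[symmetric])
     (auto intro!: sum.cong simp: Z_def vnorm_def wt_def ennreal_power simp flip: ennreal_mult)
   also have "ennreal (s i) + ennreal (real n powr (2 * (m - m'))) * hs m' (Z i)
     <= ennreal (s i) + ennreal (real n powr (2 * (m - m'))) * ennreal (8 * R^2)"
    by (intro add_left_mono mult_left_mono Zr) auto
   also have "... = ennreal (s i + real n powr (2 * (m - m')) * (8 * R^2))"
    by (subst ennreal_plus) (auto simp: s_def ennreal_mult intro: sum_nonneg)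
   finally have "(div_free_dist m (v (r i)) u)^2 <= s i + real n powr (2 * (m - m')) * (8 * R^2)"
    unfolding Zd by (subst (asm) ennreal_le_iff) (auto simp: s_def intro!: add_nonneg_nonneg sum_nonneg)
   also have "... < \<epsilon>^2" using i0[OF i] n(2) by simp
   finally show ?thesis using \<epsilon> by (intro power2_less_imp_less[of _ \<epsilon>]) (assumption, simp)
  qed
  then show "\<exists>no. \<forall>i\<ge>no. norm (div_free_dist m (v (r i)) u - 0) < \<epsilon>"
   using div_free_dist_nonneg by (intro exI[of _ i0]) auto
 qed
 then show thesis by (rule that[OF u(1) uR r])
qed

section \<open>The forward map\<close>

lemma hs_vamp_le:
 assumes "v \<in> div_free m" "div_free_norm m v <= R"
 shows "hs m (vamp v) <= ennreal (16 * pi^2 * R^2)"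
proof -
 have "hs m (vamp v) <= ennreal (16 * pi^2) * ennreal ((div_free_norm m v)^2)"
  using hs_vamp[of m v] unfolding hs_vnorm[symmetric] div_free_norm_sq[OF div_free_hs_finite[OF assms(1)]] .
 also have "... <= ennreal (16 * pi^2) * ennreal (R^2)"
  using assms(2) div_free_norm_nonneg[of m v] by (intro mult_left_mono ennreal_leI power_mono) auto
 finally show ?thesis by (simp add: ennreal_mult)
qed

lemma hs_vamp_diff_le:
 assumes "v \<in> div_free m" "w \<in> div_free m"
 shows "hs m (vamp (\<lambda>x. v x - w x)) <= ennreal (16 * pi^2 * (div_free_dist m v w)^2)"
proof -
 have "hs m (vamp (\<lambda>x. v x - w x)) <= ennreal (16 * pi^2) * hs m (vnorm (vc (\<lambda>x. v x - w x)) (vc' (\<lambda>x. v x - w x)))"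
  unfolding hs_vnorm by (rule hs_vamp)
 also have "... = ennreal (16 * pi^2) * ennreal ((div_free_dist m v w)^2)"
  unfolding adv_mat_diff(2,3)[OF assms] div_free_dist_sq[OF assms] ..
 finally show ?thesis by (simp add: ennreal_mult)
qed

lemma series_diff: "integrable freqs a ==> integrable freqs b ==> series (\<lambda>k. a k - b k) x = series a x - series b x"
 unfolding series_def by (simp add: integrable_series left_diff_distrib)

context
 fixes \<kappa> m :: real and \<theta>0 :: scalar_field
 assumes \<kappa>: "\<kappa> > 0" and m: "m > 1" and \<theta>0: "\<theta>0 \<in> sobolev m"
begin

abbreviation "sol v \<equiv> adv_diff_solution \<kappa> m v \<theta>0"

lemma sol_weak: "v \<in> div_free m ==> weak_solution \<kappa> m v \<theta>0 (sol v)"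
 unfolding adv_diff_solution_def by (rule someI_ex[OF weak_solution_exists[OF \<kappa> m _ \<theta>0]])

lemma sol_mode: "v \<in> div_free m ==> mode_sol (4 * pi^2 * \<kappa>) m (adv_mat v) (\<lambda>t. fourier_coeff (sol v t))"
 by (rule weak_imp_mode[OF \<kappa> m _ sol_weak])

lemma sol_sobolev: "v \<in> div_free m ==> t >= 0 ==> sol v t \<in> sobolev m"
 using sol_weak[of v] by (auto simp: weak_solution_def time_continuous_def)

lemma sol_initial: assumes v: "v \<in> div_free m" shows "fourier_coeff (sol v 0) = fourier_coeff \<theta>0"
proof
 fix k show "fourier_coeff (sol v 0) k = fourier_coeff \<theta>0 k" by (rule fourier_coeff_cong_AE)
   (use sol_weak[OF v] L2_torus_D(5)[OF sobolev_L2[OF sol_sobolev[OF v]], of 0] L2_torus_D(5)[OF sobolev_L2[OF \<theta>0]]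
    in \<open>auto simp: weak_solution_def\<close>)
qed

lemma sol_l1: "v \<in> div_free m ==> t >= 0 ==> integrable freqs (fourier_coeff (sol v t))"
 using sol_sobolev[of v t] by (intro hs_imp_l1(1)[OF m]) (auto simp: sobolev_iff)

lemma sol_series: "v \<in> div_free m ==> t >= 0 ==> of_real (sol v t x) = series (fourier_coeff (sol v t)) x"
 using sol_weak[of v] sobolev_L2[OF sol_sobolev[of v t]]
 by (intro continuous_eq_series sol_l1) (auto simp: weak_solution_def)

text \<open>One constant serves all fields in a ball: the growth rate depends on v only through
  \<open>hs m (vamp v)\<close>, which the radius bounds. The H^m estimates pass to point values by
  \<open>sup_bound\<close>.\<close>

lemma sol_estimates:
 assumes T: "T >= 0" and R: "R >= 0"
 obtains K where "K >= 0" "\<And>v t x. v \<in> div_free m ==> div_free_norm m v <= R ==> t \<in> {0..T} ==> \<bar>sol v t x\<bar> <= K"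
  "\<And>v w t x. v \<in> div_free m ==> w \<in> div_free m ==> div_free_norm m v <= R ==> div_free_norm m w <= R ==>
   t \<in> {0..T} ==> \<bar>sol v t x - sol w t x\<bar> <= K * div_free_dist m v w"
proof -
 define c where "c = 4 * pi^2 * \<kappa>"
 have c: "c > 0" using \<kappa> by (simp add: c_def)
 define al where "al = enn2real (alg m)"
 have al: "alg m = ennreal al" "al >= 0" using alg_finite[OF m] by (auto simp: al_def)
 define z where "z = enn2real (zeta m)"
 have z: "z >= 0" by (simp add: z_def)
 define \<rho> where "\<rho> = 4 / c * (al * (16 * pi^2 * R^2))"
 have \<rho>: "\<rho> >= 0" using c al by (simp add: \<rho>_def)
 define h0 where "h0 = enn2real (hs m (amp (fourier_coeff \<theta>0)))"
 have h0: "hs m (amp (fourier_coeff \<theta>0)) = ennreal h0" "h0 >= 0" using \<theta>0 by (auto simp: h0_def sobolev_iff)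
 define E where "E = exp (\<rho> * T)"
 have E: "E >= 0" by (simp add: E_def)
 have rate: "exp (rate c m (vamp v) * t) <= E"
  if v: "v \<in> div_free m" "div_free_norm m v <= R" and t: "t \<in> {0..T}" for v t
 proof -
  have "alg m * hs m (vamp v) <= ennreal al * ennreal (16 * pi^2 * R^2)"
   unfolding al(1) by (intro mult_left_mono hs_vamp_le v) auto
  also have "... = ennreal (al * (16 * pi^2 * R^2))" using al(2) by (simp add: ennreal_mult)
  finally have "enn2real (alg m * hs m (vamp v)) <= al * (16 * pi^2 * R^2)"
   using al(2) enn2real_mono[of _ "ennreal (al * (16 * pi^2 * R^2))"] by simp
  then have "rate c m (vamp v) <= \<rho>" unfolding rate_def \<rho>_def using c by (intro mult_left_mono) auto
  then have "rate c m (vamp v) * t <= \<rho> * T" using t \<rho> by (intro mult_mono) auto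
  then show ?thesis by (simp add: E_def)
 qed
 have hsb: "hs m (amp (fourier_coeff (sol v t))) <= ennreal (E * h0)"
  if v: "v \<in> div_free m" "div_free_norm m v <= R" and t: "t \<in> {0..T}" for v t
 proof -
  have "hs m (amp (fourier_coeff (sol v t))) <= ennreal (exp (rate c m (vamp v) * t)) * ennreal h0"
   using mode_sol_growth(1)[OF c m op_bound_adv_mat[OF v(1)] hs_vamp_finite[OF v(1) order_refl] sol_mode[OF v(1), folded c_def], of t] t
   by (simp add: sol_initial[OF v(1)] h0(1))
  also have "... <= ennreal E * ennreal h0" by (intro mult_right_mono ennreal_leI rate v t) auto
  finally show ?thesis using E h0(2) by (simp add: ennreal_mult)
 qed
 have zero: "fourier_coeff (sol v t) 0 = 0" if "v \<in> div_free m" "t >= 0" for v t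
  using sol_sobolev[OF that] by (simp add: sobolev_iff)
 define K1 where "K1 = sqrt (z * (E * h0))"
 define L where "L = E * (4 / c * T * (al * (16 * pi^2) * (E * h0)))"
 have L: "L >= 0" using E c T al h0 by (simp add: L_def)
 define K2 where "K2 = sqrt (z * L)"
 show thesis
 proof (rule that[of "max K1 K2"])
  have "K1 >= 0" using z E h0 by (simp add: K1_def)
  then show "max K1 K2 >= 0" by (simp add: le_max_iff_disj)
  fix v t x assume v: "v \<in> div_free m" "div_free_norm m v <= R" and t: "t \<in> {0..T}"
  have "cmod (of_real (sol v t x)) <= K1"
   unfolding K1_def z_def sol_series[OF v(1), of t, simplified, OF t[simplified, THEN conjunct1]]
   by (rule sup_bound[OF m zero hsb]) (use v t E h0 in auto)
  then show "\<bar>sol v t x\<bar> <= max K1 K2" by simp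
 next
  fix v w t x assume v: "v \<in> div_free m" "div_free_norm m v <= R" and w: "w \<in> div_free m" "div_free_norm m w <= R"
   and t: "t \<in> {0..T}"
  have t0: "t >= 0" using t by simp
  let ?d = "div_free_dist m v w"
  have "hs m (amp (\<lambda>k. fourier_coeff (sol v t) k - fourier_coeff (sol w t) k))
    <= ennreal (exp (rate c m (vamp v) * t)) * (ennreal (4 / c * t) * (alg m * hs m (vamp (\<lambda>x. v x - w x)) *
     (ennreal (exp (rate c m (vamp w) * t)) * hs m (amp (fourier_coeff (sol w 0))))))"
   using mode_sol_stability[OF c m op_bound_adv_mat[OF v(1)] hs_vamp_finite[OF v(1) order_refl]
     op_bound_adv_mat[OF w(1)] hs_vamp_finite[OF w(1) order_refl] adv_mat_diff(1)[OF v(1) w(1)]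
     sol_mode[OF v(1), folded c_def] sol_mode[OF w(1), folded c_def] t0] by (simp add: sol_initial v w)
  also have "... <= ennreal E * (ennreal (4 / c * T) * (ennreal al * ennreal (16 * pi^2 * ?d^2) * (ennreal E * ennreal h0)))"
   unfolding al(1) sol_initial[OF w(1)] h0(1)
   using t c by (intro mult_mono ennreal_leI rate v w t hs_vamp_diff_le order_refl) (auto simp: field_simps)
  also have "... = ennreal (E * (4 / c * T * (al * (16 * pi^2 * ?d^2) * (E * h0))))"
  proof -
   have "ennreal E * (ennreal a * (ennreal al * ennreal b * (ennreal E * ennreal h0))) = ennreal (E * (a * (al * b * (E * h0))))"
    if "a >= 0" "b >= 0" for a b
    using that E al h0 by (simp add: ennreal_mult)
   then show ?thesis using c T by simp
  qed
  also have "E * (4 / c * T * (al * (16 * pi^2 * ?d^2) * (E * h0))) = L * ?d^2" by (simp add: L_def mult_ac)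
  finally have h: "hs m (amp (\<lambda>k. fourier_coeff (sol v t) k - fourier_coeff (sol w t) k)) <= ennreal (L * ?d^2)" .
  have "cmod (series (\<lambda>k. fourier_coeff (sol v t) k - fourier_coeff (sol w t) k) x) <= sqrt (enn2real (zeta m) * (L * ?d^2))"
   by (rule sup_bound[OF m _ h]) (use zero v w t0 L in auto)
  also have "... = K2 * ?d" unfolding K2_def z_def[symmetric] using div_free_dist_nonneg[of m v w]
   by (simp add: real_sqrt_mult)
  also have "series (\<lambda>k. fourier_coeff (sol v t) k - fourier_coeff (sol w t) k) x = of_real (sol v t x - sol w t x)"
   by (simp add: series_diff sol_l1 sol_series v w t0)
  finally have "\<bar>sol v t x - sol w t x\<bar> <= K2 * ?d" by (simp only: norm_of_real)
  also have "... <= max K1 K2 * ?d" by (intro mult_right_mono) (auto simp: div_free_dist_nonneg)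
  finally show "\<bar>sol v t x - sol w t x\<bar> <= max K1 K2 * ?d" .
 qed
qed

text \<open>Time is truncated at zero because the chosen solution is arbitrary at negative times.
  The H^m distance between two times bounds the difference uniformly in space, so continuity in each
  variable combines to joint continuity.\<close>

lemma sol_continuous:
 assumes v: "v \<in> div_free m"
 shows "continuous_on UNIV (\<lambda>z. sol v (max 0 (fst z)) (snd z))"
proof (rule continuous_on_sequentiallyI)
 fix u :: "nat => real \<times> real \<times> real" and a assume u: "u \<longlonglongrightarrow> a"
 define s t where "s n = max 0 (fst (u n))" and "t = max 0 (fst a)" for n
 have st: "s \<longlonglongrightarrow> t" unfolding s_def t_def by (intro tendsto_intros u)
 have s0: "s n >= 0" and t0: "t >= 0" for n by (auto simp: s_def t_def)
 define N where "N r = sobolev_norm m (\<lambda>x. sol v r x - sol v t x)" for r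
 have L2: "sol v r \<in> L2_torus" if "r >= 0" for r by (rule sobolev_L2[OF sol_sobolev[OF v that]])
 have Nt: "N t = 0" by (simp add: N_def sobolev_norm_def fourier_coeff_zero)
 have "(N \<longlongrightarrow> 0) (at t within {0..})"
  using sol_weak[OF v] t0 unfolding weak_solution_def time_continuous_def N_def by blast
 then have "continuous (at t within {0..}) N" by (simp add: continuous_within Nt)
 then have N0: "(\<lambda>n. N (s n)) \<longlonglongrightarrow> 0"
  using continuous_within_tendsto_compose[of t "{0..}" N s sequentially] st s0 Nt by auto
 have le: "\<bar>sol v (s n) x - sol v t x\<bar> <= sqrt (enn2real (zeta m)) * N (s n)" for n x
 proof -
  have e: "fourier_coeff (\<lambda>x. sol v (s n) x - sol v t x) = (\<lambda>k. fourier_coeff (sol v (s n)) k - fourier_coeff (sol v t) k)"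
   by (auto simp: fourier_coeff_diff L2 s0 t0)
  have fin: "hs m (amp (fourier_coeff (\<lambda>x. sol v (s n) x - sol v t x))) < \<top>"
  proof -
   have "hs m (amp (fourier_coeff (\<lambda>x. sol v (s n) x - sol v t x)))
     <= hs m (\<lambda>k. amp (fourier_coeff (sol v (s n))) k + amp (fourier_coeff (sol v t)) k)"
    unfolding e by (intro hs_mono) (simp add: norm_triangle_ineq4 flip: ennreal_plus)
   also have "... <= 4 * (hs m (amp (fourier_coeff (sol v (s n)))) + hs m (amp (fourier_coeff (sol v t))))" by (rule hs_add)
   also have "... < \<top>" using sol_sobolev[OF v s0] sol_sobolev[OF v t0] by (simp add: sobolev_iff ennreal_mult_less_top)
   finally show ?thesis .
  qed
  have "cmod (series (\<lambda>k. fourier_coeff (sol v (s n)) k - fourier_coeff (sol v t) k) x) <= sqrt (enn2real (zeta m) * (N (s n))^2)"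
   by (rule sup_bound[OF m])
    (use sobolev_norm_sq[OF fin] sol_sobolev[OF v s0] sol_sobolev[OF v t0] in \<open>auto simp: e N_def sobolev_iff\<close>)
  also have "series (\<lambda>k. fourier_coeff (sol v (s n)) k - fourier_coeff (sol v t) k) x = of_real (sol v (s n) x - sol v t x)"
   by (simp add: series_diff sol_l1 sol_series v s0 t0)
  finally show ?thesis by (simp only: norm_of_real) (simp add: real_sqrt_mult N_def sobolev_norm_nonneg)
 qed
 have 1: "(\<lambda>n. sol v (s n) (snd (u n)) - sol v t (snd (u n))) \<longlonglongrightarrow> 0"
 proof (rule Lim_null_comparison)
  show "\<forall>\<^sub>F n in sequentially. norm (sol v (s n) (snd (u n)) - sol v t (snd (u n))) <= sqrt (enn2real (zeta m)) * N (s n)"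
   using le by simp
  show "(\<lambda>n. sqrt (enn2real (zeta m)) * N (s n)) \<longlonglongrightarrow> 0"
   using tendsto_mult_left[OF N0, of "sqrt (enn2real (zeta m))"] by simp
 qed
 have "continuous_on UNIV (sol v t)" using sol_weak[OF v] t0 by (simp add: weak_solution_def)
 then have 2: "(\<lambda>n. sol v t (snd (u n))) \<longlonglongrightarrow> sol v t (snd a)"
  using continuous_on_tendsto_compose[of UNIV "sol v t" "\<lambda>n. snd (u n)" "snd a"] tendsto_snd[OF u] by simp
 from tendsto_add[OF 1 2] show "(\<lambda>n. sol v (max 0 (fst (u n))) (snd (u n))) \<longlonglongrightarrow> sol v (max 0 (fst a)) (snd a)"
  by (simp add: s_def t_def)
qed

text \<open>The solution on a short time interval determines the derivative of each mode at time
  zero. As the initial values coincide, the diffusion terms cancel, and the transport terms of the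
  initial condition agree.\<close>

lemma sol_identify:
 assumes v: "v \<in> div_free m" and w: "w \<in> div_free m" and T: "T > 0"
  and eq: "\<And>t. 0 < t ==> t < T ==> (AE x in torus. sol v t x = sol w t x)"
 shows "AE x in torus. v x \<bullet> grad \<theta>0 x = w x \<bullet> grad \<theta>0 x"
proof -
 define c where "c = 4 * pi^2 * \<kappa>"
 \<comment> \<open>Agreement is given on the open interval (0, T) only. The closed interval up to S
   needs no information at T, and at time zero the initial condition decides.\<close>
 define S where "S = T / 2"
 have S: "0 < S" "S < T" using T by (auto simp: S_def)
 have same: "fourier_coeff (sol v t) k = fourier_coeff (sol w t) k" if t: "t \<in> {0..S}" for t k
 proof (cases "t = 0")
  case True then show ?thesis by (simp add: sol_initial v w)
 next
  case False
  then show ?thesis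
   using t S L2_torus_D(5)[OF sobolev_L2[OF sol_sobolev[OF v]]] L2_torus_D(5)[OF sobolev_L2[OF sol_sobolev[OF w]]]
   by (intro fourier_coeff_cong_AE eq) auto
 qed
 have \<theta>1: "\<theta>0 \<in> sobolev 1" using sobolev_mono[OF _ \<theta>0, of 1] m by simp
 have "adv (adv_mat v) (fourier_coeff \<theta>0) k = adv (adv_mat w) (fourier_coeff \<theta>0) k" for k
 proof -
  let ?n = "of_real (c * (norm (freq k))^2)"
  have sub: "{0..S} \<subseteq> {0..}" by auto
  have dv: "((\<lambda>t. fourier_coeff (sol v t) k) has_vector_derivative
    - ?n * fourier_coeff (sol v 0) k - adv (adv_mat v) (fourier_coeff (sol v 0)) k) (at 0 within cbox 0 S)"
   using has_vector_derivative_within_subset[OF mode_sol_D(3)[OF sol_mode[OF v, folded c_def], of 0 k] sub] by simp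
  have dw: "((\<lambda>t. fourier_coeff (sol w t) k) has_vector_derivative
    - ?n * fourier_coeff (sol w 0) k - adv (adv_mat w) (fourier_coeff (sol w 0)) k) (at 0 within cbox 0 S)"
   using has_vector_derivative_within_subset[OF mode_sol_D(3)[OF sol_mode[OF w, folded c_def], of 0 k] sub] by simp
  have dw': "((\<lambda>t. fourier_coeff (sol v t) k) has_vector_derivative
    - ?n * fourier_coeff (sol w 0) k - adv (adv_mat w) (fourier_coeff (sol w 0)) k) (at 0 within cbox 0 S)"
   by (rule has_vector_derivative_transform[OF _ _ dw]) (use S same in auto)
  have "- ?n * fourier_coeff (sol v 0) k - adv (adv_mat v) (fourier_coeff (sol v 0)) k
    = - ?n * fourier_coeff (sol w 0) k - adv (adv_mat w) (fourier_coeff (sol w 0)) k"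
   by (rule vector_derivative_unique_within_closed_interval[OF _ _ dv dw']) (use S in auto)
  then show ?thesis by (simp add: sol_initial v w)
 qed
 then have "fourier_coeff (\<lambda>x. v x \<bullet> grad \<theta>0 x) k = fourier_coeff (\<lambda>x. w x \<bullet> grad \<theta>0 x) k" for k
  using transport_coeff(2)[OF m v is_grad_grad[OF \<theta>1] sobolev_L2[OF \<theta>0]]
   transport_coeff(2)[OF m w is_grad_grad[OF \<theta>1] sobolev_L2[OF \<theta>0]] by simp
 then show ?thesis using transport_coeff(1)[OF m v is_grad_grad[OF \<theta>1] sobolev_L2[OF \<theta>0]]
   transport_coeff(1)[OF m w is_grad_grad[OF \<theta>1] sobolev_L2[OF \<theta>0]]
  by (intro AE_eq_of_fourier_coeff L2_torus_D(3)) auto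
qed

end

lemma identifiability:
 assumes m: "m > 1" and v: "v \<in> div_free m" and w: "w \<in> div_free m"
  and e1: "AE x in torus. v x \<bullet> grad \<theta>1 x = w x \<bullet> grad \<theta>1 x"
  and e2: "AE x in torus. v x \<bullet> grad \<theta>2 x = w x \<bullet> grad \<theta>2 x"
  and nd: "AE x in torus. perp (grad \<theta>1 x) \<bullet> grad \<theta>2 x \<noteq> 0"
 shows "v = w"
proof -
 have ae: "AE x in torus. v x = w x" using e1 e2 nd
 proof eventually_elim
  case (elim x)
  define p q where "p = fst (v x) - fst (w x)" and "q = snd (v x) - snd (w x)"
  obtain a b where ab: "grad \<theta>1 x = (a, b)" by fastforce
  obtain c d where cd: "grad \<theta>2 x = (c, d)" by fastforce
  have 1: "p * a + q * b = 0" "p * c + q * d = 0"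
   using elim(1,2) ab cd by (simp_all add: p_def q_def inner_prod_def algebra_simps)
  have D: "a * d - b * c \<noteq> 0" using elim(3) ab cd by (simp add: perp_def mult.commute)
  \<comment> \<open>Cramer's rule; the determinant is the pairing in the non-degeneracy
    condition.\<close>
  have "p * (a * d - b * c) = d * (p * a + q * b) - b * (p * c + q * d)" by (simp add: algebra_simps)
  then have "p = 0" using 1 D by simp
  have "q * (a * d - b * c) = a * (p * c + q * d) - c * (p * a + q * b)" by (simp add: algebra_simps)
  then have "q = 0" using 1 D by simp
  with \<open>p = 0\<close> show ?case by (simp add: p_def q_def prod_eq_iff)
 qed
 have meas: "fst \<circ> u \<in> borel_measurable torus" "snd \<circ> u \<in> borel_measurable torus" if "u \<in> div_free m" for u
  using L2_torus_D(5)[OF sobolev_L2[OF div_free_D(2)[OF that]]] L2_torus_D(5)[OF sobolev_L2[OF div_free_D(3)[OF that]]] by auto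
 show ?thesis
 proof (rule div_free_ext[OF m v w])
  fix k
  show "vc v k = vc w k" unfolding vc_def
   by (rule fourier_coeff_cong_AE[OF _ meas(1)[OF v] meas(1)[OF w]]) (use ae in \<open>eventually_elim, simp\<close>)
  show "vc' v k = vc' w k" unfolding vc'_def
   by (rule fourier_coeff_cong_AE[OF _ meas(2)[OF v] meas(2)[OF w]]) (use ae in \<open>eventually_elim, simp\<close>)
 qed
qed

section \<open>A strong law of large numbers for orthogonal variables\<close>

text \<open>The mean of n^2 orthogonal variables has second moment at most C / n^2, which is
  summable. The squares of these means therefore have a finite sum almost surely.\<close>

lemma (in prob_space) slln_along_squares:
 fixes X :: "nat => 'a => real"
 assumes X [measurable]: "\<And>i. random_variable borel (X i)" and int: "\<And>i j. integrable M (\<lambda>\<omega>. X i \<omega> * X j \<omega>)"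
  and orth: "\<And>i j. i \<noteq> j ==> expectation (\<lambda>\<omega>. X i \<omega> * X j \<omega>) = 0"
  and var: "\<And>i. expectation (\<lambda>\<omega>. (X i \<omega>)^2) <= C"
 shows "AE \<omega> in M. (\<lambda>n. (\<Sum>i<n^2. X i \<omega>) / real (n^2)) \<longlonglongrightarrow> 0"
proof -
 define Z where "Z n \<omega> = ((\<Sum>i<n^2. X i \<omega>) / real (n^2))^2" for n \<omega>
 have sq: "(\<Sum>i<N. X i \<omega>)^2 = (\<Sum>i<N. \<Sum>j<N. X i \<omega> * X j \<omega>)" for N \<omega> by (simp add: power2_eq_square sum_product)
 have Zint: "integrable M (Z n)" for n
  unfolding Z_def power_divide sq by (auto intro!: Bochner_Integration.integrable_sum int)
 have Zle: "expectation (Z (Suc n)) <= C / (real (Suc n))^2" for n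
 proof -
  let ?N = "(Suc n)^2"
  have "expectation (\<lambda>\<omega>. (\<Sum>i<?N. X i \<omega>)^2) = (\<Sum>i<?N. \<Sum>j<?N. expectation (\<lambda>\<omega>. X i \<omega> * X j \<omega>))"
   unfolding sq by (simp add: Bochner_Integration.integral_sum int Bochner_Integration.integrable_sum)
  also have "... = (\<Sum>i<?N. expectation (\<lambda>\<omega>. (X i \<omega>)^2))"
  proof (intro sum.cong refl)
   fix i assume "i \<in> {..<?N}"
   then have "(\<Sum>j<?N. expectation (\<lambda>\<omega>. X i \<omega> * X j \<omega>)) = (\<Sum>j\<in>{i}. expectation (\<lambda>\<omega>. X i \<omega> * X j \<omega>))"
    by (intro sum.mono_neutral_right) (auto simp: orth)
   then show "(\<Sum>j<?N. expectation (\<lambda>\<omega>. X i \<omega> * X j \<omega>)) = expectation (\<lambda>\<omega>. (X i \<omega>)^2)" by (simp add: power2_eq_square)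
  qed
  also have "... <= real ?N * C" using sum_bounded_above[of "{..<?N}" "\<lambda>i. expectation (\<lambda>\<omega>. (X i \<omega>)^2)" C] var by simp
  finally have "expectation (\<lambda>\<omega>. (\<Sum>i<?N. X i \<omega>)^2) / (real ?N)^2 <= real ?N * C / (real ?N)^2"
   by (intro divide_right_mono) auto
  also have "real ?N * C / (real ?N)^2 = C / (real (Suc n))^2"
  proof -
   define q where "q = real (Suc n)"
   have "q > 0" by (simp add: q_def)
   then show ?thesis unfolding of_nat_power q_def[symmetric] by (simp add: power2_eq_square)
  qed
  moreover have "Z (Suc n) = (\<lambda>\<omega>. (\<Sum>i<?N. X i \<omega>)^2 / (real ?N)^2)" by (rule ext) (simp only: Z_def power_divide)
  then have "expectation (Z (Suc n)) = expectation (\<lambda>\<omega>. (\<Sum>i<?N. X i \<omega>)^2) / (real ?N)^2"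
   by (simp only: Bochner_Integration.integral_divide_zero)
  ultimately show ?thesis by simp
 qed
 have C0: "C >= 0" using order_trans[OF _ var[of 0]] by simp
 have "(\<integral>\<^sup>+ \<omega>. (\<Sum>n. ennreal (Z (Suc n) \<omega>)) \<partial>M) = (\<Sum>n. \<integral>\<^sup>+ \<omega>. ennreal (Z (Suc n) \<omega>) \<partial>M)"
  by (rule nn_integral_suminf) (auto simp: Z_def)
 also have "... = (\<Sum>n. ennreal (expectation (Z (Suc n))))"
  by (intro suminf_cong nn_integral_eq_integral Zint) (auto simp: Z_def)
 also have "... <= (\<Sum>n. ennreal (C / (real (Suc n))^2))" by (intro suminf_le summableI ennreal_leI Zle)
 also have "... < \<top>"
 proof -
  have "summable (\<lambda>n. C / (real (Suc n))^2)"
   using summable_mult[OF inverse_squares_sums[THEN sums_summable], of C] by simp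
  then have "(\<Sum>n. ennreal (C / (real (Suc n))^2)) = ennreal (\<Sum>n. C / (real (Suc n))^2)"
   using C0 by (intro suminf_ennreal2) auto
  then show ?thesis by simp
 qed
 finally have "(\<integral>\<^sup>+ \<omega>. (\<Sum>n. ennreal (Z (Suc n) \<omega>)) \<partial>M) \<noteq> \<infinity>" by simp
 then have "AE \<omega> in M. (\<Sum>n. ennreal (Z (Suc n) \<omega>)) \<noteq> \<infinity>" by (intro nn_integral_PInf_AE) (auto simp: Z_def)
 then show ?thesis
 proof eventually_elim
  case (elim \<omega>)
  then have "summable (\<lambda>n. Z (Suc n) \<omega>)" by (intro summable_suminf_not_top) (auto simp: Z_def)
  then have "(\<lambda>n. Z (Suc n) \<omega>) \<longlonglongrightarrow> 0" by (rule summable_LIMSEQ_zero)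
  then have "(\<lambda>n. Z n \<omega>) \<longlonglongrightarrow> 0" by (rule LIMSEQ_imp_Suc)
  from tendsto_real_sqrt[OF this] have "(\<lambda>n. \<bar>(\<Sum>i<n^2. X i \<omega>) / real (n^2)\<bar>) \<longlonglongrightarrow> 0"
   by (simp only: Z_def real_sqrt_abs real_sqrt_zero)
  then show ?case by (simp only: tendsto_rabs_zero_iff)
 qed
qed

section \<open>From square sample sizes to all sample sizes\<close>

definition nsqrt :: "nat => nat" where "nsqrt n = nat \<lfloor>sqrt (real n)\<rfloor>"

lemma nsqrt_bounds: "(nsqrt n)^2 <= n" "n <= (Suc (nsqrt n))^2"
proof -
 have a: "real (nsqrt n) <= sqrt (real n)" "sqrt (real n) <= real (Suc (nsqrt n))"
  unfolding nsqrt_def by (simp_all add: of_nat_nat) linarith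
 have "(real (nsqrt n))^2 <= (sqrt (real n))^2" "(sqrt (real n))^2 <= (real (Suc (nsqrt n)))^2"
  using a by (intro power_mono; simp)+
 then have "real ((nsqrt n)^2) <= real n" "real n <= real ((Suc (nsqrt n))^2)" by simp_all
 then show "(nsqrt n)^2 <= n" "n <= (Suc (nsqrt n))^2" by (simp_all only: of_nat_le_iff)
qed

lemma filterlim_nsqrt: "filterlim nsqrt at_top sequentially" unfolding filterlim_at_top
proof
 fix Z :: nat
 have "Z <= nsqrt n" if "n >= Z^2" for n
 proof -
  have "real Z <= sqrt (real n)" using that by (intro real_le_rsqrt) (simp flip: of_nat_power)
  then show ?thesis by (simp add: nsqrt_def le_nat_floor)
 qed
 then show "\<forall>\<^sub>F n in sequentially. Z <= nsqrt n" by (auto simp: eventually_sequentially)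
qed

lemma nsqrt_ratio: "(\<lambda>n. real ((nsqrt n)^2) / real n) \<longlonglongrightarrow> 1" "(\<lambda>n. real ((Suc (nsqrt n))^2) / real n) \<longlonglongrightarrow> 1"
proof -
 have L: "(\<lambda>n. (real n / real (Suc n))^2) \<longlonglongrightarrow> 1^2" by (intro tendsto_intros LIMSEQ_n_over_Suc_n)
 have lo: "(\<lambda>n. (real (nsqrt n) / real (Suc (nsqrt n)))^2) \<longlonglongrightarrow> 1" using filterlim_compose[OF L filterlim_nsqrt] by simp
 have hi: "(\<lambda>n. (real (Suc (nsqrt n)) / real (nsqrt n))^2) \<longlonglongrightarrow> 1"
  using tendsto_inverse[OF lo] by (simp add: power_divide)
 have ev: "\<forall>\<^sub>F n in sequentially. n >= 1 \<and> nsqrt n >= 1"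
  using eventually_ge_at_top[of 1] filterlim_nsqrt[unfolded filterlim_at_top, rule_format, of 1]
  by eventually_elim simp
 show "(\<lambda>n. real ((nsqrt n)^2) / real n) \<longlonglongrightarrow> 1"
 proof (rule tendsto_sandwich[OF _ _ lo tendsto_const])
  show "\<forall>\<^sub>F n in sequentially. (real (nsqrt n) / real (Suc (nsqrt n)))^2 <= real ((nsqrt n)^2) / real n" using ev
  proof eventually_elim
   case (elim n)
   have "real n <= real ((Suc (nsqrt n))^2)" using nsqrt_bounds(2) by (simp only: of_nat_le_iff)
   then have "real ((nsqrt n)^2) / real ((Suc (nsqrt n))^2) <= real ((nsqrt n)^2) / real n"
    using elim by (intro divide_left_mono) auto
   then show ?case by (simp add: power_divide)
  qed
  show "\<forall>\<^sub>F n in sequentially. real ((nsqrt n)^2) / real n <= 1" using ev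
  proof eventually_elim
   case (elim n)
   have "real ((nsqrt n)^2) <= real n" using nsqrt_bounds(1) by (simp only: of_nat_le_iff)
   then show ?case using elim by (simp add: divide_le_eq)
  qed
 qed
 show "(\<lambda>n. real ((Suc (nsqrt n))^2) / real n) \<longlonglongrightarrow> 1"
 proof (rule tendsto_sandwich[OF _ _ tendsto_const hi])
  show "\<forall>\<^sub>F n in sequentially. 1 <= real ((Suc (nsqrt n))^2) / real n" using ev
  proof eventually_elim
   case (elim n)
   have "real n <= real ((Suc (nsqrt n))^2)" using nsqrt_bounds(2) by (simp only: of_nat_le_iff)
   then show ?case using elim by (simp add: le_divide_eq)
  qed
  show "\<forall>\<^sub>F n in sequentially. real ((Suc (nsqrt n))^2) / real n <= (real (Suc (nsqrt n)) / real (nsqrt n))^2" using ev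
  proof eventually_elim
   case (elim n)
   have "real ((nsqrt n)^2) <= real n" using nsqrt_bounds(1) by (simp only: of_nat_le_iff)
   then have "real ((Suc (nsqrt n))^2) / real n <= real ((Suc (nsqrt n))^2) / real ((nsqrt n)^2)"
    using elim by (intro divide_left_mono) auto
   then show ?case by (simp add: power_divide)
  qed
 qed
qed

text \<open>Partial sums of non-negative terms are monotone, so the average at n lies between those
  at the neighbouring squares, up to ratios that tend to 1.\<close>

lemma averages_of_squares_nonneg:
 fixes y :: "nat => real"
 assumes y: "\<And>i. y i >= 0" and L: "(\<lambda>n. (\<Sum>i<n^2. y i - L) / real (n^2)) \<longlonglongrightarrow> 0"
 shows "(\<lambda>n. (\<Sum>i<n. y i) / real n) \<longlonglongrightarrow> L"
proof -
 define T where "T n = (\<Sum>i<n. y i)" for n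
 have mono: "T a <= T b" if "a <= b" for a b unfolding T_def using that y by (intro sum_mono2) auto
 have "(\<lambda>n. (\<Sum>i<n^2. y i - L) / real (n^2) + L) \<longlonglongrightarrow> 0 + L" by (intro tendsto_intros L)
 moreover have "\<forall>\<^sub>F n in sequentially. (\<Sum>i<n^2. y i - L) / real (n^2) + L = T (n^2) / real (n^2)"
  using eventually_ge_at_top[of 1]
 proof eventually_elim
  case (elim n)
  then have "real (n^2) \<noteq> 0" by simp
  then show ?case by (simp add: T_def sum_subtractf diff_divide_distrib)
 qed
 ultimately have TL: "(\<lambda>n. T (n^2) / real (n^2)) \<longlonglongrightarrow> L" by (simp add: tendsto_cong)
 have lo: "(\<lambda>n. T ((nsqrt n)^2) / real ((nsqrt n)^2) * (real ((nsqrt n)^2) / real n)) \<longlonglongrightarrow> L * 1"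
  by (intro tendsto_mult nsqrt_ratio(1) filterlim_compose[OF TL filterlim_nsqrt])
 have hi: "(\<lambda>n. T ((Suc (nsqrt n))^2) / real ((Suc (nsqrt n))^2) * (real ((Suc (nsqrt n))^2) / real n)) \<longlonglongrightarrow> L * 1"
  by (intro tendsto_mult nsqrt_ratio(2) filterlim_compose[OF filterlim_compose[OF TL filterlim_Suc] filterlim_nsqrt])
 have ev: "\<forall>\<^sub>F n in sequentially. n >= 1 \<and> nsqrt n >= 1"
  using eventually_ge_at_top[of 1] filterlim_nsqrt[unfolded filterlim_at_top, rule_format, of 1]
  by eventually_elim simp
 show ?thesis unfolding T_def[symmetric]
 proof (rule tendsto_sandwich[OF _ _ lo[unfolded mult_1_right] hi[unfolded mult_1_right]])
  show "\<forall>\<^sub>F n in sequentially. T ((nsqrt n)^2) / real ((nsqrt n)^2) * (real ((nsqrt n)^2) / real n) <= T n / real n"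
   using ev
  proof eventually_elim
   case (elim n)
   then have "real ((nsqrt n)^2) \<noteq> 0" by simp
   then have "T ((nsqrt n)^2) / real ((nsqrt n)^2) * (real ((nsqrt n)^2) / real n) = T ((nsqrt n)^2) / real n"
    by (simp del: of_nat_power)
   also have "... <= T n / real n" using mono[OF nsqrt_bounds(1)[of n]] by (simp add: divide_right_mono)
   finally show ?case .
  qed
  show "\<forall>\<^sub>F n in sequentially. T n / real n <= T ((Suc (nsqrt n))^2) / real ((Suc (nsqrt n))^2) * (real ((Suc (nsqrt n))^2) / real n)"
   using ev
  proof eventually_elim
   case (elim n)
   have "real ((Suc (nsqrt n))^2) \<noteq> 0" by (simp del: of_nat_Suc)
   then have "T ((Suc (nsqrt n))^2) / real ((Suc (nsqrt n))^2) * (real ((Suc (nsqrt n))^2) / real n) = T ((Suc (nsqrt n))^2) / real n"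
    by (simp del: of_nat_power)
   then show ?case using mono[OF nsqrt_bounds(2)[of n]] by (simp add: divide_right_mono)
  qed
 qed
qed

text \<open>Signed partial sums are not monotone. Their change since the last square is bounded by
  the change of the dominating sums, which is negligible against n because the dominating averages
  converge.\<close>

lemma averages_of_squares_dominated:
 fixes x u :: "nat => real"
 assumes xu: "\<And>i. \<bar>x i\<bar> <= u i" and x0: "(\<lambda>n. (\<Sum>i<n^2. x i) / real (n^2)) \<longlonglongrightarrow> 0" and u: "(\<lambda>n. (\<Sum>i<n. u i) / real n) \<longlonglongrightarrow> L"
 shows "(\<lambda>n. (\<Sum>i<n. x i) / real n) \<longlonglongrightarrow> 0"
proof (rule Lim_null_comparison)
 define S T where "S n = (\<Sum>i<n. x i)" and "T n = (\<Sum>i<n. u i)" for n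
 let ?r = "\<lambda>n. real ((nsqrt n)^2) / real n"
 let ?g = "\<lambda>n. \<bar>S ((nsqrt n)^2) / real ((nsqrt n)^2)\<bar> * ?r n + (T n / real n - T ((nsqrt n)^2) / real ((nsqrt n)^2) * ?r n)"
 have u': "(\<lambda>n. T (n^2) / real (n^2)) \<longlonglongrightarrow> L"
  using filterlim_compose[OF u, of "\<lambda>n. n^2"] filterlim_pow_at_top[of 2 "\<lambda>n::nat. n"]
  by (simp add: T_def filterlim_ident filterlim_subseq strict_mono_def power_strict_mono)
 have "?g \<longlonglongrightarrow> \<bar>0\<bar> * 1 + (L - L * 1)" unfolding S_def T_def
  by (intro tendsto_intros nsqrt_ratio filterlim_compose[OF x0 filterlim_nsqrt] u
    filterlim_compose[OF u'[unfolded T_def] filterlim_nsqrt])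
 then show "?g \<longlonglongrightarrow> 0" by simp
 have ev: "\<forall>\<^sub>F n in sequentially. n >= 1 \<and> nsqrt n >= 1"
  using eventually_ge_at_top[of 1] filterlim_nsqrt[unfolded filterlim_at_top, rule_format, of 1]
  by eventually_elim simp
 show "\<forall>\<^sub>F n in sequentially. norm ((\<Sum>i<n. x i) / real n) <= ?g n" using ev
 proof eventually_elim
  case (elim n)
  let ?q = "(nsqrt n)^2"
  have split: "(\<Sum>i<n. f i) = (\<Sum>i<?q. f i) + (\<Sum>i\<in>{?q..<n}. f i)" for f :: "nat => real"
   using nsqrt_bounds(1)[of n] by (simp add: sum.atLeastLessThan_concat lessThan_atLeast0)
  have "\<bar>\<Sum>i\<in>{?q..<n}. x i\<bar> <= (\<Sum>i\<in>{?q..<n}. u i)" by (rule order_trans[OF sum_abs]) (intro sum_mono xu)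
  then have "\<bar>S n\<bar> <= \<bar>S ?q\<bar> + (T n - T ?q)" unfolding S_def T_def split[of x] split[of u] by linarith
  then have "\<bar>S n\<bar> / real n <= (\<bar>S ?q\<bar> + (T n - T ?q)) / real n" by (intro divide_right_mono) auto
  also have "... = ?g n" using elim by (simp add: add_divide_distrib diff_divide_distrib)
  finally show ?case by (simp add: S_def)
 qed
qed

text \<open>Odd and even observations belong to different initial conditions; their averages are
  computed separately and recombined here.\<close>

lemma average_interleave:
 fixes a :: "nat => real"
 assumes A: "(\<lambda>n. (\<Sum>i<n. a (2 * i + 1)) / real n) \<longlonglongrightarrow> A" and B: "(\<lambda>n. (\<Sum>i<n. a (2 * i + 2)) / real n) \<longlonglongrightarrow> B"
 shows "(\<lambda>N. (\<Sum>j=1..N. a j) / real N) \<longlonglongrightarrow> (A + B) / 2"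
proof -
 \<comment> \<open>Up to N there are (N + 1) div 2 odd and N div 2 positive even indices; writing N
   + 0 lets both limits follow from one argument with c = 0 or c = 1.\<close>
 have split: "(\<Sum>j=1..N. a j) = (\<Sum>i<(N + 1) div 2. a (2 * i + 1)) + (\<Sum>i<(N + 0) div 2. a (2 * i + 2))" for N
 proof (induction N)
  case (Suc N)
  show ?case
  proof (cases "even N")
   case True
   then obtain q where "N = 2 * q" by (elim evenE)
   then show ?thesis using Suc by simp
  next
   case False
   then obtain q where "N = 2 * q + 1" by (elim oddE)
   then show ?thesis using Suc by simp
  qed
 qed simp
 have half: "(\<lambda>N. real ((N + c) div 2) / real N) \<longlonglongrightarrow> 1 / 2" if c: "c = 0 \<or> c = 1" for c
 proof (rule LIM_zero_cancel, rule Lim_null_comparison)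
  show "\<forall>\<^sub>F N in sequentially. norm (real ((N + c) div 2) / real N - 1 / 2) <= 1 / real N"
   using eventually_ge_at_top[of 1]
  proof eventually_elim
   case (elim N)
   have "N <= 2 * ((N + c) div 2) + 1" "2 * ((N + c) div 2) <= N + 1" using c by auto
   then have "real N <= 2 * real ((N + c) div 2) + 1" "2 * real ((N + c) div 2) <= real N + 1" by linarith+
   then have "\<bar>real ((N + c) div 2) - real N / 2\<bar> <= 1" by (simp add: abs_le_iff)
   then have "\<bar>real ((N + c) div 2) - real N / 2\<bar> / real N <= 1 / real N" by (intro divide_right_mono) auto
   moreover have "real ((N + c) div 2) / real N - 1 / 2 = (real ((N + c) div 2) - real N / 2) / real N"
    using elim by (simp add: diff_divide_distrib)
   ultimately show ?case by simp
  qed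
  show "(\<lambda>N. 1 / real N) \<longlonglongrightarrow> 0" by (rule lim_1_over_n)
 qed
 have top: "filterlim (\<lambda>N. (N + c) div 2) at_top sequentially" for c :: nat unfolding filterlim_at_top
 proof
  fix Z :: nat
  show "\<forall>\<^sub>F N in sequentially. Z <= (N + c) div 2" using eventually_ge_at_top[of "2 * Z"] by eventually_elim auto
 qed
 have lim: "(\<lambda>N. (\<Sum>i<(N + c) div 2. b i) / real N) \<longlonglongrightarrow> L * (1 / 2)"
  if "(\<lambda>n. (\<Sum>i<n. b i) / real n) \<longlonglongrightarrow> L" "c = 0 \<or> c = 1" for b :: "nat => real" and L c
 proof -
  have "(\<lambda>N. (\<Sum>i<(N + c) div 2. b i) / real ((N + c) div 2) * (real ((N + c) div 2) / real N)) \<longlonglongrightarrow> L * (1 / 2)"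
   by (intro tendsto_mult half that filterlim_compose[OF that(1) top])
  moreover have "(\<Sum>i<q. b i) / real q * (real q / r) = (\<Sum>i<q. b i) / r" for q r by (cases "q = 0") auto
  ultimately show ?thesis by (simp only:)
 qed
 have "(\<lambda>N. (\<Sum>i<(N + 1) div 2. a (2 * i + 1)) / real N + (\<Sum>i<(N + 0) div 2. a (2 * i + 2)) / real N)
   \<longlonglongrightarrow> A * (1 / 2) + B * (1 / 2)" by (intro tendsto_add lim A B) auto
 then show ?thesis unfolding split add_divide_distrib by simp
qed

text \<open>Three errors of size e / 3. The nets for all tolerances lie in one set Q, so that
  pointwise convergence is required on Q only, which is countable in the application.\<close>

lemma uniform_limit_on_totally_bounded:
 fixes d :: "'b => 'b => real" and F :: "nat => 'b => real"
 assumes net: "\<And>e. e > 0 ==> \<exists>S. finite S \<and> S \<subseteq> Q \<and> S \<subseteq> B \<and> (\<forall>v\<in>B. \<exists>w\<in>S. d v w < e)"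
  and C: "C >= 0" and F: "\<And>N v w. N >= 1 ==> v \<in> B ==> w \<in> B ==> \<bar>F N v - F N w\<bar> <= C * d v w"
  and D: "\<And>v w. v \<in> B ==> w \<in> B ==> \<bar>D v - D w\<bar> <= C * d v w"
  and lim: "\<And>v. v \<in> Q ==> (\<lambda>N. F N v) \<longlonglongrightarrow> D v"
  and e: "e > 0"
 shows "\<forall>\<^sub>F N in sequentially. \<forall>v\<in>B. \<bar>F N v - D v\<bar> <= e"
proof -
 define r where "r = e / (3 * (C + 1))"
 have r: "r > 0" "C * r <= e / 3" using C e by (auto simp: r_def field_simps)
 obtain S where S: "finite S" "S \<subseteq> Q" "S \<subseteq> B" "\<And>v. v \<in> B ==> \<exists>w\<in>S. d v w < r" using net[OF r(1)] by blast
 have "\<forall>\<^sub>F N in sequentially. \<bar>F N w - D w\<bar> < e / 3" if "w \<in> S" for w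
  using tendstoD[OF lim, of w "e / 3"] that S(2) e by (auto simp: dist_real_def)
 then have "\<forall>\<^sub>F N in sequentially. \<forall>w\<in>S. \<bar>F N w - D w\<bar> < e / 3" using S(1) by (simp add: eventually_ball_finite)
 then show ?thesis using eventually_ge_at_top[of 1]
 proof eventually_elim
  case (elim N)
  show ?case
  proof
   fix v assume v: "v \<in> B"
   obtain w where w: "w \<in> S" "d v w < r" using S(4)[OF v] by blast
   have wB: "w \<in> B" using w S by auto
   have le: "C * d v w <= e / 3" using mult_left_mono[OF less_imp_le[OF w(2)] C] r(2) by linarith
   have "\<bar>F N v - F N w\<bar> <= e / 3" "\<bar>D v - D w\<bar> <= e / 3" "\<bar>F N w - D w\<bar> <= e / 3"
    using F[OF elim(2) v wB] D[OF v wB] le elim(1) w(1) by (auto simp: less_imp_le)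
   then show "\<bar>F N v - D v\<bar> <= e" unfolding abs_le_iff by linarith
  qed
 qed
qed

context prob_space
begin

lemma slln_nonneg:
 fixes X :: "nat => 'a => real"
 assumes X [measurable]: "\<And>i. random_variable borel (X i)" and pos: "\<And>i \<omega>. X i \<omega> >= 0"
  and int: "\<And>i. integrable M (X i)" "\<And>i j. integrable M (\<lambda>\<omega>. X i \<omega> * X j \<omega>)"
  and mean: "\<And>i. expectation (X i) = L"
  and uncor: "\<And>i j. i \<noteq> j ==> expectation (\<lambda>\<omega>. X i \<omega> * X j \<omega>) = L * L"
  and var: "\<And>i. expectation (\<lambda>\<omega>. (X i \<omega>)^2) <= C"
 shows "AE \<omega> in M. (\<lambda>n. (\<Sum>i<n. X i \<omega>) / real n) \<longlonglongrightarrow> L"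
proof -
 have eq: "expectation (\<lambda>\<omega>. (X i \<omega> - L) * (X j \<omega> - L)) = expectation (\<lambda>\<omega>. X i \<omega> * X j \<omega>) - L * L" for i j
  by (simp add: algebra_simps int mean prob_space)
 have "AE \<omega> in M. (\<lambda>n. (\<Sum>i<n^2. X i \<omega> - L) / real (n^2)) \<longlonglongrightarrow> 0"
 proof (rule slln_along_squares)
  show "random_variable borel (\<lambda>\<omega>. X i \<omega> - L)" for i by simp
  show "integrable M (\<lambda>\<omega>. (X i \<omega> - L) * (X j \<omega> - L))" for i j by (simp add: algebra_simps int)
  show "expectation (\<lambda>\<omega>. (X i \<omega> - L) * (X j \<omega> - L)) = 0" if "i \<noteq> j" for i j using uncor[OF that] by (simp add: eq)
  show "expectation (\<lambda>\<omega>. (X i \<omega> - L)^2) <= C" for i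
   using var[of i] eq[of i i] zero_le_square[of L] unfolding power2_eq_square by linarith
 qed
 then show ?thesis by eventually_elim (rule averages_of_squares_nonneg[OF pos])
qed

lemma slln_dominated:
 fixes X U :: "nat => 'a => real"
 assumes "\<And>i. random_variable borel (X i)" and "\<And>i j. integrable M (\<lambda>\<omega>. X i \<omega> * X j \<omega>)"
  and "\<And>i j. i \<noteq> j ==> expectation (\<lambda>\<omega>. X i \<omega> * X j \<omega>) = 0"
  and "\<And>i. expectation (\<lambda>\<omega>. (X i \<omega>)^2) <= C"
  and XU: "AE \<omega> in M. \<forall>i. \<bar>X i \<omega>\<bar> <= U i \<omega>" and U: "AE \<omega> in M. (\<lambda>n. (\<Sum>i<n. U i \<omega>) / real n) \<longlonglongrightarrow> L"
 shows "AE \<omega> in M. (\<lambda>n. (\<Sum>i<n. X i \<omega>) / real n) \<longlonglongrightarrow> 0"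
proof -
 have "AE \<omega> in M. (\<lambda>n. (\<Sum>i<n^2. X i \<omega>) / real (n^2)) \<longlonglongrightarrow> 0" by (rule slln_along_squares[of X C]) (fact assms)+
 then show ?thesis using XU U
 proof eventually_elim
  case (elim \<omega>)
  then show ?case by (intro averages_of_squares_dominated[of "\<lambda>i. X i \<omega>" "\<lambda>i. U i \<omega>"]) auto
 qed
qed

section \<open>Products of independent variables and moments of the noise\<close>

lemma indep_pair:
 fixes X :: "nat => 'a => 'c :: topological_space"
 assumes X: "indep_vars (\<lambda>_. borel) X I" and ij: "i \<in> I" "j \<in> I" "i \<noteq> j"
  and h: "h \<in> borel_measurable borel" and int: "\<And>k. k \<in> I ==> integrable M (\<lambda>\<omega>. h (X k \<omega>) :: real)"
 shows "integrable M (\<lambda>\<omega>. h (X i \<omega>) * h (X j \<omega>))"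
  "expectation (\<lambda>\<omega>. h (X i \<omega>) * h (X j \<omega>)) = expectation (\<lambda>\<omega>. h (X i \<omega>)) * expectation (\<lambda>\<omega>. h (X j \<omega>))"
proof -
 have "indep_vars (\<lambda>_. borel) (\<lambda>k \<omega>. h (X k \<omega>)) {i, j}"
  by (rule indep_vars_compose2[OF indep_vars_subset[OF X]]) (use ij h in auto)
 then show "integrable M (\<lambda>\<omega>. h (X i \<omega>) * h (X j \<omega>))"
  "expectation (\<lambda>\<omega>. h (X i \<omega>) * h (X j \<omega>)) = expectation (\<lambda>\<omega>. h (X i \<omega>)) * expectation (\<lambda>\<omega>. h (X j \<omega>))"
  using indep_vars_integrable[of "{i, j}" "\<lambda>k \<omega>. h (X k \<omega>)"] indep_vars_lebesgue_integral[of "{i, j}" "\<lambda>k \<omega>. h (X k \<omega>)"]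
   int ij by auto
qed

lemma normal_moments:
 assumes \<sigma>: "\<sigma> > 0" and d: "distributed M lborel E (\<lambda>z. ennreal (normal_density 0 \<sigma> z))"
 shows "integrable M E" "expectation E = 0" "integrable M (\<lambda>\<omega>. (E \<omega>)^2)" "expectation (\<lambda>\<omega>. (E \<omega>)^2) = \<sigma>^2"
  "expectation (\<lambda>\<omega>. \<bar>E \<omega>\<bar>) = sqrt (2 / pi) * \<sigma>"
proof -
 have d': "distributed M lborel E (normal_density 0 \<sigma>)" using d .
 have i: "integrable M (\<lambda>\<omega>. g (E \<omega>)) \<longleftrightarrow> integrable lborel (\<lambda>x. normal_density 0 \<sigma> x * g x)"
  "expectation (\<lambda>\<omega>. g (E \<omega>)) = (\<integral>x. normal_density 0 \<sigma> x * g x \<partial>lborel)"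
  if "g \<in> borel_measurable borel" for g :: "real => real"
  using distributed_integrable[OF d', of g] distributed_integral[OF d', of g] that by simp_all
 show "integrable M E" "expectation E = 0"
  using i[of "\<lambda>x. x"] integrable_normal_moment_nz_1[OF \<sigma>, of 0] integral_normal_moment_nz_1[OF \<sigma>, of 0] by simp_all
 show "integrable M (\<lambda>\<omega>. (E \<omega>)^2)" "expectation (\<lambda>\<omega>. (E \<omega>)^2) = \<sigma>^2"
  using i[of "\<lambda>x. x^2"] integrable_normal_moment[OF \<sigma>, of 0 2] integral_normal_moment_even[OF \<sigma>, of 0 1] by simp_all
 show "expectation (\<lambda>\<omega>. \<bar>E \<omega>\<bar>) = sqrt (2 / pi) * \<sigma>"
  using i[of "\<lambda>x. \<bar>x\<bar>"] integral_normal_moment_abs_odd[OF \<sigma>, of 0 0] by simp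
qed

end

section \<open>Posterior concentration\<close>

definition norm_ball :: "real => real => vector_field set" where "norm_ball s R = {v \<in> div_free s. div_free_norm s v <= R}"

definition locally_lipschitz :: "real => (vector_field => real) => bool" where
 "locally_lipschitz m h \<longleftrightarrow> (\<forall>R. \<exists>K\<ge>0. \<forall>v\<in>norm_ball m R. \<forall>w\<in>norm_ball m R. \<bar>h v - h w\<bar> <= K * div_free_dist m v w)"

lemma div_free_norm_mono:
 assumes "s <= r" "v \<in> div_free r" shows "div_free_norm s v <= div_free_norm r v"
 using div_free_dist_mono[OF assms zero_div_free] by (simp add: div_free_norm_eq_dist)

lemma norm_ball_subset:
 assumes "s <= r" "R <= S" shows "norm_ball r R \<subseteq> norm_ball s S"
proof
 fix v assume "v \<in> norm_ball r R"
 then show "v \<in> norm_ball s S"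
  using div_free_mono[OF assms(1), of v] div_free_norm_mono[OF assms(1), of v] assms(2) by (auto simp: norm_ball_def)
qed

lemma div_free_dist_triangle:
 assumes "m > 1" "u \<in> div_free m" "v \<in> div_free m" "w \<in> div_free m"
 shows "div_free_dist m u w <= div_free_dist m u v + div_free_dist m v w"
 by (rule Metric_space.triangle[OF Metric_space_div_free[OF assms(1)] assms(2-4)])

lemma div_free_dist_zero:
 assumes "m > 1" "u \<in> div_free m" "v \<in> div_free m" shows "div_free_dist m u v = 0 \<longleftrightarrow> u = v"
 by (rule Metric_space.zero[OF Metric_space_div_free[OF assms(1)] assms(2,3)])

lemma div_free_norm_le_dist:
 assumes "m > 1" "v \<in> div_free m" "w \<in> div_free m"
 shows "div_free_norm m w <= div_free_norm m v + div_free_dist m v w"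
 using div_free_dist_triangle[OF assms(1,3,2) zero_div_free]
 by (simp add: div_free_norm_eq_dist div_free_dist_commute[of m w v])

text \<open>Compactness gives every sequence in the ball a Cauchy subsequence, hence total
  boundedness. The net points lie in the ball itself, so the Lipschitz bounds apply to them.\<close>

lemma norm_ball_net:
 assumes m: "m > 1" "m < m'" and e: "e > 0"
 shows "\<exists>S. finite S \<and> S \<subseteq> norm_ball m' R \<and> (\<forall>v\<in>norm_ball m' R. \<exists>w\<in>S. div_free_dist m v w < e)"
proof -
 interpret Metric_space "div_free m" "div_free_dist m" by (rule Metric_space_div_free[OF m(1)])
 have sub: "norm_ball m' R \<subseteq> div_free m" using norm_ball_subset[of m m' R R] m by (auto simp: norm_ball_def)
 have "\<exists>r. strict_mono r \<and> MCauchy (v \<circ> r)" if v: "range v \<subseteq> norm_ball m' R" for v :: "nat => vector_field"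
 proof -
  have v': "v n \<in> div_free m'" "div_free_norm m' (v n) <= R" for n using v by (auto simp: norm_ball_def)
  obtain u r where u: "u \<in> div_free m'" "strict_mono (r :: nat => nat)" "(\<lambda>n. div_free_dist m (v (r n)) u) \<longlonglongrightarrow> 0"
   by (rule div_free_compact[OF m v']) (rule that)
  have um: "u \<in> div_free m" using div_free_mono[OF _ u(1), of m] m by simp
  have vm: "v n \<in> div_free m" for n using v sub by auto
  have "MCauchy (v \<circ> r)" unfolding MCauchy_def
  proof (intro conjI allI impI)
   show "range (v \<circ> r) \<subseteq> div_free m" using vm by auto
   fix e :: real assume "e > 0"
   then obtain N where N: "\<And>n. n >= N ==> div_free_dist m (v (r n)) u < e / 2"
    using LIMSEQ_D[OF u(3), of "e / 2"] by auto
   have "div_free_dist m ((v \<circ> r) a) ((v \<circ> r) b) < e" if "N <= a" "N <= b" for a b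
    using triangle[OF vm um vm, of "r a" "r b"] N[OF that(1)] N[OF that(2)]
    by (simp add: div_free_dist_commute[of m u])
   then show "\<exists>N. \<forall>n n'. N <= n \<longrightarrow> N <= n' \<longrightarrow> div_free_dist m ((v \<circ> r) n) ((v \<circ> r) n') < e" by blast
  qed
  then show ?thesis using u(2) by blast
 qed
 then have "mtotally_bounded (norm_ball m' R)" unfolding mtotally_bounded_sequentially using sub by blast
 then have "\<exists>S. finite S \<and> S \<subseteq> norm_ball m' R \<and> norm_ball m' R \<subseteq> (\<Union>x\<in>S. mball x e)"
  using e unfolding mtotally_bounded_def by simp
 then obtain S where S: "finite S" "S \<subseteq> norm_ball m' R" "norm_ball m' R \<subseteq> (\<Union>x\<in>S. mball x e)" by (elim exE conjE)
 have "\<exists>w\<in>S. div_free_dist m v w < e" if v: "v \<in> norm_ball m' R" for v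
 proof -
  obtain w where "w \<in> S" "v \<in> mball w e" using subsetD[OF S(3) v] by (elim UN_E)
  then show ?thesis by (auto simp: div_free_dist_commute[of m v])
 qed
 then show ?thesis using S(1,2) by (intro exI[of _ S] conjI ballI)
qed

subsection \<open>Measurability\<close>

lemma topspace_div_free: "m > 1 ==> topspace (div_free_topology m) = div_free m"
 unfolding div_free_topology_def by (rule Metric_space.topspace_mtopology[OF Metric_space_div_free])

lemma div_free_open_subset: "m > 1 ==> {U. openin (div_free_topology m) U} \<subseteq> Pow (div_free m)"
 using openin_subset[of "div_free_topology m"] by (auto simp: topspace_div_free)

lemma space_div_free_borel: "m > 1 ==> space (div_free_borel m) = div_free m"
 unfolding div_free_borel_def using div_free_open_subset by (simp add: space_measure_of)

lemma open_in_div_free_borel: "m > 1 ==> openin (div_free_topology m) U ==> U \<in> sets (div_free_borel m)"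
 unfolding div_free_borel_def using div_free_open_subset by (auto simp: sets_measure_of)

lemma openin_div_free: "m > 1 ==> openin (div_free_topology m) U \<longleftrightarrow>
  U \<subseteq> div_free m \<and> (\<forall>v\<in>U. \<exists>r>0. \<forall>w\<in>div_free m. div_free_dist m v w < r \<longrightarrow> w \<in> U)"
 unfolding div_free_topology_def
  Metric_space.openin_mtopology[OF Metric_space_div_free] Metric_space.mball_def[OF Metric_space_div_free] by blast

lemma continuous_measurable_div_free:
 assumes "m > 1" and h: "continuous_map (div_free_topology m) euclideanreal h"
 shows "h \<in> borel_measurable (div_free_borel m)"
proof (rule borel_measurableI)
 fix S :: "real set" assume "open S"
 then have "openin (div_free_topology m) {v \<in> topspace (div_free_topology m). h v \<in> S}"
  by (intro openin_continuous_map_preimage[OF h]) simp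
 then show "h -` S \<inter> space (div_free_borel m) \<in> sets (div_free_borel m)" using open_in_div_free_borel[OF assms(1)]
  by (simp add: space_div_free_borel topspace_div_free assms(1) vimage_def Int_def conj_commute)
qed

lemma locally_lipschitz_eps:
 assumes m: "m > 1" and h: "locally_lipschitz m h" and v: "v \<in> div_free m" and e: "e > 0"
 shows "\<exists>r>0. \<forall>w\<in>div_free m. div_free_dist m v w < r \<longrightarrow> \<bar>h w - h v\<bar> < e"
proof -
 define R where "R = div_free_norm m v + 1"
 obtain K where K: "K >= 0" "\<And>v w. v \<in> norm_ball m R ==> w \<in> norm_ball m R ==> \<bar>h v - h w\<bar> <= K * div_free_dist m v w"
  using h unfolding locally_lipschitz_def by blast
 have vR: "v \<in> norm_ball m R" using v by (simp add: norm_ball_def R_def)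
 have "\<bar>h w - h v\<bar> < e" if w: "w \<in> div_free m" "div_free_dist m v w < min 1 (e / (K + 1))" for w
 proof -
  have "w \<in> norm_ball m R" using div_free_norm_le_dist[OF m v w(1)] w by (simp add: norm_ball_def R_def)
  then have "\<bar>h w - h v\<bar> <= K * div_free_dist m v w" using K(2)[OF vR, of w] by (simp add: abs_minus_commute)
  also have "... <= (K + 1) * div_free_dist m v w" by (intro mult_right_mono) (auto simp: div_free_dist_nonneg)
  also have "... < e" using w(2) K(1) by (simp add: less_divide_eq mult.commute)
  finally show ?thesis .
 qed
 then show ?thesis using e K(1) by (intro exI[of _ "min 1 (e / (K + 1))"]) auto
qed

lemma locally_lipschitz_measurable:
 assumes m: "m > 1" and h: "locally_lipschitz m h"
 shows "h \<in> borel_measurable (div_free_borel m)"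
proof (rule borel_measurableI)
 fix S :: "real set" assume S: "open S"
 have "openin (div_free_topology m) (h -` S \<inter> div_free m)" unfolding openin_div_free[OF m]
 proof (intro conjI ballI)
  fix v assume v: "v \<in> h -` S \<inter> div_free m"
  then obtain e where e: "e > 0" "\<And>y. dist y (h v) < e ==> y \<in> S" using S unfolding open_dist by blast
  obtain r where r: "r > 0" "\<And>w. w \<in> div_free m ==> div_free_dist m v w < r ==> \<bar>h w - h v\<bar> < e"
   using locally_lipschitz_eps[OF m h _ e(1), of v] v by blast
  show "\<exists>r>0. \<forall>w\<in>div_free m. div_free_dist m v w < r \<longrightarrow> w \<in> h -` S \<inter> div_free m"
   using r e(2) by (intro exI[of _ r]) (auto simp: dist_real_def)
 qed simp
 then show "h -` S \<inter> space (div_free_borel m) \<in> sets (div_free_borel m)"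
  using open_in_div_free_borel[OF m] by (simp add: space_div_free_borel m)
qed

lemma dist_measurable:
 assumes m: "m > 1" and w: "w \<in> div_free m"
 shows "(\<lambda>v. div_free_dist m v w) \<in> borel_measurable (div_free_borel m)"
proof (rule locally_lipschitz_measurable[OF m])
 have "\<bar>div_free_dist m u w - div_free_dist m v w\<bar> <= 1 * div_free_dist m u v"
  if "u \<in> div_free m" "v \<in> div_free m" for u v
  using div_free_dist_triangle[OF m that(1,2) w] div_free_dist_triangle[OF m that(2,1) w]
  by (simp add: div_free_dist_commute[of m v u] abs_le_iff)
 then show "locally_lipschitz m (\<lambda>v. div_free_dist m v w)"
  unfolding locally_lipschitz_def norm_ball_def by (intro allI exI[of _ 1]) auto
qed

lemma norm_ball_sequence_limit:
 assumes m: "m > 1" "m < m'" and v: "\<And>n. v n \<in> norm_ball m' R"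
 obtains u r where "u \<in> norm_ball m' R" "strict_mono (r :: nat => nat)" "(\<lambda>n. div_free_dist m (v (r n)) u) \<longlonglongrightarrow> 0"
proof (rule div_free_compact[OF m, of v R])
 show "v n \<in> div_free m'" "div_free_norm m' (v n) <= R" for n using v[of n] by (auto simp: norm_ball_def)
qed (rule that, auto simp: norm_ball_def)

text \<open>The norm of V is not continuous on H, but its balls are closed in H: a sequence in the
  ball that converges in H has a subsequence whose limit compactness places in the ball.\<close>

lemma norm_ball_measurable:
 assumes m: "m > 1" "m < m'"
 shows "norm_ball m' R \<in> sets (div_free_borel m)"
proof -
 have sub: "norm_ball m' R \<subseteq> div_free m" using norm_ball_subset[of m m' R R] m by (auto simp: norm_ball_def)
 have "openin (div_free_topology m) (div_free m - norm_ball m' R)" unfolding openin_div_free[OF m(1)]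
 proof (intro conjI ballI)
  fix v assume v: "v \<in> div_free m - norm_ball m' R"
  show "\<exists>r>0. \<forall>w\<in>div_free m. div_free_dist m v w < r \<longrightarrow> w \<in> div_free m - norm_ball m' R"
  proof (rule ccontr)
   assume neg: "\<not> ?thesis"
   have "\<exists>w. w \<in> norm_ball m' R \<and> div_free_dist m v w < inverse (real (Suc n))" for n
   proof (rule ccontr)
    assume "\<not> ?thesis"
    then have "\<forall>w\<in>div_free m. div_free_dist m v w < inverse (real (Suc n)) \<longrightarrow> w \<in> div_free m - norm_ball m' R" by blast
    with neg show False by (meson inverse_positive_iff_positive of_nat_0_less_iff zero_less_Suc)
   qed
   then obtain w where w: "\<And>n. w n \<in> norm_ball m' R" "\<And>n. div_free_dist m v (w n) < inverse (real (Suc n))" by metis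
   obtain u r where u: "u \<in> norm_ball m' R" "strict_mono r" "(\<lambda>n. div_free_dist m (w (r n)) u) \<longlonglongrightarrow> 0"
    by (rule norm_ball_sequence_limit[OF m w(1)]) (rule that)
   have "(\<lambda>n. div_free_dist m v (w n)) \<longlonglongrightarrow> 0"
    by (rule Lim_null_comparison[OF _ LIMSEQ_inverse_real_of_nat]) (simp add: div_free_dist_nonneg w(2) less_imp_le del: of_nat_Suc)
   then have "(\<lambda>n. div_free_dist m v (w (r n)) + div_free_dist m (w (r n)) u) \<longlonglongrightarrow> 0 + 0"
    by (intro tendsto_add u filterlim_compose[OF _ filterlim_subseq[OF u(2)]])
   moreover have "div_free_dist m v u <= div_free_dist m v (w (r n)) + div_free_dist m (w (r n)) u" for n
    using v sub u(1) w(1)[of "r n"] by (intro div_free_dist_triangle[OF m(1)]) auto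
   ultimately have "div_free_dist m v u <= 0 + 0" by (intro LIMSEQ_le_const) auto
   then have "div_free_dist m v u = 0" using div_free_dist_nonneg[of m v u] by simp
   then have "v = u" using div_free_dist_zero[OF m(1)] v sub u(1) by auto
   then show False using v u(1) by simp
  qed
 qed simp
 from open_in_div_free_borel[OF m(1) this] have "space (div_free_borel m) - (div_free m - norm_ball m' R) \<in> sets (div_free_borel m)"
  by (rule sets.compl_sets)
 moreover have "space (div_free_borel m) - (div_free m - norm_ball m' R) = norm_ball m' R"
  using sub by (auto simp: space_div_free_borel m)
 ultimately show ?thesis by simp
qed

subsection \<open>Concentration from a uniform law of large numbers\<close>

text \<open>The norm of V dominates that of H, so h is small on small balls of V; it is to these
  that the prior is assumed to give mass.\<close>

lemma prior_small_ball:
 assumes m: "m > 1" "m < m'" and vs: "vstar \<in> div_free m'" and h: "locally_lipschitz m h" "h vstar = 0" and a: "a > 0"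
 shows "\<exists>r>0. r <= 1 \<and> (\<forall>v\<in>div_free_cball m' vstar r. h v <= a)"
proof -
 have sm: "s \<in> div_free m" if "s \<in> div_free m'" for s using div_free_mono[OF _ that, of m] m by simp
 obtain r where r: "r > 0" "\<And>w. w \<in> div_free m ==> div_free_dist m vstar w < r ==> \<bar>h w - h vstar\<bar> < a"
  using locally_lipschitz_eps[OF m(1) h(1) sm[OF vs] a] by blast
 have "h v <= a" if v: "v \<in> div_free_cball m' vstar (min 1 (r / 2))" for v
 proof -
  have v': "v \<in> div_free m'" "div_free_dist m' v vstar <= r / 2" using v by (auto simp: div_free_cball_def)
  have "div_free_dist m vstar v <= r / 2"
   using div_free_dist_mono[of m m' v vstar] v' vs m by (simp add: div_free_dist_commute[of m vstar])
  then show ?thesis using r(2)[OF sm[OF v'(1)]] r(1) h(2) by simp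
 qed
 then show ?thesis using r(1) by (intro exI[of _ "min 1 (r / 2)"]) auto
qed

text \<open>The minimum of a continuous function on a compact set, argued by sequences: points at
  which h tends to zero would have a limit in the ball with h = 0, that is \<open>vstar\<close>,
  although they all keep the distance \<delta>.\<close>

lemma bounded_below_away:
 assumes m: "m > 1" "m < m'" and vs: "vstar \<in> div_free m'"
  and h: "locally_lipschitz m h" "\<And>v. v \<in> div_free m' ==> v \<noteq> vstar ==> h v > 0" and \<delta>: "\<delta> > 0"
 shows "\<exists>a>0. \<forall>v\<in>norm_ball m' R. div_free_dist m v vstar >= \<delta> \<longrightarrow> h v >= a"
proof (rule ccontr)
 assume neg: "\<not> ?thesis"
 have "\<exists>v. v \<in> norm_ball m' R \<and> div_free_dist m v vstar >= \<delta> \<and> h v < inverse (real (Suc n))" for n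
 proof (rule ccontr)
  assume "\<not> ?thesis"
  then have "\<forall>v\<in>norm_ball m' R. div_free_dist m v vstar >= \<delta> \<longrightarrow> h v >= inverse (real (Suc n))" by (auto simp: not_less)
  with neg show False by (meson inverse_positive_iff_positive of_nat_0_less_iff zero_less_Suc)
 qed
 then obtain v where v: "\<And>n. v n \<in> norm_ball m' R" "\<And>n. div_free_dist m (v n) vstar >= \<delta>"
  "\<And>n. h (v n) < inverse (real (Suc n))" by metis
 obtain u r where u: "u \<in> norm_ball m' R" "strict_mono (r :: nat => nat)" "(\<lambda>n. div_free_dist m (v (r n)) u) \<longlonglongrightarrow> 0"
  by (rule norm_ball_sequence_limit[OF m v(1)]) (rule that)
 have sub: "norm_ball m' R \<subseteq> div_free m" "norm_ball m' R \<subseteq> norm_ball m R"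
  using norm_ball_subset[of m m' R R] m by (auto simp: norm_ball_def)
 obtain K where K: "\<And>v w. v \<in> norm_ball m R ==> w \<in> norm_ball m R ==> \<bar>h v - h w\<bar> <= K * div_free_dist m v w"
  using h(1) unfolding locally_lipschitz_def by blast
 have "h u <= inverse (real (Suc n)) + K * div_free_dist m (v (r n)) u" for n
 proof -
  have "\<bar>h (v (r n)) - h u\<bar> <= K * div_free_dist m (v (r n)) u" by (rule K) (use v(1) u(1) sub(2) in blast)+
  moreover have "inverse (real (Suc (r n))) <= inverse (real (Suc n))"
   using seq_suble[OF u(2), of n] by (intro le_imp_inverse_le) auto
  ultimately show ?thesis using v(3)[of "r n"] by linarith
 qed
 moreover have "(\<lambda>n. inverse (real (Suc n)) + K * div_free_dist m (v (r n)) u) \<longlonglongrightarrow> 0 + K * 0"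
  by (intro tendsto_add tendsto_mult tendsto_const LIMSEQ_inverse_real_of_nat u)
 ultimately have "h u <= 0 + K * 0" by (intro LIMSEQ_le_const) auto
 then have "u = vstar" using h(2)[of u] u(1) by (force simp: norm_ball_def)
 then have "\<delta> <= 0" using v(2) u(3) by (intro LIMSEQ_le_const[OF u(3)]) auto
 with \<delta> show False by simp
qed

section \<open>The posterior for one fixed realisation of the data\<close>

context
 fixes m m' \<sigma> :: real and \<mu>0 :: "vector_field measure" and vstar :: vector_field
  and g :: "nat => vector_field => real" and y :: "nat => real"
 assumes m: "m > 1" "m < m'" and \<sigma>: "\<sigma> > 0" and \<mu>0: "prob_space \<mu>0" "sets \<mu>0 = sets (div_free_borel m)"
  and vstar: "vstar \<in> div_free m'"
  and g: "\<And>j. j >= 1 ==> locally_lipschitz m (g j)"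
begin

abbreviation "excess N v \<equiv> (\<Sum>j=1..N. (y j - g j v)^2 - (y j - g j vstar)^2) / real N"
abbreviation "post N \<equiv> posterior \<sigma> \<mu>0 g y N"
abbreviation "evidence N \<equiv> (\<integral>u. likelihood \<sigma> g y N u \<partial>\<mu>0)"

lemma space_prior: "space \<mu>0 = div_free m" using sets_eq_imp_space_eq[OF \<mu>0(2)] by (simp add: space_div_free_borel m)

lemma prior_measurable: "h \<in> borel_measurable (div_free_borel m) ==> h \<in> borel_measurable \<mu>0"
 using measurable_cong_sets[OF \<mu>0(2) refl, of borel] by blast

lemma likelihood_measurable [measurable]: "likelihood \<sigma> g y N \<in> borel_measurable \<mu>0"
proof -
 have "g j \<in> borel_measurable \<mu>0" if "j \<in> {1..N}" for j
  using that by (intro prior_measurable locally_lipschitz_measurable[OF m(1)] g) auto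
 then show ?thesis unfolding likelihood_def[abs_def] by measurable
qed

lemma likelihood_bounds: "0 < likelihood \<sigma> g y N v" "likelihood \<sigma> g y N v <= 1"
 by (auto simp: likelihood_def intro!: divide_nonneg_nonneg sum_nonneg)

lemma likelihood_integrable: "integrable \<mu>0 (likelihood \<sigma> g y N)" using likelihood_bounds[of N]
 by (intro finite_measure.integrable_const_bound[OF prob_space.finite_measure[OF \<mu>0(1)], of _ 1])
  (auto simp: less_imp_le)

lemma evidence_pos: "evidence N > 0"
proof -
 interpret prob_space \<mu>0 by (rule \<mu>0(1))
 have "evidence N \<noteq> 0"
 proof
  assume "evidence N = 0"
  then have "AE v in \<mu>0. likelihood \<sigma> g y N v = 0"
   by (subst (asm) integral_nonneg_eq_0_iff_AE[OF likelihood_integrable]) (auto simp: likelihood_bounds less_imp_le)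
  then have "AE v in \<mu>0. False" by eventually_elim (use likelihood_bounds in \<open>simp add: less_le\<close>)
  then show False by simp
 qed
 moreover have "evidence N >= 0" by (intro Bochner_Integration.integral_nonneg) (auto simp: likelihood_bounds less_imp_le)
 ultimately show ?thesis by simp
qed

lemma sets_post: "sets (post N) = sets (div_free_borel m)" and space_post: "space (post N) = div_free m"
 by (simp_all add: posterior_def \<mu>0(2) space_prior)

lemma prob_space_post: "prob_space (post N)"
proof
 have "emeasure (post N) (space (post N)) = (\<integral>\<^sup>+v. ennreal (likelihood \<sigma> g y N v / evidence N) \<partial>\<mu>0)"
  by (simp add: posterior_def emeasure_density cong: nn_integral_cong)
 also have "... = ennreal (\<integral>v. likelihood \<sigma> g y N v / evidence N \<partial>\<mu>0)" using evidence_pos[of N]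
  by (intro nn_integral_eq_integral) (auto simp: likelihood_integrable likelihood_bounds less_imp_le)
 finally show "emeasure (post N) (space (post N)) = 1" using evidence_pos[of N] by simp
qed

lemma likelihood_excess:
 assumes "N >= 1"
 shows "likelihood \<sigma> g y N v = likelihood \<sigma> g y N vstar * exp (- (real N / (2 * \<sigma>^2)) * excess N v)"
 using assms \<sigma> unfolding likelihood_def exp_add[symmetric] sum_subtractf by (simp add: field_simps)

text \<open>The likelihood of \<open>vstar\<close> cancels between the numerator, bounded above on
  A, and the evidence, bounded below by its part over B.\<close>

lemma post_le:
 assumes N: "N >= 1" and A: "A \<in> sets (div_free_borel m)" "\<And>v. v \<in> A ==> excess N v >= a"
  and B: "measure \<mu>0 B > 0" "\<And>v. v \<in> B ==> excess N v <= b"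
 shows "measure (post N) A <= exp (- (real N * (a - b) / (2 * \<sigma>^2))) / measure \<mu>0 B"
proof -
 interpret prob_space \<mu>0 by (rule \<mu>0(1))
 define c where "c = likelihood \<sigma> g y N vstar"
 have c: "c > 0" by (simp add: c_def likelihood_bounds)
 define E where "E s = exp (- (real N / (2 * \<sigma>^2)) * s)" for s
 have E: "E s > 0" "s <= t ==> E t <= E s" for s t using \<sigma> by (auto simp: E_def intro!: divide_right_mono mult_left_mono)
 have L: "likelihood \<sigma> g y N v = c * E (excess N v)" for v unfolding c_def E_def by (rule likelihood_excess[OF N])
 have Bs: "B \<in> sets \<mu>0" using B(1) measure_notin_sets[of B \<mu>0] by (cases "B \<in> sets \<mu>0") auto
 have "c * E b * measure \<mu>0 B = (\<integral>v. c * E b * indicator B v \<partial>\<mu>0)" using Bs by simp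
 also have "... <= evidence N"
 proof (rule integral_mono)
  show "integrable \<mu>0 (\<lambda>v. c * E b * indicator B v)" using Bs by (simp add: less_top[symmetric])
  show "integrable \<mu>0 (likelihood \<sigma> g y N)" by (rule likelihood_integrable)
  show "c * E b * indicator B v <= likelihood \<sigma> g y N v" for v
   using E(2)[OF B(2), of v] c E(1) by (cases "v \<in> B") (auto simp: L less_imp_le)
 qed
 finally have Z: "c * E b * measure \<mu>0 B <= evidence N" .
 have le: "likelihood \<sigma> g y N v / evidence N <= E a / (E b * measure \<mu>0 B)" if "v \<in> A" for v
 proof -
  have "likelihood \<sigma> g y N v / evidence N <= c * E a / (c * E b * measure \<mu>0 B)"
  proof (rule frac_le[OF _ _ _ Z])
   show "0 <= c * E a" "0 < c * E b * measure \<mu>0 B" using c E(1)[of a] E(1)[of b] B(1) by auto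
   show "likelihood \<sigma> g y N v <= c * E a" unfolding L using c E(2)[OF A(2)[OF that]] by simp
  qed
  then show ?thesis using c by simp
 qed
 have q: "E a / (E b * measure \<mu>0 B) >= 0" using E(1) by (simp add: less_imp_le)
 have "emeasure (post N) A = (\<integral>\<^sup>+v. ennreal (likelihood \<sigma> g y N v / evidence N) * indicator A v \<partial>\<mu>0)"
  using A(1) by (simp add: posterior_def emeasure_density \<mu>0(2))
 also have "... <= (\<integral>\<^sup>+v. ennreal (E a / (E b * measure \<mu>0 B)) \<partial>\<mu>0)"
  by (intro nn_integral_mono) (auto simp: indicator_def intro!: ennreal_leI le)
 also have "... = ennreal (E a / (E b * measure \<mu>0 B))" by (simp add: emeasure_space_1)
 finally have "measure (post N) A <= E a / (E b * measure \<mu>0 B)" using q by (simp add: measure_def enn2real_leI)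
 also have "... = exp (- (real N * (a - b) / (2 * \<sigma>^2))) / measure \<mu>0 B"
  unfolding E_def divide_divide_eq_left[symmetric] exp_diff[symmetric] by (simp add: algebra_simps diff_divide_distrib)
 finally show ?thesis .
qed

lemma post_away_tendsto_0:
 assumes prior: "\<And>r. r > 0 ==> emeasure \<mu>0 (div_free_cball m' vstar r) > 0"
  and h: "locally_lipschitz m h" "h vstar = 0" "\<And>v. v \<in> div_free m' ==> v \<noteq> vstar ==> h v > 0"
  and unif: "\<And>R e. e > 0 ==> \<forall>\<^sub>F N in sequentially. \<forall>v\<in>norm_ball m' R. \<bar>excess N v - h v\<bar> <= e"
  and \<delta>: "\<delta> > 0"
 shows "(\<lambda>N. measure (post N) {v \<in> norm_ball m' R. div_free_dist m v vstar >= \<delta>}) \<longlonglongrightarrow> 0"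
proof -
 interpret prob_space \<mu>0 by (rule \<mu>0(1))
 let ?A = "{v \<in> norm_ball m' R. div_free_dist m v vstar >= \<delta>}"
 have vm: "vstar \<in> div_free m" using div_free_mono[OF _ vstar, of m] m by simp
 have "?A = norm_ball m' R \<inter> {v \<in> space (div_free_borel m). div_free_dist m v vstar >= \<delta>}"
  using norm_ball_subset[of m m' R R] m by (auto simp: space_div_free_borel norm_ball_def)
 moreover have "{v \<in> space (div_free_borel m). div_free_dist m v vstar >= \<delta>} \<in> sets (div_free_borel m)"
  using dist_measurable[OF m(1) vm] by measurable
 ultimately have A: "?A \<in> sets (div_free_borel m)" using norm_ball_measurable[OF m, of R] by auto
 \<comment> \<open>h is at least a on the set to be estimated and at most a / 4 on the prior ball.
   With a uniform error of a / 4 the excess is at least 3a/4 on the former and at most a/2 on the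
   latter; the gap a/4 gives the exponential decay.\<close>
 obtain a where a: "a > 0" "\<And>v. v \<in> ?A ==> h v >= a" using bounded_below_away[OF m vstar h(1,3) \<delta>, of R] by blast
 obtain r where r: "r > 0" "r <= 1" "\<And>v. v \<in> div_free_cball m' vstar r ==> h v <= a / 4"
  using prior_small_ball[OF m vstar h(1,2), of "a / 4"] a(1) by auto
 let ?B = "div_free_cball m' vstar r"
 have B: "measure \<mu>0 ?B > 0" using prior[OF r(1)] by (simp add: emeasure_eq_measure)
 \<comment> \<open>The uniform law is available on balls around zero, so the prior ball around
   \<open>vstar\<close> is enclosed in one.\<close>
 have BR: "?B \<subseteq> norm_ball m' (div_free_norm m' vstar + 1)"
 proof
  fix v assume "v \<in> ?B"
  then have "v \<in> div_free m'" "div_free_dist m' v vstar <= 1" using r(2) by (auto simp: div_free_cball_def)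
  then show "v \<in> norm_ball m' (div_free_norm m' vstar + 1)"
   using div_free_norm_le_dist[of m' vstar v] m vstar by (simp add: norm_ball_def div_free_dist_commute[of m' vstar])
 qed
 have a4: "a / 4 > 0" using a(1) by simp
 have "\<forall>\<^sub>F N in sequentially. measure (post N) ?A <= exp (- (real N * (a / 4) / (2 * \<sigma>^2))) / measure \<mu>0 ?B"
  using eventually_ge_at_top[of 1] unif[OF a4, of R] unif[OF a4, of "div_free_norm m' vstar + 1"]
 proof eventually_elim
  case (elim N)
  have "measure (post N) ?A <= exp (- (real N * (a * 3 / 4 - a / 2) / (2 * \<sigma>^2))) / measure \<mu>0 ?B"
  proof (rule post_le[OF elim(1) A _ B])
   show "a * 3 / 4 <= excess N v" if "v \<in> ?A" for v
   proof -
    have "\<bar>excess N v - h v\<bar> <= a / 4" using elim(2) that by blast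
    then show ?thesis using a(2)[OF that] unfolding abs_le_iff by linarith
   qed
   show "excess N v <= a / 2" if "v \<in> ?B" for v
   proof -
    have "\<bar>excess N v - h v\<bar> <= a / 4" using elim(3) BR that by blast
    then show ?thesis using r(3)[OF that] unfolding abs_le_iff by linarith
   qed
  qed
  then show ?case by (simp add: field_simps)
 qed
 moreover have "(\<lambda>N. exp (- (real N * (a / 4) / (2 * \<sigma>^2))) / measure \<mu>0 ?B) \<longlonglongrightarrow> 0"
 proof -
  define p where "p = exp (- (a / 4 / (2 * \<sigma>^2)))"
  have p: "0 < p" "p < 1" using a(1) \<sigma> by (auto simp: p_def)
  have "exp (- (real N * (a / 4) / (2 * \<sigma>^2))) = p ^ N" for N
   unfolding p_def exp_of_nat_mult[symmetric] by (simp add: mult.commute)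
  moreover have "(\<lambda>N. p ^ N / measure \<mu>0 ?B) \<longlonglongrightarrow> 0 / measure \<mu>0 ?B"
   using p B by (intro tendsto_divide tendsto_const LIMSEQ_realpow_zero) auto
  ultimately show ?thesis by simp
 qed
 ultimately show ?thesis
  by (intro Lim_null_comparison[where f = "\<lambda>N. measure (post N) ?A"]) (auto elim: eventually_mono)
qed

text \<open>Markov's inequality. By monotonicity the moment function is at least f R outside the
  ball, and it is infinite at fields that are not in V. The threshold uses K + 1 so that it stays
  positive when K = 0.\<close>

lemma post_tight:
 assumes f: "mono_on {0..} f" "\<And>r. r >= 0 ==> f r >= 0" "filterlim f at_top at_top"
  and tight: "(SUP N\<in>{1..}. \<integral>\<^sup>+v. f_of_norm f m' v \<partial>(post N)) < \<infinity>"
  and e: "e > 0"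
 shows "\<exists>R. \<forall>N\<ge>1. measure (post N) (div_free m - norm_ball m' R) <= e"
proof -
 define S where "S = (SUP N\<in>{1..}. \<integral>\<^sup>+v. f_of_norm f m' v \<partial>(post N))"
 obtain K where K: "K >= 0" "S = ennreal K" using tight[folded S_def] by (cases S) auto
 have "\<forall>\<^sub>F R in at_top. f R >= (K + 1) / e \<and> R >= 0"
  using f(3)[unfolded filterlim_at_top, rule_format, of "(K + 1) / e"] eventually_ge_at_top[of 0]
  by eventually_elim simp
 then obtain R where R: "f R >= (K + 1) / e" "R >= 0" unfolding eventually_at_top_linorder by blast
 have fR: "f R > 0" using R(1) K(1) e by (intro less_le_trans[OF _ R(1)]) simp
 have "measure (post N) (div_free m - norm_ball m' R) <= e" if N: "N >= 1" for N
 proof -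
  interpret P: prob_space "post N" by (rule prob_space_post)
  let ?A = "div_free m - norm_ball m' R"
  have A: "?A \<in> sets (post N)"
   using sets.compl_sets[OF norm_ball_measurable[OF m, of R]] by (simp add: sets_post space_div_free_borel m)
  have "ennreal (f R) * emeasure (post N) ?A = (\<integral>\<^sup>+v. ennreal (f R) * indicator ?A v \<partial>(post N))"
   using A by (simp add: nn_integral_cmult_indicator)
  also have "... <= (\<integral>\<^sup>+v. f_of_norm f m' v \<partial>(post N))"
  proof (rule nn_integral_mono)
   fix v
   show "ennreal (f R) * indicator ?A v <= f_of_norm f m' v" using mono_onD[OF f(1), of R "div_free_norm m' v"] R(2)
    by (auto simp: f_of_norm_def norm_ball_def indicator_def intro!: ennreal_leI)
  qed
  also have "... <= ennreal K" unfolding K(2)[symmetric] S_def using N by (intro SUP_upper) auto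
  finally have "ennreal (f R * measure (post N) ?A) <= ennreal K"
   using fR by (simp add: P.emeasure_eq_measure ennreal_mult)
  then have "f R * measure (post N) ?A <= K" using K(1) by (subst (asm) ennreal_le_iff) auto
  moreover have "(K + 1) / e * measure (post N) ?A <= f R * measure (post N) ?A" by (intro mult_right_mono R) auto
  ultimately have "(K + 1) / e * measure (post N) ?A <= K" by linarith
  then have "(K + 1) * measure (post N) ?A <= K * e" using e by (simp add: field_simps)
  also have "... <= (K + 1) * e" using e by simp
  finally show ?thesis using K(1) by simp
 qed
 then show ?thesis by blast
qed

text \<open>Near \<open>vstar\<close> the test function varies by less than e / 4. The remaining
  fields lie either in a large ball of V, where their mass tends to zero, or outside it, where
  tightness makes the mass small for all N.\<close>

theorem posterior_consistency:
 assumes prior: "\<And>r. r > 0 ==> emeasure \<mu>0 (div_free_cball m' vstar r) > 0"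
  and h: "locally_lipschitz m h" "h vstar = 0" "\<And>v. v \<in> div_free m' ==> v \<noteq> vstar ==> h v > 0"
  and unif: "\<And>R e. e > 0 ==> \<forall>\<^sub>F N in sequentially. \<forall>v\<in>norm_ball m' R. \<bar>excess N v - h v\<bar> <= e"
  and f: "mono_on {0..} f" "\<And>r. r >= 0 ==> f r >= 0" "filterlim f at_top at_top"
  and tight: "(SUP N\<in>{1..}. \<integral>\<^sup>+v. f_of_norm f m' v \<partial>(post N)) < \<infinity>"
  and \<phi>: "continuous_map (div_free_topology m) euclideanreal \<phi>" "bounded (\<phi> ` div_free m)"
 shows "(\<lambda>N. \<integral>v. \<phi> v \<partial>(post N)) \<longlonglongrightarrow> \<phi> vstar"
proof (rule LIMSEQ_I)
 fix e :: real assume e: "e > 0"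
 have vm: "vstar \<in> div_free m" using div_free_mono[OF _ vstar, of m] m by simp
 obtain C where C: "C > 0" "\<And>v. v \<in> div_free m ==> \<bar>\<phi> v\<bar> <= C" using \<phi>(2) unfolding bounded_pos by auto
 have "openin (div_free_topology m) {v \<in> topspace (div_free_topology m). \<phi> v \<in> ball (\<phi> vstar) (e / 4)}"
  by (intro openin_continuous_map_preimage[OF \<phi>(1)]) simp
 then obtain \<delta> where \<delta>: "\<delta> > 0" "\<And>w. w \<in> div_free m ==> div_free_dist m vstar w < \<delta> ==> \<bar>\<phi> w - \<phi> vstar\<bar> < e / 4"
  using vm e unfolding openin_div_free[OF m(1)] by (auto simp: topspace_div_free m(1) dist_real_def abs_minus_commute)
 \<comment> \<open>The oscillation of \<phi> is at most 2 C and the exceptional mass at most 2 q,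
   which makes a contribution of e / 2.\<close>
 define q where "q = e / (8 * C)"
 have q: "q > 0" "2 * C * (q + q) = e / 2" using e C(1) by (auto simp: q_def field_simps)
 obtain R where R: "\<And>N. N >= 1 ==> measure (post N) (div_free m - norm_ball m' R) <= q"
  using post_tight[OF f tight q(1)] by blast
 let ?A = "{v \<in> norm_ball m' R. div_free_dist m v vstar >= \<delta>}"
 have "\<forall>\<^sub>F N in sequentially. measure (post N) ?A < q"
  using order_tendstoD(2)[OF post_away_tendsto_0[OF prior h unif \<delta>(1), of R] q(1)] .
 then have "\<forall>\<^sub>F N in sequentially. \<bar>(\<integral>v. \<phi> v \<partial>(post N)) - \<phi> vstar\<bar> < e" using eventually_ge_at_top[of 1]
 proof eventually_elim
  case (elim N)
  interpret P: prob_space "post N" by (rule prob_space_post)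
  have \<phi>m: "\<phi> \<in> borel_measurable (post N)"
   using continuous_measurable_div_free[OF m(1) \<phi>(1)] measurable_cong_sets[OF sets_post refl, of N borel] by blast
  have int: "integrable (post N) \<phi>"
   using C(2) by (intro P.integrable_const_bound[OF _ \<phi>m, of C] AE_I2) (simp add: space_post)
  let ?F = "{v \<in> space (post N). div_free_dist m v vstar >= \<delta>}"
  have dm: "(\<lambda>v. div_free_dist m v vstar) \<in> borel_measurable (post N)"
   using dist_measurable[OF m(1) vm] measurable_cong_sets[OF sets_post refl, of N borel] by blast
  have F: "?F \<in> sets (post N)" using dm by measurable
  have nb: "norm_ball m' R \<in> sets (post N)" using norm_ball_measurable[OF m] by (simp add: sets_post)
  have A: "?A \<in> sets (post N)"
  proof -
   have "?A = norm_ball m' R \<inter> ?F" using norm_ball_subset[of m m' R R] m by (auto simp: space_post norm_ball_def)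
   then show ?thesis using F nb by simp
  qed
  have T: "div_free m - norm_ball m' R \<in> sets (post N)" using sets.compl_sets[OF nb] by (simp add: space_post)
  have "measure (post N) ?F <= measure (post N) (?A \<union> (div_free m - norm_ball m' R))"
   by (intro P.finite_measure_mono sets.Un A T) (auto simp: space_post)
  also have "... <= measure (post N) ?A + measure (post N) (div_free m - norm_ball m' R)" by (rule measure_Un_le[OF A T])
  also have "... <= q + q" using elim(1) R[OF elim(2)] by linarith
  finally have mF: "measure (post N) ?F <= q + q" .
  have "\<bar>(\<integral>v. \<phi> v \<partial>(post N)) - \<phi> vstar\<bar> = \<bar>\<integral>v. \<phi> v - \<phi> vstar \<partial>(post N)\<bar>" using int by (simp add: P.prob_space)
  also have "... <= (\<integral>v. \<bar>\<phi> v - \<phi> vstar\<bar> \<partial>(post N))" by (rule integral_abs_bound)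
  also have "... <= (\<integral>v. e / 4 + 2 * C * indicator ?F v \<partial>(post N))"
  proof (rule integral_mono)
   show "integrable (post N) (\<lambda>v. \<bar>\<phi> v - \<phi> vstar\<bar>)" using int by simp
   show "integrable (post N) (\<lambda>v. e / 4 + 2 * C * indicator ?F v)" using F by (simp add: less_top[symmetric])
   fix v assume v: "v \<in> space (post N)"
   show "\<bar>\<phi> v - \<phi> vstar\<bar> <= e / 4 + 2 * C * indicator ?F v"
   proof (cases "v \<in> ?F")
    case True
    have "\<bar>\<phi> v - \<phi> vstar\<bar> <= C + C" using C(2)[of v] C(2)[OF vm] v by (simp add: space_post abs_le_iff)
    then show ?thesis using True e by simp
   next
    case False
    then have "\<bar>\<phi> v - \<phi> vstar\<bar> < e / 4"
     using v by (intro \<delta>(2)) (auto simp: space_post div_free_dist_commute[of m vstar])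
    then show ?thesis using False by simp
   qed
  qed
  also have "... = e / 4 + 2 * C * measure (post N) ?F" using F by (simp add: P.prob_space less_top[symmetric])
  also have "... <= e / 4 + 2 * C * (q + q)" using C(1) by (intro add_left_mono mult_left_mono mF) auto
  also have "... = e / 4 + e / 2" unfolding q(2) ..
  finally show ?case using e by simp
 qed
 then show "\<exists>no. \<forall>n\<ge>no. norm ((\<integral>v. \<phi> v \<partial>(post n)) - \<phi> vstar) < e" by (simp add: eventually_at_top_linorder)
qed

end

section \<open>The population risk\<close>

text \<open>Truncation of time and the indicator change nothing on the observation region, but make
  the function Borel and bounded on the whole space, as the strong laws demand.\<close>

definition misfit :: "real => real => real => vector_field => scalar_field => vector_field => real \<times> real \<times> real => real" where
 "misfit \<kappa> m T vstar \<theta>0 v z = indicator ({0..T} \<times> unit_cell) z *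
   (adv_diff_solution \<kappa> m v \<theta>0 (max 0 (fst z)) (snd z) - adv_diff_solution \<kappa> m vstar \<theta>0 (max 0 (fst z)) (snd z))"

abbreviation observation_law :: "real => (real \<times> real \<times> real) measure" where
 "observation_law T \<equiv> uniform_measure lborel ({0..T} \<times> unit_cell)"

definition risk :: "real => real => real => vector_field => scalar_field => vector_field => real" where
 "risk \<kappa> m T vstar \<theta>0 v = (\<integral>z. (misfit \<kappa> m T vstar \<theta>0 v z)^2 \<partial>observation_law T)"

lemma observation_box:
 fixes T :: real
 assumes "T > 0"
 shows "({0..T} \<times> unit_cell) \<in> sets borel"
  "emeasure lborel ({0..T} \<times> unit_cell) \<noteq> 0" "emeasure lborel ({0..T} \<times> unit_cell) < \<infinity>"
proof -
 show "({0..T} \<times> unit_cell) \<in> sets borel" by (intro borel_closed closed_Times) auto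
 have prod: "emeasure lborel (A \<times> B) = emeasure lborel A * emeasure lborel B"
  if "A \<in> sets borel" "B \<in> sets borel" for A :: "real set" and B :: "'a :: euclidean_space set"
  using lborel.emeasure_pair_measure_Times[of A lborel B] that by (simp add: lborel_prod)
 have "unit_cell = {0..1} \<times> {0..1}" by (simp add: cbox_Pair_eq)
 then have "emeasure lborel ({0..T} \<times> unit_cell) = ennreal T" using assms by (simp add: prod borel_closed closed_Times)
 then show "emeasure lborel ({0..T} \<times> unit_cell) \<noteq> 0" "emeasure lborel ({0..T} \<times> unit_cell) < \<infinity>" using assms by auto
qed

lemma prob_space_observation_law: "T > 0 ==> prob_space (observation_law T)"
 using observation_box[of T] by (intro prob_space_uniform_measure) auto

text \<open>Here n stands for the noise: a^2 - 2 n a is the excess of one observation with misfit a,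
  and its Lipschitz constant grows linearly with |n|.\<close>

lemma abs_square_diff_le:
 fixes a b :: real
 assumes "\<bar>a\<bar> <= K" "\<bar>b\<bar> <= K" "\<bar>a - b\<bar> <= K * d" "K >= 0"
 shows "\<bar>(a^2 - 2 * n * a) - (b^2 - 2 * n * b)\<bar> <= K * (2 * K + 2 * \<bar>n\<bar>) * d"
proof -
 have "(a^2 - 2 * n * a) - (b^2 - 2 * n * b) = (a - b) * (a + b - 2 * n)" by (simp add: power2_eq_square algebra_simps)
 then have "\<bar>(a^2 - 2 * n * a) - (b^2 - 2 * n * b)\<bar> = \<bar>a - b\<bar> * \<bar>a + b - 2 * n\<bar>" by (simp add: abs_mult)
 also have "... <= (K * d) * (2 * K + 2 * \<bar>n\<bar>)" using assms by (intro mult_mono) auto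
 finally show ?thesis by (simp add: mult_ac)
qed

context
 fixes \<kappa> m T :: real and vstar :: vector_field and \<theta>0 :: scalar_field
 assumes \<kappa>: "\<kappa> > 0" and m: "m > 1" and T: "T > 0" and \<theta>0: "\<theta>0 \<in> sobolev m" and vstar: "vstar \<in> div_free m"
begin

abbreviation "mis \<equiv> misfit \<kappa> m T vstar \<theta>0"

lemma misfit_measurable: "v \<in> div_free m ==> mis v \<in> borel_measurable borel" unfolding misfit_def[abs_def]
 by (intro borel_measurable_times borel_measurable_diff borel_measurable_indicator observation_box T
   borel_measurable_continuous_onI sol_continuous \<kappa> m \<theta>0 vstar)

lemma misfit_bounds:
 obtains K where "K >= 0" "\<And>v z. v \<in> norm_ball m R ==> \<bar>mis v z\<bar> <= K"
  "\<And>v w z. v \<in> norm_ball m R ==> w \<in> norm_ball m R ==> \<bar>mis v z - mis w z\<bar> <= K * div_free_dist m v w"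
  "\<And>v w t x. v \<in> norm_ball m R ==> w \<in> norm_ball m R ==> t \<in> {0..T} ==>
   \<bar>adv_diff_solution \<kappa> m v \<theta>0 t x - adv_diff_solution \<kappa> m w \<theta>0 t x\<bar> <= K * div_free_dist m v w"
proof -
 \<comment> \<open>The radius is enlarged to include \<open>vstar\<close>, whose solution enters
   every misfit.\<close>
 define S where "S = max 0 (max R (div_free_norm m vstar))"
 have S: "S >= 0" by (simp add: S_def)
 let ?s = "\<lambda>v. adv_diff_solution \<kappa> m v \<theta>0"
 obtain K where K: "K >= 0" "\<And>v t x. v \<in> div_free m ==> div_free_norm m v <= S ==> t \<in> {0..T} ==> \<bar>?s v t x\<bar> <= K"
  "\<And>v w t x. v \<in> div_free m ==> w \<in> div_free m ==> div_free_norm m v <= S ==> div_free_norm m w <= S ==>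
   t \<in> {0..T} ==> \<bar>?s v t x - ?s w t x\<bar> <= K * div_free_dist m v w"
  by (rule sol_estimates[OF \<kappa> m \<theta>0 less_imp_le[OF T] S]) (rule that)
 have b: "v \<in> div_free m" "div_free_norm m v <= S" if "v \<in> norm_ball m R" for v
  using that by (auto simp: norm_ball_def S_def)
 have vS: "div_free_norm m vstar <= S" by (simp add: S_def)
 have le: "K * div_free_dist m v w <= 2 * K * div_free_dist m v w" for v w
  using K(1) div_free_dist_nonneg[of m v w] by (simp add: mult_right_mono)
 show thesis
 proof (rule that[of "2 * K"])
  show "\<bar>mis v z\<bar> <= 2 * K" if v: "v \<in> norm_ball m R" for v z
  proof (cases "z \<in> {0..T} \<times> unit_cell")
   case True
   then have t: "max 0 (fst z) \<in> {0..T}" by auto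
   show ?thesis
    using K(2)[OF b[OF v] t, of "snd z"] K(2)[OF vstar vS t, of "snd z"] True by (simp add: misfit_def abs_le_iff)
  qed (use K(1) in \<open>simp add: misfit_def\<close>)
  show "\<bar>mis v z - mis w z\<bar> <= 2 * K * div_free_dist m v w"
   if v: "v \<in> norm_ball m R" and w: "w \<in> norm_ball m R" for v w z
  proof (cases "z \<in> {0..T} \<times> unit_cell")
   case True
   then have t: "max 0 (fst z) \<in> {0..T}" by auto
   show ?thesis using order_trans[OF K(3)[OF b(1)[OF v] b(1)[OF w] b(2)[OF v] b(2)[OF w] t, of "snd z"] le] True
    by (simp add: misfit_def)
  qed (use K(1) in \<open>simp add: misfit_def div_free_dist_nonneg\<close>)
  show "\<bar>?s v t x - ?s w t x\<bar> <= 2 * K * div_free_dist m v w"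
   if v: "v \<in> norm_ball m R" and w: "w \<in> norm_ball m R" and t: "t \<in> {0..T}" for v w t x
   by (rule order_trans[OF K(3)[OF b(1)[OF v] b(1)[OF w] b(2)[OF v] b(2)[OF w] t] le])
 qed (use K(1) in simp)
qed

lemma forward_lipschitz: "t \<in> {0..T} ==> locally_lipschitz m (\<lambda>v. adv_diff_solution \<kappa> m v \<theta>0 t x)"
 unfolding locally_lipschitz_def
proof
 fix R assume t: "t \<in> {0..T}"
 obtain K where "K >= 0" "\<And>v w t x. v \<in> norm_ball m R ==> w \<in> norm_ball m R ==> t \<in> {0..T} ==>
   \<bar>adv_diff_solution \<kappa> m v \<theta>0 t x - adv_diff_solution \<kappa> m w \<theta>0 t x\<bar> <= K * div_free_dist m v w"
  by (rule misfit_bounds[of R]) (rule that)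
 then show "\<exists>K\<ge>0. \<forall>v\<in>norm_ball m R. \<forall>w\<in>norm_ball m R.
   \<bar>adv_diff_solution \<kappa> m v \<theta>0 t x - adv_diff_solution \<kappa> m w \<theta>0 t x\<bar> <= K * div_free_dist m v w"
  using t by blast
qed

lemma misfit_sq_integrable: "v \<in> div_free m ==> integrable (observation_law T) (\<lambda>z. (mis v z)^2)"
proof -
 assume v: "v \<in> div_free m"
 interpret prob_space "observation_law T" by (rule prob_space_observation_law[OF T])
 obtain K where K: "\<And>w z. w \<in> norm_ball m (div_free_norm m v) ==> \<bar>mis w z\<bar> <= K"
  by (rule misfit_bounds[of "div_free_norm m v"]) (rule that)
 have "(mis v z)^2 <= K^2" for z using power_mono[OF K[of v z], of 2] v by (simp add: norm_ball_def)
 then show ?thesis using misfit_measurable[OF v] by (intro integrable_const_bound[of _ "K^2"]) auto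
qed

lemma risk_lipschitz: "locally_lipschitz m (risk \<kappa> m T vstar \<theta>0)" unfolding locally_lipschitz_def
proof
 interpret prob_space "observation_law T" by (rule prob_space_observation_law[OF T])
 fix R
 obtain K where K: "K >= 0" "\<And>v z. v \<in> norm_ball m R ==> \<bar>mis v z\<bar> <= K"
  "\<And>v w z. v \<in> norm_ball m R ==> w \<in> norm_ball m R ==> \<bar>mis v z - mis w z\<bar> <= K * div_free_dist m v w"
  by (rule misfit_bounds[of R]) (rule that)
 have "\<bar>risk \<kappa> m T vstar \<theta>0 v - risk \<kappa> m T vstar \<theta>0 w\<bar> <= (K * (2 * K)) * div_free_dist m v w"
  if v: "v \<in> norm_ball m R" and w: "w \<in> norm_ball m R" for v w
 proof -
  have i: "integrable (observation_law T) (\<lambda>z. (mis v z)^2)" "integrable (observation_law T) (\<lambda>z. (mis w z)^2)"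
   using v w by (auto intro!: misfit_sq_integrable simp: norm_ball_def)
  have "\<bar>risk \<kappa> m T vstar \<theta>0 v - risk \<kappa> m T vstar \<theta>0 w\<bar> = \<bar>\<integral>z. (mis v z)^2 - (mis w z)^2 \<partial>observation_law T\<bar>"
   unfolding risk_def using i by simp
  also have "... <= (\<integral>z. \<bar>(mis v z)^2 - (mis w z)^2\<bar> \<partial>observation_law T)" by (rule integral_abs_bound)
  also have "... <= (K * (2 * K)) * div_free_dist m v w"
   using i abs_square_diff_le[OF K(2)[OF v] K(2)[OF w] K(3)[OF v w] K(1), of _ 0]
   by (intro integral_le_const AE_I2) auto
  finally show ?thesis .
 qed
 then show "\<exists>K\<ge>0. \<forall>v\<in>norm_ball m R. \<forall>w\<in>norm_ball m R.
   \<bar>risk \<kappa> m T vstar \<theta>0 v - risk \<kappa> m T vstar \<theta>0 w\<bar> <= K * div_free_dist m v w"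
  using K(1) by (intro exI[of _ "K * (2 * K)"]) auto
qed

lemma risk_nonneg: "risk \<kappa> m T vstar \<theta>0 v >= 0" and risk_vstar: "risk \<kappa> m T vstar \<theta>0 vstar = 0"
 by (simp_all add: risk_def misfit_def)

text \<open>The misfit vanishes almost everywhere in space and time. Inside the region it is
  continuous, so the set where it is nonzero is open and null, hence empty. This gives equality at
  every single time, as the argument at time zero demands.\<close>

lemma risk_zero_imp:
 assumes v: "v \<in> div_free m" and z: "risk \<kappa> m T vstar \<theta>0 v = 0"
 shows "AE x in torus. v x \<bullet> grad \<theta>0 x = vstar x \<bullet> grad \<theta>0 x"
proof (rule sol_identify[OF \<kappa> m \<theta>0 v vstar T])
 let ?B = "{0..T} \<times> unit_cell"
 let ?d = "\<lambda>z. adv_diff_solution \<kappa> m v \<theta>0 (max 0 (fst z)) (snd z) - adv_diff_solution \<kappa> m vstar \<theta>0 (max 0 (fst z)) (snd z)"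
 let ?I = "{0<..<T} \<times> box (0, 0) (1, 1::real)"
 let ?O = "{z. ?d z \<noteq> 0} \<inter> ?I"
 have "AE z in observation_law T. (mis v z)^2 = 0"
  using z unfolding risk_def by (subst (asm) integral_nonneg_eq_0_iff_AE[OF misfit_sq_integrable[OF v]]) auto
 then have ae: "AE z in lborel. z \<in> ?B \<longrightarrow> mis v z = 0" using AE_uniform_measure[OF observation_box(2,3)[OF T]] by simp
 have cont: "continuous_on UNIV ?d" by (intro continuous_on_diff sol_continuous \<kappa> m \<theta>0 v vstar)
 have O: "open ?O" by (intro open_Int open_Times open_Collect_neq cont) auto
 have "?I \<subseteq> ?B" using box_subset_cbox[of "(0, 0)" "(1, 1::real)"] by (intro Sigma_mono) auto
 then have "AE z in lborel. z \<notin> ?O" using ae by (auto simp: misfit_def elim: eventually_mono)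
 then have "?O \<in> null_sets lborel" using O by (subst AE_iff_null_sets) auto
 then have "negligible ?O" unfolding negligible_iff_null_sets by (rule null_sets_completionI)
 then have empty: "?O = {}" using open_not_negligible[OF O] by blast
 fix t :: real assume t: "0 < t" "t < T"
 have "AE x in lebesgue. x \<notin> unit_cell - box (0, 0) (1, 1)"
  using negligible_frontier_interval[of "(0, 0)" "(1, 1::real)"] by (intro AE_not_in) (simp add: negligible_iff_null_sets)
 then have "AE x in torus. x \<in> box (0, 0) (1, 1)" by (subst AE_restrict_space_iff) (auto elim: eventually_mono)
 then show "AE x in torus. adv_diff_solution \<kappa> m v \<theta>0 t x = adv_diff_solution \<kappa> m vstar \<theta>0 t x"
 proof eventually_elim
  case (elim x)
  then have "(t, x) \<in> ?I" using t by simp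
  then have "?d (t, x) = 0" using empty by blast
  then show ?case using t by simp
 qed
qed

end

section \<open>Empirical averages\<close>

context prob_space
begin

text \<open>Independence of locations and noise is assumed for the sigma-algebras generated by the
  two whole sequences; this extracts independence of a scalar function of one from a scalar function
  of the other.\<close>

lemma indep_var_of_vimage_algebras:
 fixes f :: "'b => real" and g :: "'c => real"
 assumes X: "X \<in> measurable M S" and Y: "Y \<in> measurable M T"
  and ind: "indep_set (sets (vimage_algebra (space M) X S)) (sets (vimage_algebra (space M) Y T))"
  and f: "f \<in> borel_measurable S" and g: "g \<in> borel_measurable T"
 shows "indep_var borel (\<lambda>\<omega>. f (X \<omega>)) borel (\<lambda>\<omega>. g (Y \<omega>))"
proof -
 have sub: "sigma_sets (space M) {(\<lambda>\<omega>. q (W \<omega>)) -` A \<inter> space M |A. A \<in> sets borel} \<subseteq> sets (vimage_algebra (space M) W R)"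
  if W: "W \<in> measurable M R" and q: "q \<in> borel_measurable R" for W :: "'a => 'd" and q :: "'d => real" and R
 proof -
  have "(\<lambda>\<omega>. q (W \<omega>)) -` A \<inter> space M \<in> sets (vimage_algebra (space M) W R)" if A: "A \<in> sets borel" for A
  proof -
   have "(\<lambda>\<omega>. q (W \<omega>)) -` A \<inter> space M = W -` (q -` A \<inter> space R) \<inter> space M" using measurable_space[OF W] by auto
   then show ?thesis using in_vimage_algebra[OF measurable_sets[OF q A]] by simp
  qed
  then show ?thesis
   using sets.sigma_sets_subset[of "{(\<lambda>\<omega>. q (W \<omega>)) -` A \<inter> space M |A. A \<in> sets borel}" "vimage_algebra (space M) W R"]
   by auto
 qed
 have "indep_set (sigma_sets (space M) {(\<lambda>\<omega>. f (X \<omega>)) -` A \<inter> space M |A. A \<in> sets borel})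
   (sigma_sets (space M) {(\<lambda>\<omega>. g (Y \<omega>)) -` A \<inter> space M |A. A \<in> sets borel})"
  using ind sub[OF X f] sub[OF Y g] unfolding indep_sets2_eq by blast
 then show ?thesis unfolding indep_var_eq using measurable_compose[OF X f] measurable_compose[OF Y g] by blast
qed

context
 fixes Z :: "nat => 'a => 'b :: topological_space" and U :: "'b measure" and \<eta> :: "nat => 'a => real" and \<sigma> :: real
 assumes Zi: "indep_vars (\<lambda>_. borel) Z {1..}" and Zd: "\<And>j. j >= 1 ==> distr M borel (Z j) = U"
  and \<eta>i: "indep_vars (\<lambda>_. borel) \<eta> {1..}"
  and \<eta>d: "\<And>j. j >= 1 ==> distributed M lborel (\<eta> j) (\<lambda>z. ennreal (normal_density 0 \<sigma> z))"
  and joint: "indep_set (sets (vimage_algebra (space M) (\<lambda>\<omega>. \<lambda>j\<in>{1..}. Z j \<omega>) (PiM {1..} (\<lambda>_. borel))))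
    (sets (vimage_algebra (space M) (\<lambda>\<omega>. \<lambda>j\<in>{1..}. \<eta> j \<omega>) (PiM {1..} (\<lambda>_. borel))))"
  and \<sigma>: "\<sigma> > 0"
begin

lemma Z_measurable: "j >= 1 ==> random_variable borel (Z j)" and \<eta>_measurable: "j >= 1 ==> random_variable borel (\<eta> j)"
 using Zi \<eta>i by (auto simp: indep_vars_def)

text \<open>Locations and noise carry separate indices because each location is observed with two
  noise variables. The moment factorises by the independence of the two families.\<close>

lemma joint_moment:
 assumes i: "i >= 1" "j >= 1" and k: "k >= 1" "l >= 1" and h [measurable]: "h \<in> borel_measurable borel"
  and K: "\<And>z. \<bar>h z\<bar> <= K"
 shows "integrable M (\<lambda>\<omega>. (\<eta> k \<omega> * h (Z i \<omega>)) * (\<eta> l \<omega> * h (Z j \<omega>)))"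
  "expectation (\<lambda>\<omega>. (\<eta> k \<omega> * h (Z i \<omega>)) * (\<eta> l \<omega> * h (Z j \<omega>))) =
   expectation (\<lambda>\<omega>. h (Z i \<omega>) * h (Z j \<omega>)) * expectation (\<lambda>\<omega>. \<eta> k \<omega> * \<eta> l \<omega>)"
proof -
 have X: "(\<lambda>\<omega>. \<lambda>j\<in>{1..}. Z j \<omega>) \<in> measurable M (PiM {1..} (\<lambda>_. borel))"
  and E: "(\<lambda>\<omega>. \<lambda>j\<in>{1..}. \<eta> j \<omega>) \<in> measurable M (PiM {1..} (\<lambda>_. borel))"
  by (auto intro!: measurable_restrict Z_measurable \<eta>_measurable)
 have "(\<lambda>f. h (f i) * h (f j)) \<in> borel_measurable (PiM {1..} (\<lambda>_. borel))"
  "(\<lambda>f. f k * f l) \<in> borel_measurable (PiM {1..} (\<lambda>_. borel :: real measure))"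
  using i k by (intro borel_measurable_times measurable_compose[OF _ h]
   measurable_component_singleton; simp)+
 from indep_var_of_vimage_algebras[OF X E joint this]
 have ind: "indep_var borel (\<lambda>\<omega>. h (Z i \<omega>) * h (Z j \<omega>)) borel (\<lambda>\<omega>. \<eta> k \<omega> * \<eta> l \<omega>)" using i k by simp
 have K0: "K >= 0" using order_trans[OF abs_ge_zero K] .
 have "\<bar>h (Z i \<omega>) * h (Z j \<omega>)\<bar> <= K * K" for \<omega> unfolding abs_mult using K K0 by (intro mult_mono) auto
 then have i1: "integrable M (\<lambda>\<omega>. h (Z i \<omega>) * h (Z j \<omega>))"
  using measurable_compose[OF Z_measurable[OF i(1)] h] measurable_compose[OF Z_measurable[OF i(2)] h]
  by (intro integrable_const_bound[of _ "K * K"]) auto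
 have i2: "integrable M (\<lambda>\<omega>. \<eta> k \<omega> * \<eta> l \<omega>)"
 proof (cases "k = l")
  case True
  then show ?thesis using normal_moments(3)[OF \<sigma> \<eta>d[OF k(1)]] by (simp add: power2_eq_square)
 next
  case False
  show ?thesis by (rule indep_pair(1)[OF \<eta>i _ _ False, of "\<lambda>x. x"]) (use k normal_moments(1)[OF \<sigma> \<eta>d] in auto)
 qed
 have e: "(\<eta> k \<omega> * h (Z i \<omega>)) * (\<eta> l \<omega> * h (Z j \<omega>)) = (h (Z i \<omega>) * h (Z j \<omega>)) * (\<eta> k \<omega> * \<eta> l \<omega>)" for \<omega>
  by (simp add: mult_ac)
 show "integrable M (\<lambda>\<omega>. (\<eta> k \<omega> * h (Z i \<omega>)) * (\<eta> l \<omega> * h (Z j \<omega>)))"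
  unfolding e by (rule indep_var_integrable[OF ind i1 i2])
 show "expectation (\<lambda>\<omega>. (\<eta> k \<omega> * h (Z i \<omega>)) * (\<eta> l \<omega> * h (Z j \<omega>))) =
   expectation (\<lambda>\<omega>. h (Z i \<omega>) * h (Z j \<omega>)) * expectation (\<lambda>\<omega>. \<eta> k \<omega> * \<eta> l \<omega>)"
  unfolding e by (rule indep_var_lebesgue_integral[OF ind i1 i2])
qed

text \<open>The injection p stands for the odd or the even indices: location i + 1 is observed with
  the noises 2 i + 1 and 2 i + 2.\<close>

lemma noise_average:
 assumes p: "\<And>i. p i >= 1" "inj p"
 shows "AE \<omega> in M. (\<lambda>n. (\<Sum>i<n. \<bar>\<eta> (p i) \<omega>\<bar>) / real n) \<longlonglongrightarrow> sqrt (2 / pi) * \<sigma>"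
proof (rule slln_nonneg[where C = "\<sigma>^2"])
 note mom = normal_moments[OF \<sigma> \<eta>d[OF p(1)]]
 show "random_variable borel (\<lambda>\<omega>. \<bar>\<eta> (p i) \<omega>\<bar>)" for i using \<eta>_measurable[OF p(1)[of i]] by simp
 show "integrable M (\<lambda>\<omega>. \<bar>\<eta> (p i) \<omega>\<bar>)" for i using mom(1) by simp
 show "expectation (\<lambda>\<omega>. \<bar>\<eta> (p i) \<omega>\<bar>) = sqrt (2 / pi) * \<sigma>" for i by (rule mom(5))
 show "expectation (\<lambda>\<omega>. \<bar>\<eta> (p i) \<omega>\<bar>^2) <= \<sigma>^2" for i using mom(4) by simp
 have ind: "integrable M (\<lambda>\<omega>. \<bar>\<eta> (p i) \<omega>\<bar> * \<bar>\<eta> (p j) \<omega>\<bar>)"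
  "expectation (\<lambda>\<omega>. \<bar>\<eta> (p i) \<omega>\<bar> * \<bar>\<eta> (p j) \<omega>\<bar>) = expectation (\<lambda>\<omega>. \<bar>\<eta> (p i) \<omega>\<bar>) * expectation (\<lambda>\<omega>. \<bar>\<eta> (p j) \<omega>\<bar>)"
  if "i \<noteq> j" for i j
  using indep_pair[OF \<eta>i, of "p i" "p j" abs] that p injD[OF p(2), of i j] normal_moments(1)[OF \<sigma> \<eta>d] by auto
 show "integrable M (\<lambda>\<omega>. \<bar>\<eta> (p i) \<omega>\<bar> * \<bar>\<eta> (p j) \<omega>\<bar>)" for i j
  using ind(1)[of i j] mom(3)[of i] by (cases "i = j") (auto simp: power2_eq_square)
 show "expectation (\<lambda>\<omega>. \<bar>\<eta> (p i) \<omega>\<bar> * \<bar>\<eta> (p j) \<omega>\<bar>) = sqrt (2 / pi) * \<sigma> * (sqrt (2 / pi) * \<sigma>)" if "i \<noteq> j" for i j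
  using ind(2)[OF that] mom(5) by simp
qed simp

lemma signal_average:
 assumes h [measurable]: "h \<in> borel_measurable borel" and K: "\<And>z. \<bar>h z\<bar> <= K"
 shows "AE \<omega> in M. (\<lambda>n. (\<Sum>i<n. (h (Z (Suc i) \<omega>))^2) / real n) \<longlonglongrightarrow> (\<integral>z. (h z)^2 \<partial>U)"
proof (rule slln_nonneg[where C = "(K^2)^2"])
 have [measurable]: "random_variable borel (Z (Suc i))" for i by (rule Z_measurable) simp
 have sq: "(h z)^2 <= K^2" for z using power_mono[OF K[of z], of 2] by simp
 show rv: "random_variable borel (\<lambda>\<omega>. (h (Z (Suc i) \<omega>))^2)" for i by simp
 have int: "integrable M (\<lambda>\<omega>. (h (Z j \<omega>))^2)" if "j \<in> {1..}" for j
  using sq Z_measurable[of j] that by (intro integrable_const_bound[of _ "K^2"]) auto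
 then show "integrable M (\<lambda>\<omega>. (h (Z (Suc i) \<omega>))^2)" for i by simp
 have "expectation (\<lambda>\<omega>. (h (Z (Suc i) \<omega>))^2) = (\<integral>z. (h z)^2 \<partial>distr M borel (Z (Suc i)))" for i
  by (subst integral_distr) auto
 then show mean: "expectation (\<lambda>\<omega>. (h (Z (Suc i) \<omega>))^2) = (\<integral>z. (h z)^2 \<partial>U)" for i using Zd[of "Suc i"] by simp
 have sq2: "((h z)^2)^2 <= (K^2)^2" for z using power_mono[OF sq[of z], of 2] by simp
 have int2: "integrable M (\<lambda>\<omega>. ((h (Z (Suc i) \<omega>))^2)^2)" for i
  using sq2 by (intro integrable_const_bound[of _ "(K^2)^2"]) auto
 then show "expectation (\<lambda>\<omega>. ((h (Z (Suc i) \<omega>))^2)^2) <= (K^2)^2" for i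
  using sq2 by (intro integral_le_const AE_I2) auto
 have ind: "integrable M (\<lambda>\<omega>. (h (Z (Suc i) \<omega>))^2 * (h (Z (Suc j) \<omega>))^2)"
  "expectation (\<lambda>\<omega>. (h (Z (Suc i) \<omega>))^2 * (h (Z (Suc j) \<omega>))^2) =
   expectation (\<lambda>\<omega>. (h (Z (Suc i) \<omega>))^2) * expectation (\<lambda>\<omega>. (h (Z (Suc j) \<omega>))^2)" if "i \<noteq> j" for i j
  using indep_pair[OF Zi, of "Suc i" "Suc j" "\<lambda>z. (h z)^2"] that int by auto
 show "integrable M (\<lambda>\<omega>. (h (Z (Suc i) \<omega>))^2 * (h (Z (Suc j) \<omega>))^2)" for i j
  using ind(1)[of i j] int2[of i] by (cases "i = j") (auto simp: power2_eq_square)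
 show "expectation (\<lambda>\<omega>. (h (Z (Suc i) \<omega>))^2 * (h (Z (Suc j) \<omega>))^2) = (\<integral>z. (h z)^2 \<partial>U) * (\<integral>z. (h z)^2 \<partial>U)"
  if "i \<noteq> j" for i j
  unfolding ind(2)[OF that] mean ..
qed simp

text \<open>The products are orthogonal because the noise is centred and independent of the
  locations. They have no fixed sign, so K |\<eta>| serves as the dominating sequence.\<close>

lemma cross_average:
 assumes p: "\<And>i. p i >= 1" "inj p" and h [measurable]: "h \<in> borel_measurable borel" and K: "\<And>z. \<bar>h z\<bar> <= K"
 shows "AE \<omega> in M. (\<lambda>n. (\<Sum>i<n. \<eta> (p i) \<omega> * h (Z (Suc i) \<omega>)) / real n) \<longlonglongrightarrow> 0"
proof (rule slln_dominated[where C = "K^2 * \<sigma>^2" and U = "\<lambda>i \<omega>. K * \<bar>\<eta> (p i) \<omega>\<bar>" and L = "K * (sqrt (2 / pi) * \<sigma>)"])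
 note mom = normal_moments[OF \<sigma> \<eta>d[OF p(1)]]
 have [measurable]: "random_variable borel (Z (Suc i))" "random_variable borel (\<eta> (p i))" for i
  by (rule Z_measurable \<eta>_measurable; simp add: p(1)[simplified])+
 show "random_variable borel (\<lambda>\<omega>. \<eta> (p i) \<omega> * h (Z (Suc i) \<omega>))" for i by simp
 have jm: "integrable M (\<lambda>\<omega>. (\<eta> (p i) \<omega> * h (Z (Suc i) \<omega>)) * (\<eta> (p j) \<omega> * h (Z (Suc j) \<omega>)))"
  "expectation (\<lambda>\<omega>. (\<eta> (p i) \<omega> * h (Z (Suc i) \<omega>)) * (\<eta> (p j) \<omega> * h (Z (Suc j) \<omega>))) =
   expectation (\<lambda>\<omega>. h (Z (Suc i) \<omega>) * h (Z (Suc j) \<omega>)) * expectation (\<lambda>\<omega>. \<eta> (p i) \<omega> * \<eta> (p j) \<omega>)" for i j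
  using joint_moment[OF _ _ p(1) p(1) h K, of "Suc i" "Suc j" i j] by simp_all
 show "integrable M (\<lambda>\<omega>. (\<eta> (p i) \<omega> * h (Z (Suc i) \<omega>)) * (\<eta> (p j) \<omega> * h (Z (Suc j) \<omega>)))" for i j by (rule jm(1))
 show "expectation (\<lambda>\<omega>. (\<eta> (p i) \<omega> * h (Z (Suc i) \<omega>)) * (\<eta> (p j) \<omega> * h (Z (Suc j) \<omega>))) = 0" if "i \<noteq> j" for i j
 proof -
  have "expectation (\<lambda>\<omega>. \<eta> (p i) \<omega> * \<eta> (p j) \<omega>) = expectation (\<eta> (p i)) * expectation (\<eta> (p j))"
   using indep_pair(2)[OF \<eta>i, of "p i" "p j" "\<lambda>x. x"] that p injD[OF p(2), of i j] normal_moments(1)[OF \<sigma> \<eta>d] by auto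
  then show ?thesis unfolding jm(2) mom(2) by simp
 qed
 show "expectation (\<lambda>\<omega>. (\<eta> (p i) \<omega> * h (Z (Suc i) \<omega>))^2) <= K^2 * \<sigma>^2" for i
 proof -
  have sq: "(h z)^2 <= K^2" for z using power_mono[OF K[of z], of 2] by simp
  have "integrable M (\<lambda>\<omega>. (h (Z (Suc i) \<omega>))^2)" using sq by (intro integrable_const_bound[of _ "K^2"]) auto
  then have "expectation (\<lambda>\<omega>. (h (Z (Suc i) \<omega>))^2) <= K^2" using sq by (intro integral_le_const AE_I2)
  then show ?thesis using jm(2)[of i i] mom(4)[of i] by (simp add: power2_eq_square mult_right_mono)
 qed
 show "AE \<omega> in M. \<forall>i. \<bar>\<eta> (p i) \<omega> * h (Z (Suc i) \<omega>)\<bar> <= K * \<bar>\<eta> (p i) \<omega>\<bar>"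
  using K by (auto simp: abs_mult mult.commute[of K] intro!: mult_left_mono)
 show "AE \<omega> in M. (\<lambda>n. (\<Sum>i<n. K * \<bar>\<eta> (p i) \<omega>\<bar>) / real n) \<longlonglongrightarrow> K * (sqrt (2 / pi) * \<sigma>)" using noise_average[OF p]
 proof eventually_elim
  case (elim \<omega>)
  then show ?case using tendsto_mult_left[OF elim, of K] by (simp add: sum_distrib_left[symmetric])
 qed
qed

lemma excess_average:
 assumes p: "\<And>i. p i >= 1" "inj p" and h: "h \<in> borel_measurable borel" and K: "\<And>z. \<bar>h z\<bar> <= K"
 shows "AE \<omega> in M. (\<lambda>n. (\<Sum>i<n. (h (Z (Suc i) \<omega>))^2 - 2 * \<eta> (p i) \<omega> * h (Z (Suc i) \<omega>)) / real n) \<longlonglongrightarrow> (\<integral>z. (h z)^2 \<partial>U)"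
 using signal_average[OF h K] cross_average[OF p h K]
proof eventually_elim
 case (elim \<omega>)
 have "(\<Sum>i<n. (h (Z (Suc i) \<omega>))^2 - 2 * \<eta> (p i) \<omega> * h (Z (Suc i) \<omega>)) / real n =
   (\<Sum>i<n. (h (Z (Suc i) \<omega>))^2) / real n - 2 * ((\<Sum>i<n. \<eta> (p i) \<omega> * h (Z (Suc i) \<omega>)) / real n)" for n
  by (simp add: sum_subtractf sum_distrib_left diff_divide_distrib mult.assoc)
 moreover have "(\<lambda>n. (\<Sum>i<n. (h (Z (Suc i) \<omega>))^2) / real n - 2 * ((\<Sum>i<n. \<eta> (p i) \<omega> * h (Z (Suc i) \<omega>)) / real n))
   \<longlonglongrightarrow> (\<integral>z. (h z)^2 \<partial>U) - 2 * 0" by (intro tendsto_diff tendsto_mult tendsto_const elim)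
 ultimately show ?case by simp
qed

lemma noise_average_all: "AE \<omega> in M. (\<lambda>N. (\<Sum>j=1..N. \<bar>\<eta> j \<omega>\<bar>) / real N) \<longlonglongrightarrow> sqrt (2 / pi) * \<sigma>"
proof -
 have i: "inj (\<lambda>i::nat. 2 * i + 1)" "inj (\<lambda>i::nat. 2 * i + 2)" by (auto simp: inj_def)
 have "AE \<omega> in M. (\<lambda>n. (\<Sum>i<n. \<bar>\<eta> (2 * i + 1) \<omega>\<bar>) / real n) \<longlonglongrightarrow> sqrt (2 / pi) * \<sigma>"
  "AE \<omega> in M. (\<lambda>n. (\<Sum>i<n. \<bar>\<eta> (2 * i + 2) \<omega>\<bar>) / real n) \<longlonglongrightarrow> sqrt (2 / pi) * \<sigma>"
  by (rule noise_average[OF _ i(1)] noise_average[OF _ i(2)]; simp)+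
 then show ?thesis
 proof eventually_elim
  case (elim \<omega>)
  have "(c + c) / 2 = c" for c :: real by simp
  then show ?case using average_interleave[of "\<lambda>j. \<bar>\<eta> j \<omega>\<bar>", OF elim] by (simp only:)
 qed
qed

end

end

section \<open>The main theorem\<close>

text \<open>The union of finite nets for the tolerances 1 / (n + 1) is countable, and each tolerance
  is served by one of these nets.\<close>

lemma norm_ball_nets:
 assumes m: "m > 1" "m < m'"
 obtains Q where "countable Q" "Q \<subseteq> norm_ball m' R"
  "\<And>e. e > 0 ==> \<exists>S. finite S \<and> S \<subseteq> Q \<and> S \<subseteq> norm_ball m' R \<and> (\<forall>v\<in>norm_ball m' R. \<exists>w\<in>S. div_free_dist m v w < e)"
proof -
 have "\<forall>n. \<exists>S. finite S \<and> S \<subseteq> norm_ball m' R \<and> (\<forall>v\<in>norm_ball m' R. \<exists>w\<in>S. div_free_dist m v w < inverse (real (Suc n)))"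
  by (intro allI norm_ball_net[OF m]) simp
 from choice[OF this] obtain S where S: "\<And>n. finite (S n)" "\<And>n. S n \<subseteq> norm_ball m' R"
  "\<And>n v. v \<in> norm_ball m' R ==> \<exists>w\<in>S n. div_free_dist m v w < inverse (real (Suc n))" by blast
 show thesis
 proof (rule that[of "\<Union>n. S n"])
  show "countable (\<Union>n. S n)" using S(1) by (auto intro: countable_finite)
  show "(\<Union>n. S n) \<subseteq> norm_ball m' R" using S(2) by blast
  fix e :: real assume "e > 0"
  then obtain n where n: "inverse (real (Suc n)) < e" using reals_Archimedean by blast
  have "\<exists>w\<in>S n. div_free_dist m v w < e" if "v \<in> norm_ball m' R" for v
   using S(3)[OF that, of n] n by (meson order_less_trans)
  then show "\<exists>S'. finite S' \<and> S' \<subseteq> (\<Union>n. S n) \<and> S' \<subseteq> norm_ball m' R \<and> (\<forall>v\<in>norm_ball m' R. \<exists>w\<in>S'. div_free_dist m v w < e)"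
   using S(1,2) by (intro exI[of _ "S n"]) auto
 qed
qed

text \<open>The Lipschitz constant of the empirical mean involves only the average absolute noise,
  which stays bounded along almost every path although the single noise values do not.\<close>

lemma average_excess_lipschitz:
 fixes a b n :: "nat => real"
 assumes N: "N >= 1" and K: "K >= 0" and d: "d >= 0"
  and ab: "\<And>j. j >= 1 ==> \<bar>a j\<bar> <= K" "\<And>j. j >= 1 ==> \<bar>b j\<bar> <= K" "\<And>j. j >= 1 ==> \<bar>a j - b j\<bar> <= K * d"
  and n: "(\<Sum>j=1..N. \<bar>n j\<bar>) / real N <= B"
 shows "\<bar>(\<Sum>j=1..N. (a j)^2 - 2 * n j * a j) / real N - (\<Sum>j=1..N. (b j)^2 - 2 * n j * b j) / real N\<bar>
  <= K * (2 * K + 2 * B) * d"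
proof -
 have "\<bar>(\<Sum>j=1..N. (a j)^2 - 2 * n j * a j) - (\<Sum>j=1..N. (b j)^2 - 2 * n j * b j)\<bar>
   <= (\<Sum>j=1..N. K * (2 * K + 2 * \<bar>n j\<bar>) * d)"
  unfolding sum_subtractf[symmetric] by (rule order_trans[OF sum_abs sum_mono]) (intro abs_square_diff_le ab K; simp)
 also have "... = K * (2 * K * real N + 2 * (\<Sum>j=1..N. \<bar>n j\<bar>)) * d"
  by (simp add: sum_distrib_left sum_distrib_right sum.distrib algebra_simps)
 finally have "\<bar>(\<Sum>j=1..N. (a j)^2 - 2 * n j * a j) - (\<Sum>j=1..N. (b j)^2 - 2 * n j * b j)\<bar> / real N
   <= K * (2 * K * real N + 2 * (\<Sum>j=1..N. \<bar>n j\<bar>)) * d / real N" by (intro divide_right_mono) auto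
 also have "... = K * (2 * K + 2 * ((\<Sum>j=1..N. \<bar>n j\<bar>) / real N)) * d" using N by (simp add: field_simps)
 also have "... <= K * (2 * K + 2 * B) * d" using n K d by (intro mult_right_mono mult_left_mono add_mono) auto
 finally show ?thesis by (simp add: diff_divide_distrib[symmetric])
qed

lemma locally_lipschitz_mean:
 assumes "locally_lipschitz m a" "locally_lipschitz m b"
 shows "locally_lipschitz m (\<lambda>v. (a v + b v) / 2)"
 unfolding locally_lipschitz_def
proof
 fix R
 obtain A where A: "A >= 0" "\<And>v w. v \<in> norm_ball m R ==> w \<in> norm_ball m R ==> \<bar>a v - a w\<bar> <= A * div_free_dist m v w"
  using assms(1) unfolding locally_lipschitz_def by blast
 obtain B where B: "B >= 0" "\<And>v w. v \<in> norm_ball m R ==> w \<in> norm_ball m R ==> \<bar>b v - b w\<bar> <= B * div_free_dist m v w"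
  using assms(2) unfolding locally_lipschitz_def by blast
 have "\<bar>(a v + b v) / 2 - (a w + b w) / 2\<bar> <= (A + B) / 2 * div_free_dist m v w"
  if "v \<in> norm_ball m R" "w \<in> norm_ball m R" for v w
  using A(2)[OF that] B(2)[OF that] by (simp add: abs_le_iff field_simps)
 then show "\<exists>K\<ge>0. \<forall>v\<in>norm_ball m R. \<forall>w\<in>norm_ball m R. \<bar>(a v + b v) / 2 - (a w + b w) / 2\<bar> <= K * div_free_dist m v w"
  using A(1) B(1) by (intro exI[of _ "(A + B) / 2"]) auto
qed

theorem theorem3p2:
  fixes \<kappa> T \<sigma> m mstar :: real
    and M :: "'w measure"
    and t :: "nat \<Rightarrow> 'w \<Rightarrow> real" and x :: "nat \<Rightarrow> 'w \<Rightarrow> real \<times> real"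
    and \<eta> :: "nat \<Rightarrow> 'w \<Rightarrow> real"
    and \<theta>1 \<theta>2 :: scalar_field
    and G :: "nat \<Rightarrow> 'w \<Rightarrow> vector_field \<Rightarrow> real"
    and Y :: "nat \<Rightarrow> 'w \<Rightarrow> real"
    and vstar :: vector_field
    and \<mu>0 :: "vector_field measure"
    and \<mu> :: "nat \<Rightarrow> 'w \<Rightarrow> vector_field measure"
    and f :: "real \<Rightarrow> real"
  assumes "\<kappa> > 0" and "T > 0" and "\<sigma> > 0" and "m > 1" and "mstar > m"
    and "prob_space M"
    and "prob_space.indep_vars M (\<lambda>_. borel) (\<lambda>j \<omega>. (t j \<omega>, x j \<omega>)) {1..}"
    and "\<And>j. j \<ge> 1 \<Longrightarrow>
           distr M borel (\<lambda>\<omega>. (t j \<omega>, x j \<omega>)) = uniform_measure lborel ({0..T} \<times> unit_cell)"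
    and "\<theta>1 \<in> sobolev m" and "\<theta>2 \<in> sobolev m"
    and "AE y in torus. perp (grad \<theta>1 y) \<bullet> grad \<theta>2 y \<noteq> 0"
    and "\<And>j \<omega> v. j \<ge> 1 \<Longrightarrow> v \<in> div_free m \<Longrightarrow>
           G (2 * j - 1) \<omega> v = adv_diff_solution \<kappa> m v \<theta>1 (t j \<omega>) (x j \<omega>)"
    and "\<And>j \<omega> v. j \<ge> 1 \<Longrightarrow> v \<in> div_free m \<Longrightarrow>
           G (2 * j) \<omega> v = adv_diff_solution \<kappa> m v \<theta>2 (t j \<omega>) (x j \<omega>)"
    and "vstar \<in> div_free mstar"
    and "\<And>j \<omega>. j \<ge> 1 \<Longrightarrow> Y j \<omega> = G j \<omega> vstar + \<eta> j \<omega>"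
    and "prob_space.indep_vars M (\<lambda>_. borel) \<eta> {1..}"
    and "\<And>j. j \<ge> 1 \<Longrightarrow> distributed M lborel (\<eta> j) (\<lambda>z. ennreal (normal_density 0 \<sigma> z))"
    and "prob_space.indep_set M
           (sets (vimage_algebra (space M) (\<lambda>\<omega>. \<lambda>j\<in>{1..}. (t j \<omega>, x j \<omega>)) (PiM {1..} (\<lambda>_. borel))))
           (sets (vimage_algebra (space M) (\<lambda>\<omega>. \<lambda>j\<in>{1..}. \<eta> j \<omega>) (PiM {1..} (\<lambda>_. borel))))"
    and "prob_space \<mu>0" and "sets \<mu>0 = sets (div_free_borel m)"
    and "\<And>N \<omega>. N \<ge> 1 \<Longrightarrow> \<mu> N \<omega> = posterior \<sigma> \<mu>0 (\<lambda>j. G j \<omega>) (\<lambda>j. Y j \<omega>) N"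
    and "\<And>r. r > 0 \<Longrightarrow> emeasure \<mu>0 (div_free_cball mstar vstar r) > 0"
    and "mono_on {0..} f" and "\<And>r. r \<ge> 0 \<Longrightarrow> f r \<ge> 0" and "filterlim f at_top at_top"
    and "AE \<omega> in M. (SUP N\<in>{1..}. \<integral>\<^sup>+v. f_of_norm f mstar v \<partial>(\<mu> N \<omega>)) < \<infinity>"
  shows "AE \<omega> in M. \<forall>\<phi>::vector_field \<Rightarrow> real.
           continuous_map (div_free_topology m) euclideanreal \<phi> \<and> bounded (\<phi> ` div_free m) \<longrightarrow>
           (\<lambda>N. \<integral>v. \<phi> v \<partial>(\<mu> N \<omega>)) \<longlonglongrightarrow> \<phi> vstar"
proof -
 interpret prob_space M by fact
 note \<kappa> = assms(1) and T = assms(2) and \<sigma> = assms(3) and m = assms(4) and mm = assms(5)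
  and Zi = assms(7) and Zd = assms(8) and \<theta>1 = assms(9) and \<theta>2 = assms(10) and nondeg = assms(11)
  and G1 = assms(12) and G2 = assms(13) and vs = assms(14) and Y = assms(15)
  and \<eta>i = assms(16) and \<eta>d = assms(17) and joint = assms(18) and \<mu>0 = assms(19,20) and \<mu> = assms(21)
  and prior = assms(22) and f = assms(23-25) and tight = assms(26)
 have vm: "vstar \<in> div_free m" using div_free_mono[OF _ vs, of m] mm by simp
 let ?Z = "\<lambda>j \<omega>. (t j \<omega>, x j \<omega>)"
 define h where "h v = (risk \<kappa> m T vstar \<theta>1 v + risk \<kappa> m T vstar \<theta>2 v) / 2" for v
 \<comment> \<open>Location i carries the observations 2 i - 1 and 2 i; for odd j it has index
   \<open>Suc (j div 2)\<close>, for even j it has index \<open>j div 2\<close>.\<close>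
 define \<delta> where "\<delta> j v \<omega> = (if odd j then misfit \<kappa> m T vstar \<theta>1 v (?Z (Suc (j div 2)) \<omega>)
  else misfit \<kappa> m T vstar \<theta>2 v (?Z (j div 2) \<omega>))" for j v \<omega>
 let ?F = "\<lambda>N v \<omega>. (\<Sum>j=1..N. (\<delta> j v \<omega>)^2 - 2 * \<eta> j \<omega> * \<delta> j v \<omega>) / real N"
 have inj: "inj (\<lambda>i::nat. 2 * i + 1)" "inj (\<lambda>i::nat. 2 * i + 2)" by (auto simp: inj_def)

 have pointwise: "AE \<omega> in M. (\<lambda>N. ?F N v \<omega>) \<longlonglongrightarrow> h v" if v: "v \<in> div_free m" for v
 proof -
  have one: "AE \<omega> in M. (\<lambda>n. (\<Sum>i<n. (misfit \<kappa> m T vstar \<theta> v (?Z (Suc i) \<omega>))^2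
    - 2 * \<eta> (p i) \<omega> * misfit \<kappa> m T vstar \<theta> v (?Z (Suc i) \<omega>)) / real n) \<longlonglongrightarrow> risk \<kappa> m T vstar \<theta> v"
   if \<theta>: "\<theta> \<in> sobolev m" and p: "\<And>i. p i >= 1" "inj p" for \<theta> p
  proof -
   obtain K where K: "\<And>w z. w \<in> norm_ball m (div_free_norm m v) ==> \<bar>misfit \<kappa> m T vstar \<theta> w z\<bar> <= K"
    by (rule misfit_bounds[OF \<kappa> m T \<theta> vm, of "div_free_norm m v"]) (rule that)
   have K': "\<bar>misfit \<kappa> m T vstar \<theta> v z\<bar> <= K" for z using K v by (simp add: norm_ball_def)
   show ?thesis unfolding risk_def
    by (rule excess_average[OF Zi Zd \<eta>i \<eta>d joint \<sigma> p misfit_measurable[OF \<kappa> m T \<theta> vm v] K'])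
  qed
  note one[OF \<theta>1 _ inj(1), simplified] one[OF \<theta>2 _ inj(2), simplified]
  then show ?thesis
  proof eventually_elim
   case (elim \<omega>)
   then show ?case unfolding h_def
    by (intro average_interleave[of "\<lambda>j. (\<delta> j v \<omega>)^2 - 2 * \<eta> j \<omega> * \<delta> j v \<omega>"]) (simp_all add: \<delta>_def)
  qed
 qed

 \<comment> \<open>Integer radii exhaust V and keep the family of nets, and with it the union of the
   exceptional sets, countable.\<close>
 have "\<exists>Q. \<forall>k. countable (Q k) \<and> Q k \<subseteq> norm_ball mstar (real k) \<and>
   (\<forall>e>0. \<exists>S. finite S \<and> S \<subseteq> Q k \<and> S \<subseteq> norm_ball mstar (real k) \<and> (\<forall>v\<in>norm_ball mstar (real k). \<exists>w\<in>S. div_free_dist m v w < e))"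
  (is "\<exists>Q. \<forall>k. ?net k (Q k)")
 proof (intro choice allI)
  fix k :: nat
  show "\<exists>Q. ?net k Q"
  proof (rule norm_ball_nets[OF m mm, of "real k"])
   fix Q assume q: "countable Q" "Q \<subseteq> norm_ball mstar (real k)"
    "\<And>e. e > 0 ==> \<exists>S. finite S \<and> S \<subseteq> Q \<and> S \<subseteq> norm_ball mstar (real k) \<and>
     (\<forall>v\<in>norm_ball mstar (real k). \<exists>w\<in>S. div_free_dist m v w < e)"
   show "\<exists>Q. ?net k Q" by (intro exI[of _ Q] conjI allI impI q)
  qed
 qed
 then obtain Q where net: "\<forall>k. ?net k (Q k)" by (elim exE)
 have Q: "countable (Q k)" "Q k \<subseteq> norm_ball mstar (real k)"
  "e > 0 ==> \<exists>S. finite S \<and> S \<subseteq> Q k \<and> S \<subseteq> norm_ball mstar (real k) \<and>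
   (\<forall>v\<in>norm_ball mstar (real k). \<exists>w\<in>S. div_free_dist m v w < e)" for k e
  using net[rule_format, of k] by simp_all
 have sub: "norm_ball mstar R \<subseteq> norm_ball m R" "norm_ball mstar R \<subseteq> div_free m" for R
  using norm_ball_subset[of m mstar R R] mm by (auto simp: norm_ball_def)
 have dense: "AE \<omega> in M. \<forall>k. \<forall>v\<in>Q k. (\<lambda>N. ?F N v \<omega>) \<longlonglongrightarrow> h v"
  unfolding AE_all_countable using Q(1,2) sub(2) by (intro allI AE_ball_countable' pointwise) blast+

 \<comment> \<open>The misfit is cut off outside the observation region, so it is identified with
   the difference of the forward maps only along paths whose observations all lie in the
   region.\<close>
 have box: "AE \<omega> in M. \<forall>j. j >= 1 \<longrightarrow> ?Z j \<omega> \<in> {0..T} \<times> unit_cell" unfolding AE_all_countable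
 proof
  fix j
  show "AE \<omega> in M. j >= 1 \<longrightarrow> ?Z j \<omega> \<in> {0..T} \<times> unit_cell"
  proof (cases "j >= 1")
   case True
   have ae: "AE z in distr M borel (?Z j). z \<in> {0..T} \<times> unit_cell"
    unfolding Zd[OF True] using observation_box(1)[OF T] by (intro AE_uniform_measureI) auto
   have rv: "random_variable borel (?Z j)" using Zi True by (auto simp: indep_vars_def)
   show ?thesis using AE_distrD[OF rv ae] by eventually_elim (rule impI)
  qed simp
 qed

 have h_lip: "locally_lipschitz m h"
  unfolding h_def[abs_def] by (intro locally_lipschitz_mean risk_lipschitz \<kappa> m T \<theta>1 \<theta>2 vm)
 have h0: "h vstar = 0" by (simp add: h_def risk_vstar[OF \<kappa> m T \<theta>1 vm] risk_vstar[OF \<kappa> m T \<theta>2 vm])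
 have h_pos: "h v > 0" if v: "v \<in> div_free mstar" "v \<noteq> vstar" for v
 proof (rule ccontr)
  assume "\<not> h v > 0"
  then have z: "risk \<kappa> m T vstar \<theta>1 v = 0" "risk \<kappa> m T vstar \<theta>2 v = 0"
   using risk_nonneg[OF \<kappa> m T \<theta>1 vm, of v] risk_nonneg[OF \<kappa> m T \<theta>2 vm, of v] by (auto simp: h_def)
  have v': "v \<in> div_free m" using div_free_mono[OF _ v(1), of m] mm by simp
  show False
   using identifiability[OF m v' vm risk_zero_imp[OF \<kappa> m T \<theta>1 vm v' z(1)] risk_zero_imp[OF \<kappa> m T \<theta>2 vm v' z(2)] nondeg] v(2)
   by simp
 qed

 have \<delta>_bounds: "\<exists>K\<ge>0. \<forall>j \<omega>. \<forall>v\<in>norm_ball m R. \<bar>\<delta> j v \<omega>\<bar> <= K \<and> (\<forall>w\<in>norm_ball m R. \<bar>\<delta> j v \<omega> - \<delta> j w \<omega>\<bar> <= K * div_free_dist m v w)" for R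
 proof -
  obtain K1 where K1: "K1 >= 0" "\<And>v z. v \<in> norm_ball m R ==> \<bar>misfit \<kappa> m T vstar \<theta>1 v z\<bar> <= K1"
   "\<And>v w z. v \<in> norm_ball m R ==> w \<in> norm_ball m R ==>
    \<bar>misfit \<kappa> m T vstar \<theta>1 v z - misfit \<kappa> m T vstar \<theta>1 w z\<bar> <= K1 * div_free_dist m v w"
   by (rule misfit_bounds[OF \<kappa> m T \<theta>1 vm, of R]) (rule that)
  obtain K2 where K2: "K2 >= 0" "\<And>v z. v \<in> norm_ball m R ==> \<bar>misfit \<kappa> m T vstar \<theta>2 v z\<bar> <= K2"
   "\<And>v w z. v \<in> norm_ball m R ==> w \<in> norm_ball m R ==>
    \<bar>misfit \<kappa> m T vstar \<theta>2 v z - misfit \<kappa> m T vstar \<theta>2 w z\<bar> <= K2 * div_free_dist m v w"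
   by (rule misfit_bounds[OF \<kappa> m T \<theta>2 vm, of R]) (rule that)
  have "\<bar>\<delta> j v \<omega>\<bar> <= K1 + K2" if v: "v \<in> norm_ball m R" for j v \<omega>
  proof (cases "odd j")
   case True
   then show ?thesis using K1(2)[OF v, of "?Z (Suc (j div 2)) \<omega>"] K2(1) by (simp add: \<delta>_def)
  next
   case False
   then show ?thesis using K2(2)[OF v, of "?Z (j div 2) \<omega>"] K1(1) by (simp add: \<delta>_def)
  qed
  moreover have "\<bar>\<delta> j v \<omega> - \<delta> j w \<omega>\<bar> <= (K1 + K2) * div_free_dist m v w"
   if v: "v \<in> norm_ball m R" and w: "w \<in> norm_ball m R" for j v w \<omega>
  proof -
   have nn: "K1 * div_free_dist m v w >= 0" "K2 * div_free_dist m v w >= 0"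
    using K1(1) K2(1) div_free_dist_nonneg[of m v w] by simp_all
   show ?thesis
   proof (cases "odd j")
    case True
    then show ?thesis using K1(3)[OF v w, of "?Z (Suc (j div 2)) \<omega>"] nn(2) by (simp add: \<delta>_def distrib_right)
   next
    case False
    then show ?thesis using K2(3)[OF v w, of "?Z (j div 2) \<omega>"] nn(1) by (simp add: \<delta>_def distrib_right)
   qed
  qed
  ultimately show ?thesis using K1(1) K2(1) by (intro exI[of _ "K1 + K2"]) auto
 qed

 have noise: "AE \<omega> in M. (\<lambda>N. (\<Sum>j=1..N. \<bar>\<eta> j \<omega>\<bar>) / real N) \<longlonglongrightarrow> sqrt (2 / pi) * \<sigma>"
  by (rule noise_average_all[OF Zi Zd \<eta>i \<eta>d joint \<sigma>])
 \<comment> \<open>From here on the path is fixed; the exceptional set depends neither on the test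
   function nor on the radius or the field.\<close>
 from box dense noise tight
 show ?thesis
 proof eventually_elim
  case (elim \<omega>)
  have tx: "t j \<omega> \<in> {0..T}" "x j \<omega> \<in> unit_cell" if "j >= 1" for j using elim(1) that by auto
  have cases: "\<exists>i. i >= 1 \<and> (j = 2 * i - 1 \<or> j = 2 * i)" if "j >= 1" for j :: nat using that by presburger
  have G_lip: "locally_lipschitz m (G j \<omega>)" if j: "j >= 1" for j
  proof -
   obtain i where i: "i >= 1" "j = 2 * i - 1 \<or> j = 2 * i" using cases[OF j] by blast
   have lip: "locally_lipschitz m (\<lambda>v. adv_diff_solution \<kappa> m v \<theta> (t i \<omega>) (x i \<omega>))" if "\<theta> \<in> sobolev m" for \<theta>
    by (rule forward_lipschitz[OF \<kappa> m T that vm tx(1)[OF i(1)]])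
   show ?thesis using i(2) lip[OF \<theta>1] lip[OF \<theta>2] G1[OF i(1), of _ \<omega>] G2[OF i(1), of _ \<omega>]
    unfolding locally_lipschitz_def norm_ball_def by auto
  qed
  have G\<delta>: "G j \<omega> v - G j \<omega> vstar = \<delta> j v \<omega>" if j: "j >= 1" and v: "v \<in> div_free m" for j v
  proof -
   obtain i where i: "i >= 1" "j = 2 * i - 1 \<or> j = 2 * i" using cases[OF j] by blast
   have ar: "odd (2 * i - 1)" "Suc ((2 * i - 1) div 2) = i" using i(1) by presburger+
   show ?thesis
    using i(2) ar tx[OF i(1)] by (auto simp: \<delta>_def misfit_def G1[OF i(1), unfolded One_nat_def] G2[OF i(1)] v vm)
  qed
  have F: "(\<Sum>j=1..N. (Y j \<omega> - G j \<omega> v)^2 - (Y j \<omega> - G j \<omega> vstar)^2) / real N = ?F N v \<omega>"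
   if v: "v \<in> div_free m" for N v
  proof -
   have "(Y j \<omega> - G j \<omega> v)^2 - (Y j \<omega> - G j \<omega> vstar)^2 = (\<delta> j v \<omega>)^2 - 2 * \<eta> j \<omega> * \<delta> j v \<omega>" if "j \<in> {1..N}" for j
   proof -
    have "j >= 1" using that by simp
    have "G j \<omega> v = G j \<omega> vstar + \<delta> j v \<omega>" using G\<delta>[OF \<open>j >= 1\<close> v] by simp
    then show ?thesis unfolding Y[OF \<open>j >= 1\<close>] by (simp add: power2_eq_square algebra_simps)
   qed
   then show ?thesis by simp
  qed
  obtain B where B: "\<And>N. (\<Sum>j=1..N. \<bar>\<eta> j \<omega>\<bar>) / real N <= B"
   using convergent_imp_Bseq[OF convergentI[OF elim(3)]] unfolding Bseq_def by (auto simp: abs_le_iff)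
  have unif: "\<forall>\<^sub>F N in sequentially. \<forall>v\<in>norm_ball mstar R.
    \<bar>(\<Sum>j=1..N. (Y j \<omega> - G j \<omega> v)^2 - (Y j \<omega> - G j \<omega> vstar)^2) / real N - h v\<bar> <= e" if e: "e > 0" for R e
  proof -
   \<comment> \<open>The radius is rounded up to an integer, for which the countable nets were
     prepared.\<close>
   define k where "k = nat \<lceil>R\<rceil>"
   have Rk: "norm_ball mstar R \<subseteq> norm_ball mstar (real k)"
    by (intro norm_ball_subset) (auto simp: k_def of_nat_ceiling)
   obtain K where K: "K >= 0" "\<And>j \<omega> v. v \<in> norm_ball m (real k) ==> \<bar>\<delta> j v \<omega>\<bar> <= K"
    "\<And>j \<omega> v w. v \<in> norm_ball m (real k) ==> w \<in> norm_ball m (real k) ==> \<bar>\<delta> j v \<omega> - \<delta> j w \<omega>\<bar> <= K * div_free_dist m v w"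
    using \<delta>_bounds[of "real k"] by blast
   obtain L where L: "L >= 0" "\<And>v w. v \<in> norm_ball m (real k) ==> w \<in> norm_ball m (real k) ==> \<bar>h v - h w\<bar> <= L * div_free_dist m v w"
    using h_lip unfolding locally_lipschitz_def by blast
   have B0: "B >= 0" using B[of 0] by simp
   let ?C = "K * (2 * K + 2 * B) + L"
   have C1: "K * (2 * K + 2 * B) * div_free_dist m v w <= ?C * div_free_dist m v w"
    "L * div_free_dist m v w <= ?C * div_free_dist m v w" for v w
    using K(1) L(1) B0 by (intro mult_right_mono; simp add: div_free_dist_nonneg)+
   have "\<forall>\<^sub>F N in sequentially. \<forall>v\<in>norm_ball mstar (real k). \<bar>?F N v \<omega> - h v\<bar> <= e"
   proof (rule uniform_limit_on_totally_bounded[where d = "div_free_dist m" and Q = "Q k" and C = ?C])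
    show "?C >= 0" using K(1) L(1) B0 by simp
    show "\<exists>S. finite S \<and> S \<subseteq> Q k \<and> S \<subseteq> norm_ball mstar (real k) \<and> (\<forall>v\<in>norm_ball mstar (real k). \<exists>w\<in>S. div_free_dist m v w < e)"
     if "e > 0" for e by (rule Q(3)[OF that])
    show "(\<lambda>N. ?F N v \<omega>) \<longlonglongrightarrow> h v" if "v \<in> Q k" for v using elim(2) that by blast
    show "\<bar>?F N v \<omega> - ?F N w \<omega>\<bar> <= ?C * div_free_dist m v w"
     if "N >= 1" "v \<in> norm_ball mstar (real k)" "w \<in> norm_ball mstar (real k)" for N v w
     using that sub(1)[of "real k"] K by (intro order_trans[OF average_excess_lipschitz[OF _ _ _ _ _ _ B] C1(1)])
      (auto simp: div_free_dist_nonneg subset_iff)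
    show "\<bar>h v - h w\<bar> <= ?C * div_free_dist m v w"
     if "v \<in> norm_ball mstar (real k)" "w \<in> norm_ball mstar (real k)" for v w
     by (rule order_trans[OF L(2) C1(2)]) (use that sub(1) in blast)+
   qed (rule e)
   then show ?thesis
   proof eventually_elim
    case (elim N)
    show ?case
    proof
     fix v assume "v \<in> norm_ball mstar R"
     then have v: "v \<in> norm_ball mstar (real k)" "v \<in> div_free m" using Rk sub(2)[of "real k"] by blast+
     show "\<bar>(\<Sum>j=1..N. (Y j \<omega> - G j \<omega> v)^2 - (Y j \<omega> - G j \<omega> vstar)^2) / real N - h v\<bar> <= e"
      unfolding F[OF v(2)] using elim v(1) by blast
    qed
   qed
  qed
  have tight': "(SUP N\<in>{1..}. \<integral>\<^sup>+v. f_of_norm f mstar v \<partial>(posterior \<sigma> \<mu>0 (\<lambda>j. G j \<omega>) (\<lambda>j. Y j \<omega>) N)) < \<infinity>"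
  proof -
   have "(SUP N\<in>{1..}. \<integral>\<^sup>+v. f_of_norm f mstar v \<partial>(posterior \<sigma> \<mu>0 (\<lambda>j. G j \<omega>) (\<lambda>j. Y j \<omega>) N)) =
     (SUP N\<in>{1..}. \<integral>\<^sup>+v. f_of_norm f mstar v \<partial>(\<mu> N \<omega>))" by (intro SUP_cong refl) (simp add: \<mu>)
   then show ?thesis using elim(4) by (simp only:)
  qed
  show ?case
  proof (intro allI impI)
   fix \<phi> :: "vector_field => real"
   assume \<phi>: "continuous_map (div_free_topology m) euclideanreal \<phi> \<and> bounded (\<phi> ` div_free m)"
   have "(\<lambda>N. \<integral>v. \<phi> v \<partial>(posterior \<sigma> \<mu>0 (\<lambda>j. G j \<omega>) (\<lambda>j. Y j \<omega>) N)) \<longlonglongrightarrow> \<phi> vstar"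
    by (rule posterior_consistency[OF m mm \<sigma> \<mu>0 vs _ prior h_lip h0 h_pos unif f tight']) (use \<phi> G_lip in auto)
   moreover have "\<forall>\<^sub>F N in sequentially. (\<integral>v. \<phi> v \<partial>(posterior \<sigma> \<mu>0 (\<lambda>j. G j \<omega>) (\<lambda>j. Y j \<omega>) N)) = (\<integral>v. \<phi> v \<partial>(\<mu> N \<omega>))"
    using eventually_ge_at_top[of 1] by eventually_elim (simp add: \<mu>)
   ultimately show "(\<lambda>N. \<integral>v. \<phi> v \<partial>(\<mu> N \<omega>)) \<longlonglongrightarrow> \<phi> vstar" by (rule Lim_transform_eventually)
  qed
 qed
qed

end
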